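(* Consider the system $$x'=y,\qquad y'=\rho z^2\cos x+(z^2+\kappa)\sin x\cos x-\sin x-\varepsilon y,\qquad z'=\alpha(\cos x-\beta)$$ with $\rho=0$, regarded as a family with parameter $\varepsilon$. Fix $\beta\in(0,1)$, $\alpha>0$ and $\kappa\in[0,1)$, and let $\varepsilon_c=2\alpha\beta^{3/2}(1-\kappa\beta)^{1/2}$. If $l_1(\beta,\alpha,0,\kappa)\neq0$, then the family has a transversal Hopf point at $P_0$ for $\varepsilon=\varepsilon_c$. Moreover: (a) if $l_1<0$, then at $\varepsilon=\varepsilon_c$ the equilibrium $P_0$ is asymptotically stable, and for each $\varepsilon<\varepsilon_c$ sufficiently close to $\varepsilon_c$ there is a stable periodic orbit near the unstable equilibrium $P_0$; (b) if $l_1>0$, then at $\varepsilon=\varepsilon_c$ the equilibrium $P_0$ is unstable, and for each $\varepsilon>\varepsilon_c$ sufficiently close to $\varepsilon_c$ there is an unstable periodic orbit near the asymptotically stable equilibrium $P_0$.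
   Context: For $\rho=0$ the equilibrium is $P_0=(\arccos\beta,0,(1/\beta-\kappa)^{1/2})$. Set $\omega_0=\omega_1=\sqrt{(1-\beta^2)/\beta}$. At $\varepsilon=\varepsilon_c$, the Jacobian $A=Df(P_0)$ has eigenvalues $-\varepsilon_c$ and $\pm i\omega_0$. First Lyapunov coefficient. Let $B$ and $C$ be the second- and third-derivative multilinear forms of the vector field $f$ at $P_0$ (at $\varepsilon=\varepsilon_c$). Take $q=(-i,\omega_0,\alpha\beta^{1/2}\omega_1/\omega_0)$, and let $p$ satisfy $A^{\top}p=-i\omega_0p$ and $\sum_i\bar p_iq_i=1$. Set $$G_{21}=\langle p,C(q,q,\bar q)+B(\bar q,(2i\omega_0I-A)^{-1}B(q,q))-2B(q,A^{-1}B(q,\bar q))\rangle.$$ Then $l_1(\beta,\alpha,0,\kappa)=\operatorname{Re}G_{21}/(2\omega_0)$. A Hopf point is an equilibrium whose Jacobian has eigenvalues $\pm i\omega_0$, $\omega_0>0$, and no other eigenvalues on the imaginary axis. It is transversal if the real part of the continued complex eigenvalue pair has nonzero derivative in $\varepsilon$. *)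

theory Defs
  imports "HOL-Analysis.Analysis"
begin

definition vf :: "real \<Rightarrow> real \<Rightarrow> real \<Rightarrow> real \<Rightarrow> real \<Rightarrow> real^3 \<Rightarrow> real^3" where
  "vf \<rho> \<kappa> \<alpha> \<beta> \<epsilon> v =
     (let x = v$1; y = v$2; z = v$3 in
      vector [y,
              \<rho> * z^2 * cos x + (z^2 + \<kappa>) * sin x * cos x - sin x - \<epsilon> * y,
              \<alpha> * (cos x - \<beta>)])"

definition P0 :: "real \<Rightarrow> real \<Rightarrow> real^3" where
  "P0 \<beta> \<kappa> = vector [arccos \<beta>, 0, sqrt (1/\<beta> - \<kappa>)]"

definition eps_c :: "real \<Rightarrow> real \<Rightarrow> real \<Rightarrow> real" where
  "eps_c \<beta> \<alpha> \<kappa> = 2 * \<alpha> * \<beta> powr (3/2) * sqrt (1 - \<kappa> * \<beta>)"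

definition omega0 :: "real \<Rightarrow> real" where
  "omega0 \<beta> = sqrt ((1 - \<beta>^2) / \<beta>)"

definition dd :: "(real^'n \<Rightarrow> real^'m) \<Rightarrow> real^'n \<Rightarrow> real^'n \<Rightarrow> real^'m" where
  "dd f u x = vector_derivative (\<lambda>t. f (x + t *\<^sub>R u)) (at 0)"

definition jac :: "(real^'n \<Rightarrow> real^'m) \<Rightarrow> real^'n \<Rightarrow> real^'n^'m" where
  "jac f x = (\<chi> i j. dd f (axis j 1) x $ i)"

definition cmat :: "real^'n^'m \<Rightarrow> complex^'n^'m" where
  "cmat A = (\<chi> i j. complex_of_real (A $ i $ j))"

definition is_eigenvalue :: "real^'n^'n \<Rightarrow> complex \<Rightarrow> bool" where
  "is_eigenvalue A lam \<longleftrightarrow> det (mat lam - cmat A) = 0"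

definition B_real :: "(real^'n \<Rightarrow> real^'n) \<Rightarrow> real^'n \<Rightarrow> real^'n \<Rightarrow> real^'n \<Rightarrow> real^'n" where
  "B_real f x u v = dd (\<lambda>y. dd f v y) u x"

definition C_real :: "(real^'n \<Rightarrow> real^'n) \<Rightarrow> real^'n \<Rightarrow> real^'n \<Rightarrow> real^'n \<Rightarrow> real^'n \<Rightarrow> real^'n" where
  "C_real f x u v w = dd (\<lambda>y. dd (\<lambda>y'. dd f w y') v y) u x"

definition B_form :: "(real^'n \<Rightarrow> real^'n) \<Rightarrow> real^'n \<Rightarrow> complex^'n \<Rightarrow> complex^'n \<Rightarrow> complex^'n" where
  "B_form f x u v = (\<chi> i. \<Sum>j\<in>UNIV. \<Sum>k\<in>UNIV.
       u$j * v$k * complex_of_real (B_real f x (axis j 1) (axis k 1) $ i))"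

definition C_form :: "(real^'n \<Rightarrow> real^'n) \<Rightarrow> real^'n \<Rightarrow> complex^'n \<Rightarrow> complex^'n \<Rightarrow> complex^'n \<Rightarrow> complex^'n" where
  "C_form f x u v w = (\<chi> i. \<Sum>j\<in>UNIV. \<Sum>k\<in>UNIV. \<Sum>l\<in>UNIV.
       u$j * v$k * w$l * complex_of_real (C_real f x (axis j 1) (axis k 1) (axis l 1) $ i))"

definition cconj_vec :: "complex^'n \<Rightarrow> complex^'n" where
  "cconj_vec u = (\<chi> i. cnj (u$i))"

definition cinner :: "complex^'n \<Rightarrow> complex^'n \<Rightarrow> complex" where
  "cinner p u = (\<Sum>i\<in>UNIV. cnj (p$i) * u$i)"

definition lyap1 :: "real \<Rightarrow> real \<Rightarrow> real \<Rightarrow> real" where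
  "lyap1 \<beta> \<alpha> \<kappa> =
    (let \<omega>\<^sub>0 = omega0 \<beta>; \<omega>\<^sub>1 = omega0 \<beta>;
         f = vf 0 \<kappa> \<alpha> \<beta> (eps_c \<beta> \<alpha> \<kappa>);
         x0 = P0 \<beta> \<kappa>;
         A = cmat (jac f x0);
         B = B_form f x0; C = C_form f x0;
         q = (vector [- \<i>, complex_of_real \<omega>\<^sub>0,
                      complex_of_real (\<alpha> * sqrt \<beta> * \<omega>\<^sub>1 / \<omega>\<^sub>0)] :: complex^3);
         qb = cconj_vec q;
         p = (SOME p. transpose A *v p = (- \<i> * complex_of_real \<omega>\<^sub>0) *s p \<and> cinner p q = 1);
         G21 = cinner p (C q q qb
                 + B qb (matrix_inv (mat (2 * \<i> * complex_of_real \<omega>\<^sub>0) - A) *v B q q)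
                 - 2 *s B q (matrix_inv A *v B q qb))
     in Re G21 / (2 * \<omega>\<^sub>0))"

definition hopf_point :: "(real^'n \<Rightarrow> real^'n) \<Rightarrow> real^'n \<Rightarrow> bool" where
  "hopf_point f P \<longleftrightarrow> f P = 0 \<and>
     (\<exists>\<omega>>0. is_eigenvalue (jac f P) (\<i> * complex_of_real \<omega>) \<and>
            is_eigenvalue (jac f P) (- \<i> * complex_of_real \<omega>) \<and>
            (\<forall>lam. is_eigenvalue (jac f P) lam \<and> Re lam = 0 \<longrightarrow>
                  lam = \<i> * complex_of_real \<omega> \<or> lam = - \<i> * complex_of_real \<omega>))"

definition transversal_hopf :: "(real \<Rightarrow> real^'n \<Rightarrow> real^'n) \<Rightarrow> real^'n \<Rightarrow> real \<Rightarrow> bool" where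
  "transversal_hopf F P \<epsilon>0 \<longleftrightarrow> hopf_point (F \<epsilon>0) P \<and>
     (\<exists>\<delta>>0. (\<forall>\<epsilon>\<in>ball \<epsilon>0 \<delta>. F \<epsilon> P = 0) \<and>
       (\<exists>\<mu> :: real \<Rightarrow> complex. \<exists>\<omega>>0. \<exists>d.
          \<mu> \<epsilon>0 = \<i> * complex_of_real \<omega> \<and>
          hopf_point (F \<epsilon>0) P \<and>
          is_eigenvalue (jac (F \<epsilon>0) P) (- \<i> * complex_of_real \<omega>) \<and>
          continuous_on (ball \<epsilon>0 \<delta>) \<mu> \<and>
          (\<forall>\<epsilon>\<in>ball \<epsilon>0 \<delta>. is_eigenvalue (jac (F \<epsilon>) P) (\<mu> \<epsilon>)) \<and>
          ((\<lambda>\<epsilon>. Re (\<mu> \<epsilon>)) has_real_derivative d) (at \<epsilon>0) \<and> d \<noteq> 0))"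

definition is_solution_on :: "(real^'n \<Rightarrow> real^'n) \<Rightarrow> (real \<Rightarrow> real^'n) \<Rightarrow> real set \<Rightarrow> bool" where
  "is_solution_on f x S \<longleftrightarrow> (\<forall>t\<in>S. (x has_vector_derivative f (x t)) (at t within S))"

definition lyap_stable :: "(real^'n \<Rightarrow> real^'n) \<Rightarrow> real^'n \<Rightarrow> bool" where
  "lyap_stable f P \<longleftrightarrow> (\<forall>e>0. \<exists>d>0. \<forall>T x. is_solution_on f x {0..T} \<and> dist (x 0) P < d \<longrightarrow>
      (\<forall>t\<in>{0..T}. dist (x t) P < e))"

definition asym_stable :: "(real^'n \<Rightarrow> real^'n) \<Rightarrow> real^'n \<Rightarrow> bool" where
  "asym_stable f P \<longleftrightarrow> lyap_stable f P \<and>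
     (\<exists>d>0. \<forall>x. is_solution_on f x {0..} \<and> dist (x 0) P < d \<longrightarrow> (x \<longlongrightarrow> P) at_top)"

definition periodic_solution :: "(real^'n \<Rightarrow> real^'n) \<Rightarrow> (real \<Rightarrow> real^'n) \<Rightarrow> bool" where
  "periodic_solution f \<gamma> \<longleftrightarrow> is_solution_on f \<gamma> UNIV \<and>
     (\<exists>T>0. \<forall>t. \<gamma> (t + T) = \<gamma> t) \<and> (\<exists>t. \<gamma> t \<noteq> \<gamma> 0)"

definition orbit_stable :: "(real^'n \<Rightarrow> real^'n) \<Rightarrow> (real^'n) set \<Rightarrow> bool" where
  "orbit_stable f Orb \<longleftrightarrow> (\<forall>e>0. \<exists>d>0. \<forall>T x. is_solution_on f x {0..T} \<and> infdist (x 0) Orb < d \<longrightarrow>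
      (\<forall>t\<in>{0..T}. infdist (x t) Orb < e))"

definition orbit_asym_stable :: "(real^'n \<Rightarrow> real^'n) \<Rightarrow> (real^'n) set \<Rightarrow> bool" where
  "orbit_asym_stable f Orb \<longleftrightarrow> orbit_stable f Orb \<and>
     (\<exists>d>0. \<forall>x. is_solution_on f x {0..} \<and> infdist (x 0) Orb < d \<longrightarrow>
        ((\<lambda>t. infdist (x t) Orb) \<longlongrightarrow> 0) at_top)"

end

theory Submission
  imports Defs
begin

text \<open>In coordinates \<open>Z \<in> \<complex>\<close> (critical pair) and \<open>X\<close> (distance to the quadratic approximation of the center manifold)
  a polynomial correction \<open>V = |Z|\<^sup>2 + \<dots>\<close> satisfies \<open>V' = 2 lc |Z|\<^sup>4 + 2 \<eta> Re k1 |Z|\<^sup>2 + \<dots>\<close>, where \<open>\<eta> = \<epsilon> - \<epsilon>\<^sub>c\<close>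
  and \<open>lc\<close> is a positive multiple of the first Lyapunov coefficient. Functions \<open>K X\<^sup>2 \<plusminus> V\<close> then
  decide the stability of the equilibrium.

  For the periodic orbits put \<open>|\<eta>| = m\<^sup>2\<close>, rescale \<open>Z\<close> by \<open>m\<close> and \<open>X\<close> by \<open>m\<^sup>2\<close>, and use the argument of \<open>Z\<close> as time: the
  system becomes a \<open>2\<pi>\<close>-periodic perturbation of a hyperbolic linear one, whose periodic solution is found by Banach's
  fixed point theorem applied to the Green operator. A quadratic Lyapunov function around this solution decides its stability.
  Only Lipschitz estimates enter; neither the center manifold theorem nor the smooth implicit function theorem is needed.\<close>

text \<open>The stability notions quantify over solutions that are assumed to exist. Stability
  therefore needs no existence theorem, but instability does; this is why a global Picard theorem
  for modified vector fields comes first. At criticality the decay is only |Z|^4 + X^2, and the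
  coupling |Z|^2 |X| has exactly this borderline order: it has no small factor, and a large weight K
  on X^2 must pay for it. The quadratic approximation of the center manifold is good enough because
  its defect is cubic, and |X| |Z|^3 is small against |Z|^4 + X^2. For the orbits the obstacle is
  that, per unit of angle, the level of V relaxes at a rate of order m^2 and X at a rate of order 1.
  All nonlinear terms are measured relative to the rate of their own equation, so contraction and
  stability hold uniformly in m. The level of V, not the radius, is the radial unknown: its
  derivative is already free of the non-resonant terms, so no averaging step is required. Remainders
  are carried by two calculi: \<open>lipo\<close> for orders of vanishing at the equilibrium,
  \<open>ul\<close> for what becomes of them after rescaling.\<close>

lemma sol_continuous:
  assumes "is_solution_on f x S" shows "continuous_on S x"
  unfolding continuous_on_eq_continuous_within
proof
  fix t assume "t \<in> S"
  then show "continuous (at t within S) x"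
    using assms has_vector_derivative_continuous[of x "f (x t)" t S] by (simp add: is_solution_on_def)
qed

lemma sol_subset:
  assumes "is_solution_on f x S" "T \<subseteq> S" shows "is_solution_on f x T"
  unfolding is_solution_on_def
proof
  fix t assume "t \<in> T"
  then show "(x has_vector_derivative f (x t)) (at t within T)"
    using assms has_vector_derivative_within_subset[of x "f (x t)" t S T] by (auto simp: is_solution_on_def)
qed

lemma sol_shift:
  assumes "is_solution_on f x {0..}" "0 \<le> a"
  shows "is_solution_on f (\<lambda>s. x (a + s)) {0..T}"
  unfolding is_solution_on_def
proof
  fix t assume t: "t \<in> {0..T}"
  have "(x has_vector_derivative f (x (a + t))) (at (a + t) within {0..})"
    using assms t by (auto simp: is_solution_on_def)
  then have 1: "(x has_vector_derivative f (x (a + t))) (at (a + t) within (\<lambda>s. a + s) ` {0..T})"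
    by (rule has_vector_derivative_within_subset) (use assms in auto)
  have 2: "((\<lambda>s. a + s) has_vector_derivative 1) (at t within {0..T})"
    by (auto intro!: derivative_eq_intros)
  show "((\<lambda>s. x (a + s)) has_vector_derivative f (x (a + t))) (at t within {0..T})"
    using vector_diff_chain_within[OF 2 1] by (simp add: o_def)
qed

text \<open>Lets a trajectory be cut at the first moment it meets the boundary of a tube: up to
  \<open>s\<close> it is inside, at \<open>s\<close> the level is attained exactly. The time is the
  minimum of the compact set of times at which \<open>h\<close> has reached the level.\<close>

lemma first_hit:
  fixes h :: "real \<Rightarrow> real"
  assumes "continuous_on {0..T} h" "0 \<le> T" "h 0 < e" "e \<le> h T"
  obtains s where "0 \<le> s" "s \<le> T" "h s = e" "\<And>t. 0 \<le> t \<Longrightarrow> t \<le> s \<Longrightarrow> h t \<le> e"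
proof -
  define A where "A = {t \<in> {0..T}. e \<le> h t}"
  have "closed A"
    unfolding A_def using continuous_closed_preimage[OF assms(1), of "{e..}"]
    by (auto simp: vimage_def Int_def)
  moreover have "bounded A"
    by (rule bounded_subset[OF bounded_closed_interval[of 0 T]]) (auto simp: A_def)
  ultimately have "compact A" by (simp add: compact_eq_bounded_closed)
  moreover have "A \<noteq> {}" using assms by (auto simp: A_def)
  ultimately obtain s where s: "s \<in> A" "\<And>t. t \<in> A \<Longrightarrow> s \<le> t"
    using compact_attains_inf[of A] by blast
  have sT: "0 \<le> s" "s \<le> T" "e \<le> h s" using s(1) by (auto simp: A_def)
  have "continuous_on {0..s} h"
    using assms(1) sT by (meson atLeastatMost_subset_iff continuous_on_subset order_refl)
  then obtain s' where s': "0 \<le> s'" "s' \<le> s" "h s' = e"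
    using IVT'[of h 0 e s] assms(3) sT by force
  then have "s' \<in> A" using sT by (auto simp: A_def)
  then have "s' = s" using s(2) s' by force
  then have hs: "h s = e" using s' by simp
  show ?thesis
  proof (rule that[OF sT(1,2) hs])
    fix t assume "0 \<le> t" "t \<le> s"
    show "h t \<le> e"
    proof (rule ccontr)
      assume "\<not> h t \<le> e"
      then have "t \<in> A" using \<open>0 \<le> t\<close> \<open>t \<le> s\<close> sT by (auto simp: A_def)
      then show False using s(2) \<open>t \<le> s\<close> \<open>\<not> h t \<le> e\<close> hs by force
    qed
  qed
qed

section \<open>Global existence for Lipschitz vector fields\<close>

lemma continuous_antiderivative:
  fixes f :: "real \<Rightarrow> 'a::euclidean_space"
  assumes "continuous_on UNIV f"
  obtains G where "\<And>x. (G has_vector_derivative f x) (at x)"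
proof -
  have "\<And>x. isCont f x" using assms continuous_on_eq_continuous_at by blast
  then obtain G where "\<forall>x::real. -\<infinity> < ereal x \<longrightarrow> ereal x < \<infinity> \<longrightarrow> (G has_vector_derivative f x) (at x)"
    using einterval_antiderivative[of "-\<infinity>" "\<infinity>" f] by force
  then show ?thesis using that by auto
qed

text \<open>Picard iteration on the whole half line at once. With the weight exp(-2 M t) on the
  deviation from \<open>x0\<close> the integral operator contracts by 1/2 in the sup norm, so no
  local solutions have to be glued.\<close>

lemma lipschitz_global_solution:
  fixes g :: "'a::euclidean_space \<Rightarrow> 'a"
  assumes lip: "L-lipschitz_on UNIV g"
  obtains x where "x 0 = x0" "\<And>t. 0 \<le> t \<Longrightarrow> (x has_vector_derivative g (x t)) (at t within {0..})"
proof -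
  define M where "M = L + 1"
  have M: "M > 0" using lipschitz_on_nonneg[OF lip] by (simp add: M_def)
  have gL: "norm (g a - g b) \<le> M * norm (a - b)" for a b
  proof -
    have "norm (g a - g b) \<le> L * norm (a - b)"
      using lipschitz_onD[OF lip, of a b] by (simp add: dist_norm)
    also have "\<dots> \<le> M * norm (a - b)" by (intro mult_right_mono) (auto simp: M_def)
    finally show ?thesis .
  qed
  have gc: "continuous_on UNIV g" using lip lipschitz_on_continuous_on by blast
  \<comment> \<open>\<open>\<phi>\<close> stores the weighted deviation; the curve it encodes is
    \<open>x0\<close> plus exp(2 M s) times \<open>\<phi>\<close> at s, and \<open>v\<close> is the
    field along that curve.\<close>
  define v where "v \<phi> s = g (x0 + exp (2*M * s) *\<^sub>R apply_bcontfun \<phi> s)" for \<phi> :: "(real, 'a) bcontfun" and s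
  have vc: "continuous_on UNIV (v \<phi>)" for \<phi>
    unfolding v_def by (intro continuous_intros continuous_on_compose2[OF gc]) auto
  have "\<exists>G. \<forall>x. (G has_vector_derivative v \<phi> x) (at x)" for \<phi>
    using continuous_antiderivative[OF vc] by metis
  then obtain G where G: "\<And>\<phi> x. (G \<phi> has_vector_derivative v \<phi> x) (at x)"
    by metis
  \<comment> \<open>The functions of the Banach space live on all of the reals; freezing the
    argument at \<open>max 0 t\<close> extends the operator to negative times without affecting t >=
    0.\<close>
  define T where "T \<phi> t = exp (-2*M*max 0 t) *\<^sub>R (G \<phi> (max 0 t) - G \<phi> 0)" for \<phi> t
  have Gc: "continuous_on UNIV (G \<phi>)" for \<phi>
    using G by (meson continuous_at_imp_continuous_on has_vector_derivative_continuous)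
  have expd: "((\<lambda>s. exp (2*M * s) / 2 * c) has_vector_derivative (M * exp (2*M * s) * c)) (at s)" for c s :: real
    by (auto intro!: derivative_eq_intros simp: has_real_derivative_iff_has_vector_derivative[symmetric])
  have Gdiff: "norm ((G \<phi> t - G \<phi> 0) - (G \<psi> t - G \<psi> 0)) \<le> exp (2*M*t) / 2 * dist \<phi> \<psi>" if "0 \<le> t" for \<phi> \<psi> t
  proof (cases "t = 0")
    case True then show ?thesis by simp
  next
    case False
    with that have t: "0 < t" by simp
    have "norm ((\<lambda>s. G \<phi> s - G \<psi> s) t - (\<lambda>s. G \<phi> s - G \<psi> s) 0) \<le> exp (2*M*t) / 2 * dist \<phi> \<psi> - exp (2*M*0) / 2 * dist \<phi> \<psi>"
    proof (rule differentiable_bound_general[OF t])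
      show "continuous_on {0..t} (\<lambda>s. G \<phi> s - G \<psi> s)"
        using Gc by (intro continuous_intros) (auto intro: continuous_on_subset)
      show "continuous_on {0..t} (\<lambda>s. exp (2*M * s) / 2 * dist \<phi> \<psi>)"
        by (intro continuous_intros) auto
      show "((\<lambda>s. G \<phi> s - G \<psi> s) has_vector_derivative v \<phi> s - v \<psi> s) (at s)" for s
        using G by (intro derivative_intros)
      show "((\<lambda>s. exp (2*M * s) / 2 * dist \<phi> \<psi>) has_vector_derivative M * exp (2*M * s) * dist \<phi> \<psi>) (at s)" for s
        by (rule expd)
      show "norm (v \<phi> s - v \<psi> s) \<le> M * exp (2*M * s) * dist \<phi> \<psi>" for s
      proof -
        have "norm (v \<phi> s - v \<psi> s) \<le> M * norm (exp (2*M * s) *\<^sub>R apply_bcontfun \<phi> s - exp (2*M * s) *\<^sub>R apply_bcontfun \<psi> s)"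
          unfolding v_def by (rule order_trans[OF gL]) simp
        also have "\<dots> = M * exp (2*M * s) * dist (apply_bcontfun \<phi> s) (apply_bcontfun \<psi> s)"
          by (simp add: scaleR_diff_right[symmetric] dist_norm)
        also have "\<dots> \<le> M * exp (2*M * s) * dist \<phi> \<psi>"
          using M by (intro mult_left_mono dist_bounded) auto
        finally show ?thesis .
      qed
    qed
    also have "\<dots> \<le> exp (2*M*t) / 2 * dist \<phi> \<psi>" by simp
    finally show ?thesis by (simp add: algebra_simps)
  qed
  have Tdiff: "norm (T \<phi> t - T \<psi> t) \<le> 1/2 * dist \<phi> \<psi>" for \<phi> \<psi> t
  proof -
    define r where "r = max 0 t"
    have r: "0 \<le> r" by (simp add: r_def)
    have "norm (T \<phi> t - T \<psi> t) = exp (-2*M*r) * norm ((G \<phi> r - G \<phi> 0) - (G \<psi> r - G \<psi> 0))"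
      unfolding T_def r_def[symmetric] scaleR_diff_right[symmetric] by simp
    also have "\<dots> \<le> exp (-2*M*r) * (exp (2*M*r) / 2 * dist \<phi> \<psi>)"
      by (intro mult_left_mono Gdiff r) auto
    also have "\<dots> = 1/2 * dist \<phi> \<psi>"
      by (simp add: exp_minus field_simps)
    finally show ?thesis .
  qed
  \<comment> \<open>The image of the zero function is bounded since r exp(-2 M r) <= 1/(2 M).
    Together with \<open>Tdiff\<close> this keeps the operator inside the bounded functions.\<close>
  have T0: "norm (T 0 t) \<le> norm (g x0) / (2*M)" for t
  proof -
    define r where "r = max 0 t"
    have r: "0 \<le> r" by (simp add: r_def)
    have v0: "v 0 s = g x0" for s by (simp add: v_def)
    have "((\<lambda>s. G 0 s - s *\<^sub>R g x0) has_vector_derivative 0) (at s within UNIV)" for s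
      using G[of 0 s] unfolding v0 by (auto intro!: derivative_eq_intros)
    then obtain c where c: "\<And>s. G 0 s - s *\<^sub>R g x0 = c"
      using has_vector_derivative_zero_constant[of UNIV "\<lambda>s. G 0 s - s *\<^sub>R g x0"] by auto
    have "G 0 r - G 0 0 = r *\<^sub>R g x0" using c[of r] c[of 0] by (simp add: algebra_simps)
    then have "norm (T 0 t) = exp (-2*M*r) * (r * norm (g x0))"
      unfolding T_def r_def[symmetric] using r by simp
    also have "\<dots> \<le> norm (g x0) / (2*M)"
    proof -
      have "2*M*r \<le> exp (2*M*r)" using exp_ge_add_one_self[of "2*M*r"] by linarith
      then have "exp (-2*M*r) * (2*M*r) \<le> exp (-2*M*r) * exp (2*M*r)" by (intro mult_left_mono) auto
      also have "\<dots> = 1" by (simp add: exp_add[symmetric])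
      finally have "exp (-2*M*r) * r \<le> 1 / (2*M)" using M by (simp add: field_simps)
      from mult_right_mono[OF this, of "norm (g x0)"] show ?thesis by (simp add: mult.assoc)
    qed
    finally show ?thesis .
  qed
  have Tb: "T \<phi> \<in> bcontfun" for \<phi>
  proof (rule bcontfun_normI)
    show "continuous_on UNIV (T \<phi>)"
      unfolding T_def by (intro continuous_intros continuous_on_compose2[OF Gc]) auto
    show "norm (T \<phi> t) \<le> norm (g x0) / (2*M) + 1/2 * dist \<phi> 0" for t
      using Tdiff[of \<phi> t 0] T0[of t] norm_triangle_ineq2[of "T \<phi> t" "T 0 t"] by linarith
  qed
  have "\<exists>!\<phi>. Bcontfun (T \<phi>) = \<phi>"
  proof (rule banach_fix_type)
    show "\<forall>\<phi> \<psi>. dist (Bcontfun (T \<phi>)) (Bcontfun (T \<psi>)) \<le> 1/2 * dist \<phi> \<psi>"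
    proof (intro allI dist_bound)
      fix \<phi> \<psi> t
      show "dist (apply_bcontfun (Bcontfun (T \<phi>)) t) (apply_bcontfun (Bcontfun (T \<psi>)) t) \<le> 1/2 * dist \<phi> \<psi>"
        using Tdiff[of \<phi> t \<psi>] by (simp only: Bcontfun_inverse[OF Tb] dist_norm[of "T \<phi> t"])
    qed
  qed auto
  then obtain \<phi> where "Bcontfun (T \<phi>) = \<phi>" by auto
  then have fp: "apply_bcontfun \<phi> t = T \<phi> t" for t
    using Bcontfun_inverse[OF Tb, of \<phi>] by simp
  define x where "x t = x0 + (G \<phi> t - G \<phi> 0)" for t
  have vx: "v \<phi> t = g (x t)" if "0 \<le> t" for t
    using that by (simp add: v_def fp T_def x_def exp_add[symmetric] max_def)
  show ?thesis
  proof (rule that[of x])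
    show "x 0 = x0" by (simp add: x_def)
    fix t :: real assume "0 \<le> t"
    have "(x has_vector_derivative v \<phi> t) (at t)"
      unfolding x_def using G by (auto intro!: derivative_eq_intros)
    then show "(x has_vector_derivative g (x t)) (at t within {0..})"
      using vx[OF \<open>0 \<le> t\<close>] has_vector_derivative_at_within by metis
  qed
qed

text \<open>Composing \<open>f\<close> with the nearest-point projection onto the convex set
  \<open>C\<close> gives a globally Lipschitz field that equals \<open>f\<close> on the tube. Its
  solution exists for all time, and stability itself forbids it to reach the boundary of the tube,
  so it solves the original equation.\<close>

lemma orbit_stable_forward_solution:
  fixes f :: "real^'n \<Rightarrow> real^'n"
  assumes st: "orbit_stable f K" and e: "0 < e"
    and C: "convex C" "closed C" "C \<noteq> {}" "{x. infdist x K \<le> e} \<subseteq> C" and lip: "L-lipschitz_on C f"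
  obtains d where "0 < d"
    "\<And>x0. infdist x0 K < d \<Longrightarrow> \<exists>x. x 0 = x0 \<and> is_solution_on f x {0..} \<and> (\<forall>t\<ge>0. infdist (x t) K < e)"
proof -
  obtain d where d: "0 < d" "\<And>T x. is_solution_on f x {0..T} \<Longrightarrow> infdist (x 0) K < d \<Longrightarrow>
      (\<forall>t\<in>{0..T}. infdist (x t) K < e)"
    using st e unfolding orbit_stable_def by metis
  define g where "g x = f (closest_point C x)" for x
  have "L-lipschitz_on UNIV g"
  proof (rule lipschitz_onI)
    fix a b
    have "dist (g a) (g b) \<le> L * dist (closest_point C a) (closest_point C b)"
      unfolding g_def by (intro lipschitz_onD[OF lip] closest_point_in_set C)
    also have "\<dots> \<le> L * dist a b"
      by (intro mult_left_mono closest_point_lipschitz C lipschitz_on_nonneg[OF lip])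
    finally show "dist (g a) (g b) \<le> L * dist a b" .
  qed (rule lipschitz_on_nonneg[OF lip])
  note glip = this
  have gf: "g x = f x" if "infdist x K \<le> e" for x
    using that C by (auto simp: g_def closest_point_self)
  show ?thesis
  proof (rule that[of "min d e"])
    show "0 < min d e" using d e by auto
    fix x0 assume x0: "infdist x0 K < min d e"
    obtain x where x: "x 0 = x0" "\<And>t. 0 \<le> t \<Longrightarrow> (x has_vector_derivative g (x t)) (at t within {0..})"
      using lipschitz_global_solution[OF glip] by blast
    have cx: "continuous_on {0..} x"
      using x(2) has_vector_derivative_continuous
      by (fastforce simp: continuous_on_eq_continuous_within)
    have stay: "infdist (x t) K < e" if t: "0 \<le> t" for t
    proof (rule ccontr)
      assume "\<not> infdist (x t) K < e"
      then have "e \<le> infdist (x t) K" by simp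
      moreover have "continuous_on {0..t} (\<lambda>t. infdist (x t) K)"
        by (intro continuous_on_infdist continuous_on_subset[OF cx]) auto
      ultimately obtain s where s: "0 \<le> s" "s \<le> t" "infdist (x s) K = e"
          "\<And>t. 0 \<le> t \<Longrightarrow> t \<le> s \<Longrightarrow> infdist (x t) K \<le> e"
        using first_hit[of t "\<lambda>t. infdist (x t) K" e] t x0 x(1) by auto
      \<comment> \<open>Up to the first contact with the boundary the modified and the original
        field agree along the curve, so the stability hypothesis applies to this piece and
        contradicts the contact.\<close>
      have "is_solution_on f x {0..s}"
        unfolding is_solution_on_def
      proof
        fix r assume r: "r \<in> {0..s}"
        then have "(x has_vector_derivative f (x r)) (at r within {0..})"
          using x(2)[of r] gf[OF s(4)[of r]] by auto
        then show "(x has_vector_derivative f (x r)) (at r within {0..s})"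
          by (rule has_vector_derivative_within_subset) auto
      qed
      from d(2)[OF this] x0 x(1) s show False by force
    qed
    have "is_solution_on f x {0..}"
      unfolding is_solution_on_def
    proof
      fix r :: real assume "r \<in> {0..}"
      then show "(x has_vector_derivative f (x r)) (at r within {0..})"
        using x(2)[of r] gf[of "x r"] stay[of r] by auto
    qed
    then show "\<exists>x. x 0 = x0 \<and> is_solution_on f x {0..} \<and> (\<forall>t\<ge>0. infdist (x t) K < e)"
      using x(1) stay by auto
  qed
qed

lemma lyap_stable_iff_orbit_stable: "lyap_stable f P \<longleftrightarrow> orbit_stable f {P}"
  unfolding lyap_stable_def orbit_stable_def infdist_singleton ..

lemma asym_stable_if_orbit_asym_stable:
  assumes "orbit_asym_stable f {P}" shows "asym_stable f P"
  using assms unfolding asym_stable_def orbit_asym_stable_def lyap_stable_iff_orbit_stable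
    infdist_singleton tendsto_dist_iff[where l = P] .

section \<open>Stability of compact sets\<close>

text \<open>No sign of \<open>U\<close> is fixed, so that one decrease hypothesis serves stability
  and instability alike. \<open>U_deriv\<close> concerns a curve at one instant rather than a
  derivative of \<open>U\<close> on space; this admits functions composed with the argument of a
  complex number.\<close>

locale lyapunov_set =
  fixes f :: "real^'n \<Rightarrow> real^'n" and K N :: "(real^'n) set" and U \<phi> :: "real^'n \<Rightarrow> real"
  assumes K: "compact K" "K \<noteq> {}" "K \<subseteq> N" and N: "open N"
    and U_cont: "continuous_on N U" and \<phi>_cont: "continuous_on N \<phi>"
    and U_zero: "\<And>x. x \<in> K \<Longrightarrow> U x = 0"
    and \<phi>_nonneg: "\<And>x. x \<in> N \<Longrightarrow> 0 \<le> \<phi> x" and \<phi>_pos: "\<And>x. x \<in> N \<Longrightarrow> x \<notin> K \<Longrightarrow> 0 < \<phi> x"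
    and U_deriv: "\<And>x t S. \<lbrakk>(x has_vector_derivative f (x t)) (at t within S); x t \<in> N\<rbrakk> \<Longrightarrow>
      \<exists>D \<le> - \<phi> (x t). ((\<lambda>s. U (x s)) has_real_derivative D) (at t within S)"
begin

lemma U_decrease:
  assumes sol: "is_solution_on f x {0..b}" and b: "0 \<le> b"
    and N: "\<And>t. 0 \<le> t \<Longrightarrow> t \<le> b \<Longrightarrow> x t \<in> N" and c: "\<And>t. 0 \<le> t \<Longrightarrow> t \<le> b \<Longrightarrow> c \<le> \<phi> (x t)"
  shows "U (x b) \<le> U (x 0) - c * b"
proof -
  have "\<forall>t\<in>{0..b}. \<exists>D. D \<le> - c \<and> ((\<lambda>s. U (x s)) has_real_derivative D) (at t within {0..b})"
  proof
    fix t assume t: "t \<in> {0..b}"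
    then have "(x has_vector_derivative f (x t)) (at t within {0..b})" "x t \<in> N" "c \<le> \<phi> (x t)"
      using sol N c by (auto simp: is_solution_on_def)
    then show "\<exists>D. D \<le> - c \<and> ((\<lambda>s. U (x s)) has_real_derivative D) (at t within {0..b})"
      using U_deriv[of x t "{0..b}"] by (meson dual_order.trans neg_le_iff_le)
  qed
  then obtain D where D: "\<And>t. t \<in> {0..b} \<Longrightarrow> D t \<le> - c"
      "\<And>t. t \<in> {0..b} \<Longrightarrow> ((\<lambda>s. U (x s)) has_real_derivative D t) (at t within {0..b})"
    by metis
  have "\<exists>t\<in>{0..b}. U (x b) - U (x 0) = D t * (b - 0)"
    using mvt_very_simple[OF b, of "\<lambda>s. U (x s)" "\<lambda>t. (*) (D t)"] D(2)
    by (auto simp: has_field_derivative_def)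
  then obtain t where "t \<in> {0..b}" "U (x b) - U (x 0) = D t * b" by auto
  moreover have "D t * b \<le> - c * b" using D(1) \<open>t \<in> {0..b}\<close> b by (intro mult_right_mono) auto
  ultimately show ?thesis by simp
qed

lemma tube:
  obtains e0 where "0 < e0" "{x. infdist x K \<le> e0} \<subseteq> N"
  using compact_in_open_separated[OF K(2,1) N K(3)] by blast

text \<open>Lyapunov's barrier: near \<open>K\<close> the value of \<open>U\<close> is below its
  minimum \<open>\<mu>\<close> on the shell at distance \<open>e\<close>, and it cannot grow, so the
  shell is never met.\<close>

lemma stable:
  assumes pos: "\<And>x. x \<in> N \<Longrightarrow> x \<notin> K \<Longrightarrow> 0 < U x"
  shows "orbit_stable f K"
  unfolding orbit_stable_def
proof (intro allI impI)
  fix e' :: real assume "0 < e'"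
  obtain e0 where e0: "0 < e0" "{x. infdist x K \<le> e0} \<subseteq> N" by (rule tube)
  define e where "e = min e' e0"
  have e: "0 < e" "e \<le> e'" "e \<le> e0" using \<open>0 < e'\<close> e0 by (auto simp: e_def)
  define B where "B = {x. infdist x K \<le> e} \<inter> {x. e \<le> infdist x K}"
  have cB: "compact B" unfolding B_def
    by (intro compact_Int_closed compact_infdist_le K e closed_Collect_le continuous_intros)
  have BN: "B \<subseteq> N" using e0 e by (auto simp: B_def)
  have notK: "x \<notin> K" if "e \<le> infdist x K" for x using that e K by (auto simp: infdist_zero)
  obtain \<mu> where \<mu>: "0 < \<mu>" "\<And>x. x \<in> B \<Longrightarrow> \<mu> \<le> U x"
  proof (cases "B = {}")
    case True then show ?thesis using that[of 1] by auto
  next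
    case False
    then obtain b where b: "b \<in> B" "\<And>x. x \<in> B \<Longrightarrow> U b \<le> U x"
      using continuous_attains_inf[OF cB _ continuous_on_subset[OF U_cont BN]] by blast
    then show ?thesis using that[of "U b"] pos BN notK by (auto simp: B_def)
  qed
  have "open {x \<in> N. U x < \<mu>}"
    using continuous_open_preimage[OF U_cont N, of "{..<\<mu>}"] by (auto simp: vimage_def Int_def)
  moreover have "K \<subseteq> {x \<in> N. U x < \<mu>}" using K U_zero \<mu> by auto
  ultimately obtain d where d: "0 < d" "{x. infdist x K \<le> d} \<subseteq> {x \<in> N. U x < \<mu>}"
    using compact_in_open_separated[OF K(2,1)] by blast
  show "\<exists>d>0. \<forall>T x. is_solution_on f x {0..T} \<and> infdist (x 0) K < d \<longrightarrow> (\<forall>t\<in>{0..T}. infdist (x t) K < e')"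
  proof (intro exI[of _ "min d e"] conjI allI impI ballI)
    show "0 < min d e" using d e by auto
    fix T x t assume a: "is_solution_on f x {0..T} \<and> infdist (x 0) K < min d e" and t: "t \<in> {0..T}"
    have "infdist (x t) K < e"
    proof (rule ccontr)
      assume "\<not> infdist (x t) K < e"
      moreover have "continuous_on {0..t} (\<lambda>t. infdist (x t) K)"
        using a t by (intro continuous_on_infdist continuous_on_subset[OF sol_continuous]) auto
      ultimately obtain s where s: "0 \<le> s" "s \<le> t" "infdist (x s) K = e"
          "\<And>t. 0 \<le> t \<Longrightarrow> t \<le> s \<Longrightarrow> infdist (x t) K \<le> e"
        using first_hit[of t "\<lambda>t. infdist (x t) K" e] t a by auto
      have inN: "x r \<in> N" if "0 \<le> r" "r \<le> s" for r using s(4)[OF that] e e0 by auto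
      have "U (x s) \<le> U (x 0) - 0 * s"
      proof (rule U_decrease)
        show "is_solution_on f x {0..s}" using a s t by (auto intro: sol_subset)
      qed (use s inN \<phi>_nonneg in auto)
      moreover have "x 0 \<in> {x. infdist x K \<le> d}" using a by simp
      then have "U (x 0) < \<mu>" using d(2) by blast
      moreover have "\<mu> \<le> U (x s)" using s by (intro \<mu>) (auto simp: B_def)
      ultimately show False by simp
    qed
    then show "infdist (x t) K < e'" using e by simp
  qed
qed

text \<open>A trajectory that kept away from \<open>K\<close> forever would remain in a compact
  shell on which \<open>\<phi>\<close> has a positive minimum, and \<open>U\<close> would turn
  negative in finite time. Hence it comes arbitrarily close once, and from then on stability holds
  it there.\<close>

lemma asymptotically_stable:
  assumes pos: "\<And>x. x \<in> N \<Longrightarrow> x \<notin> K \<Longrightarrow> 0 < U x"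
  shows "orbit_asym_stable f K"
  unfolding orbit_asym_stable_def
proof (intro conjI)
  show st: "orbit_stable f K" by (rule stable[OF pos])
  obtain e0 where e0: "0 < e0" "{x. infdist x K \<le> e0} \<subseteq> N" by (rule tube)
  obtain d0 where d0: "0 < d0" "\<And>T x. is_solution_on f x {0..T} \<Longrightarrow> infdist (x 0) K < d0 \<Longrightarrow>
      (\<forall>t\<in>{0..T}. infdist (x t) K < e0)"
    using st e0 unfolding orbit_stable_def by metis
  show "\<exists>d>0. \<forall>x. is_solution_on f x {0..} \<and> infdist (x 0) K < d \<longrightarrow> ((\<lambda>t. infdist (x t) K) \<longlongrightarrow> 0) at_top"
  proof (intro exI[of _ d0] conjI allI impI d0)
    fix x assume a: "is_solution_on f x {0..} \<and> infdist (x 0) K < d0"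
    have sol: "is_solution_on f x {0..T}" for T using a sol_subset by fastforce
    have stay: "infdist (x t) K < e0" if "0 \<le> t" for t
      using d0(2)[OF sol[of t]] a that by auto
    show "((\<lambda>t. infdist (x t) K) \<longlongrightarrow> 0) at_top"
    proof (rule tendstoI)
      fix e :: real assume e: "0 < e"
      obtain d where d: "0 < d" "\<And>T x. is_solution_on f x {0..T} \<Longrightarrow> infdist (x 0) K < d \<Longrightarrow>
          (\<forall>t\<in>{0..T}. infdist (x t) K < e)"
        using st e unfolding orbit_stable_def by metis
      have "\<exists>a\<ge>0. infdist (x a) K < d"
      proof (rule ccontr)
        assume "\<not> ?thesis"
        then have far: "d \<le> infdist (x t) K" if "0 \<le> t" for t using that by force
        define B where "B = {x. infdist x K \<le> e0} \<inter> {x. d \<le> infdist x K}"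
        have cB: "compact B" unfolding B_def
          by (intro compact_Int_closed compact_infdist_le K e0 closed_Collect_le continuous_intros)
        have BN: "B \<subseteq> N" using e0 by (auto simp: B_def)
        have xB: "x t \<in> B" if "0 \<le> t" for t using far stay that by (force simp: B_def)
        then have "B \<noteq> {}" by blast
        then obtain b where b: "b \<in> B" "\<And>x. x \<in> B \<Longrightarrow> \<phi> b \<le> \<phi> x"
          using continuous_attains_inf[OF cB _ continuous_on_subset[OF \<phi>_cont BN]] by blast
        have "b \<notin> K" using b(1) d K by (auto simp: B_def infdist_zero)
        then have c: "0 < \<phi> b" using \<phi>_pos BN b by auto
        \<comment> \<open>By this time a decrease at the minimal rate has brought \<open>U\<close>
          down to -1 or less.\<close>
        define T where "T = (U (x 0) + 1) / \<phi> b"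
        have "0 \<le> U (x 0)" using pos[of "x 0"] U_zero[of "x 0"] xB[of 0] BN by force
        then have T: "0 \<le> T" using c by (auto simp: T_def)
        have "U (x T) \<le> U (x 0) - \<phi> b * T"
          by (rule U_decrease[OF sol]) (use T xB BN b in auto)
        then have "U (x T) \<le> -1" using c by (simp add: T_def)
        moreover have "0 \<le> U (x T)" using pos[of "x T"] U_zero[of "x T"] xB[OF T] BN by force
        ultimately show False by simp
      qed
      then obtain t0 where t0: "0 \<le> t0" "infdist (x t0) K < d" by auto
      have "infdist (x t) K < e" if "t0 \<le> t" for t
        using d(2)[OF sol_shift[of f x t0 "t - t0"]] a t0 that
        by (auto dest!: bspec[of _ _ "t - t0"])
      then show "\<forall>\<^sub>F t in at_top. dist (infdist (x t) K) 0 < e"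
        unfolding eventually_at_top_linorder by (auto intro!: exI[of _ t0] simp: infdist_nonneg)
    qed
  qed
qed

text \<open>Chetaev's argument. From a start with negative \<open>U\<close> the value never rises
  again, so the trajectory stays off \<open>K\<close>, where \<open>U\<close> vanishes. If
  \<open>K\<close> were stable it would also stay in a compact tube forever, with a positive lower
  bound on the rate of decrease, although \<open>U\<close> is bounded below there. The Lipschitz
  hypothesis supplies the trajectory.\<close>

lemma unstable:
  assumes neg: "\<And>e. 0 < e \<Longrightarrow> \<exists>x. infdist x K < e \<and> x \<in> N \<and> U x < 0"
    and C: "convex C" "closed C" "K \<subseteq> interior C" and lip: "L-lipschitz_on C f"
  shows "\<not> orbit_stable f K"
proof
  assume st: "orbit_stable f K"
  obtain e where e: "0 < e" "{x. infdist x K \<le> e} \<subseteq> N \<inter> interior C"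
    using compact_in_open_separated[OF K(2,1), of "N \<inter> interior C"] N K(3) C(3) by blast
  have eC: "{x. infdist x K \<le> e} \<subseteq> C" using e interior_subset by blast
  have "C \<noteq> {}" using K C interior_subset by blast
  obtain d where d: "0 < d" "\<And>x0. infdist x0 K < d \<Longrightarrow>
      \<exists>x. x 0 = x0 \<and> is_solution_on f x {0..} \<and> (\<forall>t\<ge>0. infdist (x t) K < e)"
    using orbit_stable_forward_solution[OF st e(1) C(1,2) \<open>C \<noteq> {}\<close> eC lip] by blast
  obtain x0 where x0: "infdist x0 K < d" "x0 \<in> N" "U x0 < 0" using neg[OF d(1)] by blast
  obtain x where x: "x 0 = x0" "is_solution_on f x {0..}" "\<And>t. 0 \<le> t \<Longrightarrow> infdist (x t) K < e"
    using d(2)[OF x0(1)] by blast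
  have sol: "is_solution_on f x {0..T}" for T using x(2) sol_subset by fastforce
  have xN: "x t \<in> N" if "0 \<le> t" for t using x(3)[OF that] e by auto
  have mono: "U (x t) \<le> U x0" if "0 \<le> t" for t
    using U_decrease[OF sol that, of 0] xN \<phi>_nonneg x(1) by simp
  define E where "E = {x. infdist x K \<le> e}"
  have cE: "compact E" unfolding E_def by (rule compact_infdist_le[OF K(2,1) e(1)])
  have EN: "E \<subseteq> N" using e by (auto simp: E_def)
  have xE: "x t \<in> E" if "0 \<le> t" for t using x(3)[OF that] by (simp add: E_def)
  define B where "B = {y \<in> E. U y \<le> U x0}"
  have "closed B"
    using continuous_closed_preimage[OF continuous_on_subset[OF U_cont EN] compact_imp_closed[OF cE], of "{..U x0}"]
    by (auto simp: B_def vimage_def Int_def)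
  then have cB: "compact B"
    using compact_Int_closed[OF cE, of B] by (simp add: B_def Int_def conj_commute cong: conj_cong)
  have BN: "B \<subseteq> N" using EN by (auto simp: B_def)
  have xB: "x t \<in> B" if "0 \<le> t" for t using xE[OF that] mono[OF that] by (simp add: B_def)
  then have "B \<noteq> {}" by blast
  then obtain b where b: "b \<in> B" "\<And>x. x \<in> B \<Longrightarrow> \<phi> b \<le> \<phi> x"
    using continuous_attains_inf[OF cB _ continuous_on_subset[OF \<phi>_cont BN]] by blast
  have "b \<notin> K" using b(1) x0 U_zero by (force simp: B_def)
  then have c: "0 < \<phi> b" using \<phi>_pos BN b by auto
  obtain l where l: "l \<in> B" "\<And>x. x \<in> B \<Longrightarrow> U l \<le> U x"
    using continuous_attains_inf[OF cB \<open>B \<noteq> {}\<close> continuous_on_subset[OF U_cont BN]] by blast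
  define T where "T = (U x0 - U l + 1) / \<phi> b"
  have T: "0 \<le> T" using c l(1) by (auto simp: T_def B_def)
  have "U (x T) \<le> U (x 0) - \<phi> b * T"
    by (rule U_decrease[OF sol]) (use T xB BN b in auto)
  then have "U (x T) \<le> U l - 1" using c by (simp add: T_def x(1))
  then show False using l(2)[OF xB[OF T]] by simp
qed

end

section \<open>Periodic solutions of hyperbolic periodic systems\<close>

lemma continuous_antiderivative_real:
  fixes f :: "real \<Rightarrow> real"
  assumes "continuous_on UNIV f"
  obtains G where "\<And>x. (G has_real_derivative f x) (at x)"
  using continuous_antiderivative[OF assms]
  unfolding has_real_derivative_iff_has_vector_derivative by blast

text \<open>Variation of constants with the integral taken over one full period, so that a single
  formula covers growth and decay: the denominator \<open>q - 1\<close> is nonzero because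
  \<open>k\<close> is.\<close>

lemma periodic_linear_exists:
  fixes n :: "real \<Rightarrow> real"
  assumes k: "k \<noteq> 0" and p: "0 < p" and n: "continuous_on UNIV n" "\<And>\<theta>. n (\<theta> + p) = n \<theta>"
  obtains y where "\<And>\<theta>. (y has_real_derivative k * y \<theta> + n \<theta>) (at \<theta>)" "\<And>\<theta>. y (\<theta> + p) = y \<theta>"
proof -
  have "continuous_on UNIV (\<lambda>s. exp (- k * s) * n s)" using n(1) by (intro continuous_intros)
  then obtain G where G: "\<And>s. (G has_real_derivative exp (- k * s) * n s) (at s)"
    using continuous_antiderivative_real by blast
  define q where "q = exp (- k * p)"
  have q: "q - 1 \<noteq> 0" using k p by (simp add: q_def)
  have Gp: "((\<lambda>s. G (s + p)) has_real_derivative q * exp (- k * s) * n s) (at s)" for s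
  proof -
    have "((\<lambda>s. G (s + p)) has_real_derivative exp (- k * (s + p)) * n (s + p) * 1) (at s)"
      by (rule DERIV_chain2[OF G]) (auto intro!: derivative_eq_intros)
    moreover have "exp (- k * (s + p)) * n (s + p) * 1 = q * exp (- k * s) * n s"
      unfolding n(2) q_def by (simp add: exp_add[symmetric] algebra_simps)
    ultimately show ?thesis by simp
  qed
  \<comment> \<open>Shifting the antiderivative by one period multiplies it by \<open>q\<close> up
    to a constant; this relation makes the formula below periodic.\<close>
  have "((\<lambda>s. G (s + p) - q * G s) has_real_derivative 0) (at s)" for s
    using Gp[of s] G[of s] by (auto intro!: derivative_eq_intros)
  then have const: "G (s + p) - q * G s = G (t + p) - q * G t" for s t
    using DERIV_isconst_all[of "\<lambda>s. G (s + p) - q * G s"] by blast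
  define y where "y \<theta> = exp (k * \<theta>) * (G (\<theta> + p) - G \<theta>) / (q - 1)" for \<theta>
  show ?thesis
  proof
    show "(y has_real_derivative k * y \<theta> + n \<theta>) (at \<theta>)" for \<theta>
    proof -
      have "exp (k * \<theta>) * exp (- (k * \<theta>)) = 1" by (simp add: exp_add[symmetric])
      then have e: "exp (k * \<theta>) * (q * exp (- (k * \<theta>)) * n \<theta> - exp (- (k * \<theta>)) * n \<theta>) = (q - 1) * n \<theta>"
        by (simp add: algebra_simps)
      have "(y has_real_derivative (k * exp (k * \<theta>) * (G (\<theta> + p) - G \<theta>)
          + exp (k * \<theta>) * (q * exp (- (k * \<theta>)) * n \<theta> - exp (- (k * \<theta>)) * n \<theta>)) / (q - 1)) (at \<theta>)"
        unfolding y_def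
        by (rule DERIV_cdivide, (rule derivative_eq_intros Gp G refl)+) (simp add: algebra_simps)
      then show ?thesis unfolding e using q by (simp add: y_def add_divide_distrib mult.assoc)
    qed
    show "y (\<theta> + p) = y \<theta>" for \<theta>
    proof -
      have "G (\<theta> + p + p) - G (\<theta> + p) = q * (G (\<theta> + p) - G \<theta>)"
        using const[of "\<theta> + p" \<theta>] by (simp add: algebra_simps)
      then have "y (\<theta> + p) = exp (k * (\<theta> + p)) * q * (G (\<theta> + p) - G \<theta>) / (q - 1)"
        by (simp add: y_def mult.assoc)
      also have "exp (k * (\<theta> + p)) * q = exp (k * \<theta>)"
        by (simp add: q_def exp_add[symmetric] algebra_simps)
      finally show ?thesis by (simp add: y_def)
    qed
  qed
qed

text \<open>The Green operator of y' = k y + n on periodic functions has norm at most 1/|k|. The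
  increment of exp(-k s) y(s) over one period is compared with that of the antiderivative of B
  exp(-k s); periodicity pulls y out of the left side, and the factor that remains cancels.\<close>

lemma periodic_linear_bound:
  fixes y n :: "real \<Rightarrow> real"
  assumes k: "k \<noteq> 0" and p: "0 < p"
    and y: "\<And>\<theta>. (y has_real_derivative k * y \<theta> + n \<theta>) (at \<theta>)" "\<And>\<theta>. y (\<theta> + p) = y \<theta>"
    and B: "\<And>\<theta>. \<bar>n \<theta>\<bar> \<le> B"
  shows "\<bar>y \<theta>\<bar> \<le> B / \<bar>k\<bar>"
proof -
  define a b where "a = exp (- k * \<theta>)" and "b = exp (- k * (\<theta> + p))"
  have gd: "((\<lambda>s. exp (- k * s) * y s) has_vector_derivative exp (- k * s) * n s) (at s)" for s
    unfolding has_real_derivative_iff_has_vector_derivative[symmetric]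
    by (rule derivative_eq_intros y refl)+ (simp add: algebra_simps)
  have pd: "((\<lambda>s. - B * exp (- k * s) / k) has_vector_derivative B * exp (- k * s)) (at s)" for s
    unfolding has_real_derivative_iff_has_vector_derivative[symmetric]
    by (rule derivative_eq_intros refl k)+ (use k in simp)
  have "norm (exp (- k * (\<theta> + p)) * y (\<theta> + p) - exp (- k * \<theta>) * y \<theta>)
      \<le> - B * exp (- k * (\<theta> + p)) / k - - B * exp (- k * \<theta>) / k"
  proof (rule differentiable_bound_general[of \<theta> "\<theta> + p" "\<lambda>s. exp (- k * s) * y s" "\<lambda>s. - B * exp (- k * s) / k"])
    show "continuous_on {\<theta>..\<theta> + p} (\<lambda>s. exp (- k * s) * y s)"
      using gd by (meson continuous_at_imp_continuous_on has_vector_derivative_continuous)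
    show "continuous_on {\<theta>..\<theta> + p} (\<lambda>s. - B * exp (- k * s) / k)"
      using pd by (meson continuous_at_imp_continuous_on has_vector_derivative_continuous)
    show "norm (exp (- k * s) * n s) \<le> B * exp (- k * s)" for s
      using mult_left_mono[OF B[of s], of "exp (- k * s)"] by (simp add: abs_mult mult.commute)
  qed (use p gd pd in auto)
  then have "\<bar>(b - a) * y \<theta>\<bar> \<le> B * ((a - b) / k)"
    unfolding y(2) a_def[symmetric] b_def[symmetric] using k by (simp add: algebra_simps diff_divide_distrib)
  moreover have ab: "(a - b) / k > 0"
    using k p by (cases "k > 0") (auto simp: a_def b_def divide_simps mult_less_cancel_left)
  then have "(a - b) / k = \<bar>a - b\<bar> / \<bar>k\<bar>" by (metis abs_divide abs_of_pos)
  ultimately have "\<bar>a - b\<bar> * \<bar>y \<theta>\<bar> \<le> \<bar>a - b\<bar> * (B / \<bar>k\<bar>)"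
    by (simp add: abs_mult abs_minus_commute mult.commute)
  moreover have "\<bar>a - b\<bar> > 0" using ab by auto
  ultimately show ?thesis by (metis mult_le_cancel_left_pos)
qed

lemma bcontfun_eval_continuous:
  "continuous_on UNIV (\<lambda>\<phi>::(real, real) bcontfun. apply_bcontfun \<phi> \<theta>)"
  by (rule lipschitz_on_continuous_on[of 1])
    (auto intro!: lipschitz_onI simp: dist_bounded)

text \<open>The Lipschitz and smallness bounds are relative to \<open>k1\<close> and
  \<open>k2\<close>, because the Green operators have norms 1/|k1| and 1/|k2|. Each component then
  contracts by 1/4, and 3/4 + 1/4 leaves the ball of radius \<open>\<rho>\<close> invariant, however
  small one of the rates may be.\<close>

lemma periodic_hyperbolic_solution:
  fixes F1 F2 :: "real \<Rightarrow> real \<Rightarrow> real \<Rightarrow> real"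
  assumes k: "k1 \<noteq> 0" "k2 \<noteq> 0" and p: "0 < p" and \<rho>: "0 \<le> \<rho>"
    and per: "\<And>\<theta> a b. F1 (\<theta> + p) a b = F1 \<theta> a b" "\<And>\<theta> a b. F2 (\<theta> + p) a b = F2 \<theta> a b"
    and cont: "\<And>a b. \<bar>a\<bar> \<le> \<rho> \<Longrightarrow> \<bar>b\<bar> \<le> \<rho> \<Longrightarrow> continuous_on UNIV (\<lambda>\<theta>. F1 \<theta> a b)"
      "\<And>a b. \<bar>a\<bar> \<le> \<rho> \<Longrightarrow> \<bar>b\<bar> \<le> \<rho> \<Longrightarrow> continuous_on UNIV (\<lambda>\<theta>. F2 \<theta> a b)"
    and lip: "\<And>\<theta> a b a' b'. \<lbrakk>\<bar>a\<bar> \<le> \<rho>; \<bar>b\<bar> \<le> \<rho>; \<bar>a'\<bar> \<le> \<rho>; \<bar>b'\<bar> \<le> \<rho>\<rbrakk> \<Longrightarrow>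
        \<bar>F1 \<theta> a b - F1 \<theta> a' b'\<bar> \<le> \<bar>k1\<bar> / 4 * max \<bar>a - a'\<bar> \<bar>b - b'\<bar>"
      "\<And>\<theta> a b a' b'. \<lbrakk>\<bar>a\<bar> \<le> \<rho>; \<bar>b\<bar> \<le> \<rho>; \<bar>a'\<bar> \<le> \<rho>; \<bar>b'\<bar> \<le> \<rho>\<rbrakk> \<Longrightarrow>
        \<bar>F2 \<theta> a b - F2 \<theta> a' b'\<bar> \<le> \<bar>k2\<bar> / 4 * max \<bar>a - a'\<bar> \<bar>b - b'\<bar>"
    and small: "\<And>\<theta>. \<bar>F1 \<theta> 0 0\<bar> \<le> \<bar>k1\<bar> * (3/4 * \<rho>)" "\<And>\<theta>. \<bar>F2 \<theta> 0 0\<bar> \<le> \<bar>k2\<bar> * (3/4 * \<rho>)"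
  obtains y1 y2 where
    "\<And>\<theta>. (y1 has_real_derivative k1 * y1 \<theta> + F1 \<theta> (y1 \<theta>) (y2 \<theta>)) (at \<theta>)"
    "\<And>\<theta>. (y2 has_real_derivative k2 * y2 \<theta> + F2 \<theta> (y1 \<theta>) (y2 \<theta>)) (at \<theta>)"
    "\<And>\<theta>. y1 (\<theta> + p) = y1 \<theta>" "\<And>\<theta>. y2 (\<theta> + p) = y2 \<theta>" "\<And>\<theta>. \<bar>y1 \<theta>\<bar> \<le> \<rho>" "\<And>\<theta>. \<bar>y2 \<theta>\<bar> \<le> \<rho>"
proof -
  define s where "s = {\<phi> :: (real, real) bcontfun \<times> (real, real) bcontfun.
    \<forall>\<theta>. \<bar>apply_bcontfun (fst \<phi>) \<theta>\<bar> \<le> \<rho> \<and> \<bar>apply_bcontfun (snd \<phi>) \<theta>\<bar> \<le> \<rho> \<and>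
      apply_bcontfun (fst \<phi>) (\<theta> + p) = apply_bcontfun (fst \<phi>) \<theta> \<and>
      apply_bcontfun (snd \<phi>) (\<theta> + p) = apply_bcontfun (snd \<phi>) \<theta>}"
  have ev: "continuous_on UNIV (\<lambda>\<phi>::(real, real) bcontfun \<times> (real, real) bcontfun. apply_bcontfun (fst \<phi>) \<theta>)"
    "continuous_on UNIV (\<lambda>\<phi>::(real, real) bcontfun \<times> (real, real) bcontfun. apply_bcontfun (snd \<phi>) \<theta>)" for \<theta>
    by (auto intro!: continuous_on_compose2[OF bcontfun_eval_continuous] continuous_intros)
  have "closed s" unfolding s_def
    by (intro closed_Collect_all closed_Collect_conj closed_Collect_le closed_Collect_eq continuous_intros ev)
  then have cs: "complete s" by (simp add: complete_eq_closed)
  have "0 \<in> s" using \<rho> by (auto simp: s_def)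
  then have ne: "s \<noteq> {}" by blast
  \<comment> \<open>\<open>F\<close> is continuous in the angle only for frozen arguments, and
    Lipschitz in the arguments. Continuity of the composition follows by comparison with the
    arguments frozen at \<open>\<theta>0\<close>.\<close>
  have nc: "continuous_on UNIV (\<lambda>\<theta>. F \<theta> (apply_bcontfun (fst \<phi>) \<theta>) (apply_bcontfun (snd \<phi>) \<theta>))"
    if F: "\<And>a b. \<bar>a\<bar> \<le> \<rho> \<Longrightarrow> \<bar>b\<bar> \<le> \<rho> \<Longrightarrow> continuous_on UNIV (\<lambda>\<theta>. F \<theta> a b)"
      "\<And>\<theta> a b a' b'. \<lbrakk>\<bar>a\<bar> \<le> \<rho>; \<bar>b\<bar> \<le> \<rho>; \<bar>a'\<bar> \<le> \<rho>; \<bar>b'\<bar> \<le> \<rho>\<rbrakk> \<Longrightarrow>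
        \<bar>F \<theta> a b - F \<theta> a' b'\<bar> \<le> K * max \<bar>a - a'\<bar> \<bar>b - b'\<bar>"
    and \<phi>: "\<phi> \<in> s" for F :: "real \<Rightarrow> real \<Rightarrow> real \<Rightarrow> real" and K \<phi>
    unfolding continuous_on_def
  proof
    fix \<theta>0
    define a b where "a = apply_bcontfun (fst \<phi>)" and "b = apply_bcontfun (snd \<phi>)"
    have ab: "\<bar>a \<theta>\<bar> \<le> \<rho>" "\<bar>b \<theta>\<bar> \<le> \<rho>" for \<theta> using \<phi> by (auto simp: s_def a_def b_def)
    have ta: "(a \<longlongrightarrow> a \<theta>0) (at \<theta>0)" "(b \<longlongrightarrow> b \<theta>0) (at \<theta>0)"
      using continuous_on_apply_bcontfun[of UNIV] by (auto simp: a_def b_def continuous_on_def)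
    have "((\<lambda>\<theta>. F \<theta> (a \<theta>0) (b \<theta>0)) \<longlongrightarrow> F \<theta>0 (a \<theta>0) (b \<theta>0)) (at \<theta>0)"
      using F(1)[OF ab(1) ab(2)] by (auto simp: continuous_on_def)
    moreover have "((\<lambda>\<theta>. F \<theta> (a \<theta>) (b \<theta>) - F \<theta> (a \<theta>0) (b \<theta>0)) \<longlongrightarrow> 0) (at \<theta>0)"
    proof (rule Lim_null_comparison)
      show "\<forall>\<^sub>F \<theta> in at \<theta>0. norm (F \<theta> (a \<theta>) (b \<theta>) - F \<theta> (a \<theta>0) (b \<theta>0)) \<le> K * max \<bar>a \<theta> - a \<theta>0\<bar> \<bar>b \<theta> - b \<theta>0\<bar>"
        using F(2) ab by auto
      have "((\<lambda>\<theta>. K * max \<bar>a \<theta> - a \<theta>0\<bar> \<bar>b \<theta> - b \<theta>0\<bar>) \<longlongrightarrow> K * max \<bar>a \<theta>0 - a \<theta>0\<bar> \<bar>b \<theta>0 - b \<theta>0\<bar>) (at \<theta>0)"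
        by (intro tendsto_intros ta)
      then show "((\<lambda>\<theta>. K * max \<bar>a \<theta> - a \<theta>0\<bar> \<bar>b \<theta> - b \<theta>0\<bar>) \<longlongrightarrow> 0) (at \<theta>0)" by simp
    qed
    ultimately have "((\<lambda>\<theta>. F \<theta> (a \<theta>) (b \<theta>)) \<longlongrightarrow> F \<theta>0 (a \<theta>0) (b \<theta>0)) (at \<theta>0)"
      using tendsto_add by fastforce
    then show "((\<lambda>\<theta>. F \<theta> (a \<theta>) (b \<theta>)) \<longlongrightarrow> F \<theta>0 (a \<theta>0) (b \<theta>0)) (at \<theta>0 within UNIV)" by simp
  qed
  define N1 where "N1 \<phi> \<theta> = F1 \<theta> (apply_bcontfun (fst \<phi>) \<theta>) (apply_bcontfun (snd \<phi>) \<theta>)" for \<phi> \<theta>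
  define N2 where "N2 \<phi> \<theta> = F2 \<theta> (apply_bcontfun (fst \<phi>) \<theta>) (apply_bcontfun (snd \<phi>) \<theta>)" for \<phi> \<theta>
  have N1: "continuous_on UNIV (N1 \<phi>)" "N1 \<phi> (\<theta> + p) = N1 \<phi> \<theta>" if "\<phi> \<in> s" for \<phi> \<theta>
    using nc[OF cont(1) lip(1) that] that by (auto simp: N1_def[abs_def] per s_def)
  have N2: "continuous_on UNIV (N2 \<phi>)" "N2 \<phi> (\<theta> + p) = N2 \<phi> \<theta>" if "\<phi> \<in> s" for \<phi> \<theta>
    using nc[OF cont(2) lip(2) that] that by (auto simp: N2_def[abs_def] per s_def)
  have "\<exists>y. (\<forall>\<theta>. (y has_real_derivative k1 * y \<theta> + N1 \<phi> \<theta>) (at \<theta>)) \<and> (\<forall>\<theta>. y (\<theta> + p) = y \<theta>)" if "\<phi> \<in> s" for \<phi>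
    using periodic_linear_exists[OF k(1) p N1[OF that]] by metis
  then obtain y1 where y1: "\<And>\<phi> \<theta>. \<phi> \<in> s \<Longrightarrow> (y1 \<phi> has_real_derivative k1 * y1 \<phi> \<theta> + N1 \<phi> \<theta>) (at \<theta>)"
      "\<And>\<phi> \<theta>. \<phi> \<in> s \<Longrightarrow> y1 \<phi> (\<theta> + p) = y1 \<phi> \<theta>" by metis
  have "\<exists>y. (\<forall>\<theta>. (y has_real_derivative k2 * y \<theta> + N2 \<phi> \<theta>) (at \<theta>)) \<and> (\<forall>\<theta>. y (\<theta> + p) = y \<theta>)" if "\<phi> \<in> s" for \<phi>
    using periodic_linear_exists[OF k(2) p N2[OF that]] by metis
  then obtain y2 where y2: "\<And>\<phi> \<theta>. \<phi> \<in> s \<Longrightarrow> (y2 \<phi> has_real_derivative k2 * y2 \<phi> \<theta> + N2 \<phi> \<theta>) (at \<theta>)"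
      "\<And>\<phi> \<theta>. \<phi> \<in> s \<Longrightarrow> y2 \<phi> (\<theta> + p) = y2 \<phi> \<theta>" by metis
  have bd: "\<bar>apply_bcontfun (fst \<phi>) \<theta>\<bar> \<le> \<rho>" "\<bar>apply_bcontfun (snd \<phi>) \<theta>\<bar> \<le> \<rho>" if "\<phi> \<in> s" for \<phi> \<theta>
    using that by (auto simp: s_def)
  have Nb1: "\<bar>N1 \<phi> \<theta>\<bar> \<le> \<bar>k1\<bar> * \<rho>" if "\<phi> \<in> s" for \<phi> \<theta>
  proof -
    have "max \<bar>apply_bcontfun (fst \<phi>) \<theta> - 0\<bar> \<bar>apply_bcontfun (snd \<phi>) \<theta> - 0\<bar> \<le> \<rho>" using bd[OF that] by auto
    then have "\<bar>k1\<bar> / 4 * max \<bar>apply_bcontfun (fst \<phi>) \<theta> - 0\<bar> \<bar>apply_bcontfun (snd \<phi>) \<theta> - 0\<bar> \<le> \<bar>k1\<bar> / 4 * \<rho>"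
      by (intro mult_left_mono) auto
    moreover have "\<bar>N1 \<phi> \<theta> - F1 \<theta> 0 0\<bar> \<le> \<bar>k1\<bar> / 4 * max \<bar>apply_bcontfun (fst \<phi>) \<theta> - 0\<bar> \<bar>apply_bcontfun (snd \<phi>) \<theta> - 0\<bar>"
      unfolding N1_def using bd[OF that] \<rho> by (intro lip) auto
    ultimately have "\<bar>N1 \<phi> \<theta> - F1 \<theta> 0 0\<bar> \<le> \<bar>k1\<bar> / 4 * \<rho>" by linarith
    moreover have "\<bar>k1\<bar> * (3/4 * \<rho>) + \<bar>k1\<bar> / 4 * \<rho> = \<bar>k1\<bar> * \<rho>" by simp
    ultimately show ?thesis using small(1)[of \<theta>] by linarith
  qed
  have Nb2: "\<bar>N2 \<phi> \<theta>\<bar> \<le> \<bar>k2\<bar> * \<rho>" if "\<phi> \<in> s" for \<phi> \<theta>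
  proof -
    have "max \<bar>apply_bcontfun (fst \<phi>) \<theta> - 0\<bar> \<bar>apply_bcontfun (snd \<phi>) \<theta> - 0\<bar> \<le> \<rho>" using bd[OF that] by auto
    then have "\<bar>k2\<bar> / 4 * max \<bar>apply_bcontfun (fst \<phi>) \<theta> - 0\<bar> \<bar>apply_bcontfun (snd \<phi>) \<theta> - 0\<bar> \<le> \<bar>k2\<bar> / 4 * \<rho>"
      by (intro mult_left_mono) auto
    moreover have "\<bar>N2 \<phi> \<theta> - F2 \<theta> 0 0\<bar> \<le> \<bar>k2\<bar> / 4 * max \<bar>apply_bcontfun (fst \<phi>) \<theta> - 0\<bar> \<bar>apply_bcontfun (snd \<phi>) \<theta> - 0\<bar>"
      unfolding N2_def using bd[OF that] \<rho> by (intro lip) auto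
    ultimately have "\<bar>N2 \<phi> \<theta> - F2 \<theta> 0 0\<bar> \<le> \<bar>k2\<bar> / 4 * \<rho>" by linarith
    moreover have "\<bar>k2\<bar> * (3/4 * \<rho>) + \<bar>k2\<bar> / 4 * \<rho> = \<bar>k2\<bar> * \<rho>" by simp
    ultimately show ?thesis using small(2)[of \<theta>] by linarith
  qed
  have yb1: "\<bar>y1 \<phi> \<theta>\<bar> \<le> \<rho>" if "\<phi> \<in> s" for \<phi> \<theta>
    using periodic_linear_bound[OF k(1) p y1(1)[OF that] y1(2)[OF that] Nb1[OF that]] k by simp
  have yb2: "\<bar>y2 \<phi> \<theta>\<bar> \<le> \<rho>" if "\<phi> \<in> s" for \<phi> \<theta>
    using periodic_linear_bound[OF k(2) p y2(1)[OF that] y2(2)[OF that] Nb2[OF that]] k by simp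
  have yB1: "y1 \<phi> \<in> bcontfun" if "\<phi> \<in> s" for \<phi>
    by (rule bcontfun_normI[of _ \<rho>])
      (use y1(1)[OF that] yb1[OF that] in \<open>auto intro: DERIV_continuous continuous_at_imp_continuous_on\<close>)
  have yB2: "y2 \<phi> \<in> bcontfun" if "\<phi> \<in> s" for \<phi>
    by (rule bcontfun_normI[of _ \<rho>])
      (use y2(1)[OF that] yb2[OF that] in \<open>auto intro: DERIV_continuous continuous_at_imp_continuous_on\<close>)
  define T where "T \<phi> = (Bcontfun (y1 \<phi>), Bcontfun (y2 \<phi>))" for \<phi>
  have T: "apply_bcontfun (fst (T \<phi>)) = y1 \<phi>" "apply_bcontfun (snd (T \<phi>)) = y2 \<phi>" if "\<phi> \<in> s" for \<phi>
    using Bcontfun_inverse[OF yB1[OF that]] Bcontfun_inverse[OF yB2[OF that]] by (auto simp: T_def)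
  have Ts: "T ` s \<subseteq> s"
    by (auto simp: s_def[THEN eqset_imp_iff] T y1(2) y2(2) yb1 yb2)
  have contr: "dist (T \<phi>) (T \<psi>) \<le> 1/2 * dist \<phi> \<psi>" if \<phi>: "\<phi> \<in> s" and \<psi>: "\<psi> \<in> s" for \<phi> \<psi>
  proof -
    define D where "D = dist \<phi> \<psi>"
    have m: "max \<bar>apply_bcontfun (fst \<phi>) \<theta> - apply_bcontfun (fst \<psi>) \<theta>\<bar> \<bar>apply_bcontfun (snd \<phi>) \<theta> - apply_bcontfun (snd \<psi>) \<theta>\<bar> \<le> D" for \<theta>
      using dist_bounded[of "fst \<phi>" \<theta> "fst \<psi>"] dist_bounded[of "snd \<phi>" \<theta> "snd \<psi>"]
        dist_fst_le[of \<phi> \<psi>] dist_snd_le[of \<phi> \<psi>] by (auto simp: D_def dist_real_def)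
    have n1: "\<bar>N1 \<phi> \<theta> - N1 \<psi> \<theta>\<bar> \<le> \<bar>k1\<bar> / 4 * D" for \<theta>
      unfolding N1_def using bd[OF \<phi>] bd[OF \<psi>]
      by (intro order_trans[OF lip(1)] mult_left_mono m) auto
    have n2: "\<bar>N2 \<phi> \<theta> - N2 \<psi> \<theta>\<bar> \<le> \<bar>k2\<bar> / 4 * D" for \<theta>
      unfolding N2_def using bd[OF \<phi>] bd[OF \<psi>]
      by (intro order_trans[OF lip(2)] mult_left_mono m) auto
    have dd1: "((\<lambda>\<theta>. y1 \<phi> \<theta> - y1 \<psi> \<theta>) has_real_derivative
        k1 * (y1 \<phi> \<theta> - y1 \<psi> \<theta>) + (N1 \<phi> \<theta> - N1 \<psi> \<theta>)) (at \<theta>)" for \<theta>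
      using DERIV_diff[OF y1(1)[OF \<phi>, of \<theta>] y1(1)[OF \<psi>, of \<theta>]] by (simp add: algebra_simps)
    have "\<bar>y1 \<phi> \<theta> - y1 \<psi> \<theta>\<bar> \<le> \<bar>k1\<bar> / 4 * D / \<bar>k1\<bar>" for \<theta>
      by (rule periodic_linear_bound[OF k(1) p dd1 _ n1]) (simp add: y1(2)[OF \<phi>] y1(2)[OF \<psi>])
    then have d1: "dist (fst (T \<phi>)) (fst (T \<psi>)) \<le> D / 4"
      using k by (intro dist_bound) (simp add: T \<phi> \<psi> dist_real_def)
    have dd2: "((\<lambda>\<theta>. y2 \<phi> \<theta> - y2 \<psi> \<theta>) has_real_derivative
        k2 * (y2 \<phi> \<theta> - y2 \<psi> \<theta>) + (N2 \<phi> \<theta> - N2 \<psi> \<theta>)) (at \<theta>)" for \<theta>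
      using DERIV_diff[OF y2(1)[OF \<phi>, of \<theta>] y2(1)[OF \<psi>, of \<theta>]] by (simp add: algebra_simps)
    have "\<bar>y2 \<phi> \<theta> - y2 \<psi> \<theta>\<bar> \<le> \<bar>k2\<bar> / 4 * D / \<bar>k2\<bar>" for \<theta>
      by (rule periodic_linear_bound[OF k(2) p dd2 _ n2]) (simp add: y2(2)[OF \<phi>] y2(2)[OF \<psi>])
    then have d2: "dist (snd (T \<phi>)) (snd (T \<psi>)) \<le> D / 4"
      using k by (intro dist_bound) (simp add: T \<phi> \<psi> dist_real_def)
    \<comment> \<open>The Euclidean product metric is at most the sum of the component distances, so
      the two factors 1/4 combine to 1/2.\<close>
    have "dist (T \<phi>) (T \<psi>) \<le> dist (fst (T \<phi>)) (fst (T \<psi>)) + dist (snd (T \<phi>)) (snd (T \<psi>))"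
      unfolding dist_prod_def by (rule sqrt_sum_squares_le_sum) auto
    then show ?thesis using d1 d2 by (simp add: D_def)
  qed
  have "\<exists>!\<phi>. \<phi> \<in> s \<and> T \<phi> = \<phi>"
    using Banach_fix[OF cs ne _ _ Ts, of "1/2"] contr by auto
  then obtain \<phi> where \<phi>: "\<phi> \<in> s" "T \<phi> = \<phi>" by blast
  then have e: "apply_bcontfun (fst \<phi>) = y1 \<phi>" "apply_bcontfun (snd \<phi>) = y2 \<phi>" using T by metis+
  show ?thesis
  proof (rule that[of "y1 \<phi>" "y2 \<phi>"])
    show "(y1 \<phi> has_real_derivative k1 * y1 \<phi> \<theta> + F1 \<theta> (y1 \<phi> \<theta>) (y2 \<phi> \<theta>)) (at \<theta>)" for \<theta>
      using y1(1)[OF \<phi>(1), of \<theta>] by (simp add: N1_def e)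
    show "(y2 \<phi> has_real_derivative k2 * y2 \<phi> \<theta> + F2 \<theta> (y1 \<phi> \<theta>) (y2 \<phi> \<theta>)) (at \<theta>)" for \<theta>
      using y2(1)[OF \<phi>(1), of \<theta>] by (simp add: N2_def e)
  qed (use y1(2) y2(2) yb1 yb2 \<phi> in auto)
qed

text \<open>\<open>w\<close> is the angular speed, so the antiderivative \<open>\<tau>\<close> of
  1/w is time as a function of the angle, and its inverse \<open>g\<close> turns the curve into a
  solution. By periodicity of \<open>w\<close> every turn takes the same time. The two distinct
  points \<open>u a\<close> and \<open>u b\<close> exclude an equilibrium.\<close>

lemma periodic_solution_from_angle:
  fixes f :: "real^'n \<Rightarrow> real^'n" and u :: "real \<Rightarrow> real^'n"
  assumes u: "\<And>\<theta>. (u has_vector_derivative (1 / w \<theta>) *\<^sub>R f (u \<theta>)) (at \<theta>)" "\<And>\<theta>. u (\<theta> + p) = u \<theta>"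
    and w: "continuous_on UNIV w" "\<And>\<theta>. w (\<theta> + p) = w \<theta>" "\<And>\<theta>. c \<le> w \<theta>" "\<And>\<theta>. w \<theta> \<le> M" "0 < c"
    and p: "0 < p" and ne: "u a \<noteq> u b"
  obtains \<gamma> where "periodic_solution f \<gamma>" "range \<gamma> = range u"
proof -
  have wpos: "0 < w \<theta>" for \<theta> using w(3)[of \<theta>] w(5) by linarith
  have M: "0 < M" using w(4)[of 0] wpos[of 0] by linarith
  have "continuous_on UNIV (\<lambda>\<theta>. 1 / w \<theta>)"
    by (intro continuous_intros w(1)) (metis less_irrefl wpos)
  then obtain \<tau> where \<tau>: "\<And>\<theta>. (\<tau> has_real_derivative 1 / w \<theta>) (at \<theta>)"
    using continuous_antiderivative_real by blast
  \<comment> \<open>The slope of \<open>\<tau>\<close> is at least 1/M. This one estimate gives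
    injectivity, surjectivity and the Lipschitz bound on the inverse.\<close>
  have mono: "(b - a) / M \<le> \<tau> b - \<tau> a" if "a \<le> b" for a b
  proof -
    have "\<tau> a - a / M \<le> \<tau> b - b / M"
    proof (rule DERIV_nonneg_imp_nondecreasing[OF that])
      fix x
      have "((\<lambda>x. \<tau> x - x / M) has_real_derivative 1 / w x - 1 / M) (at x)"
        by (rule derivative_eq_intros \<tau> refl)+ (use M in auto)
      moreover have "0 \<le> 1 / w x - 1 / M" using w(4)[of x] wpos[of x] by (simp add: frac_le)
      ultimately show "\<exists>y. ((\<lambda>x. \<tau> x - x / M) has_real_derivative y) (at x) \<and> 0 \<le> y" by blast
    qed
    then show ?thesis by (simp add: diff_divide_distrib)
  qed
  have absmono: "\<bar>b - a\<bar> / M \<le> \<bar>\<tau> b - \<tau> a\<bar>" for a b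
    using mono[of a b] mono[of b a] by (cases "a \<le> b") auto
  have surj: "\<exists>\<theta>. \<tau> \<theta> = t" for t
  proof -
    define R where "R = M * \<bar>t - \<tau> 0\<bar>"
    have R: "R / M = \<bar>t - \<tau> 0\<bar>" "0 \<le> R" using M by (auto simp: R_def)
    have "t \<le> \<tau> R" using mono[of 0 R] R by auto
    moreover have "\<tau> (-R) \<le> t" using mono[of "-R" 0] R by auto
    moreover have "\<forall>x. isCont \<tau> x" using \<tau> DERIV_isCont by blast
    ultimately show ?thesis using IVT[of \<tau> "-R" t R] R by auto
  qed
  then obtain g where g: "\<And>t. \<tau> (g t) = t" by metis
  have inj: "a = b" if "\<tau> a = \<tau> b" for a b
    using absmono[of a b] that M by (simp add: divide_le_0_iff)
  have glip: "\<bar>g s - g t\<bar> \<le> M * \<bar>s - t\<bar>" for s t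
    using absmono[of "g s" "g t"] M by (simp add: g divide_le_eq mult.commute abs_minus_commute)
  have gc: "isCont g t" for t
  proof -
    have "M-lipschitz_on UNIV g" using glip M by (intro lipschitz_onI) (auto simp: dist_real_def)
    then show ?thesis using lipschitz_on_continuous_on continuous_on_eq_continuous_at by blast
  qed
  have gd: "(g has_real_derivative w (g t)) (at t)" for t
    using DERIV_inverse_function[of \<tau> "1 / w (g t)" g t "t - 1" "t + 1"] \<tau> g gc wpos[of "g t"]
    by (simp add: inverse_eq_divide)
  define \<gamma> where "\<gamma> t = u (g t)" for t
  have \<gamma>d: "(\<gamma> has_vector_derivative f (\<gamma> t)) (at t)" for t
  proof -
    have "((u \<circ> g) has_vector_derivative w (g t) *\<^sub>R ((1 / w (g t)) *\<^sub>R f (u (g t)))) (at t)"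
      using gd[of t] u(1)[of "g t"] unfolding has_real_derivative_iff_has_vector_derivative
      by (rule vector_diff_chain_at)
    then show ?thesis using wpos[of "g t"] by (simp add: \<gamma>_def[abs_def] o_def)
  qed
  have gg: "g (\<tau> \<theta>) = \<theta>" for \<theta> using inj[of "g (\<tau> \<theta>)" \<theta>] g by simp
  have rng: "range \<gamma> = range u"
    unfolding \<gamma>_def using gg by (metis (mono_tags, lifting) image_image surj_def)
  define T where "T = \<tau> p - \<tau> 0"
  have "((\<lambda>s. \<tau> (s + p) - \<tau> s) has_real_derivative 0) (at s)" for s
  proof -
    have "((\<lambda>s. \<tau> (s + p)) has_real_derivative 1 / w (s + p) * 1) (at s)"
      by (rule DERIV_chain2[OF \<tau>]) (auto intro!: derivative_eq_intros)
    then show ?thesis using \<tau>[of s] by (auto intro!: derivative_eq_intros simp: w(2))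
  qed
  then have \<tau>p: "\<tau> (s + p) = \<tau> s + T" for s
    using DERIV_isconst_all[of "\<lambda>s. \<tau> (s + p) - \<tau> s" s 0] by (simp add: T_def)
  have T: "0 < T" using mono[of 0 p] p M by (simp add: T_def) (smt (verit) divide_pos_pos)
  have "g (t + T) = g t + p" for t
    using \<tau>p[of "g t"] gg[of "g t + p"] g by simp
  then have per: "\<gamma> (t + T) = \<gamma> t" for t by (simp add: \<gamma>_def u(2))
  have "\<exists>t. \<gamma> t \<noteq> \<gamma> 0"
  proof (rule ccontr)
    assume "\<not> ?thesis"
    then have "u x = \<gamma> 0" for x using rng by (metis rangeE rangeI)
    then show False using ne by metis
  qed
  then have "periodic_solution f \<gamma>"
    unfolding periodic_solution_def is_solution_on_def using \<gamma>d per T by auto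
  then show ?thesis using that rng by blast
qed

section \<open>Lipschitz remainders of a given order\<close>

text \<open>Models a remainder of order k whose derivative has order k - 1, without any
  differentiability. The factor \<open>norm u\<close> on the left stands in for the exponent k - 1,
  which natural subtraction would spoil at k = 0; by symmetry only pairs with \<open>u\<close> as
  the larger point are listed.\<close>

definition lipo :: "nat \<Rightarrow> ('a::real_normed_vector \<Rightarrow> 'b::real_normed_vector) \<Rightarrow> bool" where
  "lipo k F \<longleftrightarrow> (\<exists>C\<ge>0. (\<forall>u. norm u \<le> 1 \<longrightarrow> norm (F u) \<le> C * norm u ^ k) \<and>
     (\<forall>u v. norm u \<le> 1 \<longrightarrow> norm v \<le> norm u \<longrightarrow> norm (F u - F v) * norm u \<le> C * norm u ^ k * norm (u - v)))"

lemma lipoI: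
  assumes "0 \<le> C" "\<And>u. norm u \<le> 1 \<Longrightarrow> norm (F u) \<le> C * norm u ^ k"
    "\<And>u v. norm u \<le> 1 \<Longrightarrow> norm v \<le> norm u \<Longrightarrow> norm (F u - F v) * norm u \<le> C * norm u ^ k * norm (u - v)"
  shows "lipo k F"
  unfolding lipo_def using assms by blast

lemma lipoE:
  assumes "lipo k F"
  obtains C where "0 \<le> C" "\<And>u. norm u \<le> 1 \<Longrightarrow> norm (F u) \<le> C * norm u ^ k"
    "\<And>u v. norm u \<le> 1 \<Longrightarrow> norm v \<le> norm u \<Longrightarrow> norm (F u - F v) * norm u \<le> C * norm u ^ k * norm (u - v)"
  using assms unfolding lipo_def by blast

lemma lipo_const: "lipo 0 (\<lambda>_. c)"
  by (rule lipoI[of "norm c"]) auto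

lemma lipo_linear:
  assumes "bounded_linear F" shows "lipo 1 F"
proof -
  interpret F: bounded_linear F by fact
  obtain K where K: "0 < K" "\<And>x. norm (F x) \<le> norm x * K" using F.pos_bounded by blast
  show ?thesis
  proof (rule lipoI[of K])
    show "norm (F u) \<le> K * norm u ^ 1" for u using K(2)[of u] by (simp add: mult.commute)
    show "norm (F u - F v) * norm u \<le> K * norm u ^ 1 * norm (u - v)" for u v
      using mult_right_mono[OF K(2)[of "u - v"], of "norm u"] by (simp add: F.diff mult_ac)
  qed (use K in auto)
qed

lemma lipo_add:
  assumes "lipo k F" "lipo k G" shows "lipo k (\<lambda>u. F u + G u)"
proof -
  obtain C where C: "0 \<le> C" "\<And>u. norm u \<le> 1 \<Longrightarrow> norm (F u) \<le> C * norm u ^ k"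
    "\<And>u v. norm u \<le> 1 \<Longrightarrow> norm v \<le> norm u \<Longrightarrow> norm (F u - F v) * norm u \<le> C * norm u ^ k * norm (u - v)"
    using assms(1) by (rule lipoE) blast
  obtain D where D: "0 \<le> D" "\<And>u. norm u \<le> 1 \<Longrightarrow> norm (G u) \<le> D * norm u ^ k"
    "\<And>u v. norm u \<le> 1 \<Longrightarrow> norm v \<le> norm u \<Longrightarrow> norm (G u - G v) * norm u \<le> D * norm u ^ k * norm (u - v)"
    using assms(2) by (rule lipoE) blast
  show ?thesis
  proof (rule lipoI[of "C + D"])
    show "norm (F u + G u) \<le> (C + D) * norm u ^ k" if "norm u \<le> 1" for u
      using C(2)[OF that] D(2)[OF that] norm_triangle_ineq[of "F u" "G u"] by (simp add: distrib_right)
    show "norm (F u + G u - (F v + G v)) * norm u \<le> (C + D) * norm u ^ k * norm (u - v)"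
      if "norm u \<le> 1" "norm v \<le> norm u" for u v
    proof -
      have "norm (F u + G u - (F v + G v)) \<le> norm (F u - F v) + norm (G u - G v)"
        by (rule norm_diff_triangle_ineq)
      from mult_right_mono[OF this, of "norm u"] show ?thesis
        using C(3)[OF that] D(3)[OF that] by (simp add: distrib_right)
    qed
  qed (use C D in auto)
qed

lemma lipo_bilinear:
  assumes "bounded_bilinear B" "lipo j F" "lipo k G" shows "lipo (j + k) (\<lambda>u. B (F u) (G u))"
proof -
  interpret B: bounded_bilinear B by fact
  obtain K where K: "0 < K" "\<And>a b. norm (B a b) \<le> norm a * norm b * K" using B.pos_bounded by blast
  obtain C where C: "0 \<le> C" "\<And>u. norm u \<le> 1 \<Longrightarrow> norm (F u) \<le> C * norm u ^ j"
    "\<And>u v. norm u \<le> 1 \<Longrightarrow> norm v \<le> norm u \<Longrightarrow> norm (F u - F v) * norm u \<le> C * norm u ^ j * norm (u - v)"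
    using assms(2) by (rule lipoE) blast
  obtain D where D: "0 \<le> D" "\<And>u. norm u \<le> 1 \<Longrightarrow> norm (G u) \<le> D * norm u ^ k"
    "\<And>u v. norm u \<le> 1 \<Longrightarrow> norm v \<le> norm u \<Longrightarrow> norm (G u - G v) * norm u \<le> D * norm u ^ k * norm (u - v)"
    using assms(3) by (rule lipoE) blast
  have bd: "norm (B (F u) (G u)) \<le> 2 * K * C * D * norm u ^ (j + k)" if "norm u \<le> 1" for u
  proof -
    have "norm (B (F u) (G u)) \<le> (C * norm u ^ j) * (D * norm u ^ k) * K"
      by (intro order_trans[OF K(2)] mult_right_mono mult_mono C(2) D(2) that) (use K C D in auto)
    also have "\<dots> \<le> 2 * ((C * norm u ^ j) * (D * norm u ^ k) * K)"
      using K C D by (simp add: mult_nonneg_nonneg)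
    finally show ?thesis by (simp add: power_add mult_ac)
  qed
  show ?thesis
  proof (rule lipoI[of "2 * K * C * D"])
    show "norm (B (F u) (G u)) \<le> 2 * K * C * D * norm u ^ (j + k)" if "norm u \<le> 1" for u
      by (rule bd[OF that])
    show "norm (B (F u) (G u) - B (F v) (G v)) * norm u \<le> 2 * K * C * D * norm u ^ (j + k) * norm (u - v)"
      if uv: "norm u \<le> 1" "norm v \<le> norm u" for u v
    proof -
      have v1: "norm v \<le> 1" using uv by simp
      have Gv: "norm (G v) \<le> D * norm u ^ k"
        using D(2)[OF v1] mult_left_mono[OF power_mono[OF uv(2), of k] D(1)] by force
      have "norm (B (F u) (G u) - B (F v) (G v)) \<le> norm (B (F u) (G u - G v)) + norm (B (F u - F v) (G v))"
        by (rule order_trans[OF _ norm_triangle_ineq]) (simp add: B.diff_left B.diff_right)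
      also have "\<dots> \<le> norm (F u) * norm (G u - G v) * K + norm (F u - F v) * norm (G v) * K"
        by (intro add_mono K)
      finally have "norm (B (F u) (G u) - B (F v) (G v)) * norm u
          \<le> norm (F u) * (norm (G u - G v) * norm u) * K + (norm (F u - F v) * norm u) * norm (G v) * K"
        using mult_right_mono[of _ _ "norm u"] by (fastforce simp: algebra_simps)
      also have "\<dots> \<le> (C * norm u ^ j) * (D * norm u ^ k * norm (u - v)) * K + (C * norm u ^ j * norm (u - v)) * (D * norm u ^ k) * K"
        by (intro add_mono mult_right_mono mult_mono C(2,3) D(3) Gv uv) (use K C D in auto)
      also have "\<dots> = 2 * K * C * D * norm u ^ (j + k) * norm (u - v)"
        by (simp add: power_add algebra_simps)
      finally show ?thesis .
    qed
  qed (use K C D in auto)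
qed

lemmas lipo_mult = lipo_bilinear[OF bounded_bilinear_mult]

lemma lipo_compose_linear:
  assumes "bounded_linear L" "lipo k F" shows "lipo k (\<lambda>u. L (F u))"
proof -
  interpret L: bounded_linear L by fact
  obtain K where K: "0 < K" "\<And>x. norm (L x) \<le> norm x * K" using L.pos_bounded by blast
  obtain C where C: "0 \<le> C" "\<And>u. norm u \<le> 1 \<Longrightarrow> norm (F u) \<le> C * norm u ^ k"
    "\<And>u v. norm u \<le> 1 \<Longrightarrow> norm v \<le> norm u \<Longrightarrow> norm (F u - F v) * norm u \<le> C * norm u ^ k * norm (u - v)"
    using assms(2) by (rule lipoE) blast
  show ?thesis
  proof (rule lipoI[of "K * C"])
    show "norm (L (F u)) \<le> K * C * norm u ^ k" if "norm u \<le> 1" for u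
    proof -
      have "norm (F u) * K \<le> (C * norm u ^ k) * K" using K by (intro mult_right_mono C(2)[OF that]) auto
      then show ?thesis using K(2)[of "F u"] by (simp add: mult_ac)
    qed
    show "norm (L (F u) - L (F v)) * norm u \<le> K * C * norm u ^ k * norm (u - v)"
      if "norm u \<le> 1" "norm v \<le> norm u" for u v
    proof -
      have "norm (L (F u) - L (F v)) * norm u \<le> (norm (F u - F v) * K) * norm u"
        unfolding L.diff[symmetric] by (intro mult_right_mono K) auto
      also have "\<dots> = K * (norm (F u - F v) * norm u)" by simp
      also have "\<dots> \<le> K * (C * norm u ^ k * norm (u - v))"
        using K by (intro mult_left_mono C(3)[OF that]) auto
      finally show ?thesis by (simp add: mult_ac)
    qed
  qed (use K C in auto)
qed

lemmas lipo_Re = lipo_compose_linear[OF bounded_linear_Re]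
lemmas lipo_Im = lipo_compose_linear[OF bounded_linear_Im]
lemmas lipo_cnj = lipo_compose_linear[OF bounded_linear_cnj]
lemmas lipo_of_real = lipo_compose_linear[OF bounded_linear_of_real]
lemmas lipo_uminus = lipo_compose_linear[OF bounded_linear_minus[OF bounded_linear_ident]]

lemma lipo_cmult: "lipo k F \<Longrightarrow> lipo k (\<lambda>u. c * F u)" for c :: "'a::real_normed_algebra"
  using lipo_mult[OF lipo_const] by fastforce

lemma lipo_diff: "lipo k F \<Longrightarrow> lipo k G \<Longrightarrow> lipo k (\<lambda>u. F u - G u)"
  using lipo_add[of k F "\<lambda>u. - G u"] lipo_uminus by fastforce

text \<open>Holds because only the unit ball matters. In use, the order of a polynomial term is
  first obtained by adding the orders of its factors and then lowered here to the order
  wanted.\<close>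

lemma lipo_mono:
  assumes "lipo k F" "j \<le> k" shows "lipo j F"
proof -
  obtain C where C: "0 \<le> C" "\<And>u. norm u \<le> 1 \<Longrightarrow> norm (F u) \<le> C * norm u ^ k"
    "\<And>u v. norm u \<le> 1 \<Longrightarrow> norm v \<le> norm u \<Longrightarrow> norm (F u - F v) * norm u \<le> C * norm u ^ k * norm (u - v)"
    using assms(1) by (rule lipoE) blast
  have p: "C * norm u ^ k \<le> C * norm u ^ j" if "norm u \<le> 1" for u :: 'a
    using that assms(2) C(1) by (intro mult_left_mono power_decreasing) auto
  show ?thesis
  proof (rule lipoI[of C])
    show "norm (F u) \<le> C * norm u ^ j" if "norm u \<le> 1" for u
      using C(2)[OF that] p[OF that] by linarith
    show "norm (F u - F v) * norm u \<le> C * norm u ^ j * norm (u - v)"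
      if "norm u \<le> 1" "norm v \<le> norm u" for u v
      using C(3)[OF that] mult_right_mono[OF p[OF that(1)], of "norm (u - v)"] by simp
  qed (use C in auto)
qed

lemma lipo_power:
  fixes F :: "'a::real_normed_vector \<Rightarrow> 'b::{real_normed_algebra_1}"
  assumes "lipo k F" shows "lipo (n * k) (\<lambda>u. F u ^ n)"
  by (induction n) (use assms lipo_const lipo_mult in \<open>auto\<close>)

lemma lipo_lipschitz:
  assumes "lipo (Suc k) F"
  obtains C where "C-lipschitz_on (cball 0 1) F"
proof -
  obtain C where C: "0 \<le> C" 
    "\<And>u v. norm u \<le> 1 \<Longrightarrow> norm v \<le> norm u \<Longrightarrow> norm (F u - F v) * norm u \<le> C * norm u ^ 1 * norm (u - v)"
    using lipo_mono[OF assms, of 1] by (rule lipoE) auto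
  have *: "norm (F u - F v) \<le> C * norm (u - v)" if "norm u \<le> 1" "norm v \<le> norm u" for u v
  proof (cases "norm u = 0")
    case True then show ?thesis using that by simp
  next
    case False
    then have "0 < norm u" by simp
    then show ?thesis using C(2)[OF that] by (simp add: mult_ac)
  qed
  have "C-lipschitz_on (cball 0 1) F"
  proof (rule lipschitz_onI)
    fix u v :: 'a assume "u \<in> cball 0 1" "v \<in> cball 0 1"
    then show "dist (F u) (F v) \<le> C * dist u v"
      using *[of u v] *[of v u] by (cases "norm v \<le> norm u") (auto simp: dist_norm norm_minus_commute)
  qed fact
  then show ?thesis by (rule that)
qed

text \<open>The general real quadratic form on the complex plane: \<open>a\<close> is the
  coefficient of z^2, its conjugate that of the conjugate square, and \<open>b\<close> that of
  |z|^2.\<close>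

definition quad_form :: "complex \<Rightarrow> real \<Rightarrow> complex \<Rightarrow> real" where
  "quad_form a b z = 2 * Re (a * z^2) + b * Re (z * cnj z)"

definition quad_form_deriv :: "complex \<Rightarrow> real \<Rightarrow> complex \<Rightarrow> complex \<Rightarrow> real" where
  "quad_form_deriv a b z v = 2 * Re (2 * a * z * v) + b * (2 * Re (cnj z * v))"

lemma has_derivative_along_curve:
  fixes g :: "'a::real_normed_vector \<Rightarrow> real"
  assumes g: "(g has_derivative g') (at (x t))" and x: "(x has_vector_derivative v) (at t within S)"
  shows "((\<lambda>s. g (x s)) has_real_derivative g' v) (at t within S)"
proof -
  have "((\<lambda>s. g (x s)) has_derivative (\<lambda>h. g' (h *\<^sub>R v))) (at t within S)"
    using has_derivative_compose[OF x[unfolded has_vector_derivative_def] g] .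
  moreover have "linear g'" using g has_derivative_linear by blast
  then have "(\<lambda>h. g' (h *\<^sub>R v)) = (*) (g' v)"
    by (auto simp: linear_cmul)
  ultimately show ?thesis by (simp add: has_field_derivative_def)
qed

lemma quad_form_has_derivative: "(quad_form a b has_derivative quad_form_deriv a b z) (at z)"
proof -
  have "((\<lambda>z. 2 * Re (a * z^2) + b * Re (z * cnj z)) has_derivative
      (\<lambda>v. 2 * Re (a * (of_nat 2 * v * z ^ (2 - 1))) + b * Re (z * cnj v + v * cnj z))) (at z)"
    by (intro derivative_intros has_derivative_mult_right has_derivative_mult bounded_linear.has_derivative[OF bounded_linear_Re]
        has_derivative_power bounded_linear.has_derivative[OF bounded_linear_cnj] has_derivative_add has_derivative_ident)
  moreover have "(\<lambda>v. 2 * Re (a * (of_nat 2 * v * z ^ (2 - 1))) + b * Re (z * cnj v + v * cnj z)) = quad_form_deriv a b z"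
    by (rule ext) (simp add: quad_form_deriv_def algebra_simps)
  ultimately show ?thesis unfolding quad_form_def[abs_def] by simp
qed

lemma cmod_sq_Re: "Re (z * cnj z) = (norm z)^2"
  unfolding cmod_power2 by (simp add: power2_eq_square)

section \<open>The Hopf normal form\<close>

text \<open>\<open>Z\<close> and \<open>W\<close> are the coordinates along the critical pair and along the stable direction; \<open>quad_form h20 h11\<close>
  is the quadratic part of the center manifold.\<close>

locale hopf_form =
  fixes F :: "real \<Rightarrow> real^'n \<Rightarrow> real^'n" and P :: "real^'n"
    and Z :: "real^'n \<Rightarrow> complex" and W :: "real^'n \<Rightarrow> real" and emb :: "complex \<Rightarrow> real \<Rightarrow> real^'n"
    and \<omega> \<nu> h11 :: real and h20 n20 n11 n02 d30 d21 d12 d03 k1 k2 k3 :: complex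
    and E1 E4 :: "real^'n \<Rightarrow> complex" and D1 D3 K2 :: "real^'n \<Rightarrow> real"
  assumes \<omega>: "0 < \<omega>" and \<nu>: "0 < \<nu>"
    and Z: "bounded_linear Z" and W: "bounded_linear W"
    and emb: "bounded_linear (\<lambda>q. emb (fst q) (snd q))"
    and Z_emb: "\<And>z w. Z (emb z w) = z" and W_emb: "\<And>z w. W (emb z w) = w"
    and emb_ZW: "\<And>u. emb (Z u) (W u) = u"
    and E1: "lipo 1 E1" and E4: "lipo 4 E4" and D1: "lipo 1 D1" and D3: "lipo 3 D3" and K2: "lipo 1 K2"
    and Z_F: "\<And>\<eta> u. Z (F \<eta> (P + u)) = \<i> * of_real \<omega> * Z u + of_real \<eta> * (k1 * Z u + k2 * cnj (Z u) + k3 * of_real (W u))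
       + (n20 * (Z u)^2 + n11 * Z u * cnj (Z u) + n02 * (cnj (Z u))^2)
       + (d30 * (Z u)^3 + d21 * (Z u)^2 * cnj (Z u) + d12 * Z u * (cnj (Z u))^2 + d03 * (cnj (Z u))^3)
       + of_real (W u - quad_form h20 h11 (Z u)) * E1 u + E4 u"
    and W_F: "\<And>\<eta> u. W (F \<eta> (P + u)) - quad_form_deriv h20 h11 (Z u) (Z (F \<eta> (P + u))) =
       - \<nu> * (W u - quad_form h20 h11 (Z u)) + (W u - quad_form h20 h11 (Z u)) * D1 u + D3 u + \<eta> * K2 u"
begin

abbreviation "h \<equiv> quad_form h20 h11"
abbreviation "dh \<equiv> quad_form_deriv h20 h11"
abbreviation "J \<equiv> \<i> * of_real \<omega> :: complex"

definition "X u = W u - h (Z u)"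
definition "g2 z = n20 * z^2 + n11 * z * cnj z + n02 * (cnj z)^2"
definition "g3 z = d30 * z^3 + d21 * z^2 * cnj z + d12 * z * (cnj z)^2 + d03 * (cnj z)^3"
definition "K1 u = k1 * Z u + k2 * cnj (Z u) + k3 * of_real (W u)"

text \<open>The coefficients of \<open>V\<close> are chosen so that all terms of \<open>V'\<close> up to order four cancel,
  except for the resonant term \<open>2 lc |z|\<^sup>4\<close>.\<close>

definition "ca = \<i> * cnj n02 / (3 * of_real \<omega>)"
definition "cb = \<i> * (n20 + cnj n11) / of_real \<omega>"
definition "cc = \<i> * (3 * ca * n20 + cb * cnj n02 + cnj d03) / (4 * of_real \<omega>)"
definition "cd = \<i> * (3 * ca * n11 + 2 * cb * n20 + cb * cnj n11 + d30 + cnj d12 + cnj (2 * cb * n02)) / (2 * of_real \<omega>)"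
definition "ce = \<i> * cnj k2 / (2 * of_real \<omega>)"

text \<open>The real part of the coefficient of z |z|^2 in the Poincare normal form. The coefficient
  \<open>n20\<close> of z^2 carries no factor 1/2 here; the squared moduli of \<open>n11\<close> and
  \<open>n02\<close> in the general formula only affect the imaginary part.\<close>

definition "lc = Re d21 - Im (n20 * n11) / \<omega>"

definition "V \<eta> z = Re (z * cnj z) + 2 * Re (ca * z^3 + cb * z^2 * cnj z + cc * z^4 + cd * z^3 * cnj z)
   + \<eta> * (2 * Re (ce * z^2))"

text \<open>\<open>A2\<close> and \<open>A3\<close> are the parts of degree two and three of the
  derivative in z of the cubic and quartic correction in \<open>V\<close>, \<open>B2\<close> and
  \<open>B3\<close> those of the derivative in the conjugate of z. They are separated because the
  cancellations are verified degree by degree.\<close>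

definition "A2 z = 3 * ca * z^2 + 2 * cb * z * cnj z"
definition "A3 z = 4 * cc * z^3 + 3 * cd * z^2 * cnj z"
definition "B2 z = cb * z^2"
definition "B3 z = cd * z^3"
definition "Lv z v = (cnj z + (A2 z + A3 z)) * v + (B2 z + B3 z) * cnj v"
definition "dV \<eta> z v = 2 * Re (Lv z v) + \<eta> * (2 * Re (2 * ce * z * v))"

lemma V_has_derivative: "(V \<eta> has_derivative dV \<eta> z) (at z)"
proof -
  let ?D = "\<lambda>v. Re (z * cnj v + v * cnj z) + 2 * Re (ca * (of_nat 3 * v * z ^ (3 - 1))
      + (cb * z^2 * cnj v + cb * (of_nat 2 * v * z ^ (2 - 1)) * cnj z) + cc * (of_nat 4 * v * z ^ (4 - 1))
      + (cd * z^3 * cnj v + cd * (of_nat 3 * v * z ^ (3 - 1)) * cnj z))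
      + \<eta> * (2 * Re (ce * (of_nat 2 * v * z ^ (2 - 1))))"
  have "((\<lambda>z. Re (z * cnj z) + 2 * Re (ca * z^3 + cb * z^2 * cnj z + cc * z^4 + cd * z^3 * cnj z)
      + \<eta> * (2 * Re (ce * z^2))) has_derivative ?D) (at z)"
    by (intro has_derivative_mult_right has_derivative_mult bounded_linear.has_derivative[OF bounded_linear_Re]
        has_derivative_power bounded_linear.has_derivative[OF bounded_linear_cnj] has_derivative_add has_derivative_ident)
  moreover have "?D = dV \<eta> z"
  proof
    fix v
    have "Re (z * cnj v + v * cnj z) = 2 * Re (cnj z * v)" by simp
    then show "?D v = dV \<eta> z v"
      unfolding dV_def Lv_def A2_def A3_def B2_def B3_def
      by (simp only: distrib_right distrib_left plus_complex.simps mult_2[symmetric])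
        (simp add: algebra_simps power2_eq_square power3_eq_cube del: Re_divide Im_divide times_complex.sel)
  qed
  ultimately show ?thesis unfolding V_def[abs_def] by simp
qed

text \<open>The homological equations. The rotation multiplies a monomial with exponents j of z and
  k of its conjugate by i omega (j - k), which is 3, 1, 4, 2, 2 for the five coefficients. For |z|^4
  this factor is 0, so that term cannot be removed.\<close>

lemma J_ca: "J * ca = - cnj n02 / 3" and J_cb: "J * cb = - (n20 + cnj n11)"
  and J_cc: "4 * (J * cc) = - (3 * ca * n20 + cb * cnj n02 + cnj d03)"
  and J_cd: "2 * (J * cd) = - (3 * ca * n11 + 2 * cb * n20 + cb * cnj n11 + d30 + cnj d12 + cnj (2 * cb * n02))"
  and J_ce: "2 * (J * ce) = - cnj k2"
  using \<omega> by (simp_all add: ca_def cb_def cc_def cd_def ce_def field_simps)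

lemma Re_diff_cnj: "Re (y - cnj y) = 0" by simp

lemma degree2: "Re (cnj z * (J * z)) = 0"
  by (simp add: algebra_simps)

text \<open>Only the real part has to vanish. Once the homological equations are inserted, what
  remains is \<open>y - cnj y\<close>; this is why one coefficient per conjugate pair of monomials
  suffices in \<open>V\<close>.\<close>

lemma degree3: "Re (cnj z * g2 z + (A2 z * (J * z) + B2 z * cnj (J * z))) = 0"
proof -
  define y where "y = n11 * z * (cnj z)^2 + n02 * (cnj z)^3"
  have "cnj z * g2 z + (A2 z * (J * z) + B2 z * cnj (J * z))
      = n20 * z^2 * cnj z + n11 * z * (cnj z)^2 + n02 * (cnj z)^3 + 3 * (J * ca) * z^3 + (J * cb) * z^2 * cnj z"
    unfolding g2_def A2_def B2_def by (simp add: power2_eq_square power3_eq_cube algebra_simps)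
  also have "\<dots> = y - cnj y"
    unfolding J_ca J_cb y_def by (simp add: algebra_simps)
  finally show ?thesis using Re_diff_cnj[of y] by simp
qed

lemma Re_resonant: "Re (d21 + 3 * ca * n02 + 2 * cb * n11 + cb * cnj n20) = lc"
proof -
  have "3 * ca * n02 + 2 * cb * n11 + cb * cnj n20
      = \<i> * (cnj n02 * n02 + (n20 + cnj n11) * (2 * n11 + cnj n20)) / of_real \<omega>"
    using \<omega> by (simp add: ca_def cb_def field_simps)
  then have "Re (3 * ca * n02 + 2 * cb * n11 + cb * cnj n20)
      = - Im (cnj n02 * n02 + (n20 + cnj n11) * (2 * n11 + cnj n20)) / \<omega>"
    by (simp add: Re_divide_of_real)
  \<comment> \<open>The squared moduli are real, and \<open>2 * n20 * n11\<close> plus the conjugate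
    of \<open>n20 * n11\<close> leaves a single imaginary part.\<close>
  also have "\<dots> = - Im (n20 * n11) / \<omega>"
    by (simp add: algebra_simps)
  finally have e: "Re (3 * ca * n02 + 2 * cb * n11 + cb * cnj n20) = - Im (n20 * n11) / \<omega>" .
  have "Re (d21 + 3 * ca * n02 + 2 * cb * n11 + cb * cnj n20)
      = Re d21 + Re (3 * ca * n02 + 2 * cb * n11 + cb * cnj n20)" by simp
  then show ?thesis unfolding e lc_def by (metis add_uminus_conv_diff minus_divide_left)
qed

lemma degree4:
  "Re (cnj z * g3 z + (A2 z * g2 z + B2 z * cnj (g2 z)) + (A3 z * (J * z) + B3 z * cnj (J * z))) = lc * (norm z)^4"
proof -
  define y where "y = d12 * z * (cnj z)^3 + d03 * (cnj z)^4 + 2 * cb * n02 * z * (cnj z)^3"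
  have "cnj z * g3 z + (A2 z * g2 z + B2 z * cnj (g2 z)) + (A3 z * (J * z) + B3 z * cnj (J * z))
     = (d21 + 3 * ca * n02 + 2 * cb * n11 + cb * cnj n20) * (z * cnj z)^2
       + (d30 + 3 * ca * n11 + 2 * cb * n20 + cb * cnj n11) * z^3 * cnj z
       + (3 * ca * n20 + cb * cnj n02) * z^4 + y + (4 * (J * cc)) * z^4 + (2 * (J * cd)) * z^3 * cnj z"
    unfolding g3_def g2_def A2_def B2_def A3_def B3_def y_def
    by (simp add: power2_eq_square power3_eq_cube power4_eq_xxxx algebra_simps)
  also have "\<dots> = (d21 + 3 * ca * n02 + 2 * cb * n11 + cb * cnj n20) * (z * cnj z)^2 + (y - cnj y)"
    unfolding J_cc J_cd y_def by (simp add: algebra_simps)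
  also have "(z * cnj z)^2 = of_real ((norm z)^4)"
    unfolding complex_norm_square[symmetric] by simp
  finally show ?thesis using Re_diff_cnj[of y] Re_resonant
    by (simp add: Re_complex_of_real del: of_real_power)
qed

lemma Z_field: "Z (F \<eta> (P + u)) = J * Z u + of_real \<eta> * K1 u + g2 (Z u) + g3 (Z u) + of_real (X u) * E1 u + E4 u"
  unfolding Z_F K1_def g2_def g3_def X_def by simp

text \<open>Subtracting the motion of \<open>h\<close> has removed the terms quadratic in
  \<open>Z\<close>. At \<open>\<eta>\<close> = 0 the forcing that does not carry a factor
  \<open>X\<close> therefore starts at order three.\<close>

lemma X_field: "W (F \<eta> (P + u)) - dh (Z u) (Z (F \<eta> (P + u))) = - \<nu> * X u + X u * D1 u + D3 u + \<eta> * K2 u"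
  unfolding W_F X_def by simp

lemmas lipo_Z = lipo_linear[OF Z]
lemmas lipo_W = lipo_linear[OF W]
lemmas lipo_atoms = lipo_Z lipo_W E1 E4 D1 D3 K2

lemma lipo_h: "lipo 2 (\<lambda>u. h (Z u))"
proof -
  have 1: "lipo 2 (\<lambda>u. h20 * (Z u)^2)" and 2: "lipo 2 (\<lambda>u. Z u * cnj (Z u))"
    by (rule lipo_mono, (rule lipo_atoms lipo_cmult lipo_cnj lipo_mult lipo_power)+, simp)+
  show ?thesis unfolding quad_form_def
    by (rule lipo_add[OF lipo_cmult[OF lipo_Re[OF 1]] lipo_cmult[OF lipo_Re[OF 2]]])
qed

lemma lipo_X: "lipo 1 X"
  unfolding X_def[abs_def] by (intro lipo_diff lipo_W lipo_mono[OF lipo_h]) simp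

lemma lipo_g2: "lipo 2 (\<lambda>u. g2 (Z u))"
  unfolding g2_def
  by (intro lipo_add; (rule lipo_mono, (rule lipo_atoms lipo_cmult lipo_cnj lipo_mult lipo_power)+, simp))

lemma lipo_g3: "lipo 3 (\<lambda>u. g3 (Z u))"
  unfolding g3_def
  by (intro lipo_add; (rule lipo_mono, (rule lipo_atoms lipo_cmult lipo_cnj lipo_mult lipo_power)+, simp))

lemma lipo_A2: "lipo 2 (\<lambda>u. A2 (Z u))"
  unfolding A2_def
  by (intro lipo_add; (rule lipo_mono, (rule lipo_atoms lipo_cmult lipo_cnj lipo_mult lipo_power)+, simp))

lemma lipo_A3: "lipo 3 (\<lambda>u. A3 (Z u))"
  unfolding A3_def
  by (intro lipo_add; (rule lipo_mono, (rule lipo_atoms lipo_cmult lipo_cnj lipo_mult lipo_power)+, simp))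

lemma lipo_B2: "lipo 2 (\<lambda>u. B2 (Z u))"
  unfolding B2_def
  by (rule lipo_mono, (rule lipo_atoms lipo_cmult lipo_cnj lipo_mult lipo_power)+, simp)

lemma lipo_B3: "lipo 3 (\<lambda>u. B3 (Z u))"
  unfolding B3_def
  by (rule lipo_mono, (rule lipo_atoms lipo_cmult lipo_cnj lipo_mult lipo_power)+, simp)

lemma lipo_K1: "lipo 1 K1"
  unfolding K1_def[abs_def]
  by (intro lipo_add lipo_cmult lipo_cnj lipo_of_real lipo_Z lipo_W)

lemmas lipo_parts = lipo_h lipo_X lipo_g2 lipo_g3 lipo_A2 lipo_A3 lipo_B2 lipo_B3 lipo_K1 lipo_atoms

text \<open>The remainders of the derivative of \<open>V\<close>. The digit is the order of
  vanishing; \<open>G\<close> collects terms without \<open>\<eta>\<close>, \<open>H\<close> those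
  linear and \<open>Q\<close> those quadratic in it. \<open>G2\<close> and \<open>H1\<close> come
  with a factor \<open>X\<close>; the contribution of \<open>k3\<close> is split between
  \<open>H1\<close> and \<open>H3\<close> by writing \<open>W\<close> as \<open>X\<close> plus
  \<open>h\<close>.\<close>

definition "G2 u = 2 * Re (cnj (Z u) * E1 u + A2 (Z u) * E1 u + A3 (Z u) * E1 u + B2 (Z u) * cnj (E1 u) + B3 (Z u) * cnj (E1 u))"
definition "G5 u = 2 * Re (cnj (Z u) * E4 u + A2 (Z u) * g3 (Z u) + A2 (Z u) * E4 u
   + B2 (Z u) * cnj (g3 (Z u)) + B2 (Z u) * cnj (E4 u)
   + A3 (Z u) * g2 (Z u) + A3 (Z u) * g3 (Z u) + A3 (Z u) * E4 u
   + B3 (Z u) * cnj (g2 (Z u)) + B3 (Z u) * cnj (g3 (Z u)) + B3 (Z u) * cnj (E4 u))"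
definition "H1 u = 2 * Re (2 * ce * (Z u * E1 u) + k3 * cnj (Z u))"
definition "H3 u = 2 * Re (2 * ce * (Z u * g2 (Z u)) + 2 * ce * (Z u * g3 (Z u)) + 2 * ce * (Z u * E4 u)
   + k3 * (cnj (Z u) * of_real (h (Z u)))
   + A2 (Z u) * K1 u + A3 (Z u) * K1 u + B2 (Z u) * cnj (K1 u) + B3 (Z u) * cnj (K1 u))"
definition "Q2 u = 2 * Re (2 * ce * (Z u * K1 u))"

lemma lipo_G2: "lipo 2 G2" and lipo_G5: "lipo 5 G5" and lipo_H1: "lipo 1 H1"
  and lipo_H3: "lipo 3 H3" and lipo_Q2: "lipo 2 Q2"
  unfolding G2_def[abs_def] G5_def[abs_def] H1_def[abs_def] H3_def[abs_def] Q2_def[abs_def]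
  by ((rule lipo_cmult, rule lipo_Re, ((rule lipo_add)+)?);
      (rule lipo_mono, (rule lipo_parts lipo_cmult lipo_cnj lipo_of_real lipo_mult lipo_power)+, simp))+

text \<open>Exact, with nothing dropped: the polynomial terms of degree two to four collapse by the
  cancellations above, and every other product is sorted by its factors \<open>X\<close> and
  \<open>\<eta>\<close>.\<close>

theorem V_field:
  "dV \<eta> (Z u) (Z (F \<eta> (P + u))) = 2 * lc * (norm (Z u))^4 + X u * G2 u + G5 u
     + \<eta> * (2 * Re k1 * (norm (Z u))^2 + X u * H1 u + H3 u) + \<eta>^2 * Q2 u"
proof -
  define z where "z = Z u"
  define x where "x = (of_real (X u) :: complex)"
  define a where "a = (of_real \<eta> :: complex)"
  have w: "of_real (W u) = x + (of_real (h z) :: complex)" by (simp add: x_def X_def z_def)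
  have cx: "cnj x = x" "cnj a = a" by (simp_all add: x_def a_def)
  define T where "T = (cnj z * (J * z)) + (cnj z * g2 z + (A2 z * (J * z) + B2 z * cnj (J * z)))
    + (cnj z * g3 z + (A2 z * g2 z + B2 z * cnj (g2 z)) + (A3 z * (J * z) + B3 z * cnj (J * z)))"
  define S2 where "S2 = cnj z * E1 u + A2 z * E1 u + A3 z * E1 u + B2 z * cnj (E1 u) + B3 z * cnj (E1 u)"
  define S5 where "S5 = cnj z * E4 u + A2 z * g3 z + A2 z * E4 u
   + B2 z * cnj (g3 z) + B2 z * cnj (E4 u) + A3 z * g2 z + A3 z * g3 z + A3 z * E4 u
   + B3 z * cnj (g2 z) + B3 z * cnj (g3 z) + B3 z * cnj (E4 u)"
  define SK where "SK = A2 z * K1 u + A3 z * K1 u + B2 z * cnj (K1 u) + B3 z * cnj (K1 u)"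
  have v: "Z (F \<eta> (P + u)) = J * z + a * K1 u + g2 z + g3 z + x * E1 u + E4 u"
    unfolding Z_field z_def x_def a_def ..
  have "Lv z (Z (F \<eta> (P + u))) = T + x * S2 + S5 + a * (cnj z * K1 u + SK)"
    unfolding v Lv_def T_def S2_def S5_def SK_def
    by (simp only: complex_cnj_add complex_cnj_mult cx) (simp only: distrib_left distrib_right ac_simps)
  moreover have "Re T = lc * (norm z)^4"
    unfolding T_def plus_complex.simps(1) using degree2[of z] degree3[of z] degree4[of z]
    by (metis add_0 plus_complex.simps(1))
  moreover have "Re (x * S2) = X u * Re S2" by (simp add: x_def)
  moreover have "Re (a * (cnj z * K1 u + SK)) = \<eta> * (Re (cnj z * K1 u) + Re SK)" by (simp add: a_def)
  ultimately have L: "2 * Re (Lv z (Z (F \<eta> (P + u)))) = 2 * lc * (norm z)^4 + X u * (2 * Re S2) + 2 * Re S5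
      + \<eta> * (2 * Re (cnj z * K1 u) + 2 * Re SK)" by (simp add: algebra_simps)
  have k1: "Re (cnj z * (k1 * z)) = Re k1 * (norm z)^2"
    unfolding cmod_sq_Re[symmetric] by (simp add: algebra_simps)
  \<comment> \<open>This is the purpose of the coefficient \<open>ce\<close> in \<open>V\<close>: it
    cancels the non-resonant part of the term linear in \<open>\<eta>\<close>, so that only the real
    part of \<open>k1\<close> is left.\<close>
  have k2: "Re (cnj z * (k2 * cnj z)) + Re (2 * ce * z * (J * z)) = 0"
  proof -
    have "2 * ce * z * (J * z) = (2 * (J * ce)) * z^2" by (simp add: power2_eq_square)
    also have "\<dots> = - cnj (cnj z * (k2 * cnj z))" unfolding J_ce by (simp add: power2_eq_square)
    finally show ?thesis by (simp only: uminus_complex.simps cnj.simps)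
  qed
  have Kz: "Re (cnj z * K1 u) = Re k1 * (norm z)^2 + Re (cnj z * (k2 * cnj z)) + X u * Re (k3 * cnj z) + Re (k3 * (cnj z * of_real (h z)))"
  proof -
    have "cnj z * K1 u = cnj z * (k1 * z) + cnj z * (k2 * cnj z) + x * (k3 * cnj z) + k3 * (cnj z * of_real (h z))"
      unfolding K1_def w z_def[symmetric] by (simp add: algebra_simps)
    then show ?thesis using k1 by (simp add: x_def del: times_complex.sel) (simp add: x_def)
  qed
  have E: "Re (2 * ce * z * Z (F \<eta> (P + u))) = Re (2 * ce * z * (J * z)) + \<eta> * Re (2 * ce * (z * K1 u))
      + Re (2 * ce * (z * g2 z) + 2 * ce * (z * g3 z) + 2 * ce * (z * E4 u)) + X u * Re (2 * ce * (z * E1 u))"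
  proof -
    have "2 * ce * z * Z (F \<eta> (P + u)) = 2 * ce * z * (J * z) + a * (2 * ce * (z * K1 u))
        + (2 * ce * (z * g2 z) + 2 * ce * (z * g3 z) + 2 * ce * (z * E4 u)) + x * (2 * ce * (z * E1 u))"
      unfolding v by (simp only: distrib_left ac_simps)
    then show ?thesis by (simp only: plus_complex.simps) (simp add: a_def x_def)
  qed
  have G: "G2 u = 2 * Re S2" "G5 u = 2 * Re S5"
    "H1 u = 2 * Re (2 * ce * (z * E1 u)) + 2 * Re (k3 * cnj z)"
    "H3 u = 2 * Re (2 * ce * (z * g2 z) + 2 * ce * (z * g3 z) + 2 * ce * (z * E4 u)) + 2 * Re (k3 * (cnj z * of_real (h z))) + 2 * Re SK"
    "Q2 u = 2 * Re (2 * ce * (z * K1 u))"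
    unfolding G2_def G5_def H1_def H3_def Q2_def S2_def S5_def SK_def z_def
    by (simp_all only: plus_complex.simps distrib_left add.assoc)
  have arith: "A + x * S + S' + \<eta> * (2 * (k + q1 + x * b + c) + 2 * sk) + \<eta> * (2 * (q2 + \<eta> * q + d + x * e))
      = A + x * S + S' + \<eta> * (2 * k + x * (2 * e + 2 * b) + (2 * d + 2 * c + 2 * sk)) + \<eta>^2 * (2 * q)"
    if "q1 + q2 = 0" for A x S S' k q1 q2 b c sk q d e :: real
    using that by algebra
  show ?thesis
    unfolding dV_def z_def[symmetric] G L E Kz by (subst arith[OF k2]) (simp only: mult.assoc)
qed

lemma shift_curve: "(x has_vector_derivative v) (at t within S) \<Longrightarrow> ((\<lambda>s. x s - P) has_vector_derivative v) (at t within S)"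
  by (auto intro!: derivative_eq_intros)

lemma Z_curve:
  "(x has_vector_derivative v) (at t within S) \<Longrightarrow> ((\<lambda>s. Z (x s - P)) has_vector_derivative Z v) (at t within S)"
  by (rule bounded_linear.has_vector_derivative[OF Z shift_curve])

lemma V_curve:
  "(x has_vector_derivative v) (at t within S) \<Longrightarrow>
    ((\<lambda>s. V \<eta> (Z (x s - P))) has_real_derivative dV \<eta> (Z (x t - P)) (Z v)) (at t within S)"
  by (rule has_derivative_along_curve[OF V_has_derivative Z_curve])

lemma X_curve:
  assumes "(x has_vector_derivative v) (at t within S)"
  shows "((\<lambda>s. X (x s - P)) has_real_derivative W v - dh (Z (x t - P)) (Z v)) (at t within S)"
proof -
  have "((\<lambda>s. W (x s - P)) has_real_derivative W v) (at t within S)"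
    using bounded_linear.has_vector_derivative[OF W shift_curve[OF assms]]
    by (simp add: has_real_derivative_iff_has_vector_derivative)
  moreover have "((\<lambda>s. h (Z (x s - P))) has_real_derivative dh (Z (x t - P)) (Z v)) (at t within S)"
    by (rule has_derivative_along_curve[OF quad_form_has_derivative Z_curve[OF assms]])
  ultimately show ?thesis unfolding X_def by (rule DERIV_diff)
qed

text \<open>The structure equations for the \<open>Z\<close> and \<open>W\<close> components are all
  that is known of \<open>F\<close>; the field is reassembled from them through
  \<open>emb\<close>.\<close>

lemma field_lipo: "lipo 1 (\<lambda>u. F \<eta> (P + u))"
proof -
  have z: "lipo 1 (\<lambda>u. Z (F \<eta> (P + u)))"
    unfolding Z_field
    by (intro lipo_add; (rule lipo_mono, (rule lipo_parts lipo_cmult lipo_cnj lipo_of_real lipo_mult lipo_power)+, simp))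
  have d: "lipo 1 (\<lambda>u. dh (Z u) (Z (F \<eta> (P + u))))"
  proof -
    have 1: "lipo 1 (\<lambda>u. 2 * h20 * Z u * Z (F \<eta> (P + u)))" and 2: "lipo 1 (\<lambda>u. cnj (Z u) * Z (F \<eta> (P + u)))"
      by (rule lipo_mono, (rule z lipo_parts lipo_cmult lipo_cnj lipo_mult)+, simp)+
    show ?thesis unfolding quad_form_deriv_def
      by (rule lipo_add[OF lipo_cmult[OF lipo_Re[OF 1]] lipo_cmult[OF lipo_cmult[OF lipo_Re[OF 2]]]])
  qed
  have "W (F \<eta> (P + u)) = - \<nu> * X u + X u * D1 u + D3 u + \<eta> * K2 u + dh (Z u) (Z (F \<eta> (P + u)))" for u
    using X_field[of \<eta> u] by simp
  then have w: "lipo 1 (\<lambda>u. W (F \<eta> (P + u)))"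
    by (simp only:) (intro lipo_add d; (rule lipo_mono, (rule lipo_parts lipo_cmult lipo_mult)+, simp))
  have "(\<lambda>u. F \<eta> (P + u)) = (\<lambda>u. emb (Z (F \<eta> (P + u))) 0 + emb 0 (W (F \<eta> (P + u))))"
  proof
    fix u
    interpret e: bounded_linear "\<lambda>q. emb (fst q) (snd q)" by (rule emb)
    show "F \<eta> (P + u) = emb (Z (F \<eta> (P + u))) 0 + emb 0 (W (F \<eta> (P + u)))"
      using e.add[of "(Z (F \<eta> (P + u)), 0)" "(0, W (F \<eta> (P + u)))"] by (simp add: emb_ZW)
  qed
  moreover have "bounded_linear (\<lambda>z. emb z 0)"
    using bounded_linear_compose[OF emb, of "\<lambda>z. (z, 0)"]
    by (simp add: bounded_linear_Pair bounded_linear_ident bounded_linear_zero)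
  moreover have "bounded_linear (\<lambda>w. emb 0 w)"
    using bounded_linear_compose[OF emb, of "\<lambda>w. (0, w)"]
    by (simp add: bounded_linear_Pair bounded_linear_ident bounded_linear_zero)
  ultimately show ?thesis
    using lipo_add[OF lipo_compose_linear[OF _ z] lipo_compose_linear[OF _ w], of "\<lambda>z. emb z 0" "\<lambda>w. emb 0 w"]
    by simp
qed

lemma field_lipschitz: obtains L where "L-lipschitz_on (cball P 1) (F \<eta>)"
proof -
  obtain L where L: "L-lipschitz_on (cball 0 1) (\<lambda>u. F \<eta> (P + u))"
    using lipo_lipschitz[of 0 "\<lambda>u. F \<eta> (P + u)"] field_lipo by auto
  have "L-lipschitz_on (cball P 1) (F \<eta>)"
  proof (rule lipschitz_onI)
    fix x y assume "x \<in> cball P 1" "y \<in> cball P 1"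
    then show "dist (F \<eta> x) (F \<eta> y) \<le> L * dist x y"
      using lipschitz_onD[OF L, of "x - P" "y - P"] by (simp add: dist_norm norm_minus_commute)
  qed (rule lipschitz_on_nonneg[OF L])
  then show ?thesis by (rule that)
qed

section \<open>Stability of the equilibrium at and near criticality\<close>

lemma coords_zero: "Z u = 0 \<Longrightarrow> X u = 0 \<Longrightarrow> u = 0"
  using emb_ZW[of u] linear_0[OF bounded_linear.linear[OF emb]] by (simp add: X_def quad_form_def)

lemma quad_bound: "\<bar>h z\<bar> \<le> (2 * norm h20 + \<bar>h11\<bar>) * (norm z)^2"
proof -
  have "\<bar>Re (h20 * z^2)\<bar> \<le> norm h20 * (norm z)^2"
    by (rule order_trans[OF abs_Re_le_cmod]) (simp add: norm_mult norm_power)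
  moreover have "\<bar>h11 * (norm z)^2\<bar> = \<bar>h11\<bar> * (norm z)^2" by (simp add: abs_mult)
  ultimately show ?thesis unfolding quad_form_def cmod_sq_Re by (simp add: algebra_simps abs_le_iff) linarith
qed

text \<open>\<open>Z\<close> and \<open>X\<close> form a nonlinear coordinate system. On the unit
  ball the quadratic shift \<open>h\<close> is dominated by a multiple of \<open>Z\<close>, so sizes
  in the two systems are comparable.\<close>

lemma coords_bound:
  obtains c where "1 \<le> c" "\<And>u. norm u \<le> 1 \<Longrightarrow> norm u \<le> c * (norm (Z u) + \<bar>X u\<bar>)"
    "\<And>u. norm u \<le> 1 \<Longrightarrow> norm (Z u) \<le> c * norm u" "\<And>u. norm u \<le> 1 \<Longrightarrow> \<bar>X u\<bar> \<le> c * norm u"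
proof -
  obtain a where a: "0 < a" "\<And>u. norm (Z u) \<le> norm u * a" using bounded_linear.pos_bounded[OF Z] by blast
  obtain b where b: "0 \<le> b" "\<And>u. norm u \<le> 1 \<Longrightarrow> norm (X u) \<le> b * norm u ^ 1"
    using lipo_X by (rule lipoE) blast
  obtain e where e: "0 < e" "\<And>q. norm (emb (fst q) (snd q)) \<le> norm q * e"
    using bounded_linear.pos_bounded[OF emb] by blast
  define H where "H = 2 * norm h20 + \<bar>h11\<bar>"
  have H: "0 \<le> H" by (simp add: H_def)
  define c where "c = 1 + a + b + e * (1 + H * a)"
  have c: "1 \<le> c" "a \<le> c" "b \<le> c" "e * (1 + H * a) \<le> c" using a b e H by (simp_all add: c_def)
  show ?thesis
  proof (rule that[OF c(1)])
    fix u :: "real^'n" assume u: "norm u \<le> 1"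
    show "norm (Z u) \<le> c * norm u"
      using a(2)[of u] mult_right_mono[OF c(2), of "norm u"] by (simp add: mult.commute)
    show "\<bar>X u\<bar> \<le> c * norm u" using b(2)[OF u] mult_right_mono[OF c(3), of "norm u"] by simp
    have "norm u = norm (emb (Z u) (W u))" by (simp add: emb_ZW)
    also have "\<dots> \<le> norm (Z u, W u) * e" using e(2)[of "(Z u, W u)"] by simp
    also have "\<dots> \<le> (norm (Z u) + \<bar>W u\<bar>) * e"
      using e sqrt_sum_squares_le_sum_abs[of "norm (Z u)" "W u"]
      by (intro mult_right_mono) (auto simp: norm_Pair)
    also have "\<bar>W u\<bar> \<le> \<bar>X u\<bar> + H * a * norm (Z u)"
    proof -
      have "norm (Z u) \<le> a" using a(2)[of u] mult_right_mono[OF u, of a] a(1) by linarith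
      then have "H * (norm (Z u))^2 \<le> H * (a * norm (Z u))"
        unfolding power2_eq_square using H by (intro mult_left_mono mult_right_mono) auto
      then show ?thesis using quad_bound[of "Z u"] by (simp add: X_def H_def mult_ac)
    qed
    also have "(norm (Z u) + (\<bar>X u\<bar> + H * a * norm (Z u))) * e \<le> (e * (1 + H * a)) * (norm (Z u) + \<bar>X u\<bar>)"
      using e H a by (simp add: algebra_simps)
    also have "\<dots> \<le> c * (norm (Z u) + \<bar>X u\<bar>)" by (intro mult_right_mono c) auto
    finally show "norm u \<le> c * (norm (Z u) + \<bar>X u\<bar>)" using e by (simp add: mult_right_mono)
  qed
qed

text \<open>Two scales. The first list is measured against |Z|^4 + X^2, the decay available at
  criticality; there \<open>X * G2\<close> leaves a term |Z|^2 |X| without a small factor. The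
  second is measured against |Z|^2 + X^2, the decay available for nonzero \<open>\<eta>\<close>;
  there the couplings through \<open>H1\<close> and \<open>K2\<close> and the term \<open>Q2\<close>
  lack the factor \<open>norm u\<close>.\<close>

lemma equilibrium_estimates:
  obtains M where "0 < M" "\<And>u. norm u \<le> 1 \<Longrightarrow>
     \<bar>X u * G2 u\<bar> \<le> M * ((norm (Z u))^2 * \<bar>X u\<bar>) + M * norm u * (X u)^2 \<and>
     \<bar>G5 u\<bar> \<le> M * norm u * ((norm (Z u))^4 + (X u)^2) \<and>
     \<bar>X u * X u * D1 u\<bar> \<le> M * norm u * (X u)^2 \<and>
     \<bar>X u * D3 u\<bar> \<le> M * norm u * ((norm (Z u))^4 + (X u)^2)"
    "\<And>u. norm u \<le> 1 \<Longrightarrow>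
     (norm (Z u))^4 \<le> M * norm u * ((norm (Z u))^2 + (X u)^2) \<and>
     \<bar>X u * G2 u\<bar> \<le> M * norm u * ((norm (Z u))^2 + (X u)^2) \<and>
     \<bar>G5 u\<bar> \<le> M * norm u * ((norm (Z u))^2 + (X u)^2) \<and>
     \<bar>X u * X u * D1 u\<bar> \<le> M * norm u * ((norm (Z u))^2 + (X u)^2) \<and>
     \<bar>X u * D3 u\<bar> \<le> M * norm u * ((norm (Z u))^2 + (X u)^2) \<and>
     \<bar>H3 u\<bar> \<le> M * norm u * ((norm (Z u))^2 + (X u)^2) \<and>
     \<bar>Q2 u\<bar> \<le> M * ((norm (Z u))^2 + (X u)^2) \<and>
     \<bar>X u * H1 u\<bar> \<le> M * (norm (Z u) * \<bar>X u\<bar> + (X u)^2) \<and>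
     \<bar>X u * K2 u\<bar> \<le> M * (norm (Z u) * \<bar>X u\<bar> + (X u)^2)"
proof -
  obtain c where c: "1 \<le> c" "\<And>u. norm u \<le> 1 \<Longrightarrow> norm u \<le> c * (norm (Z u) + \<bar>X u\<bar>)"
    "\<And>u. norm u \<le> 1 \<Longrightarrow> norm (Z u) \<le> c * norm u" "\<And>u. norm u \<le> 1 \<Longrightarrow> \<bar>X u\<bar> \<le> c * norm u"
    using coords_bound by blast
  have ex: "\<exists>C\<ge>0. \<forall>u. norm u \<le> 1 \<longrightarrow> \<bar>G u\<bar> \<le> C * norm u ^ k" if "lipo k G" for G :: "real^'n \<Rightarrow> real" and k
    using that unfolding lipo_def by (auto simp: real_norm_def)
  obtain a1 where a1: "0 \<le> a1" "\<And>u. norm u \<le> 1 \<Longrightarrow> \<bar>G2 u\<bar> \<le> a1 * norm u ^ 2" using ex[OF lipo_G2] by blast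
  obtain a2 where a2: "0 \<le> a2" "\<And>u. norm u \<le> 1 \<Longrightarrow> \<bar>G5 u\<bar> \<le> a2 * norm u ^ 5" using ex[OF lipo_G5] by blast
  obtain a3 where a3: "0 \<le> a3" "\<And>u. norm u \<le> 1 \<Longrightarrow> \<bar>D1 u\<bar> \<le> a3 * norm u ^ 1" using ex[OF D1] by blast
  obtain a4 where a4: "0 \<le> a4" "\<And>u. norm u \<le> 1 \<Longrightarrow> \<bar>D3 u\<bar> \<le> a4 * norm u ^ 3" using ex[OF D3] by blast
  obtain a5 where a5: "0 \<le> a5" "\<And>u. norm u \<le> 1 \<Longrightarrow> \<bar>H3 u\<bar> \<le> a5 * norm u ^ 3" using ex[OF lipo_H3] by blast
  obtain a6 where a6: "0 \<le> a6" "\<And>u. norm u \<le> 1 \<Longrightarrow> \<bar>Q2 u\<bar> \<le> a6 * norm u ^ 2" using ex[OF lipo_Q2] by blast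
  obtain a7 where a7: "0 \<le> a7" "\<And>u. norm u \<le> 1 \<Longrightarrow> \<bar>H1 u\<bar> \<le> a7 * norm u ^ 1" using ex[OF lipo_H1] by blast
  obtain a8 where a8: "0 \<le> a8" "\<And>u. norm u \<le> 1 \<Longrightarrow> \<bar>K2 u\<bar> \<le> a8 * norm u ^ 1" using ex[OF K2] by blast
  define C where "C = 1 + a1 + a2 + a3 + a4 + a5 + a6 + a7 + a8"
  \<comment> \<open>\<open>C\<close> exceeds all remainder constants, and 16 c^6 exceeds every
    numerical factor and power of \<open>c\<close> that arises when \<open>norm u\<close> is
    expressed through \<open>Z\<close> and \<open>X\<close>.\<close>
  define M where "M = C * (16 * c^6)"
  have C: "1 \<le> C" "a1 \<le> C" "a2 \<le> C" "a3 \<le> C" "a4 \<le> C" "a5 \<le> C" "a6 \<le> C" "a7 \<le> C" "a8 \<le> C"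
    using a1 a2 a3 a4 a5 a6 a7 a8 by (simp_all add: C_def)
  have bound: "g \<le> C * s" if "g \<le> a * s" "a \<le> C" "0 \<le> s" for g a s :: real
    using that mult_right_mono[OF that(2,3)] by linarith
  have cp: "c ^ i \<le> c ^ 6" if "i \<le> 6" for i using c(1) that by (intro power_increasing)
  have cp1: "1 \<le> c ^ i" for i using c(1) by (rule one_le_power)
  {
    fix u :: "real^'n" assume u: "norm u \<le> 1"
    define s r B where "s = norm u" and "r = norm (Z u)" and "B = \<bar>X u\<bar>"
    have nn: "0 \<le> s" "0 \<le> r" "0 \<le> B" "s \<le> 1" using u by (auto simp: s_def r_def B_def)
    have su: "s \<le> c * (r + B)" "r \<le> c * s" "B \<le> c * s" using c(2-4)[OF u] by (simp_all add: s_def r_def B_def)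
    have X2: "(X u)^2 = B^2" "X u * X u = B^2" by (simp_all add: B_def power2_eq_square)
    have s2: "s^2 \<le> 2 * c^2 * (r^2 + B^2)"
    proof -
      have "s^2 \<le> (c * (r + B))^2" using su(1) nn by (intro power_mono)
      also have "\<dots> = c^2 * (r + B)^2" by (simp add: power_mult_distrib)
      also have "\<dots> \<le> c^2 * (2 * (r^2 + B^2))"
        using sum_squares_bound[of r B] by (intro mult_left_mono) (auto simp: power2_sum)
      finally show ?thesis by (simp only: mult_ac)
    qed
    have r2: "r^2 \<le> c^2 * s^2" using power_mono[OF su(2) nn(2), of 2] by (simp add: power_mult_distrib)
    have sp: "s^(k+1) \<le> s" for k using nn power_decreasing[of 1 "k+1" s] by simp
    have B1: "B \<le> c" using su(3) nn c(1) by (smt (verit) mult_left_le)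
    have M1: "C * (2 * c^3) \<le> M" "C * (2 * c^2) \<le> M" "C \<le> M" "C * c \<le> M" "C * (8 * c^6) \<le> M" "C * (4 * c^3) \<le> M" "C * c^4 \<le> M" "C * (4 * c^2) \<le> M"
      unfolding M_def using C(1) cp[of 3] cp[of 2] cp[of 1] cp[of 4] cp1[of 6]
      by (auto intro!: mult_left_mono)
    have M0: "0 \<le> M" using C(1) c(1) by (simp add: M_def)
    define Q where "Q = r^2 + B^2"
    have Q: "0 \<le> Q" "s^2 \<le> 2 * c^2 * Q" using s2 by (auto simp: Q_def)
    define R where "R = r^4 + B^2"
    have BC: "B ^ 4 \<le> c^2 * B^2"
    proof -
      have "B^2 * B^2 \<le> c^2 * B^2" using B1 nn by (intro mult_right_mono power_mono) auto
      then show ?thesis by (simp add: power_numeral_even[of B] power2_eq_square mult_ac numeral_eq_Suc)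
    qed
    have s4: "s^4 \<le> 8 * c^6 * R"
    proof -
      have "s^4 = (s^2)^2" by simp
      also have "\<dots> \<le> (2 * c^2 * (r^2 + B^2))^2" using s2 by (intro power_mono) auto
      also have "\<dots> = 4 * c^4 * (r^2 + B^2)^2" by (simp add: power_mult_distrib)
      also have "(r^2 + B^2)^2 \<le> 2 * (r^4 + B^4)"
        using sum_squares_bound[of "r^2" "B^2"] by (simp add: power2_sum)
      also have "2 * (r^4 + B^4) \<le> 2 * (c^2 * (r^4 + B^2))"
        using BC mult_right_mono[OF cp1[of 2], of "r^4"] by (simp add: distrib_left)
      finally have "s^4 \<le> 4 * c^4 * (2 * (c^2 * (r^4 + B^2)))" using c(1) by (simp add: mult_left_mono)
      also have "\<dots> = 8 * c^6 * R" by (simp add: R_def power_numeral_even numeral_eq_Suc mult_ac)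
      finally show ?thesis .
    qed
    have g2: "\<bar>G2 u\<bar> \<le> C * s^2"
      unfolding s_def by (rule bound[OF a1(2)[OF u] C(2) zero_le_power[OF norm_ge_zero]])
    have g5: "\<bar>G5 u\<bar> \<le> C * s^5"
      unfolding s_def by (rule bound[OF a2(2)[OF u] C(3) zero_le_power[OF norm_ge_zero]])
    have d1: "\<bar>D1 u\<bar> \<le> C * s^1"
      unfolding s_def by (rule bound[OF a3(2)[OF u] C(4) zero_le_power[OF norm_ge_zero]])
    have d3: "\<bar>D3 u\<bar> \<le> C * s^3"
      unfolding s_def by (rule bound[OF a4(2)[OF u] C(5) zero_le_power[OF norm_ge_zero]])
    have h3: "\<bar>H3 u\<bar> \<le> C * s^3"
      unfolding s_def by (rule bound[OF a5(2)[OF u] C(6) zero_le_power[OF norm_ge_zero]])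
    have q2: "\<bar>Q2 u\<bar> \<le> C * s^2"
      unfolding s_def by (rule bound[OF a6(2)[OF u] C(7) zero_le_power[OF norm_ge_zero]])
    have h1: "\<bar>H1 u\<bar> \<le> C * s^1"
      unfolding s_def by (rule bound[OF a7(2)[OF u] C(8) zero_le_power[OF norm_ge_zero]])
    have k2: "\<bar>K2 u\<bar> \<le> C * s^1"
      unfolding s_def by (rule bound[OF a8(2)[OF u] C(9) zero_le_power[OF norm_ge_zero]])
    have C0: "0 \<le> C" using C(1) by simp
    have pos: "0 \<le> r" "0 \<le> s * Q" "0 \<le> R" "0 \<le> s * R" using nn Q by (auto simp: R_def)
    have XG2: "\<bar>X u * G2 u\<bar> \<le> B * (C * s^2)"
      unfolding abs_mult B_def[symmetric] using g2 nn by (intro mult_left_mono)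
    have 1: "\<bar>X u * G2 u\<bar> \<le> M * (r^2 * B) + M * s * B^2"
    proof -
      have "B * (C * s^2) \<le> B * (C * (2 * c^2 * (r^2 + B^2)))" using s2 C0 nn by (intro mult_left_mono)
      also have "\<dots> = C * (2 * c^2) * (r^2 * B) + C * (2 * c^2) * (B * B^2)" by (simp add: algebra_simps)
      also have "C * (2 * c^2) * (B * B^2) \<le> C * (2 * c^2) * (c * s * B^2)"
        using su(3) C0 by (intro mult_left_mono mult_right_mono) auto
      also have "\<dots> = C * (2 * c^3) * (s * B^2)" by (simp add: power3_eq_cube power2_eq_square)
      also have "\<dots> \<le> M * (s * B^2)" using nn by (intro mult_right_mono M1) auto
      also have "C * (2 * c^2) * (r^2 * B) \<le> M * (r^2 * B)" using nn by (intro mult_right_mono M1) auto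
      finally show ?thesis using XG2 by (simp add: mult_ac)
    qed
    have 2: "\<bar>G5 u\<bar> \<le> M * s * R"
    proof -
      have "C * s^5 = C * s * s^4" by (simp add: numeral_eq_Suc)
      also have "\<dots> \<le> C * s * (8 * c^6 * R)" using s4 C0 nn by (intro mult_left_mono) auto
      also have "\<dots> = C * (8 * c^6) * (s * R)" by simp
      also have "\<dots> \<le> M * (s * R)" using pos by (intro mult_right_mono M1)
      finally show ?thesis using g5 by (simp add: mult_ac)
    qed
    have XD1: "\<bar>X u * X u * D1 u\<bar> \<le> M * s * B^2"
    proof -
      have "\<bar>X u * X u * D1 u\<bar> = B^2 * \<bar>D1 u\<bar>" by (simp add: abs_mult B_def power2_eq_square)
      also have "\<dots> \<le> B^2 * (C * s)" using d1 by (intro mult_left_mono) auto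
      also have "\<dots> = C * (s * B^2)" by simp
      also have "\<dots> \<le> M * (s * B^2)" using nn by (intro mult_right_mono M1) auto
      finally show ?thesis by (simp add: mult_ac)
    qed
    have XD3': "\<bar>X u * D3 u\<bar> \<le> B * (C * s^3)"
      unfolding abs_mult B_def[symmetric] using d3 nn by (intro mult_left_mono)
    have 4: "\<bar>X u * D3 u\<bar> \<le> M * s * R"
    proof -
      have "B * (C * s^3) = C * s * (s^2 * B)" by (simp add: power3_eq_cube power2_eq_square)
      also have "s^2 * B \<le> 2 * c^2 * (r^2 + B^2) * B" using s2 nn by (intro mult_right_mono) auto
      also have "\<dots> = 2 * c^2 * (r^2 * B) + 2 * c^2 * (B * B^2)" by (simp add: algebra_simps)
      also have "r^2 * B \<le> r^4 + B^2"
      proof -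
        have "2 * r^2 * B \<le> r^4 + B^2" using sum_squares_bound[of "r^2" B] by simp
        moreover have "0 \<le> r^2 * B" using nn by simp
        ultimately show ?thesis by linarith
      qed
      also have "B * B^2 \<le> c * B^2" using B1 by (intro mult_right_mono) auto
      also have "2 * c^2 * (r^4 + B^2) + 2 * c^2 * (c * B^2) \<le> 4 * c^3 * R"
      proof -
        have "c^2 \<le> c^3" using c(1) by (intro power_increasing) auto
        then have "2 * c^2 * (r^4 + B^2) \<le> 2 * c^3 * R" unfolding R_def by (intro mult_right_mono) auto
        moreover have "2 * c^2 * (c * B^2) \<le> 2 * c^3 * R"
          unfolding R_def using c(1) by (simp add: power3_eq_cube power2_eq_square distrib_left)
        ultimately show ?thesis by linarith
      qed
      finally have "B * (C * s^3) \<le> C * s * (4 * c^3 * R)" using C0 nn c(1) by (simp add: mult_left_mono)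
      also have "\<dots> = C * (4 * c^3) * (s * R)" by simp
      also have "\<dots> \<le> M * (s * R)" using pos by (intro mult_right_mono M1)
      finally show ?thesis using XD3' by (simp add: mult_ac)
    qed
    have s3': "C * s^3 \<le> C * s * (2 * c^2 * Q)"
    proof -
      have "C * s^3 = C * s * s^2" by (simp add: power3_eq_cube power2_eq_square)
      also have "\<dots> \<le> C * s * (2 * c^2 * Q)" using Q C0 nn by (intro mult_left_mono) auto
      finally show ?thesis .
    qed
    have s3: "C * s^3 \<le> M * s * Q"
    proof -
      have "C * s^3 \<le> C * s * (2 * c^2 * Q)" by (rule s3')
      also have "\<dots> = C * (2 * c^2) * (s * Q)" by simp
      also have "\<dots> \<le> M * (s * Q)" using pos by (intro mult_right_mono M1)
      finally show ?thesis by (simp add: mult_ac)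
    qed
    have z4: "r^4 \<le> M * s * Q"
    proof -
      have "r^4 = r^2 * r^2" by (simp add: numeral_eq_Suc)
      also have "\<dots> \<le> (c^2 * s^2) * Q" using r2 Q by (intro mult_mono) (auto simp: Q_def)
      also have "\<dots> \<le> (c^2 * s) * Q" using sp[of 1] Q c(1) by (intro mult_right_mono mult_left_mono) (auto simp: power2_eq_square)
      also have "\<dots> = c^2 * (s * Q)" by simp
      also have "\<dots> \<le> M * (s * Q)"
      proof (intro mult_right_mono pos)
        have "c^2 * 1 \<le> (2 * c^2) * C" using C(1) by (intro mult_mono) auto
        then show "c^2 \<le> M" using M1(2) by (simp add: mult_ac)
      qed
      finally show ?thesis by (simp add: mult_ac)
    qed
    have XG2': "\<bar>X u * G2 u\<bar> \<le> M * s * Q"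
    proof -
      have "B * (C * s^2) \<le> (c * s) * (C * s^2)" using su(3) C0 by (intro mult_right_mono) auto
      also have "\<dots> \<le> (c * s) * (C * (2 * c^2 * Q))" using Q C0 nn c(1) by (intro mult_left_mono) auto
      also have "\<dots> = C * (2 * c^3) * (s * Q)" by (simp add: power3_eq_cube power2_eq_square)
      also have "\<dots> \<le> M * (s * Q)" using pos by (intro mult_right_mono M1)
      finally show ?thesis using XG2 by (simp add: mult_ac)
    qed
    have G5': "\<bar>G5 u\<bar> \<le> M * s * Q"
    proof -
      have "s^5 \<le> s^3" using nn by (intro power_decreasing) auto
      then have "C * s^5 \<le> C * s^3" using C0 by (intro mult_left_mono)
      then show ?thesis using g5 s3 by linarith
    qed
    have XD1': "\<bar>X u * X u * D1 u\<bar> \<le> M * s * Q"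
    proof -
      have "M * s * B^2 \<le> M * s * Q" using M0 nn by (intro mult_left_mono) (auto simp: Q_def)
      then show ?thesis using XD1 by linarith
    qed
    have XD3: "\<bar>X u * D3 u\<bar> \<le> M * s * Q"
    proof -
      have "B * (C * s^3) \<le> c * (C * s * (2 * c^2 * Q))"
        by (rule mult_mono[OF B1 s3']) (use C0 nn c(1) in auto)
      also have "\<dots> = C * (2 * c^3) * (s * Q)" by (simp add: power3_eq_cube power2_eq_square)
      also have "\<dots> \<le> M * (s * Q)" using pos by (intro mult_right_mono M1)
      finally show ?thesis using XD3' by (simp add: mult_ac)
    qed
    have Q2': "\<bar>Q2 u\<bar> \<le> M * Q"
    proof -
      have "C * s^2 \<le> C * (2 * c^2 * Q)" using Q C0 by (intro mult_left_mono)
      also have "\<dots> = C * (2 * c^2) * Q" by simp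
      also have "\<dots> \<le> M * Q" using Q by (intro mult_right_mono M1)
      finally show ?thesis using q2 by linarith
    qed
    have Xl: "\<bar>X u * Y\<bar> \<le> M * (r * B + B^2)" if "\<bar>Y\<bar> \<le> C * s^1" for Y
    proof -
      have "\<bar>X u * Y\<bar> \<le> B * (C * s)" unfolding abs_mult B_def[symmetric] using that nn by (intro mult_left_mono) auto
      also have "\<dots> \<le> B * (C * (c * (r + B)))" using su(1) C0 nn by (intro mult_left_mono)
      also have "\<dots> = C * c * (r * B + B^2)" by (simp add: algebra_simps power2_eq_square)
      also have "\<dots> \<le> M * (r * B + B^2)" using nn by (intro mult_right_mono M1) auto
      finally show ?thesis .
    qed
    note res = 1 2 XD1 4 z4 XG2' G5' XD1' XD3 order_trans[OF h3 s3] Q2' Xl[OF h1] Xl[OF k2]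
    note res[unfolded s_def r_def Q_def R_def, folded X2(1), unfolded B_def]
  } note fin = this
  show ?thesis
  proof (rule that[of M])
    show "0 < M" using C(1) c(1) by (simp add: M_def)
  qed (intro conjI fin, assumption+)+
qed

text \<open>Once D |z| <= 1/4 the cubic and quartic terms cost at most a quarter of |z|^2; the bound
  on \<open>\<eta>\<close> limits the last term to another quarter.\<close>

lemma V_lower:
  obtains \<delta> \<eta>0 where "0 < \<delta>" "0 < \<eta>0" "\<And>z \<eta>. norm z \<le> \<delta> \<Longrightarrow> \<bar>\<eta>\<bar> \<le> \<eta>0 \<Longrightarrow> (norm z)^2 / 2 \<le> V \<eta> z"
proof -
  define D where "D = 2 * (norm ca + norm cb + norm cc + norm cd) + 1"
  have D: "1 \<le> D" by (simp add: D_def)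
  define \<eta>0 where "\<eta>0 = 1 / (8 * norm ce + 8)"
  have \<eta>0: "0 < \<eta>0" "2 * \<eta>0 * norm ce \<le> 1 / 4"
    using norm_ge_zero[of ce] by (simp_all add: \<eta>0_def add_nonneg_pos divide_simps del: norm_ge_zero)
  show ?thesis
  proof (rule that[of "1 / (4 * D)" \<eta>0])
    fix z :: complex and \<eta> :: real assume z: "norm z \<le> 1 / (4 * D)" and \<eta>: "\<bar>\<eta>\<bar> \<le> \<eta>0"
    define r where "r = norm z"
    have r0: "0 \<le> r" by (simp add: r_def)
    have Dr: "D * r \<le> 1 / 4" using z D by (simp add: r_def field_simps)
    have r1: "r \<le> 1" using mult_right_mono[OF D r0] Dr by simp
    have r43: "r^4 \<le> r^3" using r0 r1 by (intro power_decreasing) auto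
    define Y where "Y = ca * z^3 + cb * z^2 * cnj z + cc * z^4 + cd * z^3 * cnj z"
    have "norm Y \<le> norm ca * r^3 + norm cb * r^3 + norm cc * r^4 + norm cd * r^4"
      unfolding Y_def
      by (rule norm_triangle_le, rule add_mono, rule norm_triangle_le, rule add_mono, rule norm_triangle_le, rule add_mono)
        (simp_all add: norm_mult norm_power r_def numeral_eq_Suc)
    also have "\<dots> \<le> norm ca * r^3 + norm cb * r^3 + norm cc * r^3 + norm cd * r^3"
      using r43 by (intro add_mono mult_left_mono) auto
    also have "2 * (norm ca * r^3 + norm cb * r^3 + norm cc * r^3 + norm cd * r^3) \<le> D * r^3"
      using r0 by (simp add: D_def algebra_simps)
    finally have 1: "\<bar>2 * Re Y\<bar> \<le> D * r^3"
      using abs_Re_le_cmod[of Y] by simp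
    have "D * r^3 = (D * r) * r^2" by (simp add: power3_eq_cube power2_eq_square)
    also have "\<dots> \<le> 1 / 4 * r^2" using Dr by (intro mult_right_mono) auto
    finally have 2: "D * r^3 \<le> r^2 / 4" by simp
    have "\<bar>Re (ce * z^2)\<bar> \<le> norm ce * r^2"
      by (rule order_trans[OF abs_Re_le_cmod]) (simp add: norm_mult norm_power r_def)
    then have "\<bar>\<eta> * (2 * Re (ce * z^2))\<bar> \<le> \<eta>0 * (2 * (norm ce * r^2))"
      unfolding abs_mult using \<eta> by (intro mult_mono) auto
    also have "\<dots> = (2 * \<eta>0 * norm ce) * r^2" by simp
    also have "\<dots> \<le> 1 / 4 * r^2" by (intro mult_right_mono \<eta>0) auto
    finally have 3: "\<bar>\<eta> * (2 * Re (ce * z^2))\<bar> \<le> r^2 / 4" by simp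
    show "(norm z)^2 / 2 \<le> V \<eta> z"
      unfolding V_def cmod_sq_Re r_def[symmetric] Y_def[symmetric] using 1 2 3 by linarith
  qed (use D \<eta>0 in auto)
qed

lemma Z_continuous: "continuous_on S (\<lambda>x. Z (x - P))"
  by (intro bounded_linear.continuous_on[OF Z] continuous_intros)

lemma X_continuous: "continuous_on S (\<lambda>x. X (x - P))"
  unfolding X_def quad_form_def
  by (intro continuous_intros Z_continuous bounded_linear.continuous_on[OF W])

lemma V_continuous: "continuous_on S (V \<eta>)"
  unfolding V_def[abs_def] by (intro continuous_intros)

lemma X_emb: "X (emb z (h z + s)) = s"
  by (simp add: X_def Z_emb W_emb)

text \<open>Both signs are handled by one function, \<open>\<tau>\<close> times \<open>V\<close>
  plus K X^2. The exponent \<open>j\<close> will be 4 at criticality and 2 away from it. For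
  \<open>\<tau>\<close> = -1, negative values arbitrarily close to the equilibrium are found on X =
  0.\<close>

lemma equilibrium_lyapunov:
  assumes \<delta>: "0 < \<delta>" "\<delta> \<le> 1" and pos: "0 < K" "0 < c" and j: "0 < j"
    and dec: "\<And>u. norm u < \<delta> \<Longrightarrow> \<tau> * dV \<eta> (Z u) (Z (F \<eta> (P + u)))
        + 2 * K * (X u * (W (F \<eta> (P + u)) - dh (Z u) (Z (F \<eta> (P + u))))) \<le> - (c * ((norm (Z u))^j + (X u)^2))"
    and low: "\<And>u. norm u < \<delta> \<Longrightarrow> (norm (Z u))^2 / 2 \<le> V \<eta> (Z u)"
  shows "\<tau> = 1 \<Longrightarrow> asym_stable (F \<eta>) P" and "\<tau> = -1 \<Longrightarrow> \<not> lyap_stable (F \<eta>) P"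
proof -
  define U where "U x = \<tau> * V \<eta> (Z (x - P)) + K * (X (x - P))^2" for x
  define \<phi> where "\<phi> x = c * ((norm (Z (x - P)))^j + (X (x - P))^2)" for x
  interpret lyapunov_set "F \<eta>" "{P}" "ball P \<delta>" U \<phi>
  proof
    show "continuous_on (ball P \<delta>) U" unfolding U_def
      by (intro continuous_intros X_continuous continuous_on_compose2[OF V_continuous Z_continuous]) auto
    show "continuous_on (ball P \<delta>) \<phi>" unfolding \<phi>_def
      by (intro continuous_intros X_continuous Z_continuous)
    show "U x = 0" if "x \<in> {P}" for x
      using that linear_0[OF bounded_linear.linear[OF Z]] linear_0[OF bounded_linear.linear[OF W]]
      by (simp add: U_def V_def X_def quad_form_def)
    show "0 \<le> \<phi> x" for x using pos by (simp add: \<phi>_def)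
    show "0 < \<phi> x" if "x \<in> ball P \<delta>" "x \<notin> {P}" for x
    proof -
      have "\<not> (Z (x - P) = 0 \<and> X (x - P) = 0)" using coords_zero[of "x - P"] that by auto
      then have "0 < (norm (Z (x - P)))^j + (X (x - P))^2"
        by (cases "Z (x - P) = 0") (auto intro: add_pos_nonneg add_nonneg_pos)
      then show ?thesis using pos by (simp add: \<phi>_def)
    qed
    fix x t S assume x: "(x has_vector_derivative F \<eta> (x t)) (at t within S)" "x t \<in> ball P \<delta>"
    define u where "u = x t - P"
    have u: "x t = P + u" "norm u < \<delta>" using x(2) by (simp_all add: u_def dist_norm norm_minus_commute)
    have "((\<lambda>s. U (x s)) has_real_derivative \<tau> * dV \<eta> (Z u) (Z (F \<eta> (P + u)))
        + 2 * K * (X u * (W (F \<eta> (P + u)) - dh (Z u) (Z (F \<eta> (P + u)))))) (at t within S)"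
      unfolding U_def using V_curve[OF x(1), of \<eta>] X_curve[OF x(1)] unfolding u_def[symmetric] u(1)
      by (auto intro!: derivative_eq_intros simp: u_def[symmetric])
    then show "\<exists>D\<le>- \<phi> (x t). ((\<lambda>s. U (x s)) has_real_derivative D) (at t within S)"
      using dec[OF u(2)] by (auto simp: \<phi>_def u_def)
  qed (use \<delta> in auto)
  show "asym_stable (F \<eta>) P" if "\<tau> = 1"
  proof (rule asym_stable_if_orbit_asym_stable, rule asymptotically_stable)
    fix x assume x: "x \<in> ball P \<delta>" "x \<notin> {P}"
    then have l: "(norm (Z (x - P)))^2 / 2 \<le> V \<eta> (Z (x - P))" by (intro low) (simp add: dist_norm norm_minus_commute)
    have "\<not> (Z (x - P) = 0 \<and> X (x - P) = 0)" using coords_zero[of "x - P"] x by auto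
    then have "0 < (norm (Z (x - P)))^2 / 2 + K * (X (x - P))^2"
      using pos by (cases "Z (x - P) = 0") (auto intro: add_pos_nonneg add_nonneg_pos)
    then show "0 < U x" using l that by (simp add: U_def)
  qed
  show "\<not> lyap_stable (F \<eta>) P" if "\<tau> = -1"
  proof -
    obtain L where L: "L-lipschitz_on (cball P 1) (F \<eta>)" by (rule field_lipschitz)
    have "\<not> orbit_stable (F \<eta>) {P}"
    proof (rule unstable[OF _ _ _ _ L])
      fix e :: real assume e: "0 < e"
      \<comment> \<open>Points on the graph of \<open>h\<close> over small real z, where X = 0 and
        \<open>U\<close> reduces to minus \<open>V\<close>. The summand 0 matches the shape required
        by \<open>X_emb\<close>.\<close>
      define q where "q t = emb (of_real t) (h (of_real t) + 0)" for t :: real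
      have "continuous_on UNIV (\<lambda>t::real. (complex_of_real t, h (of_real t)))"
        unfolding quad_form_def by (intro continuous_intros)
      from bounded_linear.continuous_on[OF emb this] have "continuous_on UNIV q"
        by (simp add: q_def)
      then have "isCont q 0" by (simp add: continuous_on_eq_continuous_at)
      moreover have "q 0 = 0" using coords_zero[of "q 0"] X_emb[of 0 0] Z_emb[of 0 "h 0"] by (simp add: q_def)
      ultimately obtain d where d: "0 < d" "\<And>t. \<bar>t\<bar> < d \<Longrightarrow> norm (q t) < min e \<delta>"
        using e \<delta> unfolding continuous_at_eps_delta by (metis diff_zero dist_norm min_less_iff_conj real_norm_def)
      define u where "u = q (d / 2)"
      have u: "norm u < e" "norm u < \<delta>" using d(2)[of "d / 2"] d(1) by (auto simp: u_def)
      have zu: "Z u = of_real (d / 2)" "X u = 0" by (simp_all only: u_def q_def Z_emb X_emb)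
      have "0 < (norm (complex_of_real (d / 2)))^2 / 2" using d(1) by simp
      then have "0 < V \<eta> (of_real (d / 2))" using low[OF u(2)] unfolding zu by linarith
      then have "U (P + u) < 0" unfolding U_def that add_diff_cancel_left' zu by simp
      then show "\<exists>x. infdist x {P} < e \<and> x \<in> ball P \<delta> \<and> U x < 0"
        using u by (intro exI[of _ "P + u"]) (simp add: dist_norm)
    qed auto
    then show ?thesis by (simp add: lyap_stable_iff_orbit_stable)
  qed
qed

text \<open>With \<open>\<tau>\<close> opposite to the sign of \<open>lc\<close> the resonant term
  always contributes decay in |Z|^4. The coupling |Z|^2 |X| is absorbed by completing the square;
  all other errors carry the factor \<open>norm u\<close>.\<close>

theorem equilibrium_critical:
  assumes "lc \<noteq> 0"
  shows "lc < 0 \<Longrightarrow> asym_stable (F 0) P" and "0 < lc \<Longrightarrow> \<not> lyap_stable (F 0) P"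
proof -
  obtain M where M: "0 < M" and est: "\<And>u. norm u \<le> 1 \<Longrightarrow>
     \<bar>X u * G2 u\<bar> \<le> M * ((norm (Z u))^2 * \<bar>X u\<bar>) + M * norm u * (X u)^2 \<and>
     \<bar>G5 u\<bar> \<le> M * norm u * ((norm (Z u))^4 + (X u)^2) \<and>
     \<bar>X u * X u * D1 u\<bar> \<le> M * norm u * (X u)^2 \<and>
     \<bar>X u * D3 u\<bar> \<le> M * norm u * ((norm (Z u))^4 + (X u)^2)"
    by (rule equilibrium_estimates) blast
  obtain dv \<eta>0 where dv: "0 < dv" "0 < \<eta>0" "\<And>z \<eta>. norm z \<le> dv \<Longrightarrow> \<bar>\<eta>\<bar> \<le> \<eta>0 \<Longrightarrow> (norm z)^2 / 2 \<le> V \<eta> z"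
    by (rule V_lower) blast
  obtain c where c: "1 \<le> c" "\<And>u. norm u \<le> 1 \<Longrightarrow> norm (Z u) \<le> c * norm u" by (rule coords_bound) blast
  define \<tau> where "\<tau> = - sgn lc"
  define a where "a = \<bar>lc\<bar>"
  have a: "0 < a" "\<tau> * lc = - a" "\<bar>\<tau>\<bar> = 1" using assms by (auto simp: a_def \<tau>_def sgn_if)
  \<comment> \<open>The decay of K X^2 has to cover the \<open>M^2 / (4 * a)\<close> left over from
    completing the square in the coupling, with 1 to spare.\<close>
  define K where "K = (M^2 / (4 * a) + 1) / (2 * \<nu>)"
  have K: "0 < K" "2 * K * \<nu> = M^2 / (4 * a) + 1"
    using M a \<nu> by (auto simp: K_def intro!: divide_pos_pos add_nonneg_pos)
  \<comment> \<open>After completing the square the decay a |Z|^4 + X^2 is left. It is at least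
    twice \<open>b\<close> times the basic quantity, so one share may be spent on the errors with
    factor \<open>norm u\<close>, whose total constant is \<open>m\<close>.\<close>
  define b where "b = min a 1 / 2"
  have b: "0 < b" "2 * b \<le> a" "2 * b \<le> 1" using a by (auto simp: b_def)
  define m where "m = M * (2 + 4 * K)"
  have m: "0 < m" using M K by (simp add: m_def)
  define \<delta> where "\<delta> = min 1 (min (dv / c) (b / m))"
  have \<delta>: "0 < \<delta>" "\<delta> \<le> 1" "\<delta> \<le> dv / c" "\<delta> \<le> b / m" using dv c b m by (auto simp: \<delta>_def)
  have dec: "\<tau> * dV 0 (Z u) (Z (F 0 (P + u))) + 2 * K * (X u * (W (F 0 (P + u)) - dh (Z u) (Z (F 0 (P + u)))))
      \<le> - (b * ((norm (Z u))^4 + (X u)^2))" if u: "norm u < \<delta>" for u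
  proof -
    define A B s where "A = (norm (Z u))^2" and "B = \<bar>X u\<bar>" and "s = norm u"
    have AB: "(norm (Z u))^4 = A^2" "(X u)^2 = B^2" by (simp_all add: A_def B_def)
    have u1: "norm u \<le> 1" using u \<delta> by simp
    note e = est[OF u1, unfolded AB, folded A_def B_def s_def]
    have s: "0 \<le> s" "s * m \<le> b"
    proof -
      have "s * m \<le> \<delta> * m" using u m by (intro mult_right_mono) (auto simp: s_def)
      moreover have "\<delta> * m \<le> b" using \<delta>(4) m by (simp add: pos_le_divide_eq)
      ultimately show "s * m \<le> b" by simp
    qed (simp add: s_def)
    have t1: "\<tau> * (X u * G2 u) \<le> M * (A * B) + M * s * B^2" and t2: "\<tau> * G5 u \<le> M * s * (A^2 + B^2)"
      using e a(3) abs_ge_self[of "\<tau> * (X u * G2 u)"] abs_ge_self[of "\<tau> * G5 u"] by (auto simp: abs_mult)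
    have "X u * X u * D1 u \<le> M * s * B^2" "X u * D3 u \<le> M * s * (A^2 + B^2)"
      using e by linarith+
    then have t3: "2 * K * (X u * X u * D1 u) \<le> 2 * K * (M * s * B^2)" and t4: "2 * K * (X u * D3 u) \<le> 2 * K * (M * s * (A^2 + B^2))"
      using K(1) by (auto intro!: mult_left_mono)
    have young: "M * (A * B) \<le> a * A^2 + M^2 / (4 * a) * B^2"
    proof -
      have "0 \<le> (2 * a * A - M * B)^2 / (4 * a)" using a by simp
      also have "\<dots> = a * A^2 - M * (A * B) + M^2 / (4 * a) * B^2"
        using a by (simp add: power2_eq_square field_simps)
      finally show ?thesis by simp
    qed
    have "M * s * B^2 \<le> M * s * (A^2 + B^2)" using M s by (intro mult_left_mono) auto
    then have t5: "M * s * B^2 \<le> M * s * (A^2 + B^2)" "2 * K * (M * s * B^2) \<le> 2 * K * (M * s * (A^2 + B^2))"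
      using K by (auto intro: mult_left_mono)
    have "M * s * (A^2 + B^2) * 2 + 2 * K * (M * s * (A^2 + B^2)) * 2 = (s * m) * (A^2 + B^2)"
      by (simp add: m_def algebra_simps)
    also have "\<dots> \<le> b * (A^2 + B^2)" using s by (intro mult_right_mono) auto
    finally have t6: "M * s * (A^2 + B^2) * 2 + 2 * K * (M * s * (A^2 + B^2)) * 2 \<le> b * (A^2 + B^2)" .
    have t7: "2 * b * (A^2 + B^2) \<le> a * A^2 + B^2"
      using mult_right_mono[OF b(2), of "A^2"] mult_right_mono[OF b(3), of "B^2"] by (simp add: algebra_simps)
    have "X u * X u = B^2" by (simp add: B_def power2_eq_square)
    then have "\<tau> * dV 0 (Z u) (Z (F 0 (P + u))) + 2 * K * (X u * (W (F 0 (P + u)) - dh (Z u) (Z (F 0 (P + u)))))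
        = 2 * (\<tau> * lc) * A^2 + \<tau> * (X u * G2 u) + \<tau> * G5 u - (2 * K * \<nu>) * B^2
          + 2 * K * (X u * X u * D1 u) + 2 * K * (X u * D3 u)"
      unfolding V_field X_field AB by (simp add: algebra_simps)
    also have "\<dots> = - 2 * a * A^2 + \<tau> * (X u * G2 u) + \<tau> * G5 u - (M^2 / (4 * a) * B^2 + B^2)
          + 2 * K * (X u * X u * D1 u) + 2 * K * (X u * D3 u)"
      unfolding a(2) K(2) by (simp add: algebra_simps)
    also have "\<dots> \<le> - (b * (A^2 + B^2))"
      using t1 t2 t3 t4 young t5 t6 t7 by linarith
    finally show ?thesis unfolding AB .
  qed
  have low: "(norm (Z u))^2 / 2 \<le> V 0 (Z u)" if "norm u < \<delta>" for u
  proof (rule dv(3))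
    have "norm (Z u) \<le> c * norm u" using that \<delta> by (intro c(2)) simp
    also have "\<dots> \<le> c * (dv / c)" using that \<delta> c(1) by (intro mult_left_mono) auto
    finally show "norm (Z u) \<le> dv" using c(1) by simp
  qed (use dv in simp)
  note E = equilibrium_lyapunov[OF \<delta>(1,2) K(1) b(1) _ dec low]
  show "asym_stable (F 0) P" if "lc < 0" using E(1) that by (simp add: \<tau>_def)
  show "\<not> lyap_stable (F 0) P" if "0 < lc" using E(2) that by (simp add: \<tau>_def)
qed

text \<open>The bound on \<open>\<eta>\<close> has to be fixed before the neighbourhood. Couplings
  of size |\<open>\<eta>\<close>| |Z| |X| and the \<open>\<eta>\<close>^2 term compete with a decay
  of order |\<open>\<eta>\<close>| |Z|^2 + X^2 and do not improve as u shrinks, so they restrict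
  \<open>\<eta>\<close>; the other errors restrict \<open>\<delta>\<close>, which may depend on
  \<open>\<eta>\<close>.\<close>

theorem equilibrium_hyperbolic:
  assumes "Re k1 \<noteq> 0"
  obtains \<eta>0 where "0 < \<eta>0" "\<And>\<eta>. \<bar>\<eta>\<bar> < \<eta>0 \<Longrightarrow> Re k1 * \<eta> < 0 \<Longrightarrow> asym_stable (F \<eta>) P"
    "\<And>\<eta>. \<bar>\<eta>\<bar> < \<eta>0 \<Longrightarrow> 0 < Re k1 * \<eta> \<Longrightarrow> \<not> lyap_stable (F \<eta>) P"
proof -
  obtain M where M: "0 < M" and est: "\<And>u. norm u \<le> 1 \<Longrightarrow>
     (norm (Z u))^4 \<le> M * norm u * ((norm (Z u))^2 + (X u)^2) \<and>
     \<bar>X u * G2 u\<bar> \<le> M * norm u * ((norm (Z u))^2 + (X u)^2) \<and>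
     \<bar>G5 u\<bar> \<le> M * norm u * ((norm (Z u))^2 + (X u)^2) \<and>
     \<bar>X u * X u * D1 u\<bar> \<le> M * norm u * ((norm (Z u))^2 + (X u)^2) \<and>
     \<bar>X u * D3 u\<bar> \<le> M * norm u * ((norm (Z u))^2 + (X u)^2) \<and>
     \<bar>H3 u\<bar> \<le> M * norm u * ((norm (Z u))^2 + (X u)^2) \<and>
     \<bar>Q2 u\<bar> \<le> M * ((norm (Z u))^2 + (X u)^2) \<and>
     \<bar>X u * H1 u\<bar> \<le> M * (norm (Z u) * \<bar>X u\<bar> + (X u)^2) \<and>
     \<bar>X u * K2 u\<bar> \<le> M * (norm (Z u) * \<bar>X u\<bar> + (X u)^2)"
    by (rule equilibrium_estimates) blast
  obtain dv \<eta>v where dv: "0 < dv" "0 < \<eta>v" "\<And>z \<eta>. norm z \<le> dv \<Longrightarrow> \<bar>\<eta>\<bar> \<le> \<eta>v \<Longrightarrow> (norm z)^2 / 2 \<le> V \<eta> z"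
    by (rule V_lower) blast
  obtain c where c: "1 \<le> c" "\<And>u. norm u \<le> 1 \<Longrightarrow> norm (Z u) \<le> c * norm u" by (rule coords_bound) blast
  define a where "a = \<bar>Re k1\<bar>"
  have a: "0 < a" using assms by (simp add: a_def)
  \<comment> \<open>The bound with \<open>a\<close> controls the \<open>Q2\<close> term. The bound
    with \<open>\<nu>\<close> pays for completing the square in three couplings, one from
    \<open>H1\<close> and two from \<open>K2\<close>, and for the accompanying multiples of
    X^2.\<close>
  define \<eta>0 where "\<eta>0 = min (min 1 \<eta>v) (min (a / (2 * M)) (\<nu> / (9 * M^2 / (2 * a) + 4 * M)))"
  have Mp: "0 < 9 * M^2 / (2 * a) + 4 * M" using M a by (intro add_nonneg_pos) auto
  have \<eta>0: "0 < \<eta>0" "\<eta>0 \<le> 1" "\<eta>0 \<le> \<eta>v" "\<eta>0 \<le> a / (2 * M)" "\<eta>0 \<le> \<nu> / (9 * M^2 / (2 * a) + 4 * M)"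
    using dv M a \<nu> Mp by (auto simp: \<eta>0_def)
  have key: "(\<tau> = 1 \<longrightarrow> asym_stable (F \<eta>) P) \<and> (\<tau> = -1 \<longrightarrow> \<not> lyap_stable (F \<eta>) P)"
    if \<eta>: "\<bar>\<eta>\<bar> < \<eta>0" "Re k1 * \<eta> \<noteq> 0" and \<tau>_def: "\<tau> = - sgn (Re k1 * \<eta>)" for \<eta> \<tau>
  proof -
    define n where "n = \<bar>\<eta>\<bar>"
    have n: "0 < n" "n \<le> 1" "n \<le> \<eta>v" using \<eta> \<eta>0 by (auto simp: n_def)
    have nM: "n * M \<le> a / 2" 
    proof -
      have "n * M \<le> \<eta>0 * M" using \<eta>(1) M by (intro mult_right_mono) (auto simp: n_def)
      moreover have "\<eta>0 * (2 * M) \<le> a" using \<eta>0(4) M by (simp add: pos_le_divide_eq)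
      ultimately show ?thesis by simp
    qed
    have nn: "n * (9 * M^2 / (2 * a) + 4 * M) \<le> \<nu>"
      using \<eta>(1) \<eta>0(5) Mp by (simp add: n_def pos_le_divide_eq[symmetric])
    have "\<tau> * (\<eta> * Re k1) = - ((Re k1 * \<eta>) * sgn (Re k1 * \<eta>))" unfolding \<tau>_def by (simp only: mult_ac mult_minus_left)
    also have "\<dots> = - (a * n)" unfolding abs_sgn[symmetric] abs_mult a_def n_def ..
    finally have \<tau>: "\<tau> * (\<eta> * Re k1) = - (a * n)" "\<bar>\<tau>\<bar> = 1"
      using \<eta>(2) by (simp_all add: \<tau>_def abs_sgn_eq del: mult_eq_0_iff)
    define b where "b = min (a * n) \<nu> / 2"
    have b: "0 < b" "2 * b \<le> a * n" "2 * b \<le> \<nu>" using a n \<nu> by (auto simp: b_def)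
    define m where "m = M * (2 * \<bar>lc\<bar> + 7)"
    have m: "0 < m" using M by (simp add: m_def)
    define \<delta> where "\<delta> = min 1 (min (dv / c) (b / m))"
    have \<delta>: "0 < \<delta>" "\<delta> \<le> 1" "\<delta> \<le> dv / c" "\<delta> \<le> b / m" using dv c b m by (auto simp: \<delta>_def)
    have dec: "\<tau> * dV \<eta> (Z u) (Z (F \<eta> (P + u))) + 2 * 1 * (X u * (W (F \<eta> (P + u)) - dh (Z u) (Z (F \<eta> (P + u)))))
        \<le> - (b * ((norm (Z u))^2 + (X u)^2))" if u: "norm u < \<delta>" for u
    proof -
      define r B s where "r = norm (Z u)" and "B = \<bar>X u\<bar>" and "s = norm u"
      define Q where "Q = r^2 + B^2"
      have X2: "(X u)^2 = B^2" "X u * X u = B^2" by (simp_all add: B_def power2_eq_square)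
      have u1: "norm u \<le> 1" using u \<delta> by simp
      note e = est[OF u1, unfolded X2(1), folded r_def B_def s_def, folded Q_def]
      have s: "0 \<le> s" "s * m \<le> b"
    proof -
      have "s * m \<le> \<delta> * m" using u m by (intro mult_right_mono) (auto simp: s_def)
      moreover have "\<delta> * m \<le> b" using \<delta>(4) m by (simp add: pos_le_divide_eq)
      ultimately show "s * m \<le> b" by simp
    qed (simp add: s_def)
      have Q: "0 \<le> Q" by (simp add: Q_def)
      define q where "q = M * s * Q"
      have q: "0 \<le> q" using M s Q by (simp add: q_def)
      have absb: "\<tau> * y \<le> Y" "\<tau> * (\<eta> * y) \<le> n * Y" "\<eta> * y \<le> n * Y" "\<tau> * (\<eta>^2 * y) \<le> n^2 * Y" if "\<bar>y\<bar> \<le> Y" for y Y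
      proof -
        have "\<tau> * x \<le> \<bar>x\<bar>" for x using abs_ge_self[of "\<tau> * x"] \<tau>(2) by (simp add: abs_mult)
        moreover have "\<bar>\<eta> * y\<bar> \<le> n * Y" unfolding abs_mult n_def using that by (intro mult_left_mono) auto
        moreover have "\<bar>\<eta>^2 * y\<bar> \<le> n^2 * Y" unfolding abs_mult n_def using that by (simp add: mult_left_mono)
        ultimately show "\<tau> * y \<le> Y" "\<tau> * (\<eta> * y) \<le> n * Y" "\<eta> * y \<le> n * Y" "\<tau> * (\<eta>^2 * y) \<le> n^2 * Y"
          using that by (smt (verit))+
      qed
      have t1: "\<tau> * (2 * lc * r^4) \<le> 2 * \<bar>lc\<bar> * q"
      proof (rule absb(1))
        have "\<bar>2 * lc * r^4\<bar> = 2 * \<bar>lc\<bar> * r^4" by (simp add: abs_mult r_def)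
        also have "\<dots> \<le> 2 * \<bar>lc\<bar> * q" using e by (intro mult_left_mono) (auto simp: q_def)
        finally show "\<bar>2 * lc * r^4\<bar> \<le> 2 * \<bar>lc\<bar> * q" .
      qed
      have t2: "\<tau> * (X u * G2 u) \<le> q" "\<tau> * G5 u \<le> q" "X u * X u * D1 u \<le> q" "X u * D3 u \<le> q"
        using e by (auto intro!: absb(1) simp: q_def)
      have t3: "\<tau> * (\<eta> * H3 u) \<le> n * q" "\<tau> * (\<eta>^2 * Q2 u) \<le> n^2 * (M * Q)"
        "\<tau> * (\<eta> * (X u * H1 u)) \<le> n * (M * (r * B + B^2))" "\<eta> * (X u * K2 u) \<le> n * (M * (r * B + B^2))"
        using e by (auto intro!: absb simp: q_def)
      have t4: "n * q \<le> q" using n q by (simp add: mult_left_le_one_le)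
      have young: "3 * M * (r * B) \<le> a / 2 * r^2 + 9 * M^2 / (2 * a) * B^2"
      proof -
        have "0 \<le> (a * r - 3 * M * B)^2 / (2 * a)" using a by simp
        also have "\<dots> = a / 2 * r^2 - 3 * M * (r * B) + 9 * M^2 / (2 * a) * B^2"
          using a by (simp add: power2_eq_square field_simps)
        finally show ?thesis by simp
      qed
      have t5: "3 * (n * (M * (r * B + B^2))) \<le> n * (a / 2 * r^2 + 9 * M^2 / (2 * a) * B^2) + n * (3 * M * B^2)"
        using mult_left_mono[OF young, of n] n by (simp add: algebra_simps)
      have t6: "n^2 * (M * Q) \<le> n * (a / 2 * r^2) + n * (M * B^2)"
      proof -
        have "n * (n * M) * r^2 \<le> n * (a / 2) * r^2" using nM n by (intro mult_right_mono mult_left_mono) auto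
        moreover have "n * (n * (M * B^2)) \<le> 1 * (n * (M * B^2))" using n M by (intro mult_right_mono) auto
        ultimately show ?thesis by (simp add: Q_def power2_eq_square algebra_simps)
      qed
      have t7: "n * (9 * M^2 / (2 * a) * B^2) + n * (3 * M * B^2) + n * (M * B^2) \<le> \<nu> * B^2"
        using mult_right_mono[OF nn, of "B^2"] by (simp add: algebra_simps)
      have "(2 * \<bar>lc\<bar> + 7) * q = (s * m) * Q" by (simp add: q_def m_def)
      also have "\<dots> \<le> b * Q" using s Q by (intro mult_right_mono)
      finally have t8: "2 * \<bar>lc\<bar> * q + 7 * q \<le> b * Q" by (simp add: algebra_simps)
      have t9: "2 * (b * Q) \<le> a * n * r^2 + \<nu> * B^2"
        using mult_right_mono[OF b(2), of "r^2"] mult_right_mono[OF b(3), of "B^2"] by (simp add: Q_def algebra_simps)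
      have "\<tau> * dV \<eta> (Z u) (Z (F \<eta> (P + u))) + 2 * 1 * (X u * (W (F \<eta> (P + u)) - dh (Z u) (Z (F \<eta> (P + u)))))
        = \<tau> * (2 * lc * r^4) + \<tau> * (X u * G2 u) + \<tau> * G5 u + 2 * (\<tau> * (\<eta> * Re k1)) * r^2
          + \<tau> * (\<eta> * (X u * H1 u)) + \<tau> * (\<eta> * H3 u) + \<tau> * (\<eta>^2 * Q2 u)
          - 2 * \<nu> * (X u * X u) + 2 * (X u * X u * D1 u) + 2 * (X u * D3 u) + 2 * (\<eta> * (X u * K2 u))"
        unfolding V_field X_field r_def[symmetric] by (simp add: algebra_simps)
      also have "\<dots> = \<tau> * (2 * lc * r^4) + \<tau> * (X u * G2 u) + \<tau> * G5 u - 2 * (a * n * r^2)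
          + \<tau> * (\<eta> * (X u * H1 u)) + \<tau> * (\<eta> * H3 u) + \<tau> * (\<eta>^2 * Q2 u)
          - 2 * (\<nu> * B^2) + 2 * (X u * X u * D1 u) + 2 * (X u * D3 u) + 2 * (\<eta> * (X u * K2 u))"
        unfolding \<tau>(1) X2(2) by simp
      also have "\<dots> \<le> 2 * \<bar>lc\<bar> * q + 7 * q + 3 * (n * (M * (r * B + B^2))) + n^2 * (M * Q) - 2 * (a * n * r^2) - 2 * (\<nu> * B^2)"
        using t1 t2 t3 t4 by linarith
      also have "\<dots> \<le> - (b * Q)"
        using t5 t6 t7 t8 t9 by (simp add: algebra_simps)
      finally show ?thesis unfolding Q_def r_def X2 .
    qed
    have low: "(norm (Z u))^2 / 2 \<le> V \<eta> (Z u)" if "norm u < \<delta>" for u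
    proof (rule dv(3))
      have "norm (Z u) \<le> c * norm u" using that \<delta> by (intro c(2)) simp
      also have "\<dots> \<le> c * (dv / c)" using that \<delta> c(1) by (intro mult_left_mono) auto
      finally show "norm (Z u) \<le> dv" using c(1) by simp
      show "\<bar>\<eta>\<bar> \<le> \<eta>v" using n by (simp add: n_def)
    qed
    show ?thesis
      using equilibrium_lyapunov[OF \<delta>(1,2) zero_less_one b(1) _ dec low] by auto
  qed
  show ?thesis
  proof (rule that[OF \<eta>0(1)])
    show "asym_stable (F \<eta>) P" if "\<bar>\<eta>\<bar> < \<eta>0" "Re k1 * \<eta> < 0" for \<eta>
      using key[OF that(1) less_imp_neq[OF that(2)] refl] that(2) by simp
    show "\<not> lyap_stable (F \<eta>) P" if "\<bar>\<eta>\<bar> < \<eta>0" "0 < Re k1 * \<eta>" for \<eta>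
      using key[OF that(1) less_imp_neq[OF that(2), symmetric] refl] that(2) by simp
  qed
qed

end

section \<open>Periodic functions of the argument, and an implicit derivative\<close>

lemma periodic_int_multiple:
  fixes g :: "real \<Rightarrow> 'a"
  assumes "\<And>\<theta>. g (\<theta> + p) = g \<theta>"
  shows "g (\<theta> + of_int k * p) = g \<theta>"
proof (induction k rule: int_induct[where k = 0])
  case (step1 i)
  then show ?case using assms[of "\<theta> + of_int i * p"] by (simp add: algebra_simps)
next
  case (step2 i)
  then show ?case using assms[of "\<theta> + of_int (i - 1) * p"] by (simp add: algebra_simps)
qed auto

lemma periodic_cis_eq:
  fixes g :: "real \<Rightarrow> 'a"
  assumes "\<And>\<theta>. g (\<theta> + 2 * pi) = g \<theta>" "cis a = cis b"
  shows "g a = g b"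
proof -
  have "cos a = cos b" "sin a = sin b" using assms(2) by (auto simp: complex_eq_iff)
  then have "sin a = sin b \<and> cos a = cos b" by simp
  then obtain k where "a = b + 2 * pi * of_int k"
    unfolding sin_cos_eq_iff by blast
  then show ?thesis using periodic_int_multiple[of g "2 * pi" b k, OF assms(1)] by (simp add: mult_ac)
qed

text \<open>\<open>Arg\<close> jumps across the negative axis, but a periodic function does not see
  the jump. Near \<open>z\<close> the argument may be replaced by a branch built from w/z, which is
  close to 1 and so away from the cut of \<open>Ln\<close>.\<close>

lemma periodic_Arg_local:
  fixes g :: "real \<Rightarrow> 'a"
  assumes g: "\<And>\<theta>. g (\<theta> + 2 * pi) = g \<theta>" and nz: "z \<noteq> 0" "w \<noteq> 0"
  shows "g (Arg w) = g (Arg z + Im (Ln (w / z)))"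
proof (rule periodic_cis_eq[of g])
  show "g (\<theta> + 2 * pi) = g \<theta>" for \<theta> by (rule g)
  have 1: "cis (Arg x) = x / of_real (norm x)" if "x \<noteq> 0" for x
    using that by (simp add: cis_Arg sgn_eq)
  have "Im (Ln (w / z)) = Arg (w / z)" using nz by (simp add: Arg_eq_Im_Ln)
  then have "cis (Arg z + Im (Ln (w / z))) = cis (Arg z) * cis (Arg (w / z))" by (simp add: cis_mult)
  also have "\<dots> = cis (Arg w)" using nz by (simp add: 1 norm_divide)
  finally show "cis (Arg w) = cis (Arg z + Im (Ln (w / z)))" ..
qed

lemma periodic_Arg_isCont:
  fixes g :: "real \<Rightarrow> real"
  assumes g: "\<And>\<theta>. g (\<theta> + 2 * pi) = g \<theta>" "\<And>\<theta>. isCont g \<theta>" and z: "z \<noteq> 0"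
  shows "isCont (\<lambda>w. g (Arg w)) z"
proof -
  have "isCont (\<lambda>w. Arg z + Im (Ln (w / z))) z"
    using z by (intro continuous_intros) auto
  from isCont_o2[OF this g(2)] have "isCont (\<lambda>w. g (Arg z + Im (Ln (w / z)))) z" .
  then have c: "isCont (\<lambda>w. g (Arg z + Im (Ln (w / z)))) z" .
  have ev: "\<forall>\<^sub>F w in nhds z. g (Arg z + Im (Ln (w / z))) = g (Arg w)"
  proof -
    have "\<forall>\<^sub>F w in nhds z. w \<in> - {0}" using z by (intro eventually_nhds_in_open) auto
    then show ?thesis by eventually_elim (use periodic_Arg_local[of g z, OF g(1) z] in auto)
  qed
  show ?thesis using c unfolding isCont_cong[OF ev] .
qed

text \<open>The argument moves with speed Im(v / zeta). Near \<open>t\<close> the function coincides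
  with its composition with the local smooth branch of the argument, and only that branch is
  differentiated.\<close>

lemma periodic_Arg_curve:
  fixes g :: "real \<Rightarrow> real" and \<zeta> :: "real \<Rightarrow> complex"
  assumes g: "\<And>\<theta>. g (\<theta> + 2 * pi) = g \<theta>" "(g has_real_derivative g') (at (Arg (\<zeta> t)))"
    and \<zeta>: "(\<zeta> has_vector_derivative v) (at t within S)" and nz: "\<zeta> t \<noteq> 0"
  shows "((\<lambda>s. g (Arg (\<zeta> s))) has_real_derivative g' * Im (v / \<zeta> t)) (at t within S)"
proof -
  have "((\<lambda>w. Im (Ln (w / \<zeta> t))) has_derivative (\<lambda>w. Im (w / \<zeta> t))) (at (\<zeta> t))"
  proof -
    have "((\<lambda>w. Ln (w / \<zeta> t)) has_field_derivative inverse (\<zeta> t / \<zeta> t) * (1 / \<zeta> t)) (at (\<zeta> t))"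
      using nz by (intro DERIV_chain2[where f = Ln] has_field_derivative_Ln) (auto intro!: derivative_eq_intros)
    moreover have "(*) (inverse (\<zeta> t / \<zeta> t) * (1 / \<zeta> t)) = (\<lambda>w. w / \<zeta> t)" using nz by auto
    ultimately have "((\<lambda>w. Ln (w / \<zeta> t)) has_derivative (\<lambda>w. w / \<zeta> t)) (at (\<zeta> t))"
      unfolding has_field_derivative_def by simp
    then show ?thesis by (rule bounded_linear.has_derivative[OF bounded_linear_Im])
  qed
  from has_derivative_along_curve[OF this \<zeta>]
  have "((\<lambda>s. Im (Ln (\<zeta> s / \<zeta> t))) has_real_derivative Im (v / \<zeta> t)) (at t within S)" .
  from DERIV_add[OF DERIV_const[of "Arg (\<zeta> t)"] this]
  have "((\<lambda>s. Arg (\<zeta> t) + Im (Ln (\<zeta> s / \<zeta> t))) has_real_derivative Im (v / \<zeta> t)) (at t within S)"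
    by simp
  moreover have "(g has_real_derivative g') (at (Arg (\<zeta> t) + Im (Ln (\<zeta> t / \<zeta> t))))" using g(2) nz by simp
  ultimately have D: "((\<lambda>s. g (Arg (\<zeta> t) + Im (Ln (\<zeta> s / \<zeta> t)))) has_real_derivative g' * Im (v / \<zeta> t)) (at t within S)"
    by (intro DERIV_chain2[of g])
  have "continuous (at t within S) \<zeta>" using \<zeta> has_vector_derivative_continuous by blast
  then obtain d where d: "0 < d" "\<And>s. s \<in> S \<Longrightarrow> dist s t < d \<Longrightarrow> dist (\<zeta> s) (\<zeta> t) < norm (\<zeta> t)"
    using nz unfolding continuous_within_eps_delta by (metis zero_less_norm_iff)
  have eq: "g (Arg (\<zeta> t) + Im (Ln (\<zeta> s / \<zeta> t))) = g (Arg (\<zeta> s))" if "s \<in> S \<or> s = t" "dist s t < d" for s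
  proof -
    have "\<zeta> s \<noteq> 0" using that d(2)[of s] nz by (auto simp: dist_norm)
    then show ?thesis using periodic_Arg_local[of g "\<zeta> t" "\<zeta> s", OF g(1) nz] by simp
  qed
  have at: "at t within S = at t within insert t S" by (simp add: at_within_def)
  show ?thesis
    unfolding at by (rule has_field_derivative_transform_within[OF D[unfolded at] d(1)]) (use eq in auto)
qed

text \<open>If the difference of \<open>S\<close> in its second argument factors algebraically,
  dividing by the factor \<open>D\<close> turns the difference quotients of \<open>y\<close> and of
  \<open>S\<close> at frozen radius into that of \<open>r\<close>. Beyond these two derivatives only
  the limit of \<open>D\<close> along the curve is needed, so no implicit function theorem
  enters.\<close>

lemma implicit_has_derivative:
  fixes S D :: "real \<Rightarrow> real \<Rightarrow> real" and r y :: "real \<Rightarrow> real"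
  assumes S: "\<And>\<theta>. S \<theta> (r \<theta>) = y \<theta>" and y: "(y has_real_derivative y') (at a)"
    and Sa: "((\<lambda>\<theta>. S \<theta> (r a)) has_real_derivative b) (at a)"
    and D: "\<And>\<theta>. S \<theta> (r \<theta>) - S \<theta> (r a) = (r \<theta> - r a) * D \<theta> (r \<theta>)" and Dl: "((\<lambda>\<theta>. D \<theta> (r \<theta>)) \<longlongrightarrow> d) (at a)" "d \<noteq> 0"
  shows "(r has_real_derivative (y' - b) / d) (at a)"
proof -
  have "((\<lambda>\<theta>. ((y \<theta> - y a) / (\<theta> - a) - (S \<theta> (r a) - S a (r a)) / (\<theta> - a)) / D \<theta> (r \<theta>)) \<longlongrightarrow> (y' - b) / d) (at a)"
    using y Sa unfolding has_field_derivative_iff by (intro tendsto_intros Dl)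
  moreover have "\<forall>\<^sub>F \<theta> in at a. ((y \<theta> - y a) / (\<theta> - a) - (S \<theta> (r a) - S a (r a)) / (\<theta> - a)) / D \<theta> (r \<theta>) = (r \<theta> - r a) / (\<theta> - a)"
  proof -
    have "\<forall>\<^sub>F \<theta> in at a. D \<theta> (r \<theta>) \<noteq> 0" using tendsto_imp_eventually_ne[OF Dl] .
    then show ?thesis
    proof eventually_elim
      case (elim \<theta>)
      have "(y \<theta> - y a) - (S \<theta> (r a) - S a (r a)) = (r \<theta> - r a) * D \<theta> (r \<theta>)"
        using D[of \<theta>] S[of \<theta>] S[of a] by simp
      then have "((y \<theta> - y a) / (\<theta> - a) - (S \<theta> (r a) - S a (r a)) / (\<theta> - a)) = (r \<theta> - r a) * D \<theta> (r \<theta>) / (\<theta> - a)"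
        by (simp add: diff_divide_distrib[symmetric])
      then show ?case using elim by simp
    qed
  qed
  ultimately show ?thesis unfolding has_field_derivative_iff
    by (rule Lim_transform_eventually)
qed

section \<open>Polar coordinates adapted to the center manifold\<close>

context hopf_form
begin

text \<open>With \<open>|\<eta>| = m\<^sup>2\<close>, the branch of periodic orbits lives at \<open>|Z| ~ m\<close> and \<open>X ~ m\<^sup>2\<close>.\<close>

definition "chart m \<theta> r \<sigma> = emb (of_real (m * r) * cis \<theta>) (h (of_real (m * r) * cis \<theta>) + m^2 * \<sigma>)"
text \<open>The imaginary part of a logarithmic derivative is the speed of the argument of
  \<open>Z\<close> along the flow. Dividing by it in \<open>R1\<close> and \<open>R2\<close>
  converts rates in time into rates in the angle.\<close>

definition "angv \<eta> u = Im (Z (F \<eta> (P + u)) / Z u)"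
text \<open>The level of \<open>V\<close>, scaled to order one, replaces \<open>r\<close> as the
  radial unknown, since its derivative is free of the low-order non-resonant terms.\<close>

definition "Svar \<eta> m \<theta> r = V \<eta> (of_real (m * r) * cis \<theta>) / m^2"
definition "R1 \<eta> m u = dV \<eta> (Z u) (Z (F \<eta> (P + u))) / m^2 / angv \<eta> u"
definition "R2 \<eta> m u = (W (F \<eta> (P + u)) - dh (Z u) (Z (F \<eta> (P + u)))) / m^2 / angv \<eta> u"

lemma Z_chart [simp]: "Z (chart m \<theta> r \<sigma>) = of_real (m * r) * cis \<theta>"
  by (simp add: chart_def Z_emb)

lemma X_chart [simp]: "X (chart m \<theta> r \<sigma>) = m^2 * \<sigma>"
  by (simp add: chart_def X_emb)

lemma cis_2pi: "cis (\<theta> + 2 * pi) = cis \<theta>"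
  by (simp add: cis.ctr)

lemma chart_periodic: "chart m (\<theta> + 2 * pi) r \<sigma> = chart m \<theta> r \<sigma>"
  unfolding chart_def cis_2pi ..

lemma Svar_periodic: "Svar \<eta> m (\<theta> + 2 * pi) r = Svar \<eta> m \<theta> r"
  unfolding Svar_def cis_2pi ..

lemma chart_of_coords:
  assumes "0 < m" shows "chart m (Arg (Z u)) (norm (Z u) / m) (X u / m^2) = u"
proof -
  have "of_real (m * (norm (Z u) / m)) * cis (Arg (Z u)) = Z u"
    using assms by (cases "Z u = 0") (simp_all add: cis_Arg sgn_eq)
  then show ?thesis using assms emb_ZW[of u] by (simp add: chart_def X_def)
qed

lemma chart_continuous:
  assumes "continuous_on T t" "continuous_on T r" "continuous_on T s"
  shows "continuous_on T (\<lambda>x. chart m (t x) (r x) (s x))"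
proof -
  have "continuous_on T (\<lambda>x. cis (t x))"
    unfolding cis_conv_exp by (intro continuous_intros assms)
  then have "continuous_on T (\<lambda>x. (of_real (m * r x) * cis (t x), h (of_real (m * r x) * cis (t x)) + m^2 * s x))"
    unfolding quad_form_def by (intro continuous_intros assms)
  from bounded_linear.continuous_on[OF emb this] show ?thesis by (simp add: chart_def)
qed

definition "a2 \<eta> \<theta> = 1 + \<eta> * (2 * Re (ce * cis \<theta>^2))"
definition "a3 \<theta> = 2 * Re (ca * cis \<theta>^3 + cb * cis \<theta>^2 * cnj (cis \<theta>))"
definition "a4 \<theta> = 2 * Re (cc * cis \<theta>^4 + cd * cis \<theta>^3 * cnj (cis \<theta>))"

text \<open>The part of degree j of \<open>V\<close> contributes the factor m^(j-2) r^j. With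
  \<open>\<eta>\<close> of size m^2 the level therefore tends to r^2 as m tends to 0.\<close>

lemma Svar_poly:
  assumes "0 < m"
  shows "Svar \<eta> m \<theta> r = a2 \<eta> \<theta> * r^2 + m * a3 \<theta> * r^3 + m^2 * a4 \<theta> * r^4"
proof -
  define w where "w = cis \<theta>"
  have w: "norm w = 1" by (simp add: w_def)
  define k where "k = m * r"
  have "V \<eta> (of_real k * w) = k^2 * Re (w * cnj w) + k^3 * (2 * Re (ca * w^3 + cb * w^2 * cnj w))
      + k^4 * (2 * Re (cc * w^4 + cd * w^3 * cnj w)) + \<eta> * (k^2 * (2 * Re (ce * w^2)))"
  proof -
    have e: "of_real k * w * cnj (of_real k * w) = of_real (k^2) * (w * cnj w)"
      "ca * (of_real k * w)^3 + cb * (of_real k * w)^2 * cnj (of_real k * w) + cc * (of_real k * w)^4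
         + cd * (of_real k * w)^3 * cnj (of_real k * w)
       = of_real (k^3) * (ca * w^3 + cb * w^2 * cnj w) + of_real (k^4) * (cc * w^4 + cd * w^3 * cnj w)"
      "ce * (of_real k * w)^2 = of_real (k^2) * (ce * w^2)"
      by (simp_all add: power_mult_distrib algebra_simps power2_eq_square power3_eq_cube power4_eq_xxxx)
    have R: "Re (of_real y * x) = y * Re x" for y x by simp
    show ?thesis unfolding V_def e plus_complex.sel(1)[of "of_real (k^3) * (ca * w^3 + cb * w^2 * cnj w)"] R
      by (simp only: distrib_left mult_ac)
  qed
  also have "Re (w * cnj w) = 1" unfolding cmod_sq_Re w by simp
  finally have e: "V \<eta> (of_real k * w) = k^2 * a2 \<eta> \<theta> + k^3 * a3 \<theta> + k^4 * a4 \<theta>"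
    by (simp only: a2_def a3_def a4_def w_def[symmetric] distrib_left mult_ac mult_1_right add_ac)
  show ?thesis
    unfolding Svar_def k_def[symmetric] w_def[symmetric] e using assms
    by (simp add: k_def field_simps power2_eq_square power3_eq_cube power4_eq_xxxx)
qed

lemma linear_dV: "linear (dV \<eta> z)"
  using has_derivative_linear[OF V_has_derivative] .

lemma linear_dh: "linear (dh z)"
  using has_derivative_linear[OF quad_form_has_derivative] .

lemma field_continuous: "continuous_on (cball 0 1) (\<lambda>u. F \<eta> (P + u))"
  using lipo_lipschitz[of 0 "\<lambda>u. F \<eta> (P + u)"] field_lipo lipschitz_on_continuous_on by (metis One_nat_def)

lemma rates_continuous:
  assumes T: "\<And>u. u \<in> T \<Longrightarrow> norm u \<le> 1 \<and> Z u \<noteq> 0 \<and> angv \<eta> u \<noteq> 0" and m: "0 < m"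
  shows "continuous_on T (angv \<eta>)" "continuous_on T (R1 \<eta> m)" "continuous_on T (R2 \<eta> m)"
proof -
  have f: "continuous_on T (\<lambda>u. F \<eta> (P + u))"
    by (rule continuous_on_subset[OF field_continuous]) (use T in auto)
  have z: "continuous_on T (\<lambda>u. Z (F \<eta> (P + u)))" "continuous_on T (\<lambda>u. W (F \<eta> (P + u)))"
    by (intro bounded_linear.continuous_on[OF Z] bounded_linear.continuous_on[OF W] f)+
  have zu: "continuous_on T Z" by (rule bounded_linear.continuous_on[OF Z continuous_on_id])
  show a: "continuous_on T (angv \<eta>)"
    unfolding angv_def[abs_def] using T by (intro continuous_intros z zu) auto
  have "continuous_on T (\<lambda>u. dV \<eta> (Z u) (Z (F \<eta> (P + u))))"
    unfolding dV_def Lv_def A2_def A3_def B2_def B3_def by (intro continuous_intros z zu)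
  then show "continuous_on T (R1 \<eta> m)"
    unfolding R1_def[abs_def] using T m by (intro continuous_intros a) auto
  have "continuous_on T (\<lambda>u. W (F \<eta> (P + u)) - dh (Z u) (Z (F \<eta> (P + u))))"
    unfolding quad_form_deriv_def by (intro continuous_intros z zu)
  then show "continuous_on T (R2 \<eta> m)"
    unfolding R2_def[abs_def]
    by (rule continuous_on_divide[OF continuous_on_divide[OF _ continuous_on_const] a]) (use T m in auto)
qed

lemma cis_vector_derivative: "(cis has_vector_derivative \<i> * cis \<theta>) (at \<theta>)"
  unfolding has_vector_derivative_complex_iff
  by (auto intro!: derivative_eq_intros)

text \<open>The two scalar equations for the level and for \<open>\<sigma>\<close>, together with
  the parametrisation by the angle, determine the velocity of the curve. What has to be excluded is
  an error along the radius, and \<open>rad\<close> does that.\<close>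

lemma chart_curve_solves:
  assumes m: "0 < m"
    and r: "\<And>\<theta>. (r has_real_derivative r' \<theta>) (at \<theta>)" "\<And>\<theta>. 0 < r \<theta>"
    and \<sigma>: "\<And>\<theta>. (\<sigma> has_real_derivative R2 \<eta> m (chart m \<theta> (r \<theta>) (\<sigma> \<theta>))) (at \<theta>)"
    and S: "\<And>\<theta>. ((\<lambda>\<theta>. Svar \<eta> m \<theta> (r \<theta>)) has_real_derivative R1 \<eta> m (chart m \<theta> (r \<theta>) (\<sigma> \<theta>))) (at \<theta>)"
    and rad: "\<And>\<theta>. dV \<eta> (of_real (m * r \<theta>) * cis \<theta>) (of_real (m * r \<theta>) * cis \<theta>) \<noteq> 0"
    and ang: "\<And>\<theta>. angv \<eta> (chart m \<theta> (r \<theta>) (\<sigma> \<theta>)) \<noteq> 0"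
  shows "((\<lambda>\<theta>. chart m \<theta> (r \<theta>) (\<sigma> \<theta>)) has_vector_derivative
      (1 / angv \<eta> (chart m \<theta> (r \<theta>) (\<sigma> \<theta>))) *\<^sub>R F \<eta> (P + chart m \<theta> (r \<theta>) (\<sigma> \<theta>))) (at \<theta>)"
proof -
  define z where "z \<theta> = of_real (m * r \<theta>) * cis \<theta>" for \<theta>
  define u where "u \<theta> = chart m \<theta> (r \<theta>) (\<sigma> \<theta>)" for \<theta>
  have Zu: "Z (u \<theta>) = z \<theta>" "X (u \<theta>) = m^2 * \<sigma> \<theta>" for \<theta> by (simp_all add: u_def z_def)
  define z' where "z' = of_real (m * r' \<theta>) * cis \<theta> + of_real (m * r \<theta>) * (\<i> * cis \<theta>)"
  have zd: "(z has_vector_derivative z') (at \<theta>)"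
  proof -
    have "((\<lambda>\<theta>. of_real (m * r \<theta>)) has_vector_derivative (of_real (m * r' \<theta>) :: complex)) (at \<theta>)"
      by (rule bounded_linear.has_vector_derivative[OF bounded_linear_of_real])
        (auto intro!: derivative_eq_intros r simp: has_real_derivative_iff_has_vector_derivative[symmetric])
    from has_vector_derivative_mult[OF this cis_vector_derivative] show ?thesis
      unfolding z_def z'_def by (simp add: add.commute)
  qed
  have nz: "z \<theta> \<noteq> 0" using m r(2)[of \<theta>] by (simp add: z_def)
  have hd: "((\<lambda>\<theta>. h (z \<theta>)) has_real_derivative dh (z \<theta>) z') (at \<theta>)"
    by (rule has_derivative_along_curve[OF quad_form_has_derivative zd])
  define w' where "w' = dh (z \<theta>) z' + m^2 * R2 \<eta> m (u \<theta>)"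
  have wd: "((\<lambda>\<theta>. h (z \<theta>) + m^2 * \<sigma> \<theta>) has_vector_derivative w') (at \<theta>)"
    unfolding has_real_derivative_iff_has_vector_derivative[symmetric] w'_def
    by (rule DERIV_add[OF hd DERIV_cmult[OF \<sigma>[of \<theta>, folded u_def]]])
  have "((\<lambda>\<theta>. (z \<theta>, h (z \<theta>) + m^2 * \<sigma> \<theta>)) has_vector_derivative (z', w')) (at \<theta>)"
    by (rule has_vector_derivative_Pair[OF zd wd])
  from bounded_linear.has_vector_derivative[OF emb this]
  have ud: "(u has_vector_derivative emb z' w') (at \<theta>)"
    unfolding u_def chart_def z_def[symmetric] by simp
  define f where "f = F \<eta> (P + u \<theta>)"
  define \<Theta> where "\<Theta> = angv \<eta> (u \<theta>)"
  have \<Theta>: "\<Theta> \<noteq> 0" using ang[of \<theta>] by (simp add: \<Theta>_def u_def)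
  have "Z f / \<Theta> = z'"
  proof -
    \<comment> \<open>The velocity error in the critical plane. Both velocities have angular speed
      1, so it is a real multiple of the radius vector; both change \<open>V\<close> at the same
      rate, so this multiple is annihilated by \<open>dV\<close> and must vanish.\<close>
    define d where "d = z' - Z f / of_real \<Theta>"
    have "Im (z' / z \<theta>) = 1"
    proof -
      have "z' / z \<theta> = of_real (r' \<theta> / r \<theta>) + \<i>"
        unfolding z'_def z_def using m r(2)[of \<theta>] by (simp add: field_simps)
      then show ?thesis by simp
    qed
    moreover have "Im (Z f / of_real \<Theta> / z \<theta>) = Im (Z f / z \<theta>) / \<Theta>"
      by (metis Im_divide_of_real divide_divide_eq_left mult.commute)
    moreover have "Im (Z f / z \<theta>) = \<Theta>" by (simp add: \<Theta>_def angv_def f_def Zu)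
    ultimately have "Im (d / z \<theta>) = 0" using \<Theta> by (simp add: d_def diff_divide_distrib)
    then obtain t where "d / z \<theta> = of_real t" by (metis complex_is_Real_iff Reals_cases)
    then have t: "d = t *\<^sub>R z \<theta>" using nz by (simp add: field_simps scaleR_conv_of_real)
    have "((\<lambda>\<theta>. V \<eta> (z \<theta>)) has_real_derivative dV \<eta> (z \<theta>) z') (at \<theta>)"
      by (rule has_derivative_along_curve[OF V_has_derivative zd])
    moreover have "(\<lambda>\<theta>. V \<eta> (z \<theta>)) = (\<lambda>\<theta>. m^2 * Svar \<eta> m \<theta> (r \<theta>))"
      using m by (auto simp: Svar_def z_def)
    moreover have "((\<lambda>\<theta>. m^2 * Svar \<eta> m \<theta> (r \<theta>)) has_real_derivative m^2 * R1 \<eta> m (u \<theta>)) (at \<theta>)"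
      by (rule DERIV_cmult[OF S[of \<theta>, folded u_def]])
    ultimately have "dV \<eta> (z \<theta>) z' = m^2 * R1 \<eta> m (u \<theta>)" by (metis DERIV_unique)
    also have "\<dots> = dV \<eta> (z \<theta>) (Z f) / \<Theta>" using m by (simp add: R1_def Zu f_def \<Theta>_def)
    also have "\<dots> = dV \<eta> (z \<theta>) ((1 / \<Theta>) *\<^sub>R Z f)" by (simp add: linear_cmul[OF linear_dV])
    finally have "dV \<eta> (z \<theta>) d = 0"
      by (simp add: d_def linear_diff[OF linear_dV] scaleR_conv_of_real divide_inverse mult.commute of_real_inverse)
    then have "t * dV \<eta> (z \<theta>) (z \<theta>) = 0" unfolding t linear_cmul[OF linear_dV] by simp
    then have "t = 0" using rad[of \<theta>] by (simp add: z_def)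
    then show ?thesis using t by (simp add: d_def)
  qed
  then have zf: "z' = (1 / \<Theta>) *\<^sub>R Z f" by (simp add: scaleR_conv_of_real divide_inverse mult.commute of_real_inverse)
  have "w' = (1 / \<Theta>) *\<^sub>R W f"
    unfolding w'_def zf linear_cmul[OF linear_dh] using m \<Theta>
    by (simp add: R2_def Zu f_def[symmetric] \<Theta>_def[symmetric] field_simps)
  then have "emb z' w' = emb (Z ((1 / \<Theta>) *\<^sub>R f)) (W ((1 / \<Theta>) *\<^sub>R f))"
    by (simp add: zf linear_cmul[OF bounded_linear.linear[OF Z]] linear_cmul[OF bounded_linear.linear[OF W]])
  then show ?thesis using ud by (simp add: emb_ZW \<Theta>_def f_def u_def[abs_def])
qed

lemma Svar_implicit_derivative:
  assumes m: "0 < m" and y: "\<And>\<theta>. Svar \<eta> m \<theta> (r \<theta>) = y \<theta>" "(y has_real_derivative y') (at a)" and r: "isCont r a"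
    and rad: "dV \<eta> (of_real (m * r a) * cis a) (of_real (m * r a) * cis a) \<noteq> 0"
  shows "\<exists>r'. (r has_real_derivative r') (at a)"
proof -
  \<comment> \<open>The level is a polynomial in the radius, so its difference quotient has this
    closed form, which is defined at coinciding radii as well.\<close>
  define D where "D \<theta> x = a2 \<eta> \<theta> * (x + r a) + m * a3 \<theta> * (x^2 + x * r a + (r a)^2)
     + m^2 * a4 \<theta> * (x^3 + x^2 * r a + x * (r a)^2 + (r a)^3)" for \<theta> x
  have D: "Svar \<eta> m \<theta> x - Svar \<eta> m \<theta> (r a) = (x - r a) * D \<theta> x" for \<theta> x
    unfolding Svar_poly[OF m] D_def by (simp add: algebra_simps power2_eq_square power3_eq_cube power4_eq_xxxx)
  have cont: "isCont (a2 \<eta>) a" "isCont a3 a" "isCont a4 a"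
    unfolding a2_def[abs_def] a3_def[abs_def] a4_def[abs_def] cis_conv_exp by (intro continuous_intros; simp)+
  have "isCont (\<lambda>\<theta>. D \<theta> (r \<theta>)) a" unfolding D_def by (intro continuous_intros cont r)
  then have Dl: "((\<lambda>\<theta>. D \<theta> (r \<theta>)) \<longlongrightarrow> D a (r a)) (at a)" by (simp add: isCont_def)
  \<comment> \<open>At coinciding radii the quotient is the radial derivative of the level, and r
    times it is, up to \<open>m^2\<close>, the quantity assumed nonzero in
    \<open>rad\<close>.\<close>
  have "D a (r a) \<noteq> 0"
  proof -
    have "((\<lambda>x. of_real (m * x) * cis a) has_vector_derivative of_real m * cis a) (at (r a))"
      by (auto intro!: derivative_eq_intros simp: scaleR_conv_of_real has_vector_derivative_def)
    from has_derivative_along_curve[OF V_has_derivative this]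
    have "((\<lambda>x. V \<eta> (of_real (m * x) * cis a)) has_real_derivative dV \<eta> (of_real (m * r a) * cis a) (of_real m * cis a)) (at (r a))" .
    from DERIV_cdivide[OF this, of "m^2"]
    have "((\<lambda>x. Svar \<eta> m a x) has_real_derivative dV \<eta> (of_real (m * r a) * cis a) (of_real m * cis a) / m^2) (at (r a))"
      by (simp add: Svar_def)
    moreover have "((\<lambda>x. Svar \<eta> m a x) has_real_derivative D a (r a)) (at (r a))"
      unfolding has_field_derivative_iff
    proof (rule Lim_transform_eventually)
      have "isCont (\<lambda>x. D a x) (r a)" unfolding D_def by (intro continuous_intros)
      then show "((\<lambda>x. D a x) \<longlongrightarrow> D a (r a)) (at (r a))" by (simp add: isCont_def)
      show "\<forall>\<^sub>F x in at (r a). D a x = (Svar \<eta> m a x - Svar \<eta> m a (r a)) / (x - r a)"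
        unfolding D by (auto simp: eventually_at_filter)
    qed
    ultimately have "D a (r a) = dV \<eta> (of_real (m * r a) * cis a) (of_real m * cis a) / m^2"
      by (rule DERIV_unique[symmetric])
    moreover have "of_real (m * r a) * cis a = r a *\<^sub>R (of_real m * cis a)" by (simp add: scaleR_conv_of_real)
    then have "dV \<eta> (of_real (m * r a) * cis a) (of_real (m * r a) * cis a)
        = r a * dV \<eta> (of_real (m * r a) * cis a) (of_real m * cis a)"
      by (metis linear_cmul[OF linear_dV] real_scaleR_def)
    ultimately show ?thesis using rad m by auto
  qed
  have "((\<lambda>\<theta>. of_real (m * r a) * cis \<theta>) has_vector_derivative of_real (m * r a) * (\<i> * cis a)) (at a)"
    by (rule has_vector_derivative_mult_right[OF cis_vector_derivative])
  from DERIV_cdivide[OF has_derivative_along_curve[OF V_has_derivative[of \<eta>] this], of "m^2"]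
  have "((\<lambda>\<theta>. Svar \<eta> m \<theta> (r a)) has_real_derivative
      dV \<eta> (of_real (m * r a) * cis a) (of_real (m * r a) * (\<i> * cis a)) / m^2) (at a)"
    by (simp add: Svar_def)
  then show ?thesis
    using implicit_has_derivative[where S = "Svar \<eta> m" and r = r and y = y and a = a and D = D, OF y(1) y(2) _ D Dl \<open>D a (r a) \<noteq> 0\<close>]
    by blast
qed

end

section \<open>A periodic orbit in polar form and its stability\<close>

lemma half_neg: "2 * t * (- q / 2) = - (t * q)" for t q :: real
  by simp

text \<open>The weights 1/|k1| and 1/|k2| normalise both diagonal contributions to minus the squares
  of \<open>d1\<close> and \<open>d2\<close>. Each error is then at most a quarter of the larger
  square, and together they cost at most half of the sum. The sign \<open>\<tau>\<close> makes the
  first contribution negative whatever the sign of \<open>k1\<close>.\<close>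

lemma hyperbolic_rate:
  fixes k1 k2 \<tau> d1 d2 e1 e2 :: real
  assumes k: "k1 \<noteq> 0" "k2 < 0" "\<tau> = - sgn k1"
    and e: "\<bar>e1\<bar> \<le> \<bar>k1\<bar> / 4 * max \<bar>d1\<bar> \<bar>d2\<bar>" "\<bar>e2\<bar> \<le> \<bar>k2\<bar> / 4 * max \<bar>d1\<bar> \<bar>d2\<bar>"
  shows "\<tau> * d1 * (k1 * d1 + e1) / \<bar>k1\<bar> + d2 * (k2 * d2 + e2) / \<bar>k2\<bar> \<le> - (d1^2 + d2^2) / 2"
proof -
  define M where "M = max \<bar>d1\<bar> \<bar>d2\<bar>"
  have M: "\<bar>d1\<bar> \<le> M" "\<bar>d2\<bar> \<le> M" "M^2 \<le> d1^2 + d2^2" by (auto simp: M_def max_def)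
  have quot: "x / a \<le> M / 4" if "x \<le> a / 4 * M" "0 < a" for x a
    using that by (simp add: pos_divide_le_eq mult.commute)
  have t: "\<tau> * k1 = - \<bar>k1\<bar>" unfolding k(3) by (simp add: abs_sgn mult.commute)
  have "\<tau> * d1 * (k1 * d1 + e1) = (\<tau> * k1) * d1\<^sup>2 + \<tau> * d1 * e1" by (simp add: algebra_simps power2_eq_square)
  then have "\<tau> * d1 * (k1 * d1 + e1) / \<bar>k1\<bar> = \<tau> * d1 * (e1 / \<bar>k1\<bar>) - d1\<^sup>2"
    unfolding t using k(1) by (simp add: add_divide_distrib diff_divide_distrib)
  moreover have "\<tau> * d1 * (e1 / \<bar>k1\<bar>) \<le> M * (M / 4)"
  proof -
    have "\<tau> * d1 * (e1 / \<bar>k1\<bar>) \<le> \<bar>\<tau> * d1 * (e1 / \<bar>k1\<bar>)\<bar>" by (rule abs_ge_self)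
    also have "\<dots> = \<bar>d1\<bar> * (\<bar>e1\<bar> / \<bar>k1\<bar>)" using k by (simp add: abs_mult abs_sgn_eq)
    also have "\<dots> \<le> M * (M / 4)"
    proof (intro mult_mono M)
      show "\<bar>e1\<bar> / \<bar>k1\<bar> \<le> M / 4"
        using quot[OF e(1)[folded M_def]] k(1) by simp
    qed (use M in auto)
    finally show ?thesis .
  qed
  moreover have "d2 * (k2 * d2 + e2) / \<bar>k2\<bar> = d2 * (e2 / \<bar>k2\<bar>) - d2\<^sup>2"
    using k(2) by (simp add: field_simps power2_eq_square)
  moreover have "d2 * (e2 / \<bar>k2\<bar>) \<le> M * (M / 4)"
  proof -
    have "d2 * (e2 / \<bar>k2\<bar>) \<le> \<bar>d2 * (e2 / \<bar>k2\<bar>)\<bar>" by (rule abs_ge_self)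
    also have "\<dots> = \<bar>d2\<bar> * (\<bar>e2\<bar> / \<bar>k2\<bar>)" by (simp add: abs_mult)
    also have "\<dots> \<le> M * (M / 4)"
    proof (intro mult_mono M)
      show "\<bar>e2\<bar> / \<bar>k2\<bar> \<le> M / 4"
        using quot[OF e(2)[folded M_def]] k(2) by simp
    qed (use M in auto)
    finally show ?thesis .
  qed
  moreover have "M * (M / 4) * 2 \<le> (d1^2 + d2^2) / 2" using M(3) by (simp add: power2_eq_square)
  ultimately show ?thesis by simp
qed

context hopf_form
begin

text \<open>Isolates the dynamics from the rescaling: all smallness sits in the hypotheses, with the
  rates \<open>\<kappa>1\<close> and \<open>\<kappa>2\<close> as units. The unknowns are the
  deviation of the level from \<open>S0\<close> and the transverse coordinate stretched by
  \<open>K\<close>. The same Lipschitz bounds serve twice, for the contraction that yields the orbit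
  and for the Lyapunov function around it.\<close>

lemma polar_orbit:
  fixes \<eta> m ra rb S0 \<rho> K \<kappa>1 \<kappa>2 c R :: real
  assumes m: "0 < m" and ra: "0 < ra" and \<rho>: "0 < \<rho>" and K: "0 < K" and \<kappa>: "\<kappa>1 \<noteq> 0" "\<kappa>2 < 0" and c: "0 < c"
   and small: "\<And>\<theta> r \<sigma>. r \<in> {ra..rb} \<Longrightarrow> \<bar>K * \<sigma>\<bar> \<le> \<rho> \<Longrightarrow> norm (chart m \<theta> r \<sigma>) < R" and R: "R \<le> 1"
   and ang: "\<And>\<theta> r \<sigma>. r \<in> {ra..rb} \<Longrightarrow> \<bar>K * \<sigma>\<bar> \<le> \<rho> \<Longrightarrow> \<omega> / 2 \<le> angv \<eta> (chart m \<theta> r \<sigma>) \<and> angv \<eta> (chart m \<theta> r \<sigma>) \<le> 2 * \<omega>"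
   and ends: "\<And>\<theta>. Svar \<eta> m \<theta> ra < S0 - \<rho>" "\<And>\<theta>. S0 + \<rho> < Svar \<eta> m \<theta> rb" and rab: "ra \<le> rb"
   and inj: "\<And>\<theta> r r'. r \<in> {ra..rb} \<Longrightarrow> r' \<in> {ra..rb} \<Longrightarrow> c * \<bar>r - r'\<bar> \<le> \<bar>Svar \<eta> m \<theta> r - Svar \<eta> m \<theta> r'\<bar>"
   and rad: "\<And>\<theta> r. r \<in> {ra..rb} \<Longrightarrow> 0 < dV \<eta> (of_real (m * r) * cis \<theta>) (of_real (m * r) * cis \<theta>)"
   and lip1: "\<And>\<theta> r r' \<sigma> \<sigma>'. \<lbrakk>r \<in> {ra..rb}; r' \<in> {ra..rb}; \<bar>Svar \<eta> m \<theta> r - S0\<bar> \<le> \<rho>; \<bar>Svar \<eta> m \<theta> r' - S0\<bar> \<le> \<rho>;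
       \<bar>K * \<sigma>\<bar> \<le> \<rho>; \<bar>K * \<sigma>'\<bar> \<le> \<rho>\<rbrakk> \<Longrightarrow>
       \<bar>(R1 \<eta> m (chart m \<theta> r \<sigma>) - \<kappa>1 * (Svar \<eta> m \<theta> r - S0)) - (R1 \<eta> m (chart m \<theta> r' \<sigma>') - \<kappa>1 * (Svar \<eta> m \<theta> r' - S0))\<bar>
         \<le> \<bar>\<kappa>1\<bar> / 4 * max \<bar>Svar \<eta> m \<theta> r - Svar \<eta> m \<theta> r'\<bar> \<bar>K * \<sigma> - K * \<sigma>'\<bar>"
   and lip2: "\<And>\<theta> r r' \<sigma> \<sigma>'. \<lbrakk>r \<in> {ra..rb}; r' \<in> {ra..rb}; \<bar>Svar \<eta> m \<theta> r - S0\<bar> \<le> \<rho>; \<bar>Svar \<eta> m \<theta> r' - S0\<bar> \<le> \<rho>;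
       \<bar>K * \<sigma>\<bar> \<le> \<rho>; \<bar>K * \<sigma>'\<bar> \<le> \<rho>\<rbrakk> \<Longrightarrow>
       \<bar>(K * R2 \<eta> m (chart m \<theta> r \<sigma>) - \<kappa>2 * (K * \<sigma>)) - (K * R2 \<eta> m (chart m \<theta> r' \<sigma>') - \<kappa>2 * (K * \<sigma>'))\<bar>
         \<le> \<bar>\<kappa>2\<bar> / 4 * max \<bar>Svar \<eta> m \<theta> r - Svar \<eta> m \<theta> r'\<bar> \<bar>K * \<sigma> - K * \<sigma>'\<bar>"
   and z1: "\<And>\<theta> r. r \<in> {ra..rb} \<Longrightarrow> Svar \<eta> m \<theta> r = S0 \<Longrightarrow> \<bar>R1 \<eta> m (chart m \<theta> r 0)\<bar> \<le> \<bar>\<kappa>1\<bar> * (3/4 * (\<rho>/2))"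
   and z2: "\<And>\<theta> r. r \<in> {ra..rb} \<Longrightarrow> Svar \<eta> m \<theta> r = S0 \<Longrightarrow> \<bar>K * R2 \<eta> m (chart m \<theta> r 0)\<bar> \<le> \<bar>\<kappa>2\<bar> * (3/4 * (\<rho>/2))"
  obtains \<gamma> where "periodic_solution (F \<eta>) \<gamma>" "range \<gamma> \<subseteq> ball P R"
    "\<kappa>1 < 0 \<Longrightarrow> orbit_asym_stable (F \<eta>) (range \<gamma>)" "0 < \<kappa>1 \<Longrightarrow> \<not> orbit_stable (F \<eta>) (range \<gamma>)"
proof -
  define T where "T = {u. norm u \<le> 1 \<and> Z u \<noteq> 0 \<and> angv \<eta> u \<noteq> 0}"
  have inT: "chart m \<theta> r \<sigma> \<in> T" if "r \<in> {ra..rb}" "\<bar>K * \<sigma>\<bar> \<le> \<rho>" for \<theta> r \<sigma>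
    using small[OF that, of \<theta>] ang[OF that, of \<theta>] that m ra R \<omega> by (auto simp: T_def)
  have contT: "continuous_on T (angv \<eta>)" "continuous_on T (R1 \<eta> m)" "continuous_on T (R2 \<eta> m)"
    by (rule rates_continuous[OF _ m]; simp add: T_def)+
  have Scont: "continuous_on A (\<lambda>x. Svar \<eta> m (t x) (r x))" if "continuous_on A t" "continuous_on A r"
    for A :: "'b::topological_space set" and t r
    unfolding Svar_poly[OF m] a2_def a3_def a4_def cis_conv_exp by (intro continuous_intros that)
  \<comment> \<open>The radius as a function of angle and level deviation. Existence comes from the
    end values, uniqueness from \<open>inj\<close>; the open interval is what later places the orbit
    inside the open set \<open>N\<close>.\<close>
  define rh where "rh \<theta> a = (SOME r. r \<in> {ra<..<rb} \<and> Svar \<eta> m \<theta> r = S0 + a)" for \<theta> a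
  have rh: "rh \<theta> a \<in> {ra<..<rb}" "Svar \<eta> m \<theta> (rh \<theta> a) = S0 + a" if a: "\<bar>a\<bar> \<le> \<rho>" for \<theta> a
  proof -
    have "continuous_on {ra..rb} (\<lambda>r. Svar \<eta> m \<theta> r)" by (intro Scont continuous_intros)
    then obtain r where r: "ra \<le> r" "r \<le> rb" "Svar \<eta> m \<theta> r = S0 + a"
      using IVT'[of "Svar \<eta> m \<theta>" ra "S0 + a" rb] ends[of \<theta>] a rab by (force simp: abs_le_iff)
    moreover have "r \<noteq> ra" "r \<noteq> rb" using r(3) ends[of \<theta>] a by (auto simp: abs_le_iff)
    ultimately have "r \<in> {ra<..<rb} \<and> Svar \<eta> m \<theta> r = S0 + a" by auto
    then have "rh \<theta> a \<in> {ra<..<rb} \<and> Svar \<eta> m \<theta> (rh \<theta> a) = S0 + a" unfolding rh_def by (rule someI)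
    then show "rh \<theta> a \<in> {ra<..<rb}" "Svar \<eta> m \<theta> (rh \<theta> a) = S0 + a" by auto
  qed
  have rh': "rh \<theta> a \<in> {ra..rb}" if "\<bar>a\<bar> \<le> \<rho>" for \<theta> a using rh(1)[OF that, of \<theta>] by auto
  have rh_per: "rh (\<theta> + 2 * pi) a = rh \<theta> a" for \<theta> a unfolding rh_def Svar_periodic ..
  have rh_uniq: "r = rh \<theta> a" if "r \<in> {ra..rb}" "Svar \<eta> m \<theta> r = S0 + a" "\<bar>a\<bar> \<le> \<rho>" for r \<theta> a
    using inj[where \<theta> = \<theta>, OF that(1) rh'[OF that(3), of \<theta>]] that(2) rh(2)[OF that(3), of \<theta>] c
    by (simp add: mult_le_0_iff)
  \<comment> \<open>\<open>inj\<close> bounds a change of radius by a change of level, and that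
    change splits into the variation of \<open>y\<close> and the variation of \<open>Svar\<close>
    with the angle at frozen radius.\<close>
  have rh_cont: "continuous_on UNIV (\<lambda>\<theta>. rh \<theta> (y \<theta>))" if y: "continuous_on UNIV y" "\<And>\<theta>. \<bar>y \<theta>\<bar> \<le> \<rho>" for y
    unfolding continuous_on_def
  proof
    fix \<theta>0 :: real
    have t: "((\<lambda>\<theta>. (\<bar>y \<theta> - y \<theta>0\<bar> + \<bar>Svar \<eta> m \<theta>0 (rh \<theta>0 (y \<theta>0)) - Svar \<eta> m \<theta> (rh \<theta>0 (y \<theta>0))\<bar>) / c) \<longlongrightarrow>
        (\<bar>y \<theta>0 - y \<theta>0\<bar> + \<bar>Svar \<eta> m \<theta>0 (rh \<theta>0 (y \<theta>0)) - Svar \<eta> m \<theta>0 (rh \<theta>0 (y \<theta>0))\<bar>) / c) (at \<theta>0)"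
    proof (intro tendsto_intros)
      show "(y \<longlongrightarrow> y \<theta>0) (at \<theta>0)" using y(1) by (simp add: continuous_on_def)
      show "((\<lambda>\<theta>. Svar \<eta> m \<theta> (rh \<theta>0 (y \<theta>0))) \<longlongrightarrow> Svar \<eta> m \<theta>0 (rh \<theta>0 (y \<theta>0))) (at \<theta>0)"
        using Scont[of UNIV "\<lambda>\<theta>. \<theta>" "\<lambda>\<theta>. rh \<theta>0 (y \<theta>0)"] by (simp add: continuous_on_def)
    qed (use c in auto)
    have b: "norm (rh \<theta> (y \<theta>) - rh \<theta>0 (y \<theta>0)) \<le> (\<bar>y \<theta> - y \<theta>0\<bar> + \<bar>Svar \<eta> m \<theta>0 (rh \<theta>0 (y \<theta>0)) - Svar \<eta> m \<theta> (rh \<theta>0 (y \<theta>0))\<bar>) / c" for \<theta>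
    proof -
      have "c * \<bar>rh \<theta> (y \<theta>) - rh \<theta>0 (y \<theta>0)\<bar> \<le> \<bar>Svar \<eta> m \<theta> (rh \<theta> (y \<theta>)) - Svar \<eta> m \<theta> (rh \<theta>0 (y \<theta>0))\<bar>"
        by (intro inj rh' y)
      also have "\<dots> \<le> \<bar>y \<theta> - y \<theta>0\<bar> + \<bar>Svar \<eta> m \<theta>0 (rh \<theta>0 (y \<theta>0)) - Svar \<eta> m \<theta> (rh \<theta>0 (y \<theta>0))\<bar>"
        unfolding rh(2)[OF y(2)] by simp
      finally show ?thesis using c by (simp add: field_simps)
    qed
    have "((\<lambda>\<theta>. rh \<theta> (y \<theta>) - rh \<theta>0 (y \<theta>0)) \<longlongrightarrow> 0) (at \<theta>0)"
      by (rule Lim_null_comparison[OF always_eventually[rule_format, OF b]]) (use t in simp)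
    then show "((\<lambda>\<theta>. rh \<theta> (y \<theta>)) \<longlongrightarrow> rh \<theta>0 (y \<theta>0)) (at \<theta>0 within UNIV)" by (simp add: LIM_zero_iff)
  qed
  define F1 where "F1 \<theta> a b = R1 \<eta> m (chart m \<theta> (rh \<theta> a) (b / K)) - \<kappa>1 * a" for \<theta> a b
  define F2 where "F2 \<theta> a b = K * R2 \<eta> m (chart m \<theta> (rh \<theta> a) (b / K)) - \<kappa>2 * b" for \<theta> a b
  have Kb: "K * (b / K) = b" for b using K by simp
  have half: "\<bar>a\<bar> \<le> \<rho> / 2 \<Longrightarrow> \<bar>a\<bar> \<le> \<rho>" for a using \<rho> by simp
  have cont_chart: "continuous_on UNIV (\<lambda>\<theta>. chart m \<theta> (rh \<theta> (y \<theta>)) (b \<theta> / K))"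
    if "continuous_on UNIV y" "\<And>\<theta>. \<bar>y \<theta>\<bar> \<le> \<rho>" "continuous_on UNIV b" for y b
    using K by (intro chart_continuous rh_cont continuous_intros that) auto
  have comp: "continuous_on UNIV (\<lambda>\<theta>. G (chart m \<theta> (rh \<theta> (y \<theta>)) (b \<theta> / K)))"
    if "continuous_on T G" "continuous_on UNIV y" "\<And>\<theta>. \<bar>y \<theta>\<bar> \<le> \<rho>" "continuous_on UNIV b" "\<And>\<theta>. \<bar>b \<theta>\<bar> \<le> \<rho>" for y b and G :: "real^'n \<Rightarrow> real"
    by (rule continuous_on_compose2[OF that(1) cont_chart[OF that(2-4)]])
      (use inT[OF rh'] that Kb in auto)
  \<comment> \<open>Solved with half of the admissible range, so that the orbit keeps a margin
    inside \<open>N\<close>, whose points may deviate by less than \<open>\<rho>\<close>.\<close>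
  obtain y1 y2 where y:
    "\<And>\<theta>. (y1 has_real_derivative \<kappa>1 * y1 \<theta> + F1 \<theta> (y1 \<theta>) (y2 \<theta>)) (at \<theta>)"
    "\<And>\<theta>. (y2 has_real_derivative \<kappa>2 * y2 \<theta> + F2 \<theta> (y1 \<theta>) (y2 \<theta>)) (at \<theta>)"
    "\<And>\<theta>. y1 (\<theta> + 2 * pi) = y1 \<theta>" "\<And>\<theta>. y2 (\<theta> + 2 * pi) = y2 \<theta>" "\<And>\<theta>. \<bar>y1 \<theta>\<bar> \<le> \<rho> / 2" "\<And>\<theta>. \<bar>y2 \<theta>\<bar> \<le> \<rho> / 2"
  proof (rule periodic_hyperbolic_solution[of \<kappa>1 \<kappa>2 "2 * pi" "\<rho> / 2" F1 F2])
    show "F1 (\<theta> + 2 * pi) a b = F1 \<theta> a b" "F2 (\<theta> + 2 * pi) a b = F2 \<theta> a b" for \<theta> a b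
      by (simp_all add: F1_def F2_def rh_per chart_periodic)
    show "continuous_on UNIV (\<lambda>\<theta>. F1 \<theta> a b)" "continuous_on UNIV (\<lambda>\<theta>. F2 \<theta> a b)" if "\<bar>a\<bar> \<le> \<rho> / 2" "\<bar>b\<bar> \<le> \<rho> / 2" for a b
      unfolding F1_def F2_def
      using comp[OF contT(2), of "\<lambda>_. a" "\<lambda>_. b"] comp[OF contT(3), of "\<lambda>_. a" "\<lambda>_. b"] half[OF that(1)] half[OF that(2)]
      by (auto intro!: continuous_intros)
    show "\<bar>F1 \<theta> a b - F1 \<theta> a' b'\<bar> \<le> \<bar>\<kappa>1\<bar> / 4 * max \<bar>a - a'\<bar> \<bar>b - b'\<bar>"
      if "\<bar>a\<bar> \<le> \<rho> / 2" "\<bar>b\<bar> \<le> \<rho> / 2" "\<bar>a'\<bar> \<le> \<rho> / 2" "\<bar>b'\<bar> \<le> \<rho> / 2" for \<theta> a b a' b'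
      using lip1[OF rh'[OF half[OF that(1)], of \<theta>] rh'[OF half[OF that(3)], of \<theta>], where \<theta> = \<theta> and \<sigma> = "b / K" and \<sigma>' = "b' / K"]
        half[OF that(1)] half[OF that(2)] half[OF that(3)] half[OF that(4)]
      unfolding Kb rh(2)[OF half[OF that(1)]] rh(2)[OF half[OF that(3)]] by (simp add: F1_def)
    show "\<bar>F2 \<theta> a b - F2 \<theta> a' b'\<bar> \<le> \<bar>\<kappa>2\<bar> / 4 * max \<bar>a - a'\<bar> \<bar>b - b'\<bar>"
      if "\<bar>a\<bar> \<le> \<rho> / 2" "\<bar>b\<bar> \<le> \<rho> / 2" "\<bar>a'\<bar> \<le> \<rho> / 2" "\<bar>b'\<bar> \<le> \<rho> / 2" for \<theta> a b a' b'
      using lip2[OF rh'[OF half[OF that(1)], of \<theta>] rh'[OF half[OF that(3)], of \<theta>], where \<theta> = \<theta> and \<sigma> = "b / K" and \<sigma>' = "b' / K"]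
        half[OF that(1)] half[OF that(2)] half[OF that(3)] half[OF that(4)]
      unfolding Kb rh(2)[OF half[OF that(1)]] rh(2)[OF half[OF that(3)]] by (simp add: F2_def)
    have 0: "\<bar>0\<bar> \<le> \<rho>" using \<rho> by simp
    show "\<bar>F1 \<theta> 0 0\<bar> \<le> \<bar>\<kappa>1\<bar> * (3 / 4 * (\<rho> / 2))" "\<bar>F2 \<theta> 0 0\<bar> \<le> \<bar>\<kappa>2\<bar> * (3 / 4 * (\<rho> / 2))" for \<theta>
      using z1[OF rh'[OF 0], of \<theta> \<theta>] z2[OF rh'[OF 0], of \<theta> \<theta>] rh(2)[OF 0, of \<theta>] by (simp_all add: F1_def F2_def)
  qed (use \<kappa> \<rho> in auto)
  have yr: "\<bar>y1 \<theta>\<bar> \<le> \<rho>" "\<bar>y2 \<theta>\<bar> \<le> \<rho>" for \<theta> using half y(5,6) by auto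
  have ycont: "continuous_on UNIV y1" "continuous_on UNIV y2"
    using y(1,2) by (auto intro!: continuous_at_imp_continuous_on DERIV_isCont)
  define r where "r \<theta> = rh \<theta> (y1 \<theta>)" for \<theta>
  define u where "u \<theta> = chart m \<theta> (r \<theta>) (y2 \<theta> / K)" for \<theta>
  have rb: "r \<theta> \<in> {ra..rb}" "r \<theta> \<in> {ra<..<rb}" "Svar \<eta> m \<theta> (r \<theta>) = S0 + y1 \<theta>" for \<theta>
    unfolding r_def using rh' rh yr by auto
  have y1d: "(y1 has_real_derivative R1 \<eta> m (u \<theta>)) (at \<theta>)" and y2d: "(y2 has_real_derivative K * R2 \<eta> m (u \<theta>)) (at \<theta>)" for \<theta>
    using y(1,2)[of \<theta>] by (simp_all add: F1_def F2_def r_def u_def)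
  have rc: "continuous_on UNIV r" unfolding r_def by (rule rh_cont[OF ycont(1) yr(1)])
  have Syd: "((\<lambda>\<theta>. S0 + y1 \<theta>) has_real_derivative R1 \<eta> m (u \<theta>)) (at \<theta>)" for \<theta>
    using DERIV_add[OF DERIV_const[of S0] y1d[of \<theta>]] by simp
  \<comment> \<open>So far the radius is only continuous, being recovered from the level; its
    differentiability is needed before the curve can be compared with the flow.\<close>
  have "\<exists>r'. (r has_real_derivative r') (at \<theta>)" for \<theta>
  proof (rule Svar_implicit_derivative[OF m _ Syd])
    show "Svar \<eta> m \<theta> (r \<theta>) = S0 + y1 \<theta>" for \<theta> by (rule rb(3))
    show "isCont r \<theta>" using rc by (simp add: continuous_on_eq_continuous_at)
    show "dV \<eta> (of_real (m * r \<theta>) * cis \<theta>) (of_real (m * r \<theta>) * cis \<theta>) \<noteq> 0" using rad[OF rb(1), of \<theta> \<theta>] by simp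
  qed
  then obtain r' where r': "\<And>\<theta>. (r has_real_derivative r' \<theta>) (at \<theta>)" by metis
  have ud: "(u has_vector_derivative (1 / angv \<eta> (u \<theta>)) *\<^sub>R F \<eta> (P + u \<theta>)) (at \<theta>)" for \<theta>
    unfolding u_def
  proof (rule chart_curve_solves[OF m r'])
    show "0 < r \<theta>" for \<theta> using rb(1)[of \<theta>] ra by simp
    show "((\<lambda>\<theta>. y2 \<theta> / K) has_real_derivative R2 \<eta> m (chart m \<theta> (r \<theta>) (y2 \<theta> / K))) (at \<theta>)" for \<theta>
      using DERIV_cdivide[OF y2d[of \<theta>], of K] K by (simp add: u_def)
    show "((\<lambda>\<theta>. Svar \<eta> m \<theta> (r \<theta>)) has_real_derivative R1 \<eta> m (chart m \<theta> (r \<theta>) (y2 \<theta> / K))) (at \<theta>)" for \<theta>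
      using Syd[of \<theta>] unfolding rb(3) by (simp add: u_def)
    show "dV \<eta> (of_real (m * r \<theta>) * cis \<theta>) (of_real (m * r \<theta>) * cis \<theta>) \<noteq> 0" for \<theta> using rad[OF rb(1), of \<theta> \<theta>] by simp
    show "angv \<eta> (chart m \<theta> (r \<theta>) (y2 \<theta> / K)) \<noteq> 0" for \<theta>
      using ang[OF rb(1), of "y2 \<theta> / K" \<theta> \<theta>] yr(2)[of \<theta>] \<omega> Kb by auto
  qed
  have uT: "u \<theta> \<in> T" for \<theta> unfolding u_def using inT[OF rb(1)] yr(2) Kb by simp
  have u_per: "u (\<theta> + 2 * pi) = u \<theta>" for \<theta>
    by (simp add: u_def r_def rh_per y chart_periodic)
  have uc: "continuous_on UNIV u"
    using ud by (meson continuous_at_imp_continuous_on has_vector_derivative_continuous)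
  have uR: "norm (u \<theta>) < R" for \<theta> unfolding u_def using small[OF rb(1)] yr(2) Kb by simp
  have Zu: "Z (u \<theta>) = of_real (m * r \<theta>) * cis \<theta>" "X (u \<theta>) = m^2 * (y2 \<theta> / K)" for \<theta> by (simp_all add: u_def)
  obtain \<gamma> where \<gamma>: "periodic_solution (F \<eta>) \<gamma>" "range \<gamma> = range (\<lambda>\<theta>. P + u \<theta>)"
  proof (rule periodic_solution_from_angle[of "\<lambda>\<theta>. P + u \<theta>" "\<lambda>\<theta>. angv \<eta> (u \<theta>)" "F \<eta>" "2 * pi" "\<omega> / 2" "2 * \<omega>" 0 pi])
    show "((\<lambda>\<theta>. P + u \<theta>) has_vector_derivative (1 / angv \<eta> (u \<theta>)) *\<^sub>R F \<eta> (P + u \<theta>)) (at \<theta>)" for \<theta>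
      using ud[of \<theta>] by (auto intro!: derivative_eq_intros)
    show "continuous_on UNIV (\<lambda>\<theta>. angv \<eta> (u \<theta>))"
      by (rule continuous_on_compose2[OF contT(1) uc]) (use uT in auto)
    show "\<omega> / 2 \<le> angv \<eta> (u \<theta>)" "angv \<eta> (u \<theta>) \<le> 2 * \<omega>" for \<theta>
      unfolding u_def using ang[OF rb(1)] yr(2) Kb by auto
    have "Re (Z (u 0)) \<noteq> Re (Z (u pi))"
    proof -
      have "0 < m * r 0" "0 < m * r pi" using rb(1)[of 0] rb(1)[of pi] m ra by auto
      then show ?thesis by (simp add: Zu)
    qed
    then show "P + u 0 \<noteq> P + u pi" by auto
  qed (use u_per \<omega> in auto)
  define Orb where "Orb = range (\<lambda>\<theta>. P + u \<theta>)"
  define q1 where "q1 x = V \<eta> (Z (x - P)) / m^2 - S0" for x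
  define q2 where "q2 x = K * (X (x - P) / m^2)" for x
  \<comment> \<open>The periodic solution evaluated at the angle of \<open>x\<close>. A point is
    thus compared with the orbit point at the same angle, which removes the neutral direction along
    the orbit.\<close>
  define Y1 where "Y1 x = y1 (Arg (Z (x - P)))" for x
  define Y2 where "Y2 x = y2 (Arg (Z (x - P)))" for x
  define N where "N = {x. ra < norm (Z (x - P)) / m \<and> norm (Z (x - P)) / m < rb \<and> \<bar>q1 x\<bar> < \<rho> \<and> \<bar>q2 x\<bar> < \<rho>}"
  define \<tau> where "\<tau> = - sgn \<kappa>1"
  \<comment> \<open>For \<open>\<kappa>1 < 0\<close> this is positive definite in the two
    deviations; for \<open>\<kappa>1 > 0\<close> the sign \<open>\<tau>\<close> makes it indefinite.
    Its derivative is negative in both cases.\<close>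
  define U where "U x = \<tau> * (q1 x - Y1 x)^2 / \<bar>\<kappa>1\<bar> + (q2 x - Y2 x)^2 / \<bar>\<kappa>2\<bar>" for x
  define \<phi> where "\<phi> x = \<omega> / 2 * ((q1 x - Y1 x)^2 + (q2 x - Y2 x)^2)" for x
  have q1c: "continuous_on A q1" for A
    unfolding q1_def[abs_def] by (intro continuous_intros continuous_on_compose2[OF V_continuous Z_continuous]) (use m in auto)
  have q2c: "continuous_on A q2" for A
    unfolding q2_def[abs_def] by (intro continuous_intros X_continuous) (use m in auto)
  have Nopen: "open N"
    unfolding N_def by (intro open_Collect_conj open_Collect_less continuous_intros q1c q2c Z_continuous) (use m in auto)
  have Nz: "Z (x - P) \<noteq> 0" if "x \<in> N" for x using that ra m by (auto simp: N_def)
  have coords: "x - P = chart m (Arg (Z (x - P))) (norm (Z (x - P)) / m) (q2 x / K)"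
      "Svar \<eta> m (Arg (Z (x - P))) (norm (Z (x - P)) / m) = S0 + q1 x" for x
  proof -
    show "x - P = chart m (Arg (Z (x - P))) (norm (Z (x - P)) / m) (q2 x / K)"
      using chart_of_coords[OF m, of "x - P"] K by (simp add: q2_def)
    have "of_real (m * (norm (Z (x - P)) / m)) * cis (Arg (Z (x - P))) = Z (x - P)"
      using m by (cases "Z (x - P) = 0") (simp_all add: cis_Arg sgn_eq)
    then show "Svar \<eta> m (Arg (Z (x - P))) (norm (Z (x - P)) / m) = S0 + q1 x" by (simp add: Svar_def q1_def)
  qed
  have ArgO: "y1 (Arg (Z (u \<theta>))) = y1 \<theta>" "y2 (Arg (Z (u \<theta>))) = y2 \<theta>" for \<theta>
  proof -
    have pos: "0 < m * r \<theta>" "m \<noteq> 0" "r \<theta> \<noteq> 0" using rb(1)[of \<theta>] m ra by auto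
    then have "Z (u \<theta>) \<noteq> 0" "norm (Z (u \<theta>)) = m * r \<theta>" by (simp_all add: Zu norm_mult del: of_real_mult)
    then have "cis (Arg (Z (u \<theta>))) = Z (u \<theta>) / of_real (m * r \<theta>)" by (simp add: cis_Arg sgn_eq)
    also have "\<dots> = cis \<theta>" unfolding Zu using pos by simp
    finally have c: "cis (Arg (Z (u \<theta>))) = cis \<theta>" .
    show "y1 (Arg (Z (u \<theta>))) = y1 \<theta>" by (rule periodic_cis_eq[of y1, OF y(3) c])
    show "y2 (Arg (Z (u \<theta>))) = y2 \<theta>" by (rule periodic_cis_eq[of y2, OF y(4) c])
  qed
  have qO: "q1 (P + u \<theta>) = y1 \<theta>" "q2 (P + u \<theta>) = y2 \<theta>" for \<theta>
    using m K rb(3)[of \<theta>] by (simp_all add: q1_def q2_def Zu Svar_def)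
  have YO: "Y1 (P + u \<theta>) = y1 \<theta>" "Y2 (P + u \<theta>) = y2 \<theta>" for \<theta>
    by (simp_all add: Y1_def Y2_def ArgO)
  have ON: "Orb \<subseteq> N"
  proof -
    have "P + u \<theta> \<in> N" for \<theta>
    proof -
      have "norm (Z (u \<theta>)) / m = r \<theta>" using rb(1)[of \<theta>] m ra by (simp add: Zu norm_mult)
      moreover have "\<bar>y1 \<theta>\<bar> < \<rho>" "\<bar>y2 \<theta>\<bar> < \<rho>" using y(5,6)[of \<theta>] \<rho> by linarith+
      ultimately show ?thesis using rb(2)[of \<theta>] by (simp add: N_def qO)
    qed
    then show ?thesis by (auto simp: Orb_def)
  qed
  have NO: "x \<in> Orb" if x: "x \<in> N" "q1 x = Y1 x" "q2 x = Y2 x" for x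
  proof -
    define \<alpha> where "\<alpha> = Arg (Z (x - P))"
    have "norm (Z (x - P)) / m \<in> {ra..rb}" using x(1) by (auto simp: N_def)
    moreover have "Svar \<eta> m \<alpha> (norm (Z (x - P)) / m) = S0 + y1 \<alpha>"
      unfolding \<alpha>_def coords(2) using x(2) by (simp add: Y1_def)
    ultimately have "norm (Z (x - P)) / m = r \<alpha>" unfolding r_def using yr by (intro rh_uniq)
    then have "x - P = u \<alpha>" using coords(1)[of x] x(3) by (simp add: u_def \<alpha>_def[symmetric] Y2_def)
    then have "x = P + u \<alpha>" by (simp add: algebra_simps)
    then show ?thesis by (auto simp: Orb_def)
  qed
  have Yc: "continuous_on N Y1" "continuous_on N Y2"
  proof -
    have "isCont (\<lambda>w. y1 (Arg w)) z" "isCont (\<lambda>w. y2 (Arg w)) z" if "z \<noteq> 0" for z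
      using that y1d y2d by (auto intro!: periodic_Arg_isCont y DERIV_isCont)
    then have "continuous_on (- {0}) (\<lambda>w. y1 (Arg w))" "continuous_on (- {0}) (\<lambda>w. y2 (Arg w))"
      by (auto intro!: continuous_at_imp_continuous_on)
    then show "continuous_on N Y1" "continuous_on N Y2"
      unfolding Y1_def[abs_def] Y2_def[abs_def]
      using Nz by (auto intro!: continuous_on_compose2[OF _ Z_continuous])
  qed
  have compOrb: "compact Orb"
  proof -
    have "Orb = (\<lambda>\<theta>. P + u \<theta>) ` {0..2 * pi}"
    proof
      show "Orb \<subseteq> (\<lambda>\<theta>. P + u \<theta>) ` {0..2 * pi}"
      proof
        fix x assume "x \<in> Orb"
        then obtain \<theta> where x: "x = P + u \<theta>" by (auto simp: Orb_def)
        define k where "k = \<lfloor>\<theta> / (2 * pi)\<rfloor>"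
        have "u (\<theta> + of_int (- k) * (2 * pi)) = u \<theta>" by (rule periodic_int_multiple[of u, OF u_per])
        moreover have "\<theta> + of_int (- k) * (2 * pi) \<in> {0..2 * pi}"
        proof -
          have "of_int k \<le> \<theta> / (2 * pi)" "\<theta> / (2 * pi) \<le> of_int k + 1" unfolding k_def by linarith+
          then have "of_int k * (2 * pi) \<le> \<theta>" "\<theta> \<le> (of_int k + 1) * (2 * pi)"
            by (simp_all add: pos_le_divide_eq pos_divide_le_eq)
          then show ?thesis by (simp add: algebra_simps)
        qed
        ultimately show "x \<in> (\<lambda>\<theta>. P + u \<theta>) ` {0..2 * pi}" using x by (metis image_eqI)
      qed
    qed (auto simp: Orb_def)
    moreover have "compact ((\<lambda>\<theta>. P + u \<theta>) ` {0..2 * pi})"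
      by (intro compact_continuous_image continuous_intros continuous_on_subset[OF uc]) auto
    ultimately show ?thesis by simp
  qed
  interpret L: lyapunov_set "F \<eta>" Orb N U \<phi>
  proof
    show "compact Orb" by (rule compOrb)
    show "Orb \<noteq> {}" by (simp add: Orb_def)
    show "Orb \<subseteq> N" by (rule ON)
    show "open N" by (rule Nopen)
    show "continuous_on N U" unfolding U_def by (intro continuous_intros q1c q2c Yc) (use \<kappa> in auto)
    show "continuous_on N \<phi>" unfolding \<phi>_def by (intro continuous_intros q1c q2c Yc)
    show "U x = 0" if "x \<in> Orb" for x using that by (auto simp: Orb_def U_def qO YO)
    show "0 \<le> \<phi> x" if "x \<in> N" for x using \<omega> by (simp add: \<phi>_def)
    show "0 < \<phi> x" if "x \<in> N" "x \<notin> Orb" for x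
    proof -
      have "\<not> (q1 x - Y1 x = 0 \<and> q2 x - Y2 x = 0)" using NO[of x] that by auto
      then have "0 < (q1 x - Y1 x)^2 + (q2 x - Y2 x)^2" by (simp add: sum_power2_gt_zero_iff)
      then show ?thesis using \<omega> by (simp add: \<phi>_def)
    qed
    fix x t S assume x: "(x has_vector_derivative F \<eta> (x t)) (at t within S)" "x t \<in> N"
    define v where "v = x t - P"
    define \<alpha> where "\<alpha> = Arg (Z v)"
    define \<Theta> where "\<Theta> = angv \<eta> v"
    have xt: "x t = P + v" by (simp add: v_def)
    have zn: "Z v \<noteq> 0" using Nz[OF x(2)] by (simp add: v_def)
    have vch: "v = chart m \<alpha> (norm (Z v) / m) (q2 (x t) / K)" "Svar \<eta> m \<alpha> (norm (Z v) / m) = S0 + q1 (x t)"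
      using coords[of "x t"] by (simp_all add: v_def \<alpha>_def)
    have nv: "norm (Z v) / m \<in> {ra..rb}" "\<bar>q1 (x t)\<bar> \<le> \<rho>" "\<bar>K * (q2 (x t) / K)\<bar> \<le> \<rho>"
      using x(2) K by (auto simp: N_def v_def)
    have \<Theta>: "\<omega> / 2 \<le> \<Theta>" using ang[OF nv(1) nv(3), of \<alpha>] vch(1) by (simp add: \<Theta>_def)
    have \<Theta>z: "\<Theta> \<noteq> 0" using \<Theta> \<omega> by linarith
    have d1: "((\<lambda>s. q1 (x s)) has_real_derivative \<Theta> * R1 \<eta> m v) (at t within S)"
    proof -
      have d: "((\<lambda>s. V \<eta> (Z (x s - P)) / m^2) has_real_derivative dV \<eta> (Z (x t - P)) (Z (F \<eta> (x t))) / m^2) (at t within S)"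
        by (rule DERIV_cdivide[OF V_curve[OF x(1)]])
      have e: "dV \<eta> (Z (x t - P)) (Z (F \<eta> (x t))) / m^2 = \<Theta> * R1 \<eta> m v"
        using \<Theta>z by (simp add: R1_def \<Theta>_def[symmetric] xt)
      show ?thesis using DERIV_diff[OF d[unfolded e] DERIV_const[of S0]] by (simp add: q1_def)
    qed
    have d2: "((\<lambda>s. q2 (x s)) has_real_derivative \<Theta> * (K * R2 \<eta> m v)) (at t within S)"
    proof -
      have "((\<lambda>s. K * (X (x s - P) / m^2)) has_real_derivative
          K * ((W (F \<eta> (x t)) - dh (Z (x t - P)) (Z (F \<eta> (x t)))) / m^2)) (at t within S)"
        by (rule DERIV_cmult[OF DERIV_cdivide[OF X_curve[OF x(1)]]])
      moreover have "K * ((W (F \<eta> (x t)) - dh (Z (x t - P)) (Z (F \<eta> (x t)))) / m^2) = \<Theta> * (K * R2 \<eta> m v)"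
        using \<Theta>z by (simp add: R2_def \<Theta>_def[symmetric] xt)
      ultimately show ?thesis unfolding q2_def by simp
    qed
    have Im: "Im (Z (F \<eta> (x t)) / Z (x t - P)) = \<Theta>" by (simp add: \<Theta>_def angv_def xt)
    have e1: "((\<lambda>s. Y1 (x s)) has_real_derivative \<Theta> * R1 \<eta> m (u \<alpha>)) (at t within S)"
      using periodic_Arg_curve[of y1, OF y(3) y1d Z_curve[OF x(1)]] zn unfolding Y1_def Im
      by (simp add: \<alpha>_def v_def mult.commute)
    have e2: "((\<lambda>s. Y2 (x s)) has_real_derivative \<Theta> * (K * R2 \<eta> m (u \<alpha>))) (at t within S)"
      using periodic_Arg_curve[of y2, OF y(4) y2d Z_curve[OF x(1)]] zn unfolding Y2_def Im
      by (simp add: \<alpha>_def v_def mult.commute)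
    define p1 p2 where "p1 = q1 (x t) - Y1 (x t)" and "p2 = q2 (x t) - Y2 (x t)"
    have Yt: "Y1 (x t) = y1 \<alpha>" "Y2 (x t) = y2 \<alpha>" by (simp_all add: Y1_def Y2_def \<alpha>_def v_def)
    \<comment> \<open>The nonlinear part at the point minus the one at the orbit point with the same
      angle, which is the form that \<open>lip1\<close> bounds.\<close>
    define f1 where "f1 = (R1 \<eta> m v - \<kappa>1 * q1 (x t)) - (R1 \<eta> m (u \<alpha>) - \<kappa>1 * y1 \<alpha>)"
    define f2 where "f2 = (K * R2 \<eta> m v - \<kappa>2 * q2 (x t)) - (K * R2 \<eta> m (u \<alpha>) - \<kappa>2 * y2 \<alpha>)"
    have Kq: "\<bar>K * (y2 \<alpha> / K)\<bar> \<le> \<rho>" unfolding Kb by (rule yr)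
    have S1: "\<bar>Svar \<eta> m \<alpha> (norm (Z v) / m) - S0\<bar> \<le> \<rho>" unfolding vch(2) using nv(2) by simp
    have S2: "\<bar>Svar \<eta> m \<alpha> (r \<alpha>) - S0\<bar> \<le> \<rho>" unfolding rb(3) using yr(1) by simp
    have f1: "\<bar>f1\<bar> \<le> \<bar>\<kappa>1\<bar> / 4 * max \<bar>p1\<bar> \<bar>p2\<bar>"
      using lip1[OF nv(1) rb(1) S1 S2 nv(3) Kq]
      unfolding vch(2) rb(3) vch(1)[symmetric] Kb u_def[symmetric] by (simp add: f1_def p1_def p2_def Yt)
    have f2: "\<bar>f2\<bar> \<le> \<bar>\<kappa>2\<bar> / 4 * max \<bar>p1\<bar> \<bar>p2\<bar>"
      using lip2[OF nv(1) rb(1) S1 S2 nv(3) Kq]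
      unfolding vch(2) rb(3) vch(1)[symmetric] Kb u_def[symmetric] by (simp add: f2_def p1_def p2_def Yt)
    have g1: "((\<lambda>s. q1 (x s) - Y1 (x s)) has_real_derivative \<Theta> * (\<kappa>1 * p1 + f1)) (at t within S)"
      using DERIV_diff[OF d1 e1] by (simp add: f1_def p1_def Yt algebra_simps)
    have g2: "((\<lambda>s. q2 (x s) - Y2 (x s)) has_real_derivative \<Theta> * (\<kappa>2 * p2 + f2)) (at t within S)"
      using DERIV_diff[OF d2 e2] by (simp add: f2_def p2_def Yt algebra_simps)
    have "((\<lambda>s. U (x s)) has_real_derivative 2 * \<Theta> * (\<tau> * p1 * (\<kappa>1 * p1 + f1) / \<bar>\<kappa>1\<bar> + p2 * (\<kappa>2 * p2 + f2) / \<bar>\<kappa>2\<bar>)) (at t within S)"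
    proof -
      have "((\<lambda>s. \<tau> * (q1 (x s) - Y1 (x s))^2 / \<bar>\<kappa>1\<bar> + (q2 (x s) - Y2 (x s))^2 / \<bar>\<kappa>2\<bar>) has_real_derivative
          \<tau> * (of_nat 2 * (\<Theta> * (\<kappa>1 * p1 + f1) * (q1 (x t) - Y1 (x t)) ^ (2 - Suc 0))) / \<bar>\<kappa>1\<bar>
          + (of_nat 2 * (\<Theta> * (\<kappa>2 * p2 + f2) * (q2 (x t) - Y2 (x t)) ^ (2 - Suc 0))) / \<bar>\<kappa>2\<bar>) (at t within S)"
        by (intro DERIV_add DERIV_cdivide DERIV_cmult DERIV_power g1 g2)
      then show ?thesis unfolding U_def p1_def[symmetric] p2_def[symmetric]
        by (simp add: algebra_simps add_divide_distrib)
    qed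
    moreover have "2 * \<Theta> * (\<tau> * p1 * (\<kappa>1 * p1 + f1) / \<bar>\<kappa>1\<bar> + p2 * (\<kappa>2 * p2 + f2) / \<bar>\<kappa>2\<bar>) \<le> - \<phi> (x t)"
    proof -
      have "2 * \<Theta> * (\<tau> * p1 * (\<kappa>1 * p1 + f1) / \<bar>\<kappa>1\<bar> + p2 * (\<kappa>2 * p2 + f2) / \<bar>\<kappa>2\<bar>) \<le> 2 * \<Theta> * (- (p1^2 + p2^2) / 2)"
        using \<Theta> \<omega> by (intro mult_left_mono hyperbolic_rate[OF \<kappa> \<tau>_def f1 f2]) auto
      also have "\<dots> = - (\<Theta> * (p1^2 + p2^2))"
        by (rule half_neg)
      also have "\<dots> \<le> - (\<omega> / 2 * (p1^2 + p2^2))" using mult_right_mono[OF \<Theta>, of "p1^2 + p2^2"] by simp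
      finally show ?thesis by (simp add: \<phi>_def p1_def p2_def)
    qed
    ultimately show "\<exists>D\<le>- \<phi> (x t). ((\<lambda>s. U (x s)) has_real_derivative D) (at t within S)" by blast
  qed
  show ?thesis
  proof (rule that[OF \<gamma>(1)])
    show "range \<gamma> \<subseteq> ball P R" unfolding \<gamma>(2) using uR by (auto simp: dist_norm)
    show "orbit_asym_stable (F \<eta>) (range \<gamma>)" if "\<kappa>1 < 0"
      unfolding \<gamma>(2) Orb_def[symmetric]
    proof (rule L.asymptotically_stable)
      fix x assume x: "x \<in> N" "x \<notin> Orb"
      then have "0 < \<phi> x" by (rule L.\<phi>_pos)
      then have "\<not> (q1 x - Y1 x = 0 \<and> q2 x - Y2 x = 0)" using \<omega> by (auto simp: \<phi>_def)
      moreover have "\<tau> = 1" using that by (simp add: \<tau>_def)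
      moreover have "0 \<le> (q1 x - Y1 x)^2 / \<bar>\<kappa>1\<bar>" "0 \<le> (q2 x - Y2 x)^2 / \<bar>\<kappa>2\<bar>" by simp_all
      moreover have "0 < (q1 x - Y1 x)^2 / \<bar>\<kappa>1\<bar>" if "q1 x - Y1 x \<noteq> 0"
        using that \<kappa> by (intro divide_pos_pos) auto
      moreover have "0 < (q2 x - Y2 x)^2 / \<bar>\<kappa>2\<bar>" if "q2 x - Y2 x \<noteq> 0"
        using that \<kappa> by (intro divide_pos_pos) auto
      moreover have "U x = (q1 x - Y1 x)^2 / \<bar>\<kappa>1\<bar> + (q2 x - Y2 x)^2 / \<bar>\<kappa>2\<bar>"
        unfolding U_def \<open>\<tau> = 1\<close> by simp
      ultimately show "0 < U x" by linarith
    qed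
    show "\<not> orbit_stable (F \<eta>) (range \<gamma>)" if "0 < \<kappa>1"
      unfolding \<gamma>(2) Orb_def[symmetric]
    proof -
      obtain LL where LL: "LL-lipschitz_on (cball P 1) (F \<eta>)" by (rule field_lipschitz)
      show "\<not> orbit_stable (F \<eta>) Orb"
      proof (rule L.unstable[OF _ _ _ _ LL])
        have "norm (u \<theta>) < 1" for \<theta> using uR[of \<theta>] R by linarith
        then show "Orb \<subseteq> interior (cball P 1)" by (auto simp: Orb_def interior_cball dist_norm)
        fix e :: real assume e: "0 < e"
        have "continuous_on UNIV (\<lambda>x. P + chart m 0 x (y2 0 / K))"
          by (intro continuous_intros chart_continuous) (use K in auto)
        then have "isCont (\<lambda>x. P + chart m 0 x (y2 0 / K)) (r 0)" by (simp add: continuous_on_eq_continuous_at)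
        moreover have "P + chart m 0 (r 0) (y2 0 / K) \<in> N" using ON by (auto simp: Orb_def u_def)
        then obtain e' where e': "0 < e'" "ball (P + u 0) e' \<subseteq> N" using Nopen by (auto simp: open_contains_ball u_def)
        ultimately obtain d where d: "0 < d" "\<And>x. dist x (r 0) < d \<Longrightarrow> dist (P + chart m 0 x (y2 0 / K)) (P + u 0) < min e e'"
          using e e' unfolding continuous_at_eps_delta u_def by (metis min_less_iff_conj)
        \<comment> \<open>A purely radial displacement at angle 0: it changes the level but neither
          the angle nor the transverse coordinate, so only the negative square in \<open>U\<close>
          is nonzero.\<close>
        define a where "a = min (r 0 + d / 2) rb"
        have a: "a \<in> {ra..rb}" "a \<noteq> r 0" "dist a (r 0) < d"
          using rb(2)[of 0] d(1) by (auto simp: a_def dist_real_def min_def)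
        define p where "p = P + chart m 0 a (y2 0 / K)"
        have pd: "dist p (P + u 0) < e" "dist p (P + u 0) < e'" using d(2)[OF a(3)] by (auto simp: p_def)
        have pN: "p \<in> N" using pd(2) e'(2) by (auto simp: dist_commute)
        have "infdist p Orb \<le> dist p (P + u 0)" by (rule infdist_le) (auto simp: Orb_def)
        then have pe: "infdist p Orb < e" using pd by linarith
        have "0 < m * a" using a(1) ra m by simp
        then have Arg0: "Arg (Z (p - P)) = 0" by (simp add: p_def Arg_of_real del: of_real_mult)
        have "q2 p = y2 0" using m K by (simp add: q2_def p_def)
        moreover have "Y2 p = y2 0" "Y1 p = y1 0" by (simp_all add: Y1_def Y2_def Arg0)
        moreover have "q1 p \<noteq> y1 0"
        proof
          assume "q1 p = y1 0"
          then have "Svar \<eta> m 0 a = S0 + y1 0" using m by (simp add: q1_def p_def Svar_def)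
          then have "a = r 0" unfolding r_def using a(1) yr by (intro rh_uniq) auto
          then show False using a(2) by simp
        qed
        moreover have "\<tau> = -1" using that by (simp add: \<tau>_def)
        ultimately have "U p < 0" unfolding U_def using \<kappa> by simp
        then show "\<exists>x. infdist x Orb < e \<and> x \<in> N \<and> U x < 0" using pe pN by blast
      qed auto
    qed
  qed
qed

end

section \<open>Uniform bounds in rescaled polar coordinates\<close>

definition ul_dom :: "real \<Rightarrow> real \<Rightarrow> real \<Rightarrow> real \<Rightarrow> real \<Rightarrow> real \<Rightarrow> bool" where
  "ul_dom a b m0 m r \<sigma> \<longleftrightarrow> 0 < m \<and> m \<le> m0 \<and> a \<le> r \<and> r \<le> b \<and> \<bar>\<sigma>\<bar> \<le> 1"

text \<open>Boundedness and a Lipschitz bound in \<open>r\<close> and \<open>\<sigma>\<close>,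
  uniform in the angle and in all small m > 0. Nothing is required of the dependence on the angle or
  on m; continuity in the angle is obtained separately.\<close>

definition ul :: "real \<Rightarrow> real \<Rightarrow> (real \<Rightarrow> real \<Rightarrow> real \<Rightarrow> real \<Rightarrow> 'b::real_normed_vector) \<Rightarrow> bool" where
  "ul a b G \<longleftrightarrow> (\<exists>C m0. 0 \<le> C \<and> 0 < m0 \<and>
     (\<forall>m \<theta> r \<sigma>. ul_dom a b m0 m r \<sigma> \<longrightarrow> norm (G m \<theta> r \<sigma>) \<le> C) \<and>
     (\<forall>m \<theta> r \<sigma> r' \<sigma>'. ul_dom a b m0 m r \<sigma> \<longrightarrow> ul_dom a b m0 m r' \<sigma>' \<longrightarrow>
        norm (G m \<theta> r \<sigma> - G m \<theta> r' \<sigma>') \<le> C * (\<bar>r - r'\<bar> + \<bar>\<sigma> - \<sigma>'\<bar>)))"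

lemma ul_dom_mono: "ul_dom a b m0 m r \<sigma> \<Longrightarrow> m0 \<le> m1 \<Longrightarrow> ul_dom a b m1 m r \<sigma>"
  by (auto simp: ul_dom_def)

lemma ulI:
  assumes "0 \<le> C" "0 < m0" "\<And>m \<theta> r \<sigma>. ul_dom a b m0 m r \<sigma> \<Longrightarrow> norm (G m \<theta> r \<sigma>) \<le> C"
    "\<And>m \<theta> r \<sigma> r' \<sigma>'. ul_dom a b m0 m r \<sigma> \<Longrightarrow> ul_dom a b m0 m r' \<sigma>' \<Longrightarrow>
        norm (G m \<theta> r \<sigma> - G m \<theta> r' \<sigma>') \<le> C * (\<bar>r - r'\<bar> + \<bar>\<sigma> - \<sigma>'\<bar>)"
  shows "ul a b G"
  unfolding ul_def using assms by blast

lemma ulE: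
  assumes "ul a b G"
  obtains C m0 where "0 \<le> C" "0 < m0" "\<And>m \<theta> r \<sigma>. ul_dom a b m0 m r \<sigma> \<Longrightarrow> norm (G m \<theta> r \<sigma>) \<le> C"
    "\<And>m \<theta> r \<sigma> r' \<sigma>'. ul_dom a b m0 m r \<sigma> \<Longrightarrow> ul_dom a b m0 m r' \<sigma>' \<Longrightarrow>
        norm (G m \<theta> r \<sigma> - G m \<theta> r' \<sigma>') \<le> C * (\<bar>r - r'\<bar> + \<bar>\<sigma> - \<sigma>'\<bar>)"
  using assms unfolding ul_def by blast

lemma ul_theta: "(\<And>\<theta>. norm (g \<theta>) \<le> B) \<Longrightarrow> ul a b (\<lambda>m \<theta> r \<sigma>. g \<theta>)"
  using order_trans[OF norm_ge_zero, of "g 0" B]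
  by (intro ulI[of B 1]) (auto simp: mult_nonneg_nonneg)

lemma ul_const: "ul a b (\<lambda>m \<theta> r \<sigma>. c)"
  by (rule ul_theta[of "\<lambda>_. c" "norm c"]) simp

lemma ul_cis: "ul a b (\<lambda>m \<theta> r \<sigma>. cis \<theta>)"
  by (rule ul_theta[of cis 1]) simp

lemma ul_m: "ul a b (\<lambda>m \<theta> r \<sigma>. m :: real)"
  by (rule ulI[of 1 1]) (auto simp: ul_dom_def)

lemma ul_r: "ul a b (\<lambda>m \<theta> r \<sigma>. r :: real)"
proof (rule ulI[of "\<bar>a\<bar> + \<bar>b\<bar> + 1" 1])
  fix m r \<sigma> r' \<sigma>' :: real assume "ul_dom a b 1 m r \<sigma>"
  then show "norm r \<le> \<bar>a\<bar> + \<bar>b\<bar> + 1" by (auto simp: ul_dom_def)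
  have "1 * (\<bar>r - r'\<bar> + \<bar>\<sigma> - \<sigma>'\<bar>) \<le> (\<bar>a\<bar> + \<bar>b\<bar> + 1) * (\<bar>r - r'\<bar> + \<bar>\<sigma> - \<sigma>'\<bar>)"
    by (intro mult_right_mono) auto
  then show "norm (r - r') \<le> (\<bar>a\<bar> + \<bar>b\<bar> + 1) * (\<bar>r - r'\<bar> + \<bar>\<sigma> - \<sigma>'\<bar>)"
    by (rule order_trans[rotated]) simp
qed auto

lemma ul_\<sigma>: "ul a b (\<lambda>m \<theta> r \<sigma>. \<sigma> :: real)"
  by (rule ulI[of 1 1]) (auto simp: ul_dom_def)

lemma ul_add:
  assumes "ul a b G" "ul a b H" shows "ul a b (\<lambda>m \<theta> r \<sigma>. G m \<theta> r \<sigma> + H m \<theta> r \<sigma>)"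
proof -
  obtain C m0 where C: "0 \<le> C" "0 < m0" "\<And>m \<theta> r \<sigma>. ul_dom a b m0 m r \<sigma> \<Longrightarrow> norm (G m \<theta> r \<sigma>) \<le> C"
    "\<And>m \<theta> r \<sigma> r' \<sigma>'. ul_dom a b m0 m r \<sigma> \<Longrightarrow> ul_dom a b m0 m r' \<sigma>' \<Longrightarrow>
        norm (G m \<theta> r \<sigma> - G m \<theta> r' \<sigma>') \<le> C * (\<bar>r - r'\<bar> + \<bar>\<sigma> - \<sigma>'\<bar>)" using ulE[OF assms(1)] by blast
  obtain D m1 where D: "0 \<le> D" "0 < m1" "\<And>m \<theta> r \<sigma>. ul_dom a b m1 m r \<sigma> \<Longrightarrow> norm (H m \<theta> r \<sigma>) \<le> D"
    "\<And>m \<theta> r \<sigma> r' \<sigma>'. ul_dom a b m1 m r \<sigma> \<Longrightarrow> ul_dom a b m1 m r' \<sigma>' \<Longrightarrow>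
        norm (H m \<theta> r \<sigma> - H m \<theta> r' \<sigma>') \<le> D * (\<bar>r - r'\<bar> + \<bar>\<sigma> - \<sigma>'\<bar>)" using ulE[OF assms(2)] by blast
  show ?thesis
  proof (rule ulI[of "C + D" "min m0 m1"])
    fix m \<theta> r \<sigma> r' \<sigma>' assume "ul_dom a b (min m0 m1) m r \<sigma>"
    then have d: "ul_dom a b m0 m r \<sigma>" "ul_dom a b m1 m r \<sigma>" by (auto elim: ul_dom_mono)
    show "norm (G m \<theta> r \<sigma> + H m \<theta> r \<sigma>) \<le> C + D"
      using C(3)[OF d(1), of \<theta>] D(3)[OF d(2), of \<theta>] norm_triangle_ineq[of "G m \<theta> r \<sigma>" "H m \<theta> r \<sigma>"] by linarith
    assume "ul_dom a b (min m0 m1) m r' \<sigma>'"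
    then have d': "ul_dom a b m0 m r' \<sigma>'" "ul_dom a b m1 m r' \<sigma>'" by (auto elim: ul_dom_mono)
    show "norm (G m \<theta> r \<sigma> + H m \<theta> r \<sigma> - (G m \<theta> r' \<sigma>' + H m \<theta> r' \<sigma>')) \<le> (C + D) * (\<bar>r - r'\<bar> + \<bar>\<sigma> - \<sigma>'\<bar>)"
      using C(4)[OF d(1) d'(1), of \<theta>] D(4)[OF d(2) d'(2), of \<theta>]
        norm_diff_triangle_ineq[of "G m \<theta> r \<sigma>" "H m \<theta> r \<sigma>" "G m \<theta> r' \<sigma>'" "H m \<theta> r' \<sigma>'"]
      by (simp only: distrib_right)
  qed (use C D in auto)
qed

lemma ul_bilinear:
  assumes "bounded_bilinear B" "ul a b G" "ul a b H" shows "ul a b (\<lambda>m \<theta> r \<sigma>. B (G m \<theta> r \<sigma>) (H m \<theta> r \<sigma>))"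
proof -
  interpret B: bounded_bilinear B by fact
  obtain K where K: "0 < K" "\<And>x y. norm (B x y) \<le> norm x * norm y * K" using B.pos_bounded by blast
  obtain C m0 where C: "0 \<le> C" "0 < m0" "\<And>m \<theta> r \<sigma>. ul_dom a b m0 m r \<sigma> \<Longrightarrow> norm (G m \<theta> r \<sigma>) \<le> C"
    "\<And>m \<theta> r \<sigma> r' \<sigma>'. ul_dom a b m0 m r \<sigma> \<Longrightarrow> ul_dom a b m0 m r' \<sigma>' \<Longrightarrow>
        norm (G m \<theta> r \<sigma> - G m \<theta> r' \<sigma>') \<le> C * (\<bar>r - r'\<bar> + \<bar>\<sigma> - \<sigma>'\<bar>)" using ulE[OF assms(2)] by blast
  obtain D m1 where D: "0 \<le> D" "0 < m1" "\<And>m \<theta> r \<sigma>. ul_dom a b m1 m r \<sigma> \<Longrightarrow> norm (H m \<theta> r \<sigma>) \<le> D"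
    "\<And>m \<theta> r \<sigma> r' \<sigma>'. ul_dom a b m1 m r \<sigma> \<Longrightarrow> ul_dom a b m1 m r' \<sigma>' \<Longrightarrow>
        norm (H m \<theta> r \<sigma> - H m \<theta> r' \<sigma>') \<le> D * (\<bar>r - r'\<bar> + \<bar>\<sigma> - \<sigma>'\<bar>)" using ulE[OF assms(3)] by blast
  show ?thesis
  proof (rule ulI[of "2 * (C * D * K)" "min m0 m1"])
    fix m \<theta> r \<sigma> r' \<sigma>' assume "ul_dom a b (min m0 m1) m r \<sigma>"
    then have d: "ul_dom a b m0 m r \<sigma>" "ul_dom a b m1 m r \<sigma>" by (auto elim: ul_dom_mono)
    have "norm (B (G m \<theta> r \<sigma>) (H m \<theta> r \<sigma>)) \<le> C * D * K"
      by (intro order_trans[OF K(2)] mult_right_mono mult_mono C(3) D(3) d) (use C D K in auto)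
    moreover have "0 \<le> C * D * K" using C D K by simp
    ultimately show "norm (B (G m \<theta> r \<sigma>) (H m \<theta> r \<sigma>)) \<le> 2 * (C * D * K)" by linarith
    assume "ul_dom a b (min m0 m1) m r' \<sigma>'"
    then have d': "ul_dom a b m0 m r' \<sigma>'" "ul_dom a b m1 m r' \<sigma>'" by (auto elim: ul_dom_mono)
    define e where "e = \<bar>r - r'\<bar> + \<bar>\<sigma> - \<sigma>'\<bar>"
    have "norm (B (G m \<theta> r \<sigma>) (H m \<theta> r \<sigma>) - B (G m \<theta> r' \<sigma>') (H m \<theta> r' \<sigma>'))
        \<le> norm (B (G m \<theta> r \<sigma>) (H m \<theta> r \<sigma> - H m \<theta> r' \<sigma>')) + norm (B (G m \<theta> r \<sigma> - G m \<theta> r' \<sigma>') (H m \<theta> r' \<sigma>'))"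
      by (rule order_trans[OF _ norm_triangle_ineq]) (simp add: B.diff_left B.diff_right)
    also have "\<dots> \<le> C * (D * e) * K + (C * e) * D * K"
    proof (rule add_mono)
      have "norm (G m \<theta> r \<sigma>) * norm (H m \<theta> r \<sigma> - H m \<theta> r' \<sigma>') \<le> C * (D * e)"
        unfolding e_def by (rule mult_mono[OF C(3)[OF d(1)] D(4)[OF d(2) d'(2)]]) (use C in auto)
      then show "norm (B (G m \<theta> r \<sigma>) (H m \<theta> r \<sigma> - H m \<theta> r' \<sigma>')) \<le> C * (D * e) * K"
        using K(1) by (intro order_trans[OF K(2)] mult_right_mono) auto
      have "norm (G m \<theta> r \<sigma> - G m \<theta> r' \<sigma>') * norm (H m \<theta> r' \<sigma>') \<le> (C * e) * D"
        unfolding e_def by (rule mult_mono[OF C(4)[OF d(1) d'(1)] D(3)[OF d'(2)]]) (use C in auto)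
      then show "norm (B (G m \<theta> r \<sigma> - G m \<theta> r' \<sigma>') (H m \<theta> r' \<sigma>')) \<le> (C * e) * D * K"
        using K(1) by (intro order_trans[OF K(2)] mult_right_mono) auto
    qed
    also have "\<dots> = 2 * (C * D * K) * e" by (simp add: algebra_simps)
    finally show "norm (B (G m \<theta> r \<sigma>) (H m \<theta> r \<sigma>) - B (G m \<theta> r' \<sigma>') (H m \<theta> r' \<sigma>')) \<le> 2 * (C * D * K) * (\<bar>r - r'\<bar> + \<bar>\<sigma> - \<sigma>'\<bar>)"
      by (simp add: e_def)
  qed (use C D K in auto)
qed

lemmas ul_mult = ul_bilinear[OF bounded_bilinear_mult]

lemma ul_linear:
  assumes "bounded_linear L" "ul a b G" shows "ul a b (\<lambda>m \<theta> r \<sigma>. L (G m \<theta> r \<sigma>))"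
proof -
  interpret L: bounded_linear L by fact
  obtain K where K: "0 < K" "\<And>x. norm (L x) \<le> norm x * K" using L.pos_bounded by blast
  obtain C m0 where C: "0 \<le> C" "0 < m0" "\<And>m \<theta> r \<sigma>. ul_dom a b m0 m r \<sigma> \<Longrightarrow> norm (G m \<theta> r \<sigma>) \<le> C"
    "\<And>m \<theta> r \<sigma> r' \<sigma>'. ul_dom a b m0 m r \<sigma> \<Longrightarrow> ul_dom a b m0 m r' \<sigma>' \<Longrightarrow>
        norm (G m \<theta> r \<sigma> - G m \<theta> r' \<sigma>') \<le> C * (\<bar>r - r'\<bar> + \<bar>\<sigma> - \<sigma>'\<bar>)" using ulE[OF assms(2)] by blast
  show ?thesis
  proof (rule ulI[of "C * K" m0])
    fix m \<theta> r \<sigma> r' \<sigma>' assume d: "ul_dom a b m0 m r \<sigma>"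
    show "norm (L (G m \<theta> r \<sigma>)) \<le> C * K"
      using K(1) by (intro order_trans[OF K(2)] mult_right_mono C(3)[OF d]) auto
    assume d': "ul_dom a b m0 m r' \<sigma>'"
    have "norm (L (G m \<theta> r \<sigma>) - L (G m \<theta> r' \<sigma>')) \<le> (C * (\<bar>r - r'\<bar> + \<bar>\<sigma> - \<sigma>'\<bar>)) * K"
      unfolding L.diff[symmetric] using K(1)
      by (intro order_trans[OF K(2)] mult_right_mono C(4)[OF d d']) auto
    then show "norm (L (G m \<theta> r \<sigma>) - L (G m \<theta> r' \<sigma>')) \<le> C * K * (\<bar>r - r'\<bar> + \<bar>\<sigma> - \<sigma>'\<bar>)"
      by (simp only: mult_ac)
  qed (use C K in auto)
qed

lemmas ul_Re = ul_linear[OF bounded_linear_Re]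
lemmas ul_Im = ul_linear[OF bounded_linear_Im]
lemmas ul_cnj = ul_linear[OF bounded_linear_cnj]
lemmas ul_of_real = ul_linear[OF bounded_linear_of_real]

lemma ul_power:
  fixes G :: "real \<Rightarrow> real \<Rightarrow> real \<Rightarrow> real \<Rightarrow> 'b::real_normed_algebra_1"
  assumes "ul a b G" shows "ul a b (\<lambda>m \<theta> r \<sigma>. G m \<theta> r \<sigma> ^ n)"
proof (induction n)
  case 0 show ?case by (simp add: ul_const)
next
  case (Suc n) show ?case using ul_mult[OF assms Suc] by simp
qed

lemma ul_uminus: "ul a b G \<Longrightarrow> ul a b (\<lambda>m \<theta> r \<sigma>. - G m \<theta> r \<sigma>)"
  by (rule ul_linear[OF bounded_linear_minus[OF bounded_linear_ident]])

lemma ul_diff: "ul a b G \<Longrightarrow> ul a b H \<Longrightarrow> ul a b (\<lambda>m \<theta> r \<sigma>. G m \<theta> r \<sigma> - H m \<theta> r \<sigma>)"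
  using ul_add[of a b G "\<lambda>m \<theta> r \<sigma>. - H m \<theta> r \<sigma>"] ul_uminus[of a b H] by simp

lemma ul_inverse:
  fixes G :: "real \<Rightarrow> real \<Rightarrow> real \<Rightarrow> real \<Rightarrow> real"
  assumes "ul a b G" and c: "0 < c" and m1: "0 < m1" and low: "\<And>m \<theta> r \<sigma>. ul_dom a b m1 m r \<sigma> \<Longrightarrow> c \<le> G m \<theta> r \<sigma>"
  shows "ul a b (\<lambda>m \<theta> r \<sigma>. 1 / G m \<theta> r \<sigma>)"
proof -
  obtain C m0 where C: "0 \<le> C" "0 < m0" "\<And>m \<theta> r \<sigma>. ul_dom a b m0 m r \<sigma> \<Longrightarrow> norm (G m \<theta> r \<sigma>) \<le> C"
    "\<And>m \<theta> r \<sigma> r' \<sigma>'. ul_dom a b m0 m r \<sigma> \<Longrightarrow> ul_dom a b m0 m r' \<sigma>' \<Longrightarrow>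
        norm (G m \<theta> r \<sigma> - G m \<theta> r' \<sigma>') \<le> C * (\<bar>r - r'\<bar> + \<bar>\<sigma> - \<sigma>'\<bar>)" using ulE[OF assms(1)] by blast
  show ?thesis
  proof (rule ulI[of "1 / c + C / (c * c)" "min m0 m1"])
    fix m \<theta> r \<sigma> r' \<sigma>' assume "ul_dom a b (min m0 m1) m r \<sigma>"
    then have d: "ul_dom a b m0 m r \<sigma>" "ul_dom a b m1 m r \<sigma>" by (auto elim: ul_dom_mono)
    have g: "c \<le> G m \<theta> r \<sigma>" by (rule low[OF d(2)])
    have "norm (1 / G m \<theta> r \<sigma>) \<le> 1 / c" using g c by (simp add: frac_le)
    then show "norm (1 / G m \<theta> r \<sigma>) \<le> 1 / c + C / (c * c)"
      using C c by (smt (verit) divide_nonneg_pos mult_pos_pos)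
    assume "ul_dom a b (min m0 m1) m r' \<sigma>'"
    then have d': "ul_dom a b m0 m r' \<sigma>'" "ul_dom a b m1 m r' \<sigma>'" by (auto elim: ul_dom_mono)
    have g': "c \<le> G m \<theta> r' \<sigma>'" by (rule low[OF d'(2)])
    define e where "e = \<bar>r - r'\<bar> + \<bar>\<sigma> - \<sigma>'\<bar>"
    have "1 / G m \<theta> r \<sigma> - 1 / G m \<theta> r' \<sigma>' = (G m \<theta> r' \<sigma>' - G m \<theta> r \<sigma>) / (G m \<theta> r \<sigma> * G m \<theta> r' \<sigma>')"
      using g g' c by (simp add: field_simps)
    then have "norm (1 / G m \<theta> r \<sigma> - 1 / G m \<theta> r' \<sigma>') = norm (G m \<theta> r \<sigma> - G m \<theta> r' \<sigma>') / (G m \<theta> r \<sigma> * G m \<theta> r' \<sigma>')"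
      using g g' c by (simp add: abs_mult abs_minus_commute)
    also have "\<dots> \<le> (C * e) / (c * c)"
      using C(4)[OF d(1) d'(1), of \<theta>] g g' c C(1) by (intro frac_le mult_mono) (auto simp: e_def)
    also have "\<dots> = C / (c * c) * e" by simp
    also have "\<dots> \<le> (1 / c + C / (c * c)) * e" using c by (intro mult_right_mono) (auto simp: e_def)
    finally show "norm (1 / G m \<theta> r \<sigma> - 1 / G m \<theta> r' \<sigma>') \<le> (1 / c + C / (c * c)) * (\<bar>r - r'\<bar> + \<bar>\<sigma> - \<sigma>'\<bar>)"
      by (simp add: e_def)
  qed (use C c m1 in auto)
qed

lemma ul_bound_pair:
  assumes "ul a b G" "ul a b H"
  obtains C m0 where "0 < C" "0 < m0" "\<And>m \<theta> r \<sigma>. ul_dom a b m0 m r \<sigma> \<Longrightarrow> norm (G m \<theta> r \<sigma>) \<le> C"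
    "\<And>m \<theta> r \<sigma>. ul_dom a b m0 m r \<sigma> \<Longrightarrow> norm (H m \<theta> r \<sigma>) \<le> C"
proof -
  obtain C m0 where C: "0 \<le> C" "0 < m0" "\<And>m \<theta> r \<sigma>. ul_dom a b m0 m r \<sigma> \<Longrightarrow> norm (G m \<theta> r \<sigma>) \<le> C"
    using assms(1) unfolding ul_def by auto
  obtain D m1 where D: "0 \<le> D" "0 < m1" "\<And>m \<theta> r \<sigma>. ul_dom a b m1 m r \<sigma> \<Longrightarrow> norm (H m \<theta> r \<sigma>) \<le> D"
    using assms(2) unfolding ul_def by auto
  show ?thesis
  proof (rule that[of "C + D + 1" "min m0 m1"])
    fix m \<theta> r \<sigma> assume "ul_dom a b (min m0 m1) m r \<sigma>"
    then have d: "ul_dom a b m0 m r \<sigma>" "ul_dom a b m1 m r \<sigma>" by (auto elim: ul_dom_mono)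
    show "norm (G m \<theta> r \<sigma>) \<le> C + D + 1" "norm (H m \<theta> r \<sigma>) \<le> C + D + 1"
      using C(3)[OF d(1), of \<theta>] D(3)[OF d(2), of \<theta>] C D by linarith+
  qed (use C D in auto)
qed

text \<open>The two points now share one radius \<open>\<rho>\<close> instead of being ordered by
  their norms, as suits two points of a chart of size proportional to m.\<close>

lemma lipo_two_point:
  assumes "lipo (Suc k) E"
  obtains C where "0 \<le> C" "\<And>u \<rho>. norm u \<le> \<rho> \<Longrightarrow> \<rho> \<le> 1 \<Longrightarrow> norm (E u) \<le> C * \<rho> ^ Suc k"
    "\<And>u v \<rho>. norm u \<le> \<rho> \<Longrightarrow> norm v \<le> \<rho> \<Longrightarrow> \<rho> \<le> 1 \<Longrightarrow> norm (E u - E v) \<le> C * \<rho> ^ k * norm (u - v)"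
proof -
  obtain C where C: "0 \<le> C" "\<And>u. norm u \<le> 1 \<Longrightarrow> norm (E u) \<le> C * norm u ^ Suc k"
    "\<And>u v. norm u \<le> 1 \<Longrightarrow> norm v \<le> norm u \<Longrightarrow> norm (E u - E v) * norm u \<le> C * norm u ^ Suc k * norm (u - v)"
    using assms by (rule lipoE) blast
  have *: "norm (E u - E v) \<le> C * \<rho> ^ k * norm (u - v)" if "norm u \<le> \<rho>" "norm v \<le> norm u" "\<rho> \<le> 1" for u v \<rho>
  proof (cases "norm u = 0")
    case True then show ?thesis using that by simp
  next
    case False
    have "norm (E u - E v) * norm u \<le> (C * norm u ^ k * norm (u - v)) * norm u"
      using C(3)[of u v] that by (simp add: mult_ac)
    then have "norm (E u - E v) \<le> C * norm u ^ k * norm (u - v)" using False by simp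
    also have "\<dots> \<le> C * \<rho> ^ k * norm (u - v)"
      using that C(1) by (intro mult_right_mono mult_left_mono power_mono) auto
    finally show ?thesis .
  qed
  show ?thesis
  proof (rule that[OF C(1)])
    show "norm (E u) \<le> C * \<rho> ^ Suc k" if "norm u \<le> \<rho>" "\<rho> \<le> 1" for u \<rho>
      using C(2)[of u] that mult_left_mono[OF power_mono[OF that(1), of "Suc k"] C(1)] by simp
    show "norm (E u - E v) \<le> C * \<rho> ^ k * norm (u - v)" if "norm u \<le> \<rho>" "norm v \<le> \<rho>" "\<rho> \<le> 1" for u v \<rho>
      using *[of u \<rho> v] *[of v \<rho> u] that by (cases "norm v \<le> norm u") (auto simp: norm_minus_commute)
  qed
qed

section \<open>The rescaled system and the branch of periodic orbits\<close>

context hopf_form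
begin

text \<open>The chart divided by m. The transverse part keeps a factor m because X is scaled by m^2
  while Z is scaled by m.\<close>

definition "chart0 m \<theta> r \<sigma> = emb (of_real r * cis \<theta>) (m * (h (of_real r * cis \<theta>) + \<sigma>))"

lemma chart_scale: "chart m \<theta> r \<sigma> = m *\<^sub>R chart0 m \<theta> r \<sigma>"
proof -
  have "h (of_real (m * r) * cis \<theta>) = m^2 * h (of_real r * cis \<theta>)"
    unfolding quad_form_def cmod_sq_Re by (simp add: power_mult_distrib norm_mult algebra_simps power2_eq_square)
  moreover have "emb (m *\<^sub>R z) (m *\<^sub>R w) = m *\<^sub>R emb z w" for z w
    using linear_cmul[OF bounded_linear.linear[OF emb], of m "(z, w)"] by simp
  moreover have "of_real (m * r) * cis \<theta> = m *\<^sub>R (of_real r * cis \<theta>)" by (simp add: scaleR_conv_of_real)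
  moreover have "m^2 * h (of_real r * cis \<theta>) + m^2 * \<sigma> = m *\<^sub>R (m * (h (of_real r * cis \<theta>) + \<sigma>))"
    by (simp add: power2_eq_square algebra_simps)
  ultimately show ?thesis unfolding chart_def chart0_def by metis
qed

lemma ul_chart0: "ul a b chart0"
proof -
  have z: "ul a b (\<lambda>m \<theta> r \<sigma>. of_real r * cis \<theta> :: complex)" by (intro ul_mult ul_of_real ul_r ul_cis)
  have hz: "ul a b (\<lambda>m \<theta> r \<sigma>. h (of_real r * cis \<theta>))"
    unfolding quad_form_def by (intro ul_add ul_mult ul_const ul_Re ul_power ul_cnj z)
  have w: "ul a b (\<lambda>m \<theta> r \<sigma>. m * (h (of_real r * cis \<theta>) + \<sigma>))"
    by (intro ul_mult ul_add ul_m hz ul_\<sigma>)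
  have "bounded_linear (\<lambda>z. emb z 0)"
    using bounded_linear_compose[OF emb, of "\<lambda>z. (z, 0)"]
    by (simp add: bounded_linear_Pair bounded_linear_ident bounded_linear_zero)
  moreover have "bounded_linear (\<lambda>w. emb 0 w)"
    using bounded_linear_compose[OF emb, of "\<lambda>w. (0, w)"]
    by (simp add: bounded_linear_Pair bounded_linear_ident bounded_linear_zero)
  ultimately have "ul a b (\<lambda>m \<theta> r \<sigma>. emb (of_real r * cis \<theta>) 0 + emb 0 (m * (h (of_real r * cis \<theta>) + \<sigma>)))"
    using ul_linear[OF _ z, of "\<lambda>z. emb z 0"] ul_linear[OF _ w, of "\<lambda>w. emb 0 w"] by (intro ul_add) auto
  moreover have "chart0 = (\<lambda>m \<theta> r \<sigma>. emb (of_real r * cis \<theta>) 0 + emb 0 (m * (h (of_real r * cis \<theta>) + \<sigma>)))"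
  proof (intro ext)
    fix m \<theta> r \<sigma>
    have "emb z w = emb z 0 + emb 0 w" for z w
      using linear_add[OF bounded_linear.linear[OF emb], of "(z, 0)" "(0, w)"] by simp
    then show "chart0 m \<theta> r \<sigma> = emb (of_real r * cis \<theta>) 0 + emb 0 (m * (h (of_real r * cis \<theta>) + \<sigma>))"
      unfolding chart0_def .
  qed
  ultimately show ?thesis by simp
qed

definition "rsc k E m \<theta> r \<sigma> = (1 / m ^ k) *\<^sub>R E (chart m \<theta> r \<sigma>)"

text \<open>Connects the two calculi. Points of the chart have size of order m and their differences
  carry a factor m, so the two-point bound of order k produces k powers of m, exactly those that the
  rescaling divides out.\<close>

lemma ul_rsc:
  assumes "lipo (Suc k) E" shows "ul a b (rsc (Suc k) E)"
proof -
  obtain C m0 where C: "0 \<le> C" "0 < m0" "\<And>m \<theta> r \<sigma>. ul_dom a b m0 m r \<sigma> \<Longrightarrow> norm (chart0 m \<theta> r \<sigma>) \<le> C"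
    "\<And>m \<theta> r \<sigma> r' \<sigma>'. ul_dom a b m0 m r \<sigma> \<Longrightarrow> ul_dom a b m0 m r' \<sigma>' \<Longrightarrow>
        norm (chart0 m \<theta> r \<sigma> - chart0 m \<theta> r' \<sigma>') \<le> C * (\<bar>r - r'\<bar> + \<bar>\<sigma> - \<sigma>'\<bar>)" using ulE[OF ul_chart0] by blast
  obtain D where D: "0 \<le> D" "\<And>u \<rho>. norm u \<le> \<rho> \<Longrightarrow> \<rho> \<le> 1 \<Longrightarrow> norm (E u) \<le> D * \<rho> ^ Suc k"
    "\<And>u v \<rho>. norm u \<le> \<rho> \<Longrightarrow> norm v \<le> \<rho> \<Longrightarrow> \<rho> \<le> 1 \<Longrightarrow> norm (E u - E v) \<le> D * \<rho> ^ k * norm (u - v)"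
    using lipo_two_point[OF assms] by blast
  define m1 where "m1 = min m0 (1 / (C + 1))"
  have m1: "0 < m1" using C by (simp add: m1_def)
  show ?thesis
  proof (rule ulI[of "D * (C + 1) ^ Suc k" m1])
    fix m \<theta> r \<sigma> r' \<sigma>' assume d1: "ul_dom a b m1 m r \<sigma>"
    then have d: "ul_dom a b m0 m r \<sigma>" by (auto elim: ul_dom_mono simp: m1_def)
    have m: "0 < m" "m \<le> 1 / (C + 1)" using d1 by (auto simp: ul_dom_def m1_def)
    define \<rho> where "\<rho> = m * (C + 1)"
    have \<rho>: "\<rho> \<le> 1" using m C(1) by (simp add: \<rho>_def pos_le_divide_eq)
    have "0 < \<rho>" using m C(1) by (simp add: \<rho>_def)
    have nq: "norm (chart m \<theta> r \<sigma>) \<le> \<rho>" if "ul_dom a b m0 m r \<sigma>" for r \<sigma>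
      unfolding chart_scale \<rho>_def using C(3)[OF that, of \<theta>] m by (simp add: mult_left_mono)
    have pw: "\<rho> ^ j = m ^ j * (C + 1) ^ j" for j by (simp add: \<rho>_def power_mult_distrib)
    have "norm (rsc (Suc k) E m \<theta> r \<sigma>) = norm (E (chart m \<theta> r \<sigma>)) / m ^ Suc k" using m by (simp add: rsc_def)
    also have "\<dots> \<le> (D * \<rho> ^ Suc k) / m ^ Suc k" using m by (intro divide_right_mono D(2) nq d \<rho>) auto
    also have "\<dots> = D * (C + 1) ^ Suc k" unfolding pw using m by simp
    finally show "norm (rsc (Suc k) E m \<theta> r \<sigma>) \<le> D * (C + 1) ^ Suc k" .
    assume "ul_dom a b m1 m r' \<sigma>'"
    then have d': "ul_dom a b m0 m r' \<sigma>'" by (auto elim: ul_dom_mono simp: m1_def)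
    define e where "e = \<bar>r - r'\<bar> + \<bar>\<sigma> - \<sigma>'\<bar>"
    have "norm (chart m \<theta> r \<sigma> - chart m \<theta> r' \<sigma>') = m * norm (chart0 m \<theta> r \<sigma> - chart0 m \<theta> r' \<sigma>')"
      unfolding chart_scale scaleR_diff_right[symmetric] using m by simp
    also have "\<dots> \<le> m * ((C + 1) * e)"
      using C(4)[OF d d', of \<theta>] m by (intro mult_left_mono) (auto simp: e_def distrib_right)
    finally have dq: "norm (chart m \<theta> r \<sigma> - chart m \<theta> r' \<sigma>') \<le> m * ((C + 1) * e)" .
    have "norm (rsc (Suc k) E m \<theta> r \<sigma> - rsc (Suc k) E m \<theta> r' \<sigma>')
        = norm (E (chart m \<theta> r \<sigma>) - E (chart m \<theta> r' \<sigma>')) / m ^ Suc k"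
      using m by (simp add: rsc_def scaleR_diff_right[symmetric])
    also have "\<dots> \<le> (D * \<rho> ^ k * (m * ((C + 1) * e))) / m ^ Suc k"
      using m \<open>0 < \<rho>\<close> D(1) by (intro divide_right_mono order_trans[OF D(3)[OF nq[OF d] nq[OF d'] \<rho>]] mult_left_mono dq) auto
    also have "\<dots> = D * (C + 1) ^ Suc k * e" unfolding pw using m by (simp add: field_simps)
    finally show "norm (rsc (Suc k) E m \<theta> r \<sigma> - rsc (Suc k) E m \<theta> r' \<sigma>') \<le> D * (C + 1) ^ Suc k * (\<bar>r - r'\<bar> + \<bar>\<sigma> - \<sigma>'\<bar>)"
      by (simp add: e_def)
  qed (use C D m1 in auto)
qed

lemma rsc_eq: "0 < m \<Longrightarrow> E (chart m \<theta> r \<sigma>) = m ^ k *\<^sub>R rsc k E m \<theta> r \<sigma>"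
  for E :: "real^'n \<Rightarrow> 'c::real_normed_vector"
  unfolding rsc_def scaleR_scaleR by simp

lemma ul_rescaled: "lipo k E \<Longrightarrow> 0 < k \<Longrightarrow> ul a b (rsc k E)"
  using ul_rsc[of "k - 1" E] by simp

definition "Nl u = g2 (Z u) + g3 (Z u) + of_real (X u) * E1 u + E4 u"

lemma lipo_Nl: "lipo 2 Nl"
  unfolding Nl_def[abs_def]
  by (intro lipo_add; (rule lipo_mono, (rule lipo_parts lipo_cmult lipo_cnj lipo_of_real lipo_mult lipo_power)+, simp))

text \<open>By linearity the left side is r times the derivative of \<open>V\<close> along the ray,
  which is read off from the polynomial form of the level.\<close>

lemma radial_derivative:
  assumes m: "0 < m"
  shows "dV \<eta> (of_real (m * r) * cis \<theta>) (of_real (m * r) * cis \<theta>)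
    = m^2 * (2 * a2 \<eta> \<theta> * r^2 + 3 * m * a3 \<theta> * r^3 + 4 * m^2 * a4 \<theta> * r^4)"
proof -
  have "((\<lambda>x. of_real (m * x) * cis \<theta>) has_vector_derivative of_real m * cis \<theta>) (at r)"
    by (auto intro!: derivative_eq_intros simp: scaleR_conv_of_real has_vector_derivative_def)
  from has_derivative_along_curve[OF V_has_derivative[of \<eta>] this]
  have d1: "((\<lambda>x. V \<eta> (of_real (m * x) * cis \<theta>)) has_real_derivative dV \<eta> (of_real (m * r) * cis \<theta>) (of_real m * cis \<theta>)) (at r)" .
  have e: "V \<eta> (of_real (m * x) * cis \<theta>) = m^2 * (a2 \<eta> \<theta> * x^2 + m * a3 \<theta> * x^3 + m^2 * a4 \<theta> * x^4)" for x
    using m unfolding Svar_poly[OF m, symmetric] by (simp add: Svar_def)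
  have "((\<lambda>x. m^2 * (a2 \<eta> \<theta> * x^2 + m * a3 \<theta> * x^3 + m^2 * a4 \<theta> * x^4)) has_real_derivative
      m^2 * (2 * a2 \<eta> \<theta> * r + 3 * m * a3 \<theta> * r^2 + 4 * m^2 * a4 \<theta> * r^3)) (at r)"
    by (auto intro!: derivative_eq_intros simp: algebra_simps)
  from DERIV_unique[OF d1[unfolded e] this]
  have "dV \<eta> (of_real (m * r) * cis \<theta>) (of_real m * cis \<theta>)
      = m^2 * (2 * a2 \<eta> \<theta> * r + 3 * m * a3 \<theta> * r^2 + 4 * m^2 * a4 \<theta> * r^3)" .
  moreover have "of_real (m * r) * cis \<theta> = r *\<^sub>R (of_real m * cis \<theta>)" by (simp add: scaleR_conv_of_real)
  then have "dV \<eta> (of_real (m * r) * cis \<theta>) (of_real (m * r) * cis \<theta>)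
      = r * dV \<eta> (of_real (m * r) * cis \<theta>) (of_real m * cis \<theta>)"
    by (metis linear_cmul[OF linear_dV] real_scaleR_def)
  ultimately show ?thesis by (simp add: algebra_simps power2_eq_square power3_eq_cube power4_eq_xxxx)
qed

text \<open>\<open>s\<close> is the sign of \<open>\<eta>\<close>. As m tends to 0 the angle turns
  at rate \<open>\<omega>\<close>, the level obeys m^2 times a quadratic equation, and
  \<open>\<sigma>\<close> decays at a fixed rate. The coupling through \<open>Ga\<close> has the
  same order m^2 as the quadratic terms; it is not small here and is dealt with later by stretching
  \<open>\<sigma>\<close>.\<close>

lemma scaled_system:
  fixes s a b :: real
  assumes s: "s^2 = 1" and a: "0 < a"
  obtains Ga Gb Gc Qs Qd :: "real \<Rightarrow> real \<Rightarrow> real \<Rightarrow> real \<Rightarrow> real" and m0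
  where "0 < m0" "ul a b Ga" "ul a b Gb" "ul a b Gc" "ul a b Qs" "ul a b Qd"
    "\<And>m \<theta> r \<sigma>. ul_dom a b m0 m r \<sigma> \<Longrightarrow>
      \<omega> / 2 \<le> angv (s * m^2) (chart m \<theta> r \<sigma>) \<and> angv (s * m^2) (chart m \<theta> r \<sigma>) \<le> 2 * \<omega> \<and>
      Svar (s * m^2) m \<theta> r = r^2 + m * Qs m \<theta> r \<sigma> \<and>
      dV (s * m^2) (of_real (m * r) * cis \<theta>) (of_real (m * r) * cis \<theta>) = m^2 * (2 * r^2 + m * Qd m \<theta> r \<sigma>) \<and>
      R1 (s * m^2) m (chart m \<theta> r \<sigma>) = m^2 * ((2 * lc * (Svar (s * m^2) m \<theta> r)^2 + 2 * Re k1 * s * Svar (s * m^2) m \<theta> r) / \<omega>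
          + \<sigma> * Ga m \<theta> r \<sigma> + m * Gb m \<theta> r \<sigma>) \<and>
      R2 (s * m^2) m (chart m \<theta> r \<sigma>) = - (\<nu> / \<omega>) * \<sigma> + m * Gc m \<theta> r \<sigma>"
proof -
  \<comment> \<open>The correction of the angular speed divided by m; its \<open>\<eta>\<close>-part
    carries another factor m because \<open>K1\<close> has order one and \<open>Nl\<close> order
    two.\<close>
  define T where "T m \<theta> r \<sigma> = Im ((of_real (s * m) * rsc 1 K1 m \<theta> r \<sigma> + rsc 2 Nl m \<theta> r \<sigma>) * cnj (cis \<theta>)) * (1 / r)" for m \<theta> r \<sigma> :: real
  have ur: "ul a b (\<lambda>m \<theta> r \<sigma>. 1 / r)"
    by (rule ul_inverse[OF ul_r a, of 1]) (auto simp: ul_dom_def)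
  note ulr = ul_rescaled[OF lipo_G2] ul_rescaled[OF lipo_G5] ul_rescaled[OF lipo_H1] ul_rescaled[OF lipo_H3]
    ul_rescaled[OF lipo_Q2] ul_rescaled[OF D1] ul_rescaled[OF D3] ul_rescaled[OF K2] ul_rescaled[OF lipo_K1] ul_rescaled[OF lipo_Nl]
  have uT: "ul a b T" unfolding T_def[abs_def]
    by (intro ul_mult ul_Im ul_add ul_of_real ul_const ul_m ul_cnj ul_cis ulr ur) simp_all
  define c2 where "c2 \<theta> = 2 * Re (ce * cis \<theta>^2)" for \<theta>
  have uc: "ul a b (\<lambda>m \<theta> r \<sigma>. c2 \<theta>)" "ul a b (\<lambda>m \<theta> r \<sigma>. a3 \<theta>)" "ul a b (\<lambda>m \<theta> r \<sigma>. a4 \<theta>)"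
    unfolding c2_def a3_def a4_def by (intro ul_mult ul_Re ul_add ul_const ul_power ul_cnj ul_cis)+
  define Qs where "Qs m \<theta> r \<sigma> = s * m * c2 \<theta> * r^2 + a3 \<theta> * r^3 + m * a4 \<theta> * r^4" for m \<theta> r \<sigma> :: real
  have uQs: "ul a b Qs" unfolding Qs_def[abs_def]
    by (intro ul_add ul_mult ul_const ul_m ul_power ul_r uc)
  define Qd where "Qd m \<theta> r \<sigma> = 2 * s * m * c2 \<theta> * r^2 + 3 * a3 \<theta> * r^3 + 4 * m * a4 \<theta> * r^4" for m \<theta> r \<sigma> :: real
  have uQd: "ul a b Qd" unfolding Qd_def[abs_def]
    by (intro ul_add ul_mult ul_const ul_m ul_power ul_r uc)
  have a2: "a2 (s * m^2) \<theta> = 1 + s * m^2 * c2 \<theta>" for m \<theta> by (simp add: a2_def c2_def)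
  have Sv: "Svar (s * m^2) m \<theta> r = r^2 + m * Qs m \<theta> r \<sigma>" if "0 < m" for m \<theta> r \<sigma>
    unfolding Svar_poly[OF that] a2 Qs_def by (simp add: algebra_simps power2_eq_square)
  have rad: "dV (s * m^2) (of_real (m * r) * cis \<theta>) (of_real (m * r) * cis \<theta>) = m^2 * (2 * r^2 + m * Qd m \<theta> r \<sigma>)" if "0 < m" for m \<theta> r \<sigma>
    unfolding radial_derivative[OF that] a2 Qd_def by (simp add: algebra_simps power2_eq_square)
  define Th where "Th m \<theta> r \<sigma> = \<omega> + m * T m \<theta> r \<sigma>" for m \<theta> r \<sigma>
  have ang: "angv (s * m^2) (chart m \<theta> r \<sigma>) = Th m \<theta> r \<sigma>" if "0 < m" "0 < r" for m \<theta> r \<sigma>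
  proof -
    define n where "n = of_real (s * m) * rsc 1 K1 m \<theta> r \<sigma> + rsc 2 Nl m \<theta> r \<sigma>"
    have "Z (F (s * m^2) (P + chart m \<theta> r \<sigma>)) = J * (of_real (m * r) * cis \<theta>) + of_real (s * m^2) * K1 (chart m \<theta> r \<sigma>) + Nl (chart m \<theta> r \<sigma>)"
      unfolding Z_field Nl_def Z_chart by simp
    also have "K1 (chart m \<theta> r \<sigma>) = of_real m * rsc 1 K1 m \<theta> r \<sigma>"
      using rsc_eq[OF that(1), of K1 \<theta> r \<sigma> 1] by (simp add: scaleR_conv_of_real)
    also have "Nl (chart m \<theta> r \<sigma>) = of_real (m^2) * rsc 2 Nl m \<theta> r \<sigma>"
      using rsc_eq[OF that(1), of Nl \<theta> r \<sigma> 2] by (simp add: scaleR_conv_of_real)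
    finally have e: "Z (F (s * m^2) (P + chart m \<theta> r \<sigma>)) = J * (of_real (m * r) * cis \<theta>) + of_real (m^2) * n"
      by (simp add: n_def algebra_simps power2_eq_square)
    have "of_real (m^2) * n / (of_real (m * r) * cis \<theta>) = of_real (m * (1 / r)) * (n * cnj (cis \<theta>))"
      using that by (simp add: field_simps power2_eq_square cis_cnj cis_mult)
    then have eq: "Z (F (s * m^2) (P + chart m \<theta> r \<sigma>)) / Z (chart m \<theta> r \<sigma>) = J + of_real (m * (1 / r)) * (n * cnj (cis \<theta>))"
      unfolding e Z_chart using that by (simp add: add_divide_distrib)
    have gen: "Im (J + of_real k * w) = \<omega> + k * Im w" for k w by simp
    show ?thesis
      unfolding angv_def eq gen Th_def T_def n_def[symmetric] by simp
  qed
  obtain C m1 where C: "0 < C" "0 < m1" "\<And>m \<theta> r \<sigma>. ul_dom a b m1 m r \<sigma> \<Longrightarrow> norm (T m \<theta> r \<sigma>) \<le> C"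
    by (rule ul_bound_pair[OF uT uT]) blast
  \<comment> \<open>Keeps the correction of the angular speed below half of
    \<open>\<omega>\<close>.\<close>
  define m0 where "m0 = min m1 (\<omega> / (2 * C))"
  have m0: "0 < m0" "m0 \<le> m1" "m0 \<le> \<omega> / (2 * C)" using C \<omega> by (auto simp: m0_def)
  have Thb: "\<omega> / 2 \<le> Th m \<theta> r \<sigma>" "Th m \<theta> r \<sigma> \<le> 2 * \<omega>" if d: "ul_dom a b m0 m r \<sigma>" for m \<theta> r \<sigma>
  proof -
    have m: "0 < m" "m \<le> \<omega> / (2 * C)" using d m0 by (auto simp: ul_dom_def)
    have "\<bar>m * T m \<theta> r \<sigma>\<bar> \<le> m * C"
      using C(3)[OF ul_dom_mono[OF d m0(2)], of \<theta>] m by (simp add: abs_mult mult_left_mono)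
    also have "\<dots> \<le> \<omega> / 2" using m C by (simp add: field_simps)
    finally show "\<omega> / 2 \<le> Th m \<theta> r \<sigma>" "Th m \<theta> r \<sigma> \<le> 2 * \<omega>" using \<omega> unfolding Th_def by linarith+
  qed
  have uTh: "ul a b Th" unfolding Th_def[abs_def] by (intro ul_add ul_mult ul_const ul_m uT)
  define I where "I m \<theta> r \<sigma> = 1 / Th m \<theta> r \<sigma>" for m \<theta> r \<sigma>
  have uI: "ul a b I" unfolding I_def[abs_def]
    by (rule ul_inverse[of a b Th "\<omega> / 2" m0, OF uTh _ m0(1) Thb(1)]) (use \<omega> in auto)
  define S where "S m \<theta> r \<sigma> = Svar (s * m^2) m \<theta> r" for m \<theta> r \<sigma> :: real
  define S' where "S' m \<theta> r \<sigma> = r^2 + m * Qs m \<theta> r \<sigma>" for m \<theta> r \<sigma>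
  have uS: "ul a b S'" unfolding S'_def[abs_def] by (intro ul_add ul_power ul_r ul_mult ul_m uQs)
  define gS where "gS m \<theta> r \<sigma> = 2 * lc * (S' m \<theta> r \<sigma>)^2 + 2 * Re k1 * s * S' m \<theta> r \<sigma>" for m \<theta> r \<sigma>
  have ug: "ul a b gS" unfolding gS_def[abs_def] by (intro ul_add ul_mult ul_const ul_power uS)
  \<comment> \<open>The last bracket appears because the leading terms are polynomials in r, while
    the equation is written in the level: r^2 equals the level minus \<open>m * Qs\<close>, and the
    difference is of order m.\<close>
  define Ra where "Ra m \<theta> r \<sigma> = rsc 5 G5 m \<theta> r \<sigma> + s * \<sigma> * rsc 1 H1 m \<theta> r \<sigma> + s * rsc 3 H3 m \<theta> r \<sigma> + m * rsc 2 Q2 m \<theta> r \<sigma>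
     + (2 * lc * (m * (Qs m \<theta> r \<sigma>)^2 - 2 * S' m \<theta> r \<sigma> * Qs m \<theta> r \<sigma>) - 2 * Re k1 * s * Qs m \<theta> r \<sigma>)" for m \<theta> r \<sigma>
  have uRa: "ul a b Ra" unfolding Ra_def[abs_def]
    by (intro ul_add ul_diff ul_mult ul_const ul_m ul_\<sigma> ul_power ulr uQs uS) simp_all
  define Rc where "Rc m \<theta> r \<sigma> = \<sigma> * rsc 1 D1 m \<theta> r \<sigma> + rsc 3 D3 m \<theta> r \<sigma> + s * rsc 1 K2 m \<theta> r \<sigma>" for m \<theta> r \<sigma>
  have uRc: "ul a b Rc" unfolding Rc_def[abs_def]
    by (intro ul_add ul_mult ul_const ul_\<sigma> ulr) simp_all
  define Ga where "Ga m \<theta> r \<sigma> = rsc 2 G2 m \<theta> r \<sigma> * I m \<theta> r \<sigma>" for m \<theta> r \<sigma>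
  define Gb where "Gb m \<theta> r \<sigma> = Ra m \<theta> r \<sigma> * I m \<theta> r \<sigma> - gS m \<theta> r \<sigma> * T m \<theta> r \<sigma> * I m \<theta> r \<sigma> * (1 / \<omega>)" for m \<theta> r \<sigma>
  define Gc where "Gc m \<theta> r \<sigma> = Rc m \<theta> r \<sigma> * I m \<theta> r \<sigma> + \<nu> * \<sigma> * T m \<theta> r \<sigma> * I m \<theta> r \<sigma> * (1 / \<omega>)" for m \<theta> r \<sigma>
  have u3: "ul a b Ga" "ul a b Gb" "ul a b Gc"
    unfolding Ga_def[abs_def] Gb_def[abs_def] Gc_def[abs_def]
    by (intro ul_add ul_diff ul_mult ul_const ul_\<sigma> ulr uRa uI ug uT uRc; simp)+
  show ?thesis
  proof (rule that[OF m0(1) u3 uQs uQd])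
    fix m \<theta> r \<sigma> assume d: "ul_dom a b m0 m r \<sigma>"
    have m: "0 < m" and r: "0 < r" using d a by (auto simp: ul_dom_def)
    define q where "q = chart m \<theta> r \<sigma>"
    have Th: "Th m \<theta> r \<sigma> \<noteq> 0" using Thb(1)[OF d, of \<theta>] \<omega> by linarith
    \<comment> \<open>Splits the reciprocal of the angular speed into its limit and a term of order
      m, so that the leading part of both rates has constant coefficients.\<close>
    have Ieq: "I m \<theta> r \<sigma> = 1 / \<omega> - m * T m \<theta> r \<sigma> * I m \<theta> r \<sigma> * (1 / \<omega>)"
    proof -
      have "I m \<theta> r \<sigma> * Th m \<theta> r \<sigma> = 1" using Th by (simp add: I_def)
      then have "I m \<theta> r \<sigma> * \<omega> = 1 - m * T m \<theta> r \<sigma> * I m \<theta> r \<sigma>" by (simp add: Th_def algebra_simps)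
      then have "I m \<theta> r \<sigma> = (1 - m * T m \<theta> r \<sigma> * I m \<theta> r \<sigma>) / \<omega>" using \<omega> by (simp add: field_simps)
      then show ?thesis by (simp add: diff_divide_distrib)
    qed
    have S': "Svar (s * m^2) m \<theta> r = S' m \<theta> r \<sigma>" unfolding S'_def by (rule Sv[OF m])
    have nz: "norm (Z q) = m * r" using m r by (simp add: q_def norm_mult)
    have e1: "G2 q = m^2 * rsc 2 G2 m \<theta> r \<sigma>" "G5 q = m^5 * rsc 5 G5 m \<theta> r \<sigma>" "H1 q = m * rsc 1 H1 m \<theta> r \<sigma>"
      "H3 q = m^3 * rsc 3 H3 m \<theta> r \<sigma>" "Q2 q = m^2 * rsc 2 Q2 m \<theta> r \<sigma>" "D1 q = m * rsc 1 D1 m \<theta> r \<sigma>"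
      "D3 q = m^3 * rsc 3 D3 m \<theta> r \<sigma>" "K2 q = m * rsc 1 K2 m \<theta> r \<sigma>"
      using rsc_eq[OF m, of G2 \<theta> r \<sigma> 2] rsc_eq[OF m, of G5 \<theta> r \<sigma> 5] rsc_eq[OF m, of H1 \<theta> r \<sigma> 1]
        rsc_eq[OF m, of H3 \<theta> r \<sigma> 3] rsc_eq[OF m, of Q2 \<theta> r \<sigma> 2] rsc_eq[OF m, of D1 \<theta> r \<sigma> 1]
        rsc_eq[OF m, of D3 \<theta> r \<sigma> 3] rsc_eq[OF m, of K2 \<theta> r \<sigma> 1] by (simp_all add: q_def)
    have Xq: "X q = m^2 * \<sigma>" by (simp add: q_def)
    have s2: "(s * m^2)^2 = m^4" using s by (simp add: power_mult_distrib)
    have r2: "r^2 = S' m \<theta> r \<sigma> - m * Qs m \<theta> r \<sigma>" by (simp add: S'_def)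
    have r4: "r^4 = (S' m \<theta> r \<sigma> - m * Qs m \<theta> r \<sigma>)^2" unfolding r2[symmetric] by simp
    have "dV (s * m^2) (Z q) (Z (F (s * m^2) (P + q))) = m^4 * (2 * lc * r^4 + 2 * Re k1 * s * r^2 + \<sigma> * rsc 2 G2 m \<theta> r \<sigma>
        + m * (rsc 5 G5 m \<theta> r \<sigma> + s * \<sigma> * rsc 1 H1 m \<theta> r \<sigma> + s * rsc 3 H3 m \<theta> r \<sigma> + m * rsc 2 Q2 m \<theta> r \<sigma>))"
      unfolding V_field nz s2 unfolding e1 Xq
      by (simp add: power_mult_distrib) (simp add: algebra_simps numeral_eq_Suc)
    also have "\<dots> = m^4 * (gS m \<theta> r \<sigma> + \<sigma> * rsc 2 G2 m \<theta> r \<sigma> + m * Ra m \<theta> r \<sigma>)"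
      unfolding r2 r4 gS_def Ra_def by (simp add: algebra_simps power2_eq_square)
    finally have dV: "dV (s * m^2) (Z q) (Z (F (s * m^2) (P + q))) = m^4 * (gS m \<theta> r \<sigma> + \<sigma> * rsc 2 G2 m \<theta> r \<sigma> + m * Ra m \<theta> r \<sigma>)" .
    have "R1 (s * m^2) m q = m^2 * ((gS m \<theta> r \<sigma> + \<sigma> * rsc 2 G2 m \<theta> r \<sigma> + m * Ra m \<theta> r \<sigma>) * I m \<theta> r \<sigma>)"
      unfolding R1_def dV unfolding q_def ang[OF m r] I_def using m
      by (simp add: power2_eq_square power4_eq_xxxx)
    also have "(gS m \<theta> r \<sigma> + \<sigma> * rsc 2 G2 m \<theta> r \<sigma> + m * Ra m \<theta> r \<sigma>) * I m \<theta> r \<sigma>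
        = gS m \<theta> r \<sigma> * I m \<theta> r \<sigma> + \<sigma> * Ga m \<theta> r \<sigma> + m * (Ra m \<theta> r \<sigma> * I m \<theta> r \<sigma>)"
      unfolding Ga_def by (simp only: distrib_right mult.assoc)
    also have "gS m \<theta> r \<sigma> * I m \<theta> r \<sigma> = gS m \<theta> r \<sigma> / \<omega> - m * (gS m \<theta> r \<sigma> * T m \<theta> r \<sigma> * I m \<theta> r \<sigma> * (1 / \<omega>))"
      by (subst Ieq) (simp add: algebra_simps)
    finally have R1: "R1 (s * m^2) m q = m^2 * (gS m \<theta> r \<sigma> / \<omega> + \<sigma> * Ga m \<theta> r \<sigma> + m * Gb m \<theta> r \<sigma>)"
      unfolding Gb_def by (simp add: algebra_simps)
    have dX: "W (F (s * m^2) (P + q)) - dh (Z q) (Z (F (s * m^2) (P + q))) = m^2 * (- \<nu> * \<sigma> + m * Rc m \<theta> r \<sigma>)"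
      unfolding X_field unfolding e1 Xq Rc_def by (simp add: algebra_simps power2_eq_square power3_eq_cube)
    have "R2 (s * m^2) m q = (- \<nu> * \<sigma> + m * Rc m \<theta> r \<sigma>) * I m \<theta> r \<sigma>"
      unfolding R2_def dX unfolding q_def ang[OF m r] I_def using m by simp
    also have "\<dots> = - \<nu> * \<sigma> * I m \<theta> r \<sigma> + m * (Rc m \<theta> r \<sigma> * I m \<theta> r \<sigma>)" by (simp only: distrib_right mult.assoc)
    also have "- \<nu> * \<sigma> * I m \<theta> r \<sigma> = - (\<nu> / \<omega>) * \<sigma> + m * (\<nu> * \<sigma> * T m \<theta> r \<sigma> * I m \<theta> r \<sigma> * (1 / \<omega>))"
      by (subst Ieq) (simp add: algebra_simps)
    finally have R2: "R2 (s * m^2) m q = - (\<nu> / \<omega>) * \<sigma> + m * Gc m \<theta> r \<sigma>"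
      unfolding Gc_def by (simp add: algebra_simps)
    show "\<omega> / 2 \<le> angv (s * m^2) (chart m \<theta> r \<sigma>) \<and> angv (s * m^2) (chart m \<theta> r \<sigma>) \<le> 2 * \<omega> \<and>
      Svar (s * m^2) m \<theta> r = r^2 + m * Qs m \<theta> r \<sigma> \<and>
      dV (s * m^2) (of_real (m * r) * cis \<theta>) (of_real (m * r) * cis \<theta>) = m^2 * (2 * r^2 + m * Qd m \<theta> r \<sigma>) \<and>
      R1 (s * m^2) m (chart m \<theta> r \<sigma>) = m^2 * ((2 * lc * (Svar (s * m^2) m \<theta> r)^2 + 2 * Re k1 * s * Svar (s * m^2) m \<theta> r) / \<omega>
          + \<sigma> * Ga m \<theta> r \<sigma> + m * Gb m \<theta> r \<sigma>) \<and>
      R2 (s * m^2) m (chart m \<theta> r \<sigma>) = - (\<nu> / \<omega>) * \<sigma> + m * Gc m \<theta> r \<sigma>"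
      unfolding ang[OF m r] unfolding q_def[symmetric] using R1 R2
      by (intro conjI Thb[OF d] Sv[OF m] rad[OF m]) (simp_all only: gS_def S')
  qed
qed

text \<open>\<open>S0\<close> is the nonzero equilibrium of the limiting equation for the level; the
  sign condition makes it positive. Linearising there gives the radial rate, whose sign is that of
  \<open>lc\<close>, and every remaining term is made small compared with the rate of its own
  equation.\<close>

lemma branch_orbit:
  fixes s R :: real
  assumes s: "s^2 = 1" and lc: "lc \<noteq> 0" and sgn: "Re k1 * s * lc < 0" and R: "0 < R"
  obtains m0 where "0 < m0" "\<And>m. 0 < m \<Longrightarrow> m \<le> m0 \<Longrightarrow> \<exists>\<gamma>. periodic_solution (F (s * m^2)) \<gamma> \<and> range \<gamma> \<subseteq> ball P R \<and>
      (lc < 0 \<longrightarrow> orbit_asym_stable (F (s * m^2)) (range \<gamma>)) \<and> (0 < lc \<longrightarrow> \<not> orbit_stable (F (s * m^2)) (range \<gamma>))"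
proof -
  define S0 where "S0 = - (Re k1 * s) / lc"
  have S0: "0 < S0" unfolding S0_def using sgn lc by (cases "0 < lc") (auto simp: divide_simps mult_less_0_iff)
  have aS: "Re k1 * s = - lc * S0" using lc by (simp add: S0_def)
  define ra where "ra = sqrt S0 / 2"
  define rb where "rb = 2 * sqrt S0"
  have ra: "0 < ra" "ra \<le> rb" "ra^2 = S0 / 4" "rb^2 = 4 * S0" using S0 by (auto simp: ra_def rb_def power_divide power_mult_distrib)
  obtain Ga Gb Gc Qs Qd :: "real \<Rightarrow> real \<Rightarrow> real \<Rightarrow> real \<Rightarrow> real" and m1
  where m1: "0 < m1" and uls: "ul ra rb Ga" "ul ra rb Gb" "ul ra rb Gc" "ul ra rb Qs" "ul ra rb Qd"
    and sys: "\<And>m \<theta> r \<sigma>. ul_dom ra rb m1 m r \<sigma> \<Longrightarrow>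
      \<omega> / 2 \<le> angv (s * m^2) (chart m \<theta> r \<sigma>) \<and> angv (s * m^2) (chart m \<theta> r \<sigma>) \<le> 2 * \<omega> \<and>
      Svar (s * m^2) m \<theta> r = r^2 + m * Qs m \<theta> r \<sigma> \<and>
      dV (s * m^2) (of_real (m * r) * cis \<theta>) (of_real (m * r) * cis \<theta>) = m^2 * (2 * r^2 + m * Qd m \<theta> r \<sigma>) \<and>
      R1 (s * m^2) m (chart m \<theta> r \<sigma>) = m^2 * ((2 * lc * (Svar (s * m^2) m \<theta> r)^2 + 2 * Re k1 * s * Svar (s * m^2) m \<theta> r) / \<omega>
          + \<sigma> * Ga m \<theta> r \<sigma> + m * Gb m \<theta> r \<sigma>) \<and>
      R2 (s * m^2) m (chart m \<theta> r \<sigma>) = - (\<nu> / \<omega>) * \<sigma> + m * Gc m \<theta> r \<sigma>"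
    by (rule scaled_system[where b = rb, OF s ra(1)], rule that, assumption+)
  \<comment> \<open>The five coefficient functions come with separate constants; one bound and one
    range of m for all of them are obtained by induction on the finite set.\<close>
  have common: "\<exists>C m0. 0 < C \<and> 0 < m0 \<and> (\<forall>G\<in>A. (\<forall>m \<theta> r \<sigma>. ul_dom ra rb m0 m r \<sigma> \<longrightarrow> \<bar>G m \<theta> r \<sigma>\<bar> \<le> C) \<and>
     (\<forall>m \<theta> r \<sigma> r' \<sigma>'. ul_dom ra rb m0 m r \<sigma> \<longrightarrow> ul_dom ra rb m0 m r' \<sigma>' \<longrightarrow> \<bar>G m \<theta> r \<sigma> - G m \<theta> r' \<sigma>'\<bar> \<le> C * (\<bar>r - r'\<bar> + \<bar>\<sigma> - \<sigma>'\<bar>)))"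
    if "finite A" "\<And>G. G \<in> A \<Longrightarrow> ul ra rb G" for A :: "(real \<Rightarrow> real \<Rightarrow> real \<Rightarrow> real \<Rightarrow> real) set"
    using that
  proof (induction A rule: finite_induct)
    case empty show ?case by (intro exI[of _ 1]) auto
  next
    case (insert G A)
    obtain C m0 where C: "0 < C" "0 < m0" "\<And>G m \<theta> r \<sigma>. G \<in> A \<Longrightarrow> ul_dom ra rb m0 m r \<sigma> \<Longrightarrow> \<bar>G m \<theta> r \<sigma>\<bar> \<le> C"
      "\<And>G m \<theta> r \<sigma> r' \<sigma>'. G \<in> A \<Longrightarrow> ul_dom ra rb m0 m r \<sigma> \<Longrightarrow> ul_dom ra rb m0 m r' \<sigma>' \<Longrightarrow> \<bar>G m \<theta> r \<sigma> - G m \<theta> r' \<sigma>'\<bar> \<le> C * (\<bar>r - r'\<bar> + \<bar>\<sigma> - \<sigma>'\<bar>)"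
    proof -
      have "\<exists>C m0. 0 < C \<and> 0 < m0 \<and> (\<forall>G\<in>A. (\<forall>m \<theta> r \<sigma>. ul_dom ra rb m0 m r \<sigma> \<longrightarrow> \<bar>G m \<theta> r \<sigma>\<bar> \<le> C) \<and>
       (\<forall>m \<theta> r \<sigma> r' \<sigma>'. ul_dom ra rb m0 m r \<sigma> \<longrightarrow> ul_dom ra rb m0 m r' \<sigma>' \<longrightarrow> \<bar>G m \<theta> r \<sigma> - G m \<theta> r' \<sigma>'\<bar> \<le> C * (\<bar>r - r'\<bar> + \<bar>\<sigma> - \<sigma>'\<bar>)))"
        by (rule insert.IH) (rule insert.prems, simp)
      then show ?thesis using that by auto
    qed
    obtain D m2 where D: "0 \<le> D" "0 < m2" "\<And>m \<theta> r \<sigma>. ul_dom ra rb m2 m r \<sigma> \<Longrightarrow> norm (G m \<theta> r \<sigma>) \<le> D"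
      "\<And>m \<theta> r \<sigma> r' \<sigma>'. ul_dom ra rb m2 m r \<sigma> \<Longrightarrow> ul_dom ra rb m2 m r' \<sigma>' \<Longrightarrow>
        norm (G m \<theta> r \<sigma> - G m \<theta> r' \<sigma>') \<le> D * (\<bar>r - r'\<bar> + \<bar>\<sigma> - \<sigma>'\<bar>)" using ulE[OF insert.prems[OF insertI1]] by blast
    have le: "C * e \<le> (C + D) * e" "D * e \<le> (C + D) * e" if "0 \<le> e" for e
      using that C(1) D(1) by (auto intro: mult_right_mono)
    have d: "ul_dom ra rb m0 m r \<sigma>" "ul_dom ra rb m2 m r \<sigma>" if "ul_dom ra rb (min m0 m2) m r \<sigma>" for m r \<sigma>
      using that by (auto simp: ul_dom_def)
    show ?case
    proof (rule exI[of _ "C + D"], rule exI[of _ "min m0 m2"], intro conjI ballI allI impI)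
      fix H m \<theta> r \<sigma> assume H: "H \<in> insert G A" and dom: "ul_dom ra rb (min m0 m2) m r \<sigma>"
      show "\<bar>H m \<theta> r \<sigma>\<bar> \<le> C + D"
        using H C(3)[OF _ d(1)[OF dom], of H \<theta>] D(3)[OF d(2)[OF dom], of \<theta>] C(1) D(1) by force
      fix r' \<sigma>' assume dom': "ul_dom ra rb (min m0 m2) m r' \<sigma>'"
      define e where "e = \<bar>r - r'\<bar> + \<bar>\<sigma> - \<sigma>'\<bar>"
      have e: "0 \<le> e" by (simp add: e_def)
      have "\<bar>H m \<theta> r \<sigma> - H m \<theta> r' \<sigma>'\<bar> \<le> C * e \<or> \<bar>H m \<theta> r \<sigma> - H m \<theta> r' \<sigma>'\<bar> \<le> D * e"
        using H C(4)[OF _ d(1)[OF dom] d(1)[OF dom'], of H \<theta>] D(4)[OF d(2)[OF dom] d(2)[OF dom'], of \<theta>] by (auto simp: e_def)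
      then show "\<bar>H m \<theta> r \<sigma> - H m \<theta> r' \<sigma>'\<bar> \<le> (C + D) * (\<bar>r - r'\<bar> + \<bar>\<sigma> - \<sigma>'\<bar>)"
        unfolding e_def[symmetric] using le[OF e] by linarith
    qed (use C D in auto)
  qed
  define GG where "GG = {Ga, Gb, Gc, Qs, Qd}"
  have "\<exists>C m0. 0 < C \<and> 0 < m0 \<and> (\<forall>G\<in>GG. (\<forall>m \<theta> r \<sigma>. ul_dom ra rb m0 m r \<sigma> \<longrightarrow> \<bar>G m \<theta> r \<sigma>\<bar> \<le> C) \<and>
     (\<forall>m \<theta> r \<sigma> r' \<sigma>'. ul_dom ra rb m0 m r \<sigma> \<longrightarrow> ul_dom ra rb m0 m r' \<sigma>' \<longrightarrow> \<bar>G m \<theta> r \<sigma> - G m \<theta> r' \<sigma>'\<bar> \<le> C * (\<bar>r - r'\<bar> + \<bar>\<sigma> - \<sigma>'\<bar>)))"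
    by (rule common) (use uls in \<open>auto simp: GG_def\<close>)
  then obtain C m2 where C: "0 < C" "0 < m2" and bd0: "\<And>G m \<theta> r \<sigma>. G \<in> GG \<Longrightarrow> ul_dom ra rb m2 m r \<sigma> \<Longrightarrow> \<bar>G m \<theta> r \<sigma>\<bar> \<le> C"
    and lp0: "\<And>G m \<theta> r \<sigma> r' \<sigma>'. G \<in> GG \<Longrightarrow> ul_dom ra rb m2 m r \<sigma> \<Longrightarrow> ul_dom ra rb m2 m r' \<sigma>' \<Longrightarrow>
        \<bar>G m \<theta> r \<sigma> - G m \<theta> r' \<sigma>'\<bar> \<le> C * (\<bar>r - r'\<bar> + \<bar>\<sigma> - \<sigma>'\<bar>)"
    by auto
  note bd = bd0[unfolded GG_def] and lp = lp0[unfolded GG_def]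
  obtain B m3 where B: "0 < B" "0 < m3" "\<And>m \<theta> r \<sigma>. ul_dom ra rb m3 m r \<sigma> \<Longrightarrow> norm (chart0 m \<theta> r \<sigma>) \<le> B"
    by (rule ul_bound_pair[OF ul_chart0 ul_chart0]) blast
  \<comment> \<open>The derivative of the limiting level equation at \<open>S0\<close>, up to the
    factor m^2.\<close>
  define kk where "kk = 2 * lc * S0 / \<omega>"
  have kk: "kk \<noteq> 0" "\<bar>kk\<bar> = 2 * \<bar>lc\<bar> * S0 / \<omega>" using lc S0 \<omega> by (auto simp: kk_def abs_mult)
  have kkp: "0 < \<bar>kk\<bar>" using kk(1) by simp
  define ir where "ir = 1 / ra"
  have ir: "0 < ir" using ra by (simp add: ir_def)
  \<comment> \<open>On this range the quadratic term of the level equation has Lipschitz constant at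
    most |kk|/16; the deviation also stays well inside the annulus.\<close>
  define \<rho> where "\<rho> = min 1 (S0 / 32)"
  have \<rho>: "0 < \<rho>" "\<rho> \<le> 1" "\<rho> \<le> S0 / 32" using S0 by (auto simp: \<rho>_def)
  \<comment> \<open>The stretching of \<open>\<sigma>\<close> that tames \<open>Ga\<close>: in terms
    of \<open>K * \<sigma>\<close> its coefficient is divided by \<open>K\<close>. The factor 2 + ir
    adds the variation of \<open>\<sigma>\<close> to that of \<open>Ga\<close>, whose radius change
    costs \<open>ir\<close>.\<close>
  define K where "K = 1 + 16 * C * (2 + ir) / \<bar>kk\<bar>"
  have Kp: "0 < 16 * C * (2 + ir) / \<bar>kk\<bar>" using C ir kkp by (intro divide_pos_pos mult_pos_pos) auto
  have K: "1 \<le> K" unfolding K_def using Kp by linarith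
  have K0: "0 < K" using K by linarith
  have CK: "C * (2 + ir) / K \<le> \<bar>kk\<bar> / 16"
  proof -
    have "16 * C * (2 + ir) / \<bar>kk\<bar> \<le> K" by (simp add: K_def)
    then have "16 * C * (2 + ir) \<le> K * \<bar>kk\<bar>" using kkp by (simp add: pos_divide_le_eq)
    then show ?thesis using K0 by (simp add: field_simps)
  qed
  \<comment> \<open>One constant above all factors that get multiplied by m; \<open>m * E\<close> at
    most \<open>lim\<close> then enforces every smallness condition at once.\<close>
  define E where "E = (ir + 1) * C * K + C * K + C + C * (ir + 1)"
  have E: "0 < E" "C \<le> E" "C * (ir + 1) \<le> E" "K * C * (ir + 1) \<le> E" "K * C \<le> E"
    using C K0 ir by (auto simp: E_def mult_ac add_pos_pos intro!: add_nonneg_nonneg add_increasing add_increasing2 mult_nonneg_nonneg)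
  \<comment> \<open>The entries serve injectivity in the radius, the end values of the annulus, the
    Lipschitz bounds of the two equations, the two residuals at the centre of the ball, and
    positivity of the radial derivative.\<close>
  define lim where "lim = Min {ra, S0 / 8, \<bar>kk\<bar> / 16, \<nu> / (4 * \<omega>), \<bar>kk\<bar> * (3/8 * \<rho>), \<nu> / \<omega> * (3/8 * \<rho>), ra^2}"
  have "0 < \<nu> / (4 * \<omega>)" "0 < \<bar>kk\<bar> * (3/8 * \<rho>)" "0 < \<nu> / \<omega> * (3/8 * \<rho>)" "0 < ra^2" "0 < S0 / 8" "0 < \<bar>kk\<bar> / 16"
    using kkp \<nu> \<omega> \<rho>(1) ra(1) S0 by simp_all
  then have lim0: "0 < lim" unfolding lim_def using ra(1) by simp
  have lim: "0 < lim" "lim \<le> ra" "lim \<le> S0 / 8" "lim \<le> \<bar>kk\<bar> / 16" "lim \<le> \<nu> / (4 * \<omega>)"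
    "lim \<le> \<bar>kk\<bar> * (3/8 * \<rho>)" "lim \<le> \<nu> / \<omega> * (3/8 * \<rho>)" "lim \<le> ra^2"
    by (rule lim0) (unfold lim_def, (rule Min_le, simp, blast)+)
  define m0 where "m0 = Min {m1, m2, m3, lim / E, R / (2 * B), 1 / (2 * B)}"
  have "0 < lim / E" "0 < R / (2 * B)" "0 < 1 / (2 * B)" using lim0 E(1) R B(1) by simp_all
  then have m00: "0 < m0" unfolding m0_def using m1 C(2) B(2) by simp
  have m0: "0 < m0" "m0 \<le> m1" "m0 \<le> m2" "m0 \<le> m3" "m0 \<le> lim / E" "m0 \<le> R / (2 * B)" "m0 \<le> 1 / (2 * B)"
    by (rule m00) (unfold m0_def, (rule Min_le, simp, blast)+)
  show ?thesis
  proof (rule that[OF m0(1)])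
    fix m :: real assume m: "0 < m" "m \<le> m0"
    define \<eta> where "\<eta> = s * m^2"
    have mE: "m * E \<le> lim" 
    proof -
      have "m * E \<le> (lim / E) * E" using m m0(5) E(1) by (intro mult_right_mono) auto
      then show ?thesis using E(1) by simp
    qed
    have mc: "m * c \<le> lim" if "c \<le> E" for c using mult_left_mono[OF that, of m] m mE by linarith
    have dom: "ul_dom ra rb m1 m r \<sigma>" "ul_dom ra rb m2 m r \<sigma>" "ul_dom ra rb m3 m r \<sigma>" if "r \<in> {ra..rb}" "\<bar>K * \<sigma>\<bar> \<le> \<rho>" for r \<sigma>
    proof -
      have "K * \<bar>\<sigma>\<bar> \<le> \<rho>" using that(2) K0 by (simp add: abs_mult)
      moreover have "1 * \<bar>\<sigma>\<bar> \<le> K * \<bar>\<sigma>\<bar>" using K by (intro mult_right_mono) auto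
      ultimately have "\<bar>\<sigma>\<bar> \<le> 1" using \<rho> by linarith
      then show "ul_dom ra rb m1 m r \<sigma>" "ul_dom ra rb m2 m r \<sigma>" "ul_dom ra rb m3 m r \<sigma>"
        using that(1) m m0 by (auto simp: ul_dom_def)
    qed
    have z0: "\<bar>K * 0\<bar> \<le> \<rho>" using \<rho> by simp
    define S where "S \<theta> r = Svar \<eta> m \<theta> r" for \<theta> r
    have Seq: "S \<theta> r = r^2 + m * Qs m \<theta> r 0" if "r \<in> {ra..rb}" for \<theta> r
      using sys[OF dom(1)[OF that z0], of \<theta>] by (simp add: S_def \<eta>_def)
    have Qb: "\<bar>m * Qs m \<theta> r 0\<bar> \<le> lim" if "r \<in> {ra..rb}" for \<theta> r
    proof -
      have "\<bar>m * Qs m \<theta> r 0\<bar> \<le> m * C" using bd[OF _ dom(2)[OF that z0], of Qs \<theta>] m by (simp add: abs_mult mult_left_mono)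
      then show ?thesis using mc[OF E(2)] by linarith
    qed
    have rab: "ra \<in> {ra..rb}" "rb \<in> {ra..rb}" using ra by auto
    have inj: "ra * \<bar>r - r'\<bar> \<le> \<bar>S \<theta> r - S \<theta> r'\<bar>" if "r \<in> {ra..rb}" "r' \<in> {ra..rb}" for \<theta> r r'
    proof -
      have "\<bar>m * (Qs m \<theta> r 0 - Qs m \<theta> r' 0)\<bar> \<le> m * (C * \<bar>r - r'\<bar>)"
        using lp[OF _ dom(2)[OF that(1) z0] dom(2)[OF that(2) z0], of Qs \<theta>] m by (simp add: abs_mult mult_left_mono)
      also have "\<dots> = (m * C) * \<bar>r - r'\<bar>" by simp
      also have "\<dots> \<le> ra * \<bar>r - r'\<bar>" using mc[OF E(2)] lim by (intro mult_right_mono) auto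
      finally have 1: "\<bar>m * (Qs m \<theta> r 0 - Qs m \<theta> r' 0)\<bar> \<le> ra * \<bar>r - r'\<bar>" .
      have "2 * ra * \<bar>r - r'\<bar> \<le> (r + r') * \<bar>r - r'\<bar>" using that by (intro mult_right_mono) auto
      also have "\<dots> = \<bar>(r + r') * (r - r')\<bar>" using that ra by (simp add: abs_mult)
      finally have 2: "2 * ra * \<bar>r - r'\<bar> \<le> \<bar>(r + r') * (r - r')\<bar>" .
      have "S \<theta> r - S \<theta> r' = (r + r') * (r - r') + m * (Qs m \<theta> r 0 - Qs m \<theta> r' 0)"
        unfolding Seq[OF that(1)] Seq[OF that(2)] by (simp add: algebra_simps power2_eq_square)
      then show ?thesis using 1 2 by linarith
    qed
    have dr: "\<bar>r - r'\<bar> \<le> ir * \<bar>S \<theta> r - S \<theta> r'\<bar>" if "r \<in> {ra..rb}" "r' \<in> {ra..rb}" for \<theta> r r'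
      using inj[OF that, of \<theta>] ra by (simp add: ir_def field_simps)
    \<comment> \<open>What remains of the level equation, divided by m^2, after the linear part at
      \<open>S0\<close> has been taken out.\<close>
    define g where "g \<theta> r \<sigma> = (2 * lc / \<omega>) * (S \<theta> r - S0)^2 + \<sigma> * Ga m \<theta> r \<sigma> + m * Gb m \<theta> r \<sigma>" for \<theta> r \<sigma>
    have R1eq: "R1 \<eta> m (chart m \<theta> r \<sigma>) = m^2 * kk * (S \<theta> r - S0) + m^2 * g \<theta> r \<sigma>" if "r \<in> {ra..rb}" "\<bar>K * \<sigma>\<bar> \<le> \<rho>" for \<theta> r \<sigma>
    proof -
      have "R1 \<eta> m (chart m \<theta> r \<sigma>) = m^2 * ((2 * lc * (S \<theta> r)^2 + 2 * (Re k1 * s) * S \<theta> r) / \<omega> + \<sigma> * Ga m \<theta> r \<sigma> + m * Gb m \<theta> r \<sigma>)"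
        using sys[OF dom(1)[OF that], of \<theta>] by (simp add: S_def \<eta>_def mult.assoc)
      also have "2 * lc * (S \<theta> r)^2 + 2 * (Re k1 * s) * S \<theta> r = 2 * lc * S0 * (S \<theta> r - S0) + 2 * lc * (S \<theta> r - S0)^2"
        unfolding aS by (simp add: algebra_simps power2_eq_square)
      finally have e: "R1 \<eta> m (chart m \<theta> r \<sigma>) = m^2 * ((2 * lc * S0 * (S \<theta> r - S0) + 2 * lc * (S \<theta> r - S0)^2) / \<omega>
          + \<sigma> * Ga m \<theta> r \<sigma> + m * Gb m \<theta> r \<sigma>)" .
      have "m^2 * ((2 * lc * S0 * D + 2 * lc * D^2) / \<omega> + x + y) = m^2 * (2 * lc * S0 / \<omega>) * D + m^2 * ((2 * lc / \<omega>) * D^2 + x + y)"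
        for D x y by (simp add: algebra_simps add_divide_distrib)
      then show ?thesis unfolding e g_def kk_def .
    qed
    have R2eq: "R2 \<eta> m (chart m \<theta> r \<sigma>) = - (\<nu> / \<omega>) * \<sigma> + m * Gc m \<theta> r \<sigma>" if "r \<in> {ra..rb}" "\<bar>K * \<sigma>\<bar> \<le> \<rho>" for \<theta> r \<sigma>
      using sys[OF dom(1)[OF that], of \<theta>] by (simp add: \<eta>_def)
    have step: "\<bar>r - r'\<bar> + \<bar>\<sigma> - \<sigma>'\<bar> \<le> (ir + 1) * max \<bar>S \<theta> r - S \<theta> r'\<bar> \<bar>K * \<sigma> - K * \<sigma>'\<bar>"
        "\<bar>\<sigma> - \<sigma>'\<bar> \<le> max \<bar>S \<theta> r - S \<theta> r'\<bar> \<bar>K * \<sigma> - K * \<sigma>'\<bar> / K"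
      if r: "r \<in> {ra..rb}" "r' \<in> {ra..rb}" for \<theta> r r' \<sigma> \<sigma>'
    proof -
      define D where "D = max \<bar>S \<theta> r - S \<theta> r'\<bar> \<bar>K * \<sigma> - K * \<sigma>'\<bar>"
      have D: "\<bar>S \<theta> r - S \<theta> r'\<bar> \<le> D" "\<bar>K * \<sigma> - K * \<sigma>'\<bar> \<le> D" "0 \<le> D" by (auto simp: D_def)
      have "K * \<bar>\<sigma> - \<sigma>'\<bar> = \<bar>K * \<sigma> - K * \<sigma>'\<bar>" using K0 by (simp add: abs_mult right_diff_distrib[symmetric])
      then have 1: "K * \<bar>\<sigma> - \<sigma>'\<bar> \<le> D" using D(2) by linarith
      then show "\<bar>\<sigma> - \<sigma>'\<bar> \<le> max \<bar>S \<theta> r - S \<theta> r'\<bar> \<bar>K * \<sigma> - K * \<sigma>'\<bar> / K"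
        using K0 unfolding D_def[symmetric] by (simp add: pos_le_divide_eq mult.commute)
      have "1 * \<bar>\<sigma> - \<sigma>'\<bar> \<le> K * \<bar>\<sigma> - \<sigma>'\<bar>" using K by (intro mult_right_mono) auto
      moreover have "\<bar>r - r'\<bar> \<le> ir * D" using dr[OF r, of \<theta>] mult_left_mono[OF D(1), of ir] ir by linarith
      ultimately show "\<bar>r - r'\<bar> + \<bar>\<sigma> - \<sigma>'\<bar> \<le> (ir + 1) * max \<bar>S \<theta> r - S \<theta> r'\<bar> \<bar>K * \<sigma> - K * \<sigma>'\<bar>"
        unfolding D_def[symmetric] using 1 by (simp add: distrib_right)
    qed
    have glip: "\<bar>g \<theta> r \<sigma> - g \<theta> r' \<sigma>'\<bar> \<le> \<bar>kk\<bar> / 4 * max \<bar>S \<theta> r - S \<theta> r'\<bar> \<bar>K * \<sigma> - K * \<sigma>'\<bar>"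
      if r: "r \<in> {ra..rb}" "r' \<in> {ra..rb}" and y: "\<bar>S \<theta> r - S0\<bar> \<le> \<rho>" "\<bar>S \<theta> r' - S0\<bar> \<le> \<rho>" and sg: "\<bar>K * \<sigma>\<bar> \<le> \<rho>" "\<bar>K * \<sigma>'\<bar> \<le> \<rho>"
      for \<theta> r r' \<sigma> \<sigma>'
    proof -
      define D where "D = max \<bar>S \<theta> r - S \<theta> r'\<bar> \<bar>K * \<sigma> - K * \<sigma>'\<bar>"
      have D: "\<bar>S \<theta> r - S \<theta> r'\<bar> \<le> D" "0 \<le> D" by (auto simp: D_def)
      note st = step[OF r, of \<sigma> \<sigma>' \<theta>, folded D_def]
      note dd = dom(2)[OF r(1) sg(1)] dom(2)[OF r(2) sg(2)]
      define e where "e = \<bar>r - r'\<bar> + \<bar>\<sigma> - \<sigma>'\<bar>"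
      have e: "0 \<le> e" "e \<le> (ir + 1) * D" using st(1) by (auto simp: e_def)
      have 1: "\<bar>(2 * lc / \<omega>) * (S \<theta> r - S0)^2 - (2 * lc / \<omega>) * (S \<theta> r' - S0)^2\<bar> \<le> \<bar>kk\<bar> / 16 * D"
      proof -
        have "(2 * lc / \<omega>) * (S \<theta> r - S0)^2 - (2 * lc / \<omega>) * (S \<theta> r' - S0)^2
            = (2 * lc / \<omega>) * (((S \<theta> r - S0) + (S \<theta> r' - S0)) * (S \<theta> r - S \<theta> r'))"
        proof -
          have "k * x^2 - k * y^2 = k * ((x + y) * (x - y))" for k x y :: real by (simp add: algebra_simps power2_eq_square)
          from this[of "2 * lc / \<omega>" "S \<theta> r - S0" "S \<theta> r' - S0"] show ?thesis by simp
        qed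
        also have "\<bar>\<dots>\<bar> = (2 * \<bar>lc\<bar> / \<omega>) * (\<bar>(S \<theta> r - S0) + (S \<theta> r' - S0)\<bar> * \<bar>S \<theta> r - S \<theta> r'\<bar>)"
          using \<omega> by (simp add: abs_mult)
        also have "\<dots> \<le> (2 * \<bar>lc\<bar> / \<omega>) * ((S0 / 16) * D)"
        proof (intro mult_left_mono mult_mono D)
          show "\<bar>(S \<theta> r - S0) + (S \<theta> r' - S0)\<bar> \<le> S0 / 16" using y \<rho> by linarith
        qed (use S0 \<omega> in auto)
        also have "\<dots> = \<bar>kk\<bar> / 16 * D" unfolding kk by simp
        finally show ?thesis .
      qed
      have 2: "\<bar>\<sigma> * Ga m \<theta> r \<sigma> - \<sigma>' * Ga m \<theta> r' \<sigma>'\<bar> \<le> \<bar>kk\<bar> / 16 * D"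
      proof -
        have "\<sigma> * Ga m \<theta> r \<sigma> - \<sigma>' * Ga m \<theta> r' \<sigma>' = (\<sigma> - \<sigma>') * Ga m \<theta> r \<sigma> + \<sigma>' * (Ga m \<theta> r \<sigma> - Ga m \<theta> r' \<sigma>')"
          by (simp add: algebra_simps)
        then have "\<bar>\<sigma> * Ga m \<theta> r \<sigma> - \<sigma>' * Ga m \<theta> r' \<sigma>'\<bar> \<le> \<bar>\<sigma> - \<sigma>'\<bar> * \<bar>Ga m \<theta> r \<sigma>\<bar> + \<bar>\<sigma>'\<bar> * \<bar>Ga m \<theta> r \<sigma> - Ga m \<theta> r' \<sigma>'\<bar>"
          using abs_triangle_ineq[of "(\<sigma> - \<sigma>') * Ga m \<theta> r \<sigma>" "\<sigma>' * (Ga m \<theta> r \<sigma> - Ga m \<theta> r' \<sigma>')"] by (simp add: abs_mult)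
        also have "\<dots> \<le> (D / K) * C + (1 / K) * (C * ((ir + 1) * D))"
        proof (intro add_mono mult_mono st(2))
          show "\<bar>Ga m \<theta> r \<sigma>\<bar> \<le> C" by (rule bd[OF _ dd(1)]) simp
          show "\<bar>Ga m \<theta> r \<sigma> - Ga m \<theta> r' \<sigma>'\<bar> \<le> C * ((ir + 1) * D)"
            using lp[OF _ dd, of Ga \<theta>] e C by (intro order_trans[OF _ mult_left_mono[OF e(2), of C]]) (auto simp: e_def)
          have "K * \<bar>\<sigma>'\<bar> \<le> 1" using sg(2) \<rho> K0 by (simp add: abs_mult)
          then show "\<bar>\<sigma>'\<bar> \<le> 1 / K" using K0 by (simp add: field_simps)
        qed (use D K0 in auto)
        also have "\<dots> = C * (2 + ir) / K * D" by (simp add: algebra_simps add_divide_distrib)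
        also have "\<dots> \<le> \<bar>kk\<bar> / 16 * D" by (rule mult_right_mono[OF CK D(2)])
        finally show ?thesis .
      qed
      have 3: "\<bar>m * Gb m \<theta> r \<sigma> - m * Gb m \<theta> r' \<sigma>'\<bar> \<le> \<bar>kk\<bar> / 16 * D"
      proof -
        have "\<bar>m * Gb m \<theta> r \<sigma> - m * Gb m \<theta> r' \<sigma>'\<bar> = m * \<bar>Gb m \<theta> r \<sigma> - Gb m \<theta> r' \<sigma>'\<bar>"
          unfolding right_diff_distrib[symmetric] using m by (simp add: abs_mult)
        also have "\<dots> \<le> m * (C * ((ir + 1) * D))"
          using lp[OF _ dd, of Gb \<theta>] e C m
          by (intro mult_left_mono order_trans[OF _ mult_left_mono[OF e(2), of C]]) (auto simp: e_def)
        also have "\<dots> = (m * (C * (ir + 1))) * D" by simp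
        also have "\<dots> \<le> \<bar>kk\<bar> / 16 * D" using mc[OF E(3)] lim(4) D by (intro mult_right_mono) auto
        finally show ?thesis .
      qed
      \<comment> \<open>Three contributions of 1/16 each stay below the quarter that
        \<open>polar_orbit\<close> allows.\<close>
      have "\<bar>kk\<bar> / 16 * D * 3 \<le> \<bar>kk\<bar> / 4 * D" using D kkp by simp
      then show ?thesis unfolding g_def D_def[symmetric] using 1 2 3 by linarith
    qed
    have Gclip: "\<bar>K * (m * Gc m \<theta> r \<sigma>) - K * (m * Gc m \<theta> r' \<sigma>')\<bar> \<le> (\<nu> / \<omega>) / 4 * max \<bar>S \<theta> r - S \<theta> r'\<bar> \<bar>K * \<sigma> - K * \<sigma>'\<bar>"
      if r: "r \<in> {ra..rb}" "r' \<in> {ra..rb}" and sg: "\<bar>K * \<sigma>\<bar> \<le> \<rho>" "\<bar>K * \<sigma>'\<bar> \<le> \<rho>" for \<theta> r r' \<sigma> \<sigma>'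
    proof -
      define D where "D = max \<bar>S \<theta> r - S \<theta> r'\<bar> \<bar>K * \<sigma> - K * \<sigma>'\<bar>"
      have D: "0 \<le> D" by (auto simp: D_def)
      note dd = dom(2)[OF r(1) sg(1)] dom(2)[OF r(2) sg(2)]
      have "\<bar>Gc m \<theta> r \<sigma> - Gc m \<theta> r' \<sigma>'\<bar> \<le> C * (\<bar>r - r'\<bar> + \<bar>\<sigma> - \<sigma>'\<bar>)"
        by (rule lp[OF _ dd]) simp
      also have "\<dots> \<le> C * ((ir + 1) * D)"
        using C(1) by (intro mult_left_mono step(1)[OF r, of \<sigma> \<sigma>' \<theta>, folded D_def]) auto
      finally have "K * m * \<bar>Gc m \<theta> r \<sigma> - Gc m \<theta> r' \<sigma>'\<bar> \<le> K * m * (C * ((ir + 1) * D))"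
        using K0 m by (intro mult_left_mono) auto
      also have "\<dots> = (m * (K * C * (ir + 1))) * D" by simp
      also have "\<dots> \<le> (\<nu> / (4 * \<omega>)) * D" using mc[OF E(4)] lim(5) D by (intro mult_right_mono) auto
      finally show ?thesis unfolding D_def[symmetric]
        using K0 m by (simp add: abs_mult right_diff_distrib[symmetric] mult.assoc)
    qed
    have Sc: "0 < S0" by (rule S0)
    show "\<exists>\<gamma>. periodic_solution (F (s * m^2)) \<gamma> \<and> range \<gamma> \<subseteq> ball P R \<and>
      (lc < 0 \<longrightarrow> orbit_asym_stable (F (s * m^2)) (range \<gamma>)) \<and> (0 < lc \<longrightarrow> \<not> orbit_stable (F (s * m^2)) (range \<gamma>))"
      unfolding \<eta>_def[symmetric]
    \<comment> \<open>The radial rate carries the factor m^2 while the transverse rate does not;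
      both sets of hypotheses are relative, so the disparity is harmless. The minimum with 1 keeps
      the chart in the unit ball.\<close>
    proof (rule polar_orbit[of m ra \<rho> K "m^2 * kk" "- (\<nu> / \<omega>)" ra rb "min R 1" \<eta> S0])
      show "m^2 * kk \<noteq> 0" "- (\<nu> / \<omega>) < 0" using m kk \<nu> \<omega> by auto
      show "norm (chart m \<theta> r \<sigma>) < min R 1" if "r \<in> {ra..rb}" "\<bar>K * \<sigma>\<bar> \<le> \<rho>" for \<theta> r \<sigma>
      proof -
        have "norm (chart m \<theta> r \<sigma>) \<le> m * B"
          unfolding chart_scale using B(3)[OF dom(3)[OF that], of \<theta>] m by (simp add: mult_left_mono)
        moreover have "m * (2 * B) \<le> R" "m * (2 * B) \<le> 1"
        proof -
          have "m * (2 * B) \<le> R / (2 * B) * (2 * B)" "m * (2 * B) \<le> 1 / (2 * B) * (2 * B)"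
            using m m0(6,7) B(1) by (intro mult_right_mono; simp)+
          then show "m * (2 * B) \<le> R" "m * (2 * B) \<le> 1" using B(1) by simp_all
        qed
        moreover have "0 < m * B" using m B by simp
        ultimately show ?thesis by simp
      qed
      show "\<omega> / 2 \<le> angv \<eta> (chart m \<theta> r \<sigma>) \<and> angv \<eta> (chart m \<theta> r \<sigma>) \<le> 2 * \<omega>" if "r \<in> {ra..rb}" "\<bar>K * \<sigma>\<bar> \<le> \<rho>" for \<theta> r \<sigma>
        using sys[OF dom(1)[OF that], of \<theta>] by (simp add: \<eta>_def)
      show "Svar \<eta> m \<theta> ra < S0 - \<rho>" for \<theta>
        using Seq[OF rab(1), of \<theta>] Qb[OF rab(1), of \<theta>] lim(3) ra(3) \<rho> S0 unfolding S_def by linarith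
      show "S0 + \<rho> < Svar \<eta> m \<theta> rb" for \<theta>
        using Seq[OF rab(2), of \<theta>] Qb[OF rab(2), of \<theta>] lim(3) ra(4) \<rho> S0 unfolding S_def by linarith
      show "ra * \<bar>r - r'\<bar> \<le> \<bar>Svar \<eta> m \<theta> r - Svar \<eta> m \<theta> r'\<bar>" if "r \<in> {ra..rb}" "r' \<in> {ra..rb}" for \<theta> r r'
        using inj[OF that, of \<theta>] by (simp add: S_def)
      show "0 < dV \<eta> (of_real (m * r) * cis \<theta>) (of_real (m * r) * cis \<theta>)" if r: "r \<in> {ra..rb}" for \<theta> r
      proof -
        have "\<bar>m * Qd m \<theta> r 0\<bar> \<le> m * C" using bd[OF _ dom(2)[OF r z0], of Qd \<theta>] m by (simp add: abs_mult mult_left_mono)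
        then have "\<bar>m * Qd m \<theta> r 0\<bar> \<le> ra^2" using mc[OF E(2)] lim(8) by linarith
        moreover have "ra^2 \<le> r^2" using r ra by (intro power_mono) auto
        moreover have "0 < ra^2" using ra by simp
        ultimately have "0 < 2 * r^2 + m * Qd m \<theta> r 0" by linarith
        then show ?thesis using sys[OF dom(1)[OF r z0], of \<theta>] m by (simp add: \<eta>_def)
      qed
      show "\<bar>R1 \<eta> m (chart m \<theta> r \<sigma>) - m^2 * kk * (Svar \<eta> m \<theta> r - S0) - (R1 \<eta> m (chart m \<theta> r' \<sigma>') - m^2 * kk * (Svar \<eta> m \<theta> r' - S0))\<bar>
         \<le> \<bar>m^2 * kk\<bar> / 4 * max \<bar>Svar \<eta> m \<theta> r - Svar \<eta> m \<theta> r'\<bar> \<bar>K * \<sigma> - K * \<sigma>'\<bar>"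
        if "r \<in> {ra..rb}" "r' \<in> {ra..rb}" "\<bar>Svar \<eta> m \<theta> r - S0\<bar> \<le> \<rho>" "\<bar>Svar \<eta> m \<theta> r' - S0\<bar> \<le> \<rho>" "\<bar>K * \<sigma>\<bar> \<le> \<rho>" "\<bar>K * \<sigma>'\<bar> \<le> \<rho>" for \<theta> r r' \<sigma> \<sigma>'
      proof -
        have "R1 \<eta> m (chart m \<theta> r \<sigma>) - m^2 * kk * (S \<theta> r - S0) - (R1 \<eta> m (chart m \<theta> r' \<sigma>') - m^2 * kk * (S \<theta> r' - S0))
            = m^2 * (g \<theta> r \<sigma> - g \<theta> r' \<sigma>')"
          unfolding R1eq[OF that(1,5)] R1eq[OF that(2,6)] by (simp add: algebra_simps)
        moreover have "\<bar>m^2 * (g \<theta> r \<sigma> - g \<theta> r' \<sigma>')\<bar> \<le> m^2 * (\<bar>kk\<bar> / 4 * max \<bar>S \<theta> r - S \<theta> r'\<bar> \<bar>K * \<sigma> - K * \<sigma>'\<bar>)"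
          unfolding abs_mult abs_power2
          by (intro mult_left_mono glip[OF that(1,2) that(3)[folded S_def] that(4)[folded S_def] that(5,6)]) simp
        ultimately show ?thesis unfolding S_def by (simp add: abs_mult)
      qed
      show "\<bar>K * R2 \<eta> m (chart m \<theta> r \<sigma>) - - (\<nu> / \<omega>) * (K * \<sigma>) - (K * R2 \<eta> m (chart m \<theta> r' \<sigma>') - - (\<nu> / \<omega>) * (K * \<sigma>'))\<bar>
         \<le> \<bar>- (\<nu> / \<omega>)\<bar> / 4 * max \<bar>Svar \<eta> m \<theta> r - Svar \<eta> m \<theta> r'\<bar> \<bar>K * \<sigma> - K * \<sigma>'\<bar>"
        if "r \<in> {ra..rb}" "r' \<in> {ra..rb}" "\<bar>Svar \<eta> m \<theta> r - S0\<bar> \<le> \<rho>" "\<bar>Svar \<eta> m \<theta> r' - S0\<bar> \<le> \<rho>" "\<bar>K * \<sigma>\<bar> \<le> \<rho>" "\<bar>K * \<sigma>'\<bar> \<le> \<rho>" for \<theta> r r' \<sigma> \<sigma>'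
      proof -
        have "K * R2 \<eta> m (chart m \<theta> r \<sigma>) - - (\<nu> / \<omega>) * (K * \<sigma>) - (K * R2 \<eta> m (chart m \<theta> r' \<sigma>') - - (\<nu> / \<omega>) * (K * \<sigma>'))
            = K * (m * Gc m \<theta> r \<sigma>) - K * (m * Gc m \<theta> r' \<sigma>')"
          unfolding R2eq[OF that(1,5)] R2eq[OF that(2,6)] by (simp add: algebra_simps)
        moreover have "\<bar>- (\<nu> / \<omega>)\<bar> = \<nu> / \<omega>" using \<nu> \<omega> by simp
        ultimately show ?thesis using Gclip[OF that(1,2,5,6), of \<theta>] unfolding S_def by simp
      qed
      show "\<bar>R1 \<eta> m (chart m \<theta> r 0)\<bar> \<le> \<bar>m^2 * kk\<bar> * (3 / 4 * (\<rho> / 2))" if r: "r \<in> {ra..rb}" "Svar \<eta> m \<theta> r = S0" for \<theta> r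
      proof -
        have "R1 \<eta> m (chart m \<theta> r 0) = m^2 * (m * Gb m \<theta> r 0)"
          using R1eq[OF r(1) z0, of \<theta>] r(2) by (simp add: S_def g_def)
        moreover have "\<bar>m * Gb m \<theta> r 0\<bar> \<le> \<bar>kk\<bar> * (3/8 * \<rho>)"
        proof -
          have "\<bar>m * Gb m \<theta> r 0\<bar> \<le> m * C" using bd[OF _ dom(2)[OF r(1) z0], of Gb \<theta>] m by (simp add: abs_mult mult_left_mono)
          then show ?thesis using mc[OF E(2)] lim(6) by linarith
        qed
        then have "\<bar>m^2 * (m * Gb m \<theta> r 0)\<bar> \<le> m^2 * (\<bar>kk\<bar> * (3/8 * \<rho>))"
          unfolding abs_mult[of "m^2"] abs_power2 by (intro mult_left_mono) auto
        ultimately have "\<bar>R1 \<eta> m (chart m \<theta> r 0)\<bar> \<le> m^2 * (\<bar>kk\<bar> * (3/8 * \<rho>))" by simp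
        then show ?thesis by (simp add: abs_mult)
      qed
      show "\<bar>K * R2 \<eta> m (chart m \<theta> r 0)\<bar> \<le> \<bar>- (\<nu> / \<omega>)\<bar> * (3 / 4 * (\<rho> / 2))" if r: "r \<in> {ra..rb}" "Svar \<eta> m \<theta> r = S0" for \<theta> r
      proof -
        have "\<bar>K * R2 \<eta> m (chart m \<theta> r 0)\<bar> = K * (m * \<bar>Gc m \<theta> r 0\<bar>)"
          using R2eq[OF r(1) z0, of \<theta>] K0 m by (simp add: abs_mult)
        also have "\<dots> \<le> K * (m * C)"
          using bd[OF _ dom(2)[OF r(1) z0], of Gc \<theta>] K0 m by (intro mult_left_mono) auto
        also have "\<dots> = m * (K * C)" by simp
        also have "\<dots> \<le> \<nu> / \<omega> * (3/8 * \<rho>)" using mc[OF E(5)] lim(7) by linarith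
        finally show ?thesis using \<nu> \<omega> by simp
      qed
      show "\<exists>\<gamma>. periodic_solution (F \<eta>) \<gamma> \<and> range \<gamma> \<subseteq> ball P R \<and>
        (lc < 0 \<longrightarrow> orbit_asym_stable (F \<eta>) (range \<gamma>)) \<and> (0 < lc \<longrightarrow> \<not> orbit_stable (F \<eta>) (range \<gamma>))"
        if \<gamma>: "periodic_solution (F \<eta>) \<gamma>" "range \<gamma> \<subseteq> ball P (min R 1)"
        "m^2 * kk < 0 \<Longrightarrow> orbit_asym_stable (F \<eta>) (range \<gamma>)" "0 < m^2 * kk \<Longrightarrow> \<not> orbit_stable (F \<eta>) (range \<gamma>)" for \<gamma>
      proof (intro exI[of _ \<gamma>] conjI impI)
        show "range \<gamma> \<subseteq> ball P R" using \<gamma>(2) by auto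
        show "orbit_asym_stable (F \<eta>) (range \<gamma>)" if "lc < 0"
          using that m S0 \<omega> by (intro \<gamma>(3)) (auto simp: kk_def mult_less_0_iff divide_less_0_iff)
        show "\<not> orbit_stable (F \<eta>) (range \<gamma>)" if "0 < lc"
          using that m S0 \<omega> by (intro \<gamma>(4)) (auto simp: kk_def)
      qed (rule \<gamma>(1))
    qed (use m ra \<rho> K0 in auto)
  qed
qed

text \<open>The sign condition fixes the sign of \<open>\<eta>\<close> to be \<open>s\<close>, so
  \<open>\<eta>\<close> is \<open>s * m^2\<close> with m the square root of its absolute value; the
  orbits thus have size of order the square root of |eta|.\<close>

theorem periodic_branch:
  assumes lc: "lc \<noteq> 0" and k: "Re k1 \<noteq> 0" and R: "0 < R"
  obtains \<delta> where "0 < \<delta>" "\<And>\<eta>. \<bar>\<eta>\<bar> < \<delta> \<Longrightarrow> Re k1 * \<eta> * lc < 0 \<Longrightarrow>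
      \<exists>\<gamma>. periodic_solution (F \<eta>) \<gamma> \<and> range \<gamma> \<subseteq> ball P R \<and>
      (lc < 0 \<longrightarrow> orbit_asym_stable (F \<eta>) (range \<gamma>)) \<and> (0 < lc \<longrightarrow> \<not> orbit_stable (F \<eta>) (range \<gamma>))"
proof -
  define s where "s = - sgn (Re k1 * lc)"
  have s: "s^2 = 1" "Re k1 * s * lc < 0"
  proof -
    have "Re k1 * lc \<noteq> 0" using lc k by simp
    then show "s^2 = 1" by (simp add: s_def power2_eq_square sgn_if)
    have "Re k1 * s * lc = - \<bar>Re k1 * lc\<bar>" unfolding s_def abs_sgn by simp
    then show "Re k1 * s * lc < 0" using \<open>Re k1 * lc \<noteq> 0\<close> by simp
  qed
  obtain m0 where m0: "0 < m0" "\<And>m. 0 < m \<Longrightarrow> m \<le> m0 \<Longrightarrow> \<exists>\<gamma>. periodic_solution (F (s * m^2)) \<gamma> \<and> range \<gamma> \<subseteq> ball P R \<and>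
      (lc < 0 \<longrightarrow> orbit_asym_stable (F (s * m^2)) (range \<gamma>)) \<and> (0 < lc \<longrightarrow> \<not> orbit_stable (F (s * m^2)) (range \<gamma>))"
    using branch_orbit[OF s(1) lc s(2) R] by blast
  show ?thesis
  proof (rule that[of "m0^2"])
    show "0 < m0^2" using m0 by simp
    fix \<eta> :: real assume \<eta>: "\<bar>\<eta>\<bar> < m0^2" "Re k1 * \<eta> * lc < 0"
    define m where "m = sqrt \<bar>\<eta>\<bar>"
    have "\<eta> \<noteq> 0" using \<eta>(2) by auto
    then have m: "0 < m" "m \<le> m0" "m^2 = \<bar>\<eta>\<bar>"
      using \<eta>(1) m0(1) by (auto simp: m_def real_le_lsqrt)
    have "\<eta> = s * m^2"
    proof -
      define p where "p = Re k1 * lc"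
      have "p * \<eta> < 0" using \<eta>(2) by (simp add: p_def mult_ac)
      then have "sgn \<eta> = s" unfolding s_def p_def[symmetric] by (auto simp: sgn_if mult_less_0_iff)
      then show ?thesis unfolding m(3) using sgn_mult_abs[of \<eta>] by simp
    qed
    then show "\<exists>\<gamma>. periodic_solution (F \<eta>) \<gamma> \<and> range \<gamma> \<subseteq> ball P R \<and>
      (lc < 0 \<longrightarrow> orbit_asym_stable (F \<eta>) (range \<gamma>)) \<and> (0 < lc \<longrightarrow> \<not> orbit_stable (F \<eta>) (range \<gamma>))"
      using m0(2)[OF m(1,2)] by simp
  qed
qed

end

section \<open>Vector fields given by their third-order jet\<close>

text \<open>The coefficient in front of \<open>u $ 1\<close> in the third equation is chosen so that
  the linear part at \<open>\<eta>\<close> = 0 has characteristic polynomial (x + e)(x^2 + omega^2).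
  Only the monomials that the application produces are listed, with Taylor normalisation 1/2 and
  1/6.\<close>

locale hopf_jet =
  fixes F :: "real \<Rightarrow> real^3 \<Rightarrow> real^3" and P :: "real^3" and e \<omega> b q11 q13 q33 r11 t111 t113 t133 r111 :: real
    and R2 R3 :: "real^3 \<Rightarrow> real"
  assumes pos: "0 < e" "0 < \<omega>" "0 < b"
    and R2: "lipo 4 R2" and R3: "lipo 4 R3"
    and F1: "\<And>\<eta> u. F \<eta> (P + u) $ 1 = u $ 2"
    and F2: "\<And>\<eta> u. F \<eta> (P + u) $ 2 = - (\<omega>^2) * u $ 1 - (e + \<eta>) * u $ 2 + b * u $ 3
        + (q11 * (u $ 1)^2 + 2 * q13 * u $ 1 * u $ 3 + q33 * (u $ 3)^2) / 2
        + (t111 * (u $ 1)^3 + 3 * t113 * (u $ 1)^2 * u $ 3 + 3 * t133 * u $ 1 * (u $ 3)^2) / 6 + R2 u"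
    and F3: "\<And>\<eta> u. F \<eta> (P + u) $ 3 = - (\<omega>^2 * e / b) * u $ 1 + r11 * (u $ 1)^2 / 2 + r111 * (u $ 1)^3 / 6 + R3 u"
begin

definition "D = \<omega>^2 + e^2"
definition "g = \<omega> * e / b"
definition "k = \<omega>^2 / b"
text \<open>\<open>Z\<close> and \<open>W\<close> are the coefficients in the basis of eigenvectors
  (-i, omega, g), its conjugate and (1, -e, k) of the linear part; \<open>emb\<close> recombines
  them.\<close>

definition Z :: "real^3 \<Rightarrow> complex" where
  "Z u = Complex ((\<omega> * u $ 2 + e * b / \<omega> * u $ 3) / (2 * D)) ((D * u $ 1 + e * u $ 2 - b * u $ 3) / (2 * D))"
definition W :: "real^3 \<Rightarrow> real" where
  "W u = (b * u $ 3 - e * u $ 2) / D"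
definition emb :: "complex \<Rightarrow> real \<Rightarrow> real^3" where
  "emb z w = vector [2 * Im z + w, 2 * \<omega> * Re z - e * w, 2 * g * Re z + k * w]"
text \<open>The left eigenvector behind \<open>Z\<close>, restricted to vectors with vanishing first
  entry: \<open>Z\<close> of (0, y, w) is \<open>pc * (y + pd * w)\<close>.\<close>

definition "pc = Complex (\<omega> / (2 * D)) (e / (2 * D))"
definition "pd = - \<i> * of_real (b / \<omega>)"

text \<open>The nonlinear terms occupy only the last two components. The \<open>c\<close> family
  holds their critical components, obtained with \<open>pc\<close> and \<open>pd\<close>, the
  \<open>v\<close> family their stable components.\<close>

definition "c11 = pc * (of_real q11 + pd * of_real r11)"
definition "c13 = pc * of_real q13"
definition "c33 = pc * of_real q33"
definition "c111 = pc * (of_real t111 + pd * of_real r111)"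
definition "c113 = pc * of_real t113"
definition "c133 = pc * of_real t133"
definition "v11 = (b * r11 - e * q11) / D"
definition "v13 = - e * q13 / D"
definition "v33 = - e * q33 / D"
definition "v111 = (b * r111 - e * t111) / D"
definition "v113 = - e * t113 / D"
definition "v133 = - e * t133 / D"

text \<open>\<open>b1\<close> and \<open>b2\<close> are the coefficients of Z W and of its
  counterpart with the conjugate of Z in the critical equation; they transmit the center manifold to
  the cubic terms.\<close>

definition "b1 = - \<i> * c11 + c13 * (of_real g - \<i> * of_real k) + c33 * of_real (k * g)"
definition "b2 = \<i> * c11 + c13 * (of_real g + \<i> * of_real k) + c33 * of_real (k * g)"
definition "n20 = (- c11 - 2 * \<i> * of_real g * c13 + of_real (g^2) * c33) / 2"
definition "n11 = c11 + of_real (g^2) * c33"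
definition "n02 = (- c11 + 2 * \<i> * of_real g * c13 + of_real (g^2) * c33) / 2"
definition "m20 = Complex ((g^2 * v33 - v11) / 2) (- g * v13)"
definition "m11 = v11 + g^2 * v33"
text \<open>Solves the invariance equation of the manifold at second order: the rotation multiplies
  z^2 by 2 i omega, and contraction at rate \<open>e\<close> adds \<open>e\<close>.\<close>

definition "h20 = m20 / (of_real e + 2 * \<i> * of_real \<omega>)"
definition "h11 = m11 / e"

text \<open>The first bracket is the pure cubic part; the products with \<open>b1\<close> and
  \<open>b2\<close> come from replacing \<open>W\<close> by the quadratic form of the manifold in
  the mixed quadratic terms.\<close>

definition "d30 = (\<i> * c111 - 3 * of_real g * c113 - 3 * \<i> * of_real (g^2) * c133) / 6 + h20 * b1"
definition "d21 = (- 3 * \<i> * c111 + 3 * of_real g * c113 - 3 * \<i> * of_real (g^2) * c133) / 6 + of_real h11 * b1 + h20 * b2"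
definition "d12 = (3 * \<i> * c111 + 3 * of_real g * c113 + 3 * \<i> * of_real (g^2) * c133) / 6 + cnj h20 * b1 + of_real h11 * b2"
definition "d03 = (- \<i> * c111 - 3 * of_real g * c113 + 3 * \<i> * of_real (g^2) * c133) / 6 + cnj h20 * b2"

definition "x1 u = - \<i> * Z u + \<i> * cnj (Z u)"
definition "x3 u = of_real g * (Z u + cnj (Z u))"
definition "cw = (c11 + 2 * c13 * of_real k + c33 * of_real (k^2)) / 2"
text \<open>The cubic form at u minus its value on the critical plane, divided by \<open>W\<close>;
  the division is exact because \<open>x1\<close>, \<open>x3\<close> are the values of the two
  components on that plane.\<close>

definition "Mc u = (c111 * (3 * x1 u * x1 u + 3 * x1 u * of_real (W u) + of_real (W u) * of_real (W u))
   + 3 * c113 * ((2 * x1 u + of_real (W u)) * of_real (u $ 3) + of_real k * (x1 u * x1 u))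
   + 3 * c133 * (of_real (u $ 3) * of_real (u $ 3) + x1 u * (2 * of_real k * x3 u + of_real (k^2) * of_real (W u)))) / 6"
definition "hz u = quad_form h20 h11 (Z u)"
definition "Rc u = pc * (of_real (R2 u) + pd * of_real (R3 u))"
text \<open>\<open>E1\<close> and \<open>E4\<close> separate the factor X = W - H, with H the value
  of the quadratic form \<open>hz\<close>: W^2 is (W - H)(W + H) + H^2, and W Mc is (W - H) Mc + H
  Mc. The parts free of X have order four.\<close>

definition "E1 u = b1 * Z u + b2 * cnj (Z u) + cw * of_real (W u) + cw * of_real (hz u) + Mc u"
definition "E4 u = Rc u + of_real (hz u) * Mc u + cw * of_real (hz u) * of_real (hz u)"
definition "k1 = - pc * of_real \<omega>"
definition "k3 = pc * of_real e"

definition "Nc u = (n20 * (Z u)^2 + n11 * Z u * cnj (Z u) + n02 * (cnj (Z u))^2)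
       + (d30 * (Z u)^3 + d21 * (Z u)^2 * cnj (Z u) + d12 * Z u * (cnj (Z u))^2 + d03 * (cnj (Z u))^3)
       + of_real (W u - quad_form h20 h11 (Z u)) * E1 u + E4 u"
definition "D1 u = v11 * (2 * Im (Z u)) + v13 * (k * (2 * Im (Z u)) + g * (2 * Re (Z u))) + v33 * k * (g * (2 * Re (Z u)))
   + (v11 + 2 * v13 * k + v33 * k^2) / 2 * W u"
text \<open>Writing W as X plus the quadratic form leaves \<open>hz\<close> times \<open>D1\<close>;
  the last term is the motion of that form caused by the nonlinear part of the critical equation.
  Both are of order three.\<close>

definition "D3 u = hz u * D1 u + (v111 * (u $ 1)^3 + 3 * v113 * ((u $ 1)^2 * u $ 3) + 3 * v133 * (u $ 1 * (u $ 3)^2)) / 6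
   + (b * R3 u - e * R2 u) / D - quad_form_deriv h20 h11 (Z u) (Nc u)"
definition "K2 u = e / D * u $ 2 - quad_form_deriv h20 h11 (Z u) (k1 * Z u + k1 * cnj (Z u) + k3 * of_real (W u))"

lemma D_pos: "0 < D" using pos by (simp add: D_def add_pos_pos)

lemma D_ne [simp]: "D \<noteq> 0" using D_pos by simp

lemma Z_linear: "bounded_linear Z"
proof -
  have "linear Z"
    by (rule linearI) (auto simp: Z_def complex_eq_iff algebra_simps add_divide_distrib diff_divide_distrib)
  then show ?thesis by (rule linear_conv_bounded_linear[THEN iffD1])
qed

lemma W_linear: "bounded_linear W"
proof -
  have "linear W"
    by (rule linearI) (auto simp: W_def algebra_simps add_divide_distrib diff_divide_distrib)
  then show ?thesis by (rule linear_conv_bounded_linear[THEN iffD1])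
qed

lemma emb_linear: "bounded_linear (\<lambda>q. emb (fst q) (snd q))"
proof -
  have "linear (\<lambda>q. emb (fst q) (snd q))"
    by (rule linearI) (auto simp: emb_def vec_eq_iff forall_3 algebra_simps)
  then show ?thesis by (rule linear_conv_bounded_linear[THEN iffD1])
qed

lemma Z_emb: "Z (emb z w) = z"
proof -
  have "\<omega> * (2 * \<omega> * Re z - e * w) + e * b / \<omega> * (2 * g * Re z + k * w) = 2 * D * Re z"
    using pos by (simp add: g_def k_def D_def field_simps power2_eq_square)
  moreover have "D * (2 * Im z + w) + e * (2 * \<omega> * Re z - e * w) - b * (2 * g * Re z + k * w) = 2 * D * Im z"
    using pos by (simp add: g_def k_def D_def field_simps power2_eq_square)
  ultimately show ?thesis by (simp add: Z_def emb_def complex_eq_iff)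
qed

lemma W_emb: "W (emb z w) = w"
proof -
  have "b * (2 * g * Re z + k * w) - e * (2 * \<omega> * Re z - e * w) = D * w"
    using pos by (simp add: g_def k_def D_def field_simps power2_eq_square)
  then show ?thesis by (simp add: W_def emb_def)
qed

lemma coordinates: "u $ 1 = 2 * Im (Z u) + W u" "u $ 2 = 2 * \<omega> * Re (Z u) - e * W u" "u $ 3 = 2 * g * Re (Z u) + k * W u"
proof -
  show "u $ 1 = 2 * Im (Z u) + W u" by (simp add: Z_def W_def field_simps)
  have "\<omega> * (\<omega> * u $ 2 + e * b / \<omega> * u $ 3) - e * (b * u $ 3 - e * u $ 2) = D * u $ 2"
    using pos by (simp add: D_def field_simps power2_eq_square)
  then have "u $ 2 = (\<omega> * (\<omega> * u $ 2 + e * b / \<omega> * u $ 3) - e * (b * u $ 3 - e * u $ 2)) / D" by simp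
  moreover have "2 * c * (x / (2 * d)) - y * (z / d) = (c * x - y * z) / d" for c x y z d :: real
    by (simp add: diff_divide_distrib)
  ultimately show "u $ 2 = 2 * \<omega> * Re (Z u) - e * W u"
    unfolding Z_def W_def complex.sel by simp
  have "g * (\<omega> * u $ 2 + e * b / \<omega> * u $ 3) + k * (b * u $ 3 - e * u $ 2) = D * u $ 3"
    using pos by (simp add: g_def k_def D_def field_simps power2_eq_square)
  then have "u $ 3 = (g * (\<omega> * u $ 2 + e * b / \<omega> * u $ 3) + k * (b * u $ 3 - e * u $ 2)) / D" by simp
  moreover have "2 * c * (x / (2 * d)) + y * (z / d) = (c * x + y * z) / d" for c x y z d :: real
    by (simp add: add_divide_distrib)
  ultimately show "u $ 3 = 2 * g * Re (Z u) + k * W u"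
    unfolding Z_def W_def complex.sel by simp
qed

lemma emb_ZW: "emb (Z u) (W u) = u"
  unfolding emb_def coordinates[symmetric] by (simp add: vec_eq_iff forall_3)

lemma coord_complex: "of_real (u $ 1) = x1 u + of_real (W u)" "of_real (u $ 3) = x3 u + of_real k * of_real (W u)"
  "of_real (u $ 2) = of_real \<omega> * (Z u + cnj (Z u)) - of_real e * of_real (W u)"
  unfolding coordinates x1_def x3_def by (simp_all add: complex_eq_iff)

lemma Z_vertical: "Z (vector [0, y, w]) = pc * (of_real y + pd * of_real w)"
  using pos by (simp add: Z_def pc_def pd_def complex_eq_iff field_simps)

lemma lipo_component: "lipo 1 (\<lambda>u::real^3. u $ i)"
  by (rule lipo_linear) (rule bounded_linear_vec_nth)

lemmas jet_atoms = lipo_linear[OF Z_linear] lipo_linear[OF W_linear] lipo_component R2 R3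

lemma lipo_x1: "lipo 1 x1" and lipo_x3: "lipo 1 x3"
  unfolding x1_def[abs_def] x3_def[abs_def]
  by (intro lipo_add lipo_cmult lipo_cnj jet_atoms)+

lemma lipo_hz: "lipo 2 hz"
proof -
  have 1: "lipo 2 (\<lambda>u. h20 * (Z u)^2)" and 2: "lipo 2 (\<lambda>u. Z u * cnj (Z u))"
    by (rule lipo_mono, (rule jet_atoms lipo_cmult lipo_cnj lipo_mult lipo_power)+, simp)+
  show ?thesis unfolding hz_def[abs_def] quad_form_def
    by (rule lipo_add[OF lipo_cmult[OF lipo_Re[OF 1]] lipo_cmult[OF lipo_Re[OF 2]]])
qed

lemma lipo_divide: "lipo n G \<Longrightarrow> lipo n (\<lambda>u. G u / c)" for c :: "'c::real_normed_field"
  using lipo_cmult[of n G "1 / c"] by simp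

lemma lipo_Mc: "lipo 2 Mc"
proof -
  have a: "lipo 2 (\<lambda>u. 3 * x1 u * x1 u + 3 * x1 u * of_real (W u) + of_real (W u) * of_real (W u))"
    by (intro lipo_add; (rule lipo_mono, (rule lipo_x1 lipo_x3 jet_atoms lipo_cmult lipo_of_real lipo_mult)+, simp))
  have "lipo 1 (\<lambda>u. 2 * x1 u + of_real (W u))"
    by (intro lipo_add lipo_cmult lipo_of_real lipo_x1 jet_atoms)
  from lipo_mult[OF this lipo_of_real[OF lipo_component[of 3]]]
  have "lipo 2 (\<lambda>u. (2 * x1 u + of_real (W u)) * of_real (u $ 3))" by (simp add: numeral_2_eq_2)
  moreover have "lipo 2 (\<lambda>u. of_real k * (x1 u * x1 u))"
    by (rule lipo_mono, (rule lipo_x1 lipo_cmult lipo_mult)+, simp)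
  ultimately have c: "lipo 2 (\<lambda>u. (2 * x1 u + of_real (W u)) * of_real (u $ 3) + of_real k * (x1 u * x1 u))"
    by (rule lipo_add)
  have "lipo 1 (\<lambda>u. 2 * of_real k * x3 u + of_real (k^2) * of_real (W u))"
    by (intro lipo_add lipo_cmult lipo_of_real lipo_x3 jet_atoms)
  from lipo_mult[OF lipo_x1 this]
  have "lipo 2 (\<lambda>u. x1 u * (2 * of_real k * x3 u + of_real (k^2) * of_real (W u)))" by (simp add: numeral_2_eq_2)
  moreover have "lipo 2 (\<lambda>u::real^3. of_real (u $ 3) * of_real (u $ 3) :: complex)"
    by (rule lipo_mono, (rule jet_atoms lipo_of_real lipo_mult)+, simp)
  ultimately have d: "lipo 2 (\<lambda>u. of_real (u $ 3) * of_real (u $ 3) + x1 u * (2 * of_real k * x3 u + of_real (k^2) * of_real (W u)))"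
    by (rule lipo_add[rotated])
  show ?thesis unfolding Mc_def[abs_def]
    by (intro lipo_divide lipo_add lipo_cmult a c d)
qed

lemma lipo_E1: "lipo 1 E1"
  unfolding E1_def[abs_def]
  by (intro lipo_add; (rule lipo_mono, (rule lipo_hz lipo_Mc jet_atoms lipo_cmult lipo_cnj lipo_of_real)+, simp))

lemma lipo_E4: "lipo 4 E4"
proof -
  have "lipo 4 Rc" unfolding Rc_def[abs_def]
    by (intro lipo_cmult lipo_add lipo_of_real R2 R3)
  moreover have "lipo 4 (\<lambda>u. of_real (hz u) * Mc u)" "lipo 4 (\<lambda>u. cw * of_real (hz u) * of_real (hz u))"
    by (rule lipo_mono, (rule lipo_hz lipo_Mc lipo_cmult lipo_of_real lipo_mult)+, simp)+
  ultimately show ?thesis unfolding E4_def[abs_def] by (intro lipo_add)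
qed

lemma lipo_Nc: "lipo 2 Nc"
proof -
  have X: "lipo 1 (\<lambda>u. of_real (W u - quad_form h20 h11 (Z u)) :: complex)"
    by (intro lipo_of_real lipo_diff jet_atoms) (rule lipo_mono[OF lipo_hz[unfolded hz_def[abs_def]]], simp)
  show ?thesis unfolding Nc_def[abs_def]
    by (intro lipo_add; (rule lipo_mono, (rule X lipo_E1 lipo_E4 jet_atoms lipo_cmult lipo_cnj lipo_of_real lipo_mult lipo_power)+, simp))
qed

lemma lipo_quad_deriv:
  assumes "lipo n G" shows "lipo (Suc n) (\<lambda>u. quad_form_deriv h20 h11 (Z u) (G u))"
proof -
  have 1: "lipo (Suc n) (\<lambda>u. 2 * h20 * Z u * G u)" and 2: "lipo (Suc n) (\<lambda>u. cnj (Z u) * G u)"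
    by (rule lipo_mono, (rule assms jet_atoms lipo_cmult lipo_cnj lipo_mult)+, simp)+
  show ?thesis unfolding quad_form_deriv_def
    by (rule lipo_add[OF lipo_cmult[OF lipo_Re[OF 1]] lipo_cmult[OF lipo_cmult[OF lipo_Re[OF 2]]]])
qed

lemma lipo_D1: "lipo 1 D1"
proof -
  have i: "lipo 1 (\<lambda>u. Im (Z u))" "lipo 1 (\<lambda>u. Re (Z u))" by (intro lipo_Im lipo_Re jet_atoms)+
  show ?thesis unfolding D1_def[abs_def] by (intro lipo_add lipo_cmult i jet_atoms)
qed

lemma lipo_D3: "lipo 3 D3"
proof -
  have 1: "lipo 3 (\<lambda>u. hz u * D1 u)"
    by (rule lipo_mono, (rule lipo_hz lipo_D1 lipo_mult)+, simp)
  have 2: "lipo 3 (\<lambda>u::real^3. (v111 * (u $ 1)^3 + 3 * v113 * ((u $ 1)^2 * u $ 3) + 3 * v133 * (u $ 1 * (u $ 3)^2)) / 6)"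
    by (intro lipo_divide lipo_add; (rule lipo_mono, (rule jet_atoms lipo_cmult lipo_mult lipo_power)+, simp))
  have 3: "lipo 3 (\<lambda>u. (b * R3 u - e * R2 u) / D)"
    by (intro lipo_divide lipo_diff lipo_cmult lipo_mono[OF R2] lipo_mono[OF R3]) simp_all
  have 4: "lipo 3 (\<lambda>u. quad_form_deriv h20 h11 (Z u) (Nc u))"
    using lipo_quad_deriv[OF lipo_Nc] by (simp add: numeral_3_eq_3 numeral_2_eq_2)
  show ?thesis unfolding D3_def[abs_def] by (intro lipo_diff lipo_add 1 2 3 4)
qed

lemma lipo_K2: "lipo 1 K2"
proof -
  have "lipo 1 (\<lambda>u. k1 * Z u + k1 * cnj (Z u) + k3 * of_real (W u))"
    by (intro lipo_add lipo_cmult lipo_cnj lipo_of_real jet_atoms)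
  from lipo_mono[OF lipo_quad_deriv[OF this]] show ?thesis
    unfolding K2_def[abs_def] by (intro lipo_diff lipo_cmult jet_atoms) simp
qed

definition "n2 u = (q11 * (u $ 1)^2 + 2 * q13 * u $ 1 * u $ 3 + q33 * (u $ 3)^2) / 2
        + (t111 * (u $ 1)^3 + 3 * t113 * (u $ 1)^2 * u $ 3 + 3 * t133 * u $ 1 * (u $ 3)^2) / 6 + R2 u" for u :: "real^3"
definition "n3 u = r11 * (u $ 1)^2 / 2 + r111 * (u $ 1)^3 / 6 + R3 u" for u :: "real^3"

definition lin :: "real^3 \<Rightarrow> real^3" where
  "lin u = vector [u $ 2, - (\<omega>^2) * u $ 1 - e * u $ 2 + b * u $ 3, - (\<omega>^2 * e / b) * u $ 1]"

lemma F_split: "F \<eta> (P + u) = lin u + vector [0, n2 u - \<eta> * u $ 2, n3 u]"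
  by (simp add: vec_eq_iff forall_3 F1 F2 F3 n2_def n3_def lin_def algebra_simps)

lemma Z_lin: "Z (lin u) = \<i> * of_real \<omega> * Z u"
proof -
  have 1: "\<omega> * (lin u $ 2) + e * b / \<omega> * (lin u $ 3) = - \<omega> * (D * u $ 1 + e * u $ 2 - b * u $ 3)"
    using pos by (simp add: lin_def D_def field_simps power2_eq_square)
  have 2: "D * lin u $ 1 + e * lin u $ 2 - b * lin u $ 3 = \<omega> * (\<omega> * u $ 2 + e * b / \<omega> * u $ 3)"
    using pos by (simp add: lin_def D_def field_simps power2_eq_square)
  show ?thesis unfolding Z_def[of "lin u"] 1 2 by (simp add: Z_def complex_eq_iff)
qed

lemma W_lin: "W (lin u) = - e * W u"
proof -
  have "b * lin u $ 3 - e * lin u $ 2 = - e * (b * u $ 3 - e * u $ 2)"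
    using pos by (simp add: lin_def field_simps power2_eq_square)
  then show ?thesis by (simp add: W_def)
qed

lemma Z_split: "Z (F \<eta> (P + u)) = \<i> * of_real \<omega> * Z u + Z (vector [0, n2 u - \<eta> * u $ 2, n3 u])"
  unfolding F_split linear_add[OF bounded_linear.linear[OF Z_linear]] Z_lin ..

lemma W_split: "W (F \<eta> (P + u)) = - e * W u + W (vector [0, n2 u - \<eta> * u $ 2, n3 u])"
  unfolding F_split linear_add[OF bounded_linear.linear[OF W_linear]] W_lin ..

text \<open>The perturbation is vertical, so \<open>Z_vertical\<close> reduces it to one complex
  combination. That is expanded around the critical plane in powers of W; adding and subtracting H
  times the linear coupling moves the latter into the cubic coefficients.\<close>

lemma Z_nonlinear: "Z (vector [0, n2 u - \<eta> * u $ 2, n3 u]) = of_real \<eta> * (k1 * Z u + k1 * cnj (Z u) + k3 * of_real (W u)) + Nc u"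
proof -
  define z where "z = Z u"
  define w where "w = complex_of_real (W u)"
  define y1 where "y1 = x1 u"
  define y3 where "y3 = x3 u"
  define H where "H = complex_of_real (hz u)"
  have u: "of_real (u $ 1) = y1 + w" "of_real (u $ 3) = y3 + of_real k * w" "of_real (u $ 2) = of_real \<omega> * (z + cnj z) - of_real e * w"
    using coord_complex[of u] by (simp_all add: z_def w_def y1_def y3_def)
  have y: "y1 = - \<i> * z + \<i> * cnj z" "y3 = of_real g * (z + cnj z)" by (simp_all add: y1_def y3_def x1_def x3_def z_def)
  have H: "H = h20 * z^2 + of_real h11 * (z * cnj z) + cnj h20 * (cnj z)^2"
    by (simp add: H_def hz_def quad_form_def z_def complex_eq_iff power2_eq_square algebra_simps)
  have "pc * (of_real (n2 u) + pd * of_real (n3 u))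
      = (c11 * (y1 + w)^2 + 2 * c13 * (y1 + w) * (y3 + of_real k * w) + c33 * (y3 + of_real k * w)^2) / 2
        + (c111 * (y1 + w)^3 + 3 * c113 * (y1 + w)^2 * (y3 + of_real k * w) + 3 * c133 * (y1 + w) * (y3 + of_real k * w)^2) / 6 + Rc u"
    unfolding n2_def n3_def c11_def c13_def c33_def c111_def c113_def c133_def Rc_def u[symmetric]
    by (simp add: algebra_simps add_divide_distrib)
  also have "(c11 * (y1 + w)^2 + 2 * c13 * (y1 + w) * (y3 + of_real k * w) + c33 * (y3 + of_real k * w)^2) / 2
      = (c11 * y1^2 + 2 * c13 * y1 * y3 + c33 * y3^2) / 2 + w * (c11 * y1 + c13 * (of_real k * y1 + y3) + c33 * of_real k * y3) + cw * w^2"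
    unfolding cw_def by (simp add: field_simps power2_eq_square)
  also have "(c11 * y1^2 + 2 * c13 * y1 * y3 + c33 * y3^2) / 2 = n20 * z^2 + n11 * z * cnj z + n02 * (cnj z)^2"
    unfolding y n20_def n11_def n02_def by (simp add: field_simps power2_eq_square)
  also have "c11 * y1 + c13 * (of_real k * y1 + y3) + c33 * of_real k * y3 = b1 * z + b2 * cnj z"
    unfolding y b1_def b2_def by (simp add: algebra_simps)
  also have "(c111 * (y1 + w)^3 + 3 * c113 * (y1 + w)^2 * (y3 + of_real k * w) + 3 * c133 * (y1 + w) * (y3 + of_real k * w)^2) / 6
      = (c111 * y1^3 + 3 * c113 * y1^2 * y3 + 3 * c133 * y1 * y3^2) / 6 + w * Mc u"
    unfolding Mc_def y1_def[symmetric] y3_def[symmetric] w_def[symmetric] u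
    by (simp add: field_simps power2_eq_square power3_eq_cube)
  also have "(c111 * y1^3 + 3 * c113 * y1^2 * y3 + 3 * c133 * y1 * y3^2) / 6
      = (d30 * z^3 + d21 * z^2 * cnj z + d12 * z * (cnj z)^2 + d03 * (cnj z)^3) - H * (b1 * z + b2 * cnj z)"
    unfolding y H d30_def d21_def d12_def d03_def by (simp add: field_simps power2_eq_square power3_eq_cube)
  finally have "pc * (of_real (n2 u) + pd * of_real (n3 u))
      = n20 * z^2 + n11 * z * cnj z + n02 * (cnj z)^2 + w * (b1 * z + b2 * cnj z) + cw * w^2
        + ((d30 * z^3 + d21 * z^2 * cnj z + d12 * z * (cnj z)^2 + d03 * (cnj z)^3) - H * (b1 * z + b2 * cnj z) + w * Mc u) + Rc u" .
  also have "\<dots> = Nc u"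
  proof -
    have eq: "of_real (W u - quad_form h20 h11 (Z u)) = w - H" by (simp add: w_def H_def hz_def)
    show ?thesis
      unfolding Nc_def eq E1_def E4_def unfolding z_def[symmetric] w_def[symmetric] H_def[symmetric]
      by (simp add: algebra_simps power2_eq_square)
  qed
  finally have 1: "pc * (of_real (n2 u) + pd * of_real (n3 u)) = Nc u" .
  have "Z (vector [0, n2 u - \<eta> * u $ 2, n3 u]) = pc * (of_real (n2 u) + pd * of_real (n3 u)) - of_real \<eta> * (pc * of_real (u $ 2))"
    unfolding Z_vertical by (simp add: algebra_simps)
  also have "pc * of_real (u $ 2) = - (k1 * z + k1 * cnj z + k3 * w)"
    unfolding u k1_def k3_def by (simp add: algebra_simps)
  finally show ?thesis unfolding 1 z_def w_def by (simp add: algebra_simps)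
qed

text \<open>The quadratic invariance equation for the graph of the form: the forcing
  \<open>m20\<close>, \<open>m11\<close> balances rotation and contraction. The |z|^2 part is
  unchanged by rotation, hence the plain division by \<open>e\<close> in \<open>h11\<close>.\<close>

lemma h_equations: "quad_form m20 m11 z = quad_form_deriv h20 h11 z (\<i> * of_real \<omega> * z) + e * quad_form h20 h11 z"
proof -
  have "of_real e + 2 * \<i> * of_real \<omega> \<noteq> 0" using pos by (simp add: complex_eq_iff)
  then have m: "m20 = h20 * (of_real e + 2 * \<i> * of_real \<omega>)" by (simp add: h20_def)
  have m': "m11 = e * h11" using pos by (simp add: h11_def)
  have 1: "m20 * z^2 = 2 * h20 * z * (\<i> * of_real \<omega> * z) + of_real e * (h20 * z^2)"
    unfolding m by (simp add: algebra_simps power2_eq_square)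
  have 2: "Re (cnj z * (\<i> * of_real \<omega> * z)) = 0" by (simp add: algebra_simps)
  show ?thesis unfolding quad_form_def quad_form_deriv_def 1 2 m' plus_complex.sel(1)
    by (simp add: algebra_simps)
qed

lemma W_nonlinear: "W (vector [0, n2 u - \<eta> * u $ 2, n3 u]) = quad_form m20 m11 (Z u) + W u * D1 u
   + ((v111 * (u $ 1)^3 + 3 * v113 * ((u $ 1)^2 * u $ 3) + 3 * v133 * (u $ 1 * (u $ 3)^2)) / 6 + (b * R3 u - e * R2 u) / D) + \<eta> * (e / D * u $ 2)"
proof -
  define p r w where "p = 2 * Im (Z u)" and "r = g * (2 * Re (Z u))" and "w = W u"
  have u: "u $ 1 = p + w" "u $ 3 = r + k * w" using coordinates[of u] by (simp_all add: p_def r_def w_def)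
  have "W (vector [0, n2 u - \<eta> * u $ 2, n3 u]) = (b * n3 u - e * n2 u) / D + \<eta> * (e / D * u $ 2)"
    by (simp add: W_def field_simps)
  also have "(b * n3 u - e * n2 u) / D = (v11 * (u $ 1)^2 + 2 * v13 * u $ 1 * u $ 3 + v33 * (u $ 3)^2) / 2
      + ((v111 * (u $ 1)^3 + 3 * v113 * ((u $ 1)^2 * u $ 3) + 3 * v133 * (u $ 1 * (u $ 3)^2)) / 6 + (b * R3 u - e * R2 u) / D)"
    unfolding n2_def n3_def v11_def v13_def v33_def v111_def v113_def v133_def by (simp add: field_simps)
  also have "(v11 * (u $ 1)^2 + 2 * v13 * u $ 1 * u $ 3 + v33 * (u $ 3)^2) / 2
      = (v11 * p^2 + 2 * v13 * p * r + v33 * r^2) / 2 + w * (v11 * p + v13 * (k * p + r) + v33 * k * r + (v11 + 2 * v13 * k + v33 * k^2) / 2 * w)"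
    unfolding u by (simp add: field_simps power2_eq_square)
  also have "(v11 * p^2 + 2 * v13 * p * r + v33 * r^2) / 2 = quad_form m20 m11 (Z u)"
    unfolding quad_form_def m20_def m11_def p_def r_def by (simp add: field_simps power2_eq_square)
  also have "v11 * p + v13 * (k * p + r) + v33 * k * r + (v11 + 2 * v13 * k + v33 * k^2) / 2 * w = D1 u"
    unfolding D1_def p_def r_def w_def ..
  finally show ?thesis by (simp add: w_def)
qed

text \<open>\<open>k1\<close> is passed twice: the parameter acts through the second component
  alone, whose critical part is \<open>\<omega>\<close> times the sum of \<open>Z\<close> and its
  conjugate, so both receive the same coefficient.\<close>

sublocale hopf_form F P Z W emb \<omega> e h11 h20 n20 n11 n02 d30 d21 d12 d03 k1 k1 k3 E1 E4 D1 D3 K2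
proof (rule hopf_form.intro)
  show "Z (F \<eta> (P + u)) = \<i> * of_real \<omega> * Z u + of_real \<eta> * (k1 * Z u + k1 * cnj (Z u) + k3 * of_real (W u))
       + (n20 * (Z u)^2 + n11 * Z u * cnj (Z u) + n02 * (cnj (Z u))^2)
       + (d30 * (Z u)^3 + d21 * (Z u)^2 * cnj (Z u) + d12 * Z u * (cnj (Z u))^2 + d03 * (cnj (Z u))^3)
       + of_real (W u - quad_form h20 h11 (Z u)) * E1 u + E4 u" for \<eta> u
    unfolding Z_split Z_nonlinear Nc_def by (simp only: add.assoc)
  show "W (F \<eta> (P + u)) - quad_form_deriv h20 h11 (Z u) (Z (F \<eta> (P + u))) =
       - e * (W u - quad_form h20 h11 (Z u)) + (W u - quad_form h20 h11 (Z u)) * D1 u + D3 u + \<eta> * K2 u" for \<eta> u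
  proof -
    have l: "linear (quad_form_deriv h20 h11 (Z u))" using has_derivative_linear[OF quad_form_has_derivative] .
    have s: "of_real \<eta> * x = \<eta> *\<^sub>R x" for x :: complex by (simp add: scaleR_conv_of_real)
    show ?thesis
      unfolding Z_split Z_nonlinear W_split W_nonlinear linear_add[OF l] s linear_cmul[OF l] h_equations D3_def K2_def hz_def
      by (simp add: algebra_simps)
  qed
qed (rule pos Z_linear W_linear emb_linear Z_emb W_emb emb_ZW lipo_E1 lipo_E4 lipo_D1 lipo_D3 lipo_K2)+

end

section \<open>The first Lyapunov coefficient\<close>

lemma det_companion:
  fixes A :: "complex^3^3"
  assumes "A = vector [vector [0, 1, 0], vector [a, c, d], vector [f, 0, 0]]"
  shows "det (mat x - A) = x^3 - c * x^2 - a * x - d * f"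
  unfolding assms det_3
  by (simp add: mat_def algebra_simps power2_eq_square power3_eq_cube)

text \<open>Reduces the choice in \<open>matrix_inv\<close> to exhibiting a preimage, which is easy
  in an eigenbasis.\<close>

lemma matrix_inv_eqI:
  fixes M :: "complex^'n^'n"
  assumes "det M \<noteq> 0" "M *v x = y"
  shows "matrix_inv M *v y = x"
proof -
  have "invertible M" using assms(1) by (simp add: invertible_det_nz)
  then have "M ** matrix_inv M = mat 1 \<and> matrix_inv M ** M = mat 1"
    unfolding invertible_def matrix_inv_def by (rule someI_ex)
  then have "matrix_inv M ** M = mat 1" ..
  then show ?thesis unfolding assms(2)[symmetric] matrix_vector_mul_assoc by simp
qed

context hopf_jet
begin

text \<open>Linear, quadratic and cubic parts of the jet as complex multilinear maps, together with
  the critical eigenvector \<open>q0\<close> and the real eigenvector \<open>qr\<close>; they match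
  the ingredients of \<open>lyap1\<close>.\<close>

definition A0 :: "complex^3^3" where
  "A0 = vector [vector [0, 1, 0], vector [- of_real (\<omega>^2), - of_real e, of_real b], vector [- of_real (\<omega>^2 * e / b), 0, 0]]"
definition q0 :: "complex^3" where "q0 = vector [- \<i>, of_real \<omega>, of_real g]"
definition qr :: "complex^3" where "qr = vector [1, - of_real e, of_real k]"
definition B0 :: "complex^3 \<Rightarrow> complex^3 \<Rightarrow> complex^3" where
  "B0 x y = vector [0, of_real q11 * x$1 * y$1 + of_real q13 * (x$1 * y$3 + x$3 * y$1) + of_real q33 * x$3 * y$3, of_real r11 * x$1 * y$1]"
definition C0 :: "complex^3 \<Rightarrow> complex^3 \<Rightarrow> complex^3 \<Rightarrow> complex^3" where
  "C0 x y w = vector [0, of_real t111 * x$1 * y$1 * w$1 + of_real t113 * (x$1 * y$1 * w$3 + x$1 * y$3 * w$1 + x$3 * y$1 * w$1)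
     + of_real t133 * (x$1 * y$3 * w$3 + x$3 * y$1 * w$3 + x$3 * y$3 * w$1), of_real r111 * x$1 * y$1 * w$1]"

lemma conj_q0: "cconj_vec q0 = vector [\<i>, of_real \<omega>, of_real g]"
  by (simp add: cconj_vec_def q0_def vec_eq_iff forall_3)

lemma A0_mult: "A0 *v x = vector [x$2, - of_real (\<omega>^2) * x$1 - of_real e * x$2 + of_real b * x$3, - of_real (\<omega>^2 * e / b) * x$1]"
  by (simp add: A0_def matrix_vector_mult_def vec_eq_iff forall_3 sum_3)

lemma real_relations: "\<omega>^2 * e / b * b = \<omega>^2 * e" "b * g = \<omega> * e" "b * k = \<omega>^2" "\<omega>^2 * e / b = \<omega> * g" "\<omega>^2 * e / b = e * k"
  using pos by (simp_all add: g_def k_def power2_eq_square)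

lemma A0_eigen: "A0 *v q0 = (\<i> * of_real \<omega>) *s q0" "A0 *v cconj_vec q0 = (- \<i> * of_real \<omega>) *s cconj_vec q0"
  "A0 *v qr = (- of_real e) *s qr"
proof -
  have c: "complex_of_real b * of_real g = of_real \<omega> * of_real e" "complex_of_real b * of_real k = of_real \<omega> * of_real \<omega>"
    using real_relations(2,3) by (metis of_real_mult, metis of_real_mult power2_eq_square)
  show "A0 *v q0 = (\<i> * of_real \<omega>) *s q0" "A0 *v cconj_vec q0 = (- \<i> * of_real \<omega>) *s cconj_vec q0"
    unfolding A0_mult conj_q0 unfolding q0_def real_relations(4)
    by (simp_all add: vec_eq_iff forall_3 c power2_eq_square algebra_simps)
  show "A0 *v qr = (- of_real e) *s qr"
    unfolding A0_mult qr_def real_relations(5)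
    by (simp add: vec_eq_iff forall_3 c power2_eq_square algebra_simps)
qed

text \<open>All values of \<open>B0\<close> and \<open>C0\<close> have vanishing first entry, so
  this expansion in eigenvectors covers everything in the Lyapunov coefficient. In that basis the
  two inverse matrices act as scalars.\<close>

lemma vertical_decomposition:
  "(vector [0, y, w] :: complex^3) = (pc * (y + pd * w)) *s q0 + (cnj pc * (y + cnj pd * w)) *s cconj_vec q0
     + ((of_real b * w - of_real e * y) / of_real D) *s qr"
proof -
  have nz: "complex_of_real D \<noteq> 0" "complex_of_real \<omega> \<noteq> 0" "complex_of_real b \<noteq> 0" using D_ne pos by auto
  have pc: "pc = (of_real \<omega> + \<i> * of_real e) / (2 * of_real D)" "cnj pc = (of_real \<omega> - \<i> * of_real e) / (2 * of_real D)"
    by (simp_all add: pc_def complex_eq_iff)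
  have pd: "pd = - \<i> * of_real b / of_real \<omega>" "cnj pd = \<i> * of_real b / of_real \<omega>" by (simp_all add: pd_def)
  have gk': "complex_of_real g = of_real \<omega> * of_real e / of_real b" "complex_of_real k = of_real \<omega> * of_real \<omega> / of_real b"
    by (simp_all add: g_def k_def power2_eq_square)
  have Dd: "complex_of_real D = of_real \<omega> * of_real \<omega> + of_real e * of_real e" by (simp add: D_def power2_eq_square)
  have ii: "\<i> * (\<i> * x) = - x" for x by (simp add: mult.assoc[symmetric])
  have 1: "0 = pc * (y + pd * w) * (- \<i>) + cnj pc * (y + cnj pd * w) * \<i> + (of_real b * w - of_real e * y) / of_real D"
    unfolding pc pd using nz by (simp add: field_simps ii)
  have 2: "y = pc * (y + pd * w) * of_real \<omega> + cnj pc * (y + cnj pd * w) * of_real \<omega> + (of_real b * w - of_real e * y) / of_real D * (- of_real e)"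
  proof -
    have "pc * (y + pd * w) * of_real \<omega> + cnj pc * (y + cnj pd * w) * of_real \<omega> + (of_real b * w - of_real e * y) / of_real D * (- of_real e)
        = y * (of_real \<omega> * of_real \<omega> + of_real e * of_real e) / of_real D"
      unfolding pc pd using nz by (simp add: field_simps ii)
    then show ?thesis using nz unfolding Dd by simp
  qed
  have 3: "w = pc * (y + pd * w) * of_real g + cnj pc * (y + cnj pd * w) * of_real g + (of_real b * w - of_real e * y) / of_real D * of_real k"
  proof -
    have "pc * (y + pd * w) * of_real g + cnj pc * (y + cnj pd * w) * of_real g + (of_real b * w - of_real e * y) / of_real D * of_real k
        = w * (of_real \<omega> * of_real \<omega> + of_real e * of_real e) / of_real D"
      unfolding pc pd gk' using nz by (simp add: field_simps ii)
    then show ?thesis using nz unfolding Dd by simp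
  qed
  show ?thesis
    unfolding conj_q0 unfolding q0_def qr_def vec_eq_iff forall_3 using 1 2 3 by simp
qed

lemma left_eigenvector_exists: "\<exists>p. transpose A0 *v p = (- \<i> * of_real \<omega>) *s p \<and> cinner p q0 = 1"
proof -
  define p :: "complex^3" where "p = vector [cnj pc * (of_real e - \<i> * of_real \<omega>), cnj pc, cnj pc * (\<i> * of_real (b / \<omega>))]"
  have nz: "complex_of_real D \<noteq> 0" "complex_of_real \<omega> \<noteq> 0" "complex_of_real b \<noteq> 0" using D_ne pos by auto
  have "transpose A0 *v p = (- \<i> * of_real \<omega>) *s p"
    unfolding A0_def p_def
    using nz by (simp add: matrix_vector_mult_def transpose_def vec_eq_iff forall_3 sum_3 field_simps power2_eq_square)
  moreover have "cinner p q0 = 1"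
  proof -
    have "cinner p q0 = pc * (2 * (of_real \<omega> - \<i> * of_real e))"
      unfolding cinner_def p_def q0_def sum_3 g_def using nz by (simp add: field_simps)
    also have "\<dots> = 1" by (simp add: pc_def complex_eq_iff field_simps) (simp add: D_def power2_eq_square)
    finally show ?thesis .
  qed
  ultimately show ?thesis by blast
qed

text \<open>\<open>lyap1\<close> takes \<open>p\<close> by choice. The eigenvector equation
  determines \<open>p\<close> up to its second entry and the normalisation fixes that entry, so the
  pairing does not depend on the choice and agrees with \<open>Z_vertical\<close>.\<close>

lemma left_eigenvector_unique:
  assumes p: "transpose A0 *v p = (- \<i> * of_real \<omega>) *s p" "cinner p q0 = 1"
  shows "cinner p (vector [0, y, w]) = pc * (y + pd * w)"
proof -
  have nz: "complex_of_real D \<noteq> 0" "complex_of_real \<omega> \<noteq> 0" "complex_of_real b \<noteq> 0" using D_ne pos by auto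
  have e2: "p$1 - of_real e * p$2 = - \<i> * of_real \<omega> * p$2" and e3: "of_real b * p$2 = - \<i> * of_real \<omega> * p$3"
    using p(1) unfolding A0_def
    by (simp_all add: matrix_vector_mult_def transpose_def vec_eq_iff forall_3 sum_3)
  have p1: "p$1 = (of_real e - \<i> * of_real \<omega>) * p$2" using e2 by (simp add: algebra_simps)
  have p3: "p$3 = \<i> * of_real (b / \<omega>) * p$2"
  proof -
    have "\<i> * (of_real b * p$2) = of_real \<omega> * p$3" unfolding e3 by (simp add: mult.assoc[symmetric])
    then show ?thesis using nz by (simp add: field_simps)
  qed
  have "cinner p q0 = cnj (p$2) * (2 * (of_real \<omega> - \<i> * of_real e))"
    unfolding cinner_def sum_3 p1 p3 q0_def g_def using nz by (simp add: field_simps)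
  then have "cnj (p$2) * (2 * (of_real \<omega> - \<i> * of_real e)) = 1" using p(2) by simp
  moreover have "pc * (2 * (of_real \<omega> - \<i> * of_real e)) = 1"
    by (simp add: pc_def complex_eq_iff field_simps) (simp add: D_def power2_eq_square)
  ultimately have p2: "cnj (p$2) = pc" by (metis mult_cancel_right mult_zero_right zero_neq_one)
  show ?thesis
    unfolding cinner_def sum_3 p3 by (simp add: p2 pd_def algebra_simps)
qed

text \<open>The eigenbasis coefficients are the coefficients of the normal form, doubled in the
  first case because the Taylor term carries 1/2.\<close>

lemma B0_values:
  "B0 q0 q0 = (2 * n20) *s q0 + (cnj (2 * n02)) *s cconj_vec q0 + (2 * m20) *s qr"
  "B0 q0 (cconj_vec q0) = n11 *s q0 + cnj n11 *s cconj_vec q0 + of_real m11 *s qr"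
proof -
  have ii: "\<i> * (\<i> * x) = - x" for x by (simp add: mult.assoc[symmetric])
  have 1: "B0 q0 q0 = vector [0, - of_real q11 - 2 * \<i> * of_real g * of_real q13 + of_real (g^2) * of_real q33, - of_real r11]"
    unfolding B0_def q0_def by (simp add: vec_eq_iff forall_3 algebra_simps power2_eq_square ii)
  have a: "pc * ((- of_real q11 - 2 * \<i> * of_real g * of_real q13 + of_real (g^2) * of_real q33) + pd * (- of_real r11)) = 2 * n20"
    unfolding n20_def c11_def c13_def c33_def by (simp add: field_simps)
  have b: "cnj pc * ((- of_real q11 - 2 * \<i> * of_real g * of_real q13 + of_real (g^2) * of_real q33) + cnj pd * (- of_real r11)) = cnj (2 * n02)"
    unfolding n02_def c11_def c13_def c33_def by (simp add: field_simps)
  have c: "(of_real b * (- of_real r11) - of_real e * (- of_real q11 - 2 * \<i> * of_real g * of_real q13 + of_real (g^2) * of_real q33)) / of_real D = 2 * m20"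
    unfolding m20_def v11_def v13_def v33_def by (simp add: complex_eq_iff field_simps)
  show "B0 q0 q0 = (2 * n20) *s q0 + (cnj (2 * n02)) *s cconj_vec q0 + (2 * m20) *s qr"
    unfolding 1 by (subst vertical_decomposition) (simp only: a b c)
  have 2: "B0 q0 (cconj_vec q0) = vector [0, of_real q11 + of_real (g^2) * of_real q33, of_real r11]"
    unfolding B0_def conj_q0 unfolding q0_def by (simp add: vec_eq_iff forall_3 algebra_simps power2_eq_square ii)
  have a: "pc * ((of_real q11 + of_real (g^2) * of_real q33) + pd * of_real r11) = n11"
    unfolding n11_def c11_def c33_def by (simp add: field_simps)
  have b: "cnj pc * ((of_real q11 + of_real (g^2) * of_real q33) + cnj pd * of_real r11) = cnj n11"
    unfolding n11_def c11_def c33_def by (simp add: field_simps)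
  have c: "(of_real b * of_real r11 - of_real e * (of_real q11 + of_real (g^2) * of_real q33)) / of_real D = (of_real m11 :: complex)"
    unfolding m11_def v11_def v33_def by (simp add: complex_eq_iff field_simps)
  show "B0 q0 (cconj_vec q0) = n11 *s q0 + cnj n11 *s cconj_vec q0 + of_real m11 *s qr"
    unfolding 2 by (subst vertical_decomposition) (simp only: a b c)
qed

lemma det_A0: "det (mat x - A0) = (x + of_real e) * (x^2 + of_real (\<omega>^2))"
proof -
  have "complex_of_real b * of_real (\<omega>^2 * e / b) = of_real (\<omega>^2) * of_real e"
    using real_relations(1) by (metis mult.commute of_real_mult)
  then show ?thesis
    unfolding det_companion[OF A0_def] by (simp add: algebra_simps power2_eq_square power3_eq_cube)
qed

text \<open>The resolvent divides by i omega, 3 i omega and e + 2 i omega on the three eigenvectors.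
  The last quotient is twice \<open>h20\<close>: the resolvent term of the Lyapunov coefficient
  computes the center manifold.\<close>

lemma resolvent_value:
  "matrix_inv (mat (2 * \<i> * of_real \<omega>) - A0) *v B0 q0 q0
    = (2 * n20 / (\<i> * of_real \<omega>)) *s q0 + (cnj (2 * n02) / (3 * \<i> * of_real \<omega>)) *s cconj_vec q0 + (2 * h20) *s qr"
proof (rule matrix_inv_eqI)
  have nz: "complex_of_real \<omega> \<noteq> 0" "of_real e + 2 * \<i> * of_real \<omega> \<noteq> 0" using pos by (auto simp: complex_eq_iff)
  show "det (mat (2 * \<i> * of_real \<omega>) - A0) \<noteq> 0"
  proof -
    have "(2 * \<i> * of_real \<omega>)^2 + of_real (\<omega>^2) = - (3 * complex_of_real \<omega> ^ 2)" by (simp add: power_mult_distrib)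
    moreover have "2 * \<i> * of_real \<omega> + of_real e \<noteq> 0" using nz by (simp add: add.commute)
    ultimately show ?thesis unfolding det_A0 mult_eq_0_iff using nz by (simp only: neg_equal_0_iff_equal mult_eq_0_iff power_eq_0_iff) simp
  qed
  have ev: "(mat l - A0) *v (c *s x) = (c * (l - m)) *s x" if "A0 *v x = m *s x" for l c m x
    proof -
    have "(mat l - A0) *v x = (l - m) *s x"
      unfolding matrix_vector_mult_diff_rdistrib that
      by (simp add: vec_eq_iff forall_3 mat_def matrix_vector_mult_def sum_3 algebra_simps)
    then show ?thesis by (simp only: vector_scalar_commute vector_smult_assoc)
  qed
  have h: "2 * h20 * (2 * \<i> * of_real \<omega> - (- of_real e)) = 2 * m20" using nz by (simp add: h20_def field_simps)
  have 1: "2 * n20 / (\<i> * of_real \<omega>) * (2 * \<i> * of_real \<omega> - \<i> * of_real \<omega>) = 2 * n20" using nz by (simp add: field_simps)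
  have 2: "cnj (2 * n02) / (3 * \<i> * of_real \<omega>) * (2 * \<i> * of_real \<omega> - (- \<i> * of_real \<omega>)) = cnj (2 * n02)" using nz by (simp add: field_simps)
  show "(mat (2 * \<i> * of_real \<omega>) - A0) *v ((2 * n20 / (\<i> * of_real \<omega>)) *s q0 + (cnj (2 * n02) / (3 * \<i> * of_real \<omega>)) *s cconj_vec q0 + (2 * h20) *s qr) = B0 q0 q0"
    unfolding B0_values matrix_vector_right_distrib ev[OF A0_eigen(1)] ev[OF A0_eigen(2)] ev[OF A0_eigen(3)] h 1 2 ..
qed

lemma inverse_value:
  "matrix_inv A0 *v B0 q0 (cconj_vec q0)
    = (n11 / (\<i> * of_real \<omega>)) *s q0 + (- cnj n11 / (\<i> * of_real \<omega>)) *s cconj_vec q0 + (- of_real h11) *s qr"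
proof (rule matrix_inv_eqI)
  have nz: "complex_of_real \<omega> \<noteq> 0" "complex_of_real e \<noteq> 0" using pos by auto
  have "det A0 = - (of_real e * of_real (\<omega>^2))"
  proof -
    have "complex_of_real b * of_real (\<omega>^2 * e / b) = of_real (\<omega>^2) * of_real e"
      using real_relations(1) by (metis mult.commute of_real_mult)
    then show ?thesis unfolding A0_def det_3 by (simp add: algebra_simps)
  qed
  then show "det A0 \<noteq> 0" using nz by simp
  have ev: "A0 *v (c *s x) = (c * m) *s x" if "A0 *v x = m *s x" for c m x
    unfolding vector_scalar_commute that by (simp add: vec_eq_iff)
  have h: "- of_real h11 * (- of_real e) = (of_real m11 :: complex)" using nz by (simp add: h11_def)
  have 1: "n11 / (\<i> * of_real \<omega>) * (\<i> * of_real \<omega>) = n11" "- cnj n11 / (\<i> * of_real \<omega>) * (- \<i> * of_real \<omega>) = cnj n11"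
    using nz by (simp_all add: field_simps)
  show "A0 *v ((n11 / (\<i> * of_real \<omega>)) *s q0 + (- cnj n11 / (\<i> * of_real \<omega>)) *s cconj_vec q0 + (- of_real h11) *s qr) = B0 q0 (cconj_vec q0)"
    unfolding B0_values matrix_vector_right_distrib ev[OF A0_eigen(1)] ev[OF A0_eigen(2)] ev[OF A0_eigen(3)] h 1 ..
qed

text \<open>Inserting the two inverses brings in \<open>h20 * b2\<close> and
  \<open>h11 * b1\<close>, which complete the cubic coefficient to \<open>d21\<close>. Besides it
  there remain the product of \<open>n20\<close> and \<open>n11\<close> and squared moduli times i,
  which have no real part.\<close>

theorem Re_G21:
  assumes p: "transpose A0 *v p = (- \<i> * of_real \<omega>) *s p" "cinner p q0 = 1"
  shows "Re (cinner p (C0 q0 q0 (cconj_vec q0) + B0 (cconj_vec q0) (matrix_inv (mat (2 * \<i> * of_real \<omega>) - A0) *v B0 q0 q0)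
     - 2 *s B0 q0 (matrix_inv A0 *v B0 q0 (cconj_vec q0)))) = 2 * lc"
proof -
  have nz: "complex_of_real \<omega> \<noteq> 0" using pos by auto
  have ii: "\<i> * (\<i> * x) = - x" for x by (simp add: mult.assoc[symmetric])
  have add: "cinner p (x + y) = cinner p x + cinner p y" "cinner p (x - y) = cinner p x - cinner p y"
    "cinner p (c *s x) = c * cinner p x" for x y c
    unfolding cinner_def sum_3 by (simp_all add: algebra_simps)
  have lB: "cinner p (B0 x y) = c11 * x$1 * y$1 + c13 * (x$1 * y$3 + x$3 * y$1) + c33 * x$3 * y$3" for x y
    unfolding B0_def left_eigenvector_unique[OF p] c11_def c13_def c33_def by (simp add: algebra_simps)
  have lBl: "cinner p (B0 x (a *s y + c *s z + d *s w)) = a * cinner p (B0 x y) + c * cinner p (B0 x z) + d * cinner p (B0 x w)" for x y z w a c d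
    unfolding lB by (simp add: algebra_simps)
  have v1: "cinner p (B0 (cconj_vec q0) q0) = n11" "cinner p (B0 q0 (cconj_vec q0)) = n11"
    unfolding lB conj_q0 unfolding q0_def n11_def by (simp_all add: algebra_simps power2_eq_square)
  have v2: "cinner p (B0 (cconj_vec q0) (cconj_vec q0)) = 2 * n02" "cinner p (B0 q0 q0) = 2 * n20"
    unfolding lB conj_q0 unfolding q0_def n02_def n20_def by (simp_all add: field_simps power2_eq_square ii)
  have v3: "cinner p (B0 (cconj_vec q0) qr) = b2" "cinner p (B0 q0 qr) = b1"
    unfolding lB conj_q0 unfolding q0_def qr_def b1_def b2_def by (simp_all add: algebra_simps)
  have lC: "cinner p (C0 q0 q0 (cconj_vec q0)) = - \<i> * c111 + of_real g * c113 - \<i> * of_real (g^2) * c133"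
    unfolding C0_def left_eigenvector_unique[OF p] c111_def c113_def c133_def conj_q0 unfolding q0_def
    by (simp add: algebra_simps power2_eq_square ii)
  define G where "G = cinner p (C0 q0 q0 (cconj_vec q0) + B0 (cconj_vec q0) (matrix_inv (mat (2 * \<i> * of_real \<omega>) - A0) *v B0 q0 q0)
     - 2 *s B0 q0 (matrix_inv A0 *v B0 q0 (cconj_vec q0)))"
  have G: "G = (- \<i> * c111 + of_real g * c113 - \<i> * of_real (g^2) * c133)
     + (2 * n20 / (\<i> * of_real \<omega>) * n11 + cnj (2 * n02) / (3 * \<i> * of_real \<omega>) * (2 * n02) + 2 * h20 * b2)
     - 2 * (n11 / (\<i> * of_real \<omega>) * (2 * n20) + - cnj n11 / (\<i> * of_real \<omega>) * n11 + - of_real h11 * b1)"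
    unfolding G_def resolvent_value inverse_value add lBl v1 v2 v3 lC ..
  have "G = 2 * d21 + (2 * n20 * n11) * (\<i> / of_real \<omega>) - \<i> * of_real ((4 * (norm n02)^2 / 3 + 2 * (norm n11)^2) / \<omega>)"
  proof -
    have n: "cnj n02 * n02 = of_real ((norm n02)^2)" "cnj n11 * n11 = of_real ((norm n11)^2)"
      by (metis complex_norm_square mult.commute)+
    have inv: "1 / (\<i> * of_real \<omega>) = - \<i> / of_real \<omega>" using nz by (simp add: field_simps)
    have s: "x / (\<i> * of_real \<omega>) = x * (- \<i> / of_real \<omega>)" "x / (3 * \<i> * of_real \<omega>) = x * (- \<i> / of_real \<omega>) / 3" for x
      using nz by (simp_all add: field_simps)
    have "G = (- \<i> * c111 + of_real g * c113 - \<i> * of_real (g^2) * c133) + 2 * h20 * b2 + 2 * of_real h11 * b1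
        + (2 * n20 * n11) * (\<i> / of_real \<omega>) + (- \<i> / of_real \<omega>) * (4 * (cnj n02 * n02) / 3 + 2 * (cnj n11 * n11))"
      unfolding G s by (simp add: algebra_simps)
    also have "(- \<i> / of_real \<omega>) * (4 * (cnj n02 * n02) / 3 + 2 * (cnj n11 * n11)) = - \<i> * of_real ((4 * (norm n02)^2 / 3 + 2 * (norm n11)^2) / \<omega>)"
      unfolding n by simp
    also have "(- \<i> * c111 + of_real g * c113 - \<i> * of_real (g^2) * c133) + 2 * h20 * b2 + 2 * of_real h11 * b1 = 2 * d21"
      unfolding d21_def by (simp add: field_simps)
    finally show ?thesis by simp
  qed
  then have "Re G = 2 * Re d21 + Re ((2 * n20 * n11) * (\<i> / of_real \<omega>))" by simp
  also have "(2 * n20 * n11) * (\<i> / of_real \<omega>) = of_real (2 / \<omega>) * (\<i> * (n20 * n11))" by simp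
  also have "Re (of_real (2 / \<omega>) * (\<i> * (n20 * n11))) = - 2 * Im (n20 * n11) / \<omega>" by simp
  also have "2 * Re d21 + - 2 * Im (n20 * n11) / \<omega> = 2 * lc"
  proof -
    have "2 * a + - 2 * c / \<omega> = 2 * (a - c / \<omega>)" for a c :: real by (simp add: algebra_simps)
    then show ?thesis unfolding lc_def .
  qed
  finally show ?thesis unfolding G_def[symmetric] .
qed

end

section \<open>Remainders of sine and cosine\<close>

text \<open>A derivative bounded by |t|^k gives, by the mean value inequality on the interval
  containing both values of L, a remainder of order k + 1.\<close>

lemma lipo_scalar_compose:
  fixes g g' :: "real \<Rightarrow> real"
  assumes g: "\<And>t. (g has_real_derivative g' t) (at t)" "g 0 = 0" "\<And>t. \<bar>g' t\<bar> \<le> \<bar>t\<bar>^k"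
    and L: "bounded_linear L"
  shows "lipo (Suc k) (\<lambda>u. g (L u))"
proof -
  interpret L: bounded_linear L by fact
  obtain K where K: "0 < K" "\<And>x. norm (L x) \<le> norm x * K" using L.pos_bounded by blast
  have bd: "norm (g (L u) - g (L v)) \<le> (K * norm u)^k * (K * norm (u - v))" if "norm v \<le> norm u" for u v
  proof -
    have "norm (g (L u) - g (L v)) \<le> (K * norm u)^k * norm (L u - L v)"
    proof (rule field_differentiable_bound[of "cball 0 (K * norm u)" g g'])
      show "(g has_field_derivative g' z) (at z within cball 0 (K * norm u))" for z
        using g(1) by (rule has_field_derivative_at_within)
      show "norm (g' z) \<le> (K * norm u)^k" if "z \<in> cball 0 (K * norm u)" for z
        using g(3)[of z] power_mono[of "\<bar>z\<bar>" "K * norm u" k] that by (simp add: dist_norm)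
      show "L u \<in> cball 0 (K * norm u)" using K(2)[of u] by (simp add: mult.commute)
      have "norm v * K \<le> norm u * K" using that K by simp
      then show "L v \<in> cball 0 (K * norm u)" using K(2)[of v] by (simp add: mult.commute)
    qed simp
    also have "\<dots> \<le> (K * norm u)^k * (K * norm (u - v))"
      using K(2)[of "u - v"] K(1) by (intro mult_left_mono) (simp_all add: L.diff mult.commute)
    finally show ?thesis .
  qed
  show ?thesis
  proof (rule lipoI[of "K ^ Suc k"])
    show "norm (g (L u)) \<le> K ^ Suc k * norm u ^ Suc k" for u
      using bd[of 0 u] by (simp add: L.zero g(2) power_mult_distrib mult_ac)
    show "norm (g (L u) - g (L v)) * norm u \<le> K ^ Suc k * norm u ^ Suc k * norm (u - v)" if "norm v \<le> norm u" for u v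
      using mult_right_mono[OF bd[OF that], of "norm u"] by (simp add: power_mult_distrib mult_ac)
  qed (use K in simp)
qed

definition sin_rem :: "real \<Rightarrow> real" where "sin_rem t = sin t - t + t^3 / 6"
definition cos_rem :: "real \<Rightarrow> real" where "cos_rem t = cos t - 1 + t^2 / 2"

text \<open>The derivative of \<open>sin_rem\<close> is \<open>cos_rem\<close>, and that of
  \<open>cos_rem\<close> is t - sin t. Both are bounded by |t|^3, which gives order four, as a cubic
  jet requires.\<close>

lemma lipo_trig_rem:
  assumes "bounded_linear L"
  shows "lipo 4 (\<lambda>u. sin_rem (L u))" "lipo 4 (\<lambda>u. cos_rem (L u))"
proof -
  have "lipo (Suc 3) (\<lambda>u. sin_rem (L u))"
  proof (rule lipo_scalar_compose[OF _ _ _ assms])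
    show "(sin_rem has_real_derivative cos_rem t) (at t)" for t
      unfolding sin_rem_def[abs_def] cos_rem_def
      by (auto intro!: derivative_eq_intros)
    show "sin_rem 0 = 0" by (simp add: sin_rem_def)
    show "\<bar>cos_rem t\<bar> \<le> \<bar>t\<bar>^3" for t
    proof -
      obtain s where s: "cos t = (\<Sum>m<3. cos_coeff m * t ^ m) + cos (s + 1/2 * real 3 * pi) / fact 3 * t ^ 3"
        using Maclaurin_cos_expansion[of t 3] by blast
      define c where "c = cos (s + 1/2 * real 3 * pi)"
      have c: "\<bar>c\<bar> \<le> 1" by (simp add: c_def)
      have "cos_rem t = c / 6 * t ^ 3"
        unfolding cos_rem_def s c_def[symmetric] by (simp add: numeral_eq_Suc cos_coeff_def)
      then have "\<bar>cos_rem t\<bar> = \<bar>c\<bar> / 6 * \<bar>t\<bar> ^ 3" by (simp only: abs_mult abs_divide power_abs abs_numeral)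
      also have "\<dots> \<le> 1 * \<bar>t\<bar>^3" using c by (intro mult_right_mono) auto
      finally show ?thesis by simp
    qed
  qed
  then show "lipo 4 (\<lambda>u. sin_rem (L u))" by simp
  have "lipo (Suc 3) (\<lambda>u. cos_rem (L u))"
  proof (rule lipo_scalar_compose[OF _ _ _ assms])
    show "(cos_rem has_real_derivative t - sin t) (at t)" for t
      unfolding cos_rem_def[abs_def]
      by (auto intro!: derivative_eq_intros)
    show "cos_rem 0 = 0" by (simp add: cos_rem_def)
    show "\<bar>t - sin t\<bar> \<le> \<bar>t\<bar>^3" for t :: real
    proof -
      have "\<bar>sin t - (\<Sum>m<3. sin_coeff m * t ^ m)\<bar> \<le> inverse (fact 3) * \<bar>t\<bar> ^ 3" by (rule Maclaurin_sin_bound)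
      also have "(\<Sum>m<3. sin_coeff m * t ^ m) = t" by (simp add: numeral_eq_Suc sin_coeff_def)
      also have "inverse (fact 3) * \<bar>t\<bar> ^ 3 \<le> 1 * \<bar>t\<bar>^3" by (intro mult_right_mono) (auto simp: numeral_eq_Suc)
      finally show ?thesis by (simp add: abs_minus_commute)
    qed
  qed
  then show "lipo 4 (\<lambda>u. cos_rem (L u))" by simp
qed

section \<open>The governor system\<close>

lemma has_vector_derivative_vector3:
  assumes "(a has_real_derivative a') (at t)" "(b has_real_derivative b') (at t)" "(c has_real_derivative c') (at t)"
  shows "((\<lambda>t. vector [a t, b t, c t] :: real^3) has_vector_derivative vector [a', b', c']) (at t)"
proof -
  have v: "(vector [x, y, z] :: real^3) = x *\<^sub>R vector [1,0,0] + y *\<^sub>R vector [0,1,0] + z *\<^sub>R vector [0,0,1]" for x y z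
    by (simp add: vec_eq_iff forall_3)
  show ?thesis
    unfolding v[of "a _"] v[of a']
    by (intro has_vector_derivative_add)
      (use has_vector_derivative_scaleR[OF assms(1) has_vector_derivative_const] has_vector_derivative_scaleR[OF assms(2) has_vector_derivative_const]
        has_vector_derivative_scaleR[OF assms(3) has_vector_derivative_const] in simp_all)
qed

text \<open>Iterated directional derivatives in closed form. Products of sines and cosines stay
  unexpanded, so that they can be evaluated at the equilibrium by substitution.\<close>

definition vf_d1 :: "real \<Rightarrow> real \<Rightarrow> real \<Rightarrow> real^3 \<Rightarrow> real^3 \<Rightarrow> real^3" where
  "vf_d1 \<kappa> \<alpha> \<epsilon> v y = vector [v$2,
     ((y$3)^2 + \<kappa>) * (cos (y$1) * cos (y$1) - sin (y$1) * sin (y$1)) * v$1 + 2 * y$3 * sin (y$1) * cos (y$1) * v$3 - cos (y$1) * v$1 - \<epsilon> * v$2,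
     - \<alpha> * sin (y$1) * v$1]"

definition vf_d2 :: "real \<Rightarrow> real \<Rightarrow> real^3 \<Rightarrow> real^3 \<Rightarrow> real^3 \<Rightarrow> real^3" where
  "vf_d2 \<kappa> \<alpha> u v y = vector [0,
     ((y$3)^2 + \<kappa>) * (- 4 * sin (y$1) * cos (y$1)) * u$1 * v$1
       + 2 * y$3 * (cos (y$1) * cos (y$1) - sin (y$1) * sin (y$1)) * (u$3 * v$1 + u$1 * v$3)
       + 2 * sin (y$1) * cos (y$1) * u$3 * v$3 + sin (y$1) * u$1 * v$1,
     - \<alpha> * cos (y$1) * u$1 * v$1]"

definition vf_d3 :: "real \<Rightarrow> real \<Rightarrow> real^3 \<Rightarrow> real^3 \<Rightarrow> real^3 \<Rightarrow> real^3 \<Rightarrow> real^3" where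
  "vf_d3 \<kappa> \<alpha> u v w y = vector [0,
     ((y$3)^2 + \<kappa>) * (- 4 * (cos (y$1) * cos (y$1) - sin (y$1) * sin (y$1))) * u$1 * v$1 * w$1
       + 2 * y$3 * (- 4 * sin (y$1) * cos (y$1)) * (u$3 * v$1 * w$1 + u$1 * v$3 * w$1 + u$1 * v$1 * w$3)
       + 2 * (cos (y$1) * cos (y$1) - sin (y$1) * sin (y$1)) * (u$3 * v$3 * w$1 + u$3 * v$1 * w$3 + u$1 * v$3 * w$3)
       + cos (y$1) * u$1 * v$1 * w$1,
     \<alpha> * sin (y$1) * u$1 * v$1 * w$1]"

lemma dd_vf: "dd (vf 0 \<kappa> \<alpha> \<beta> \<epsilon>) v = vf_d1 \<kappa> \<alpha> \<epsilon> v"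
proof (rule ext)
  fix y
  show "(dd (vf 0 \<kappa> \<alpha> \<beta> \<epsilon>) v) y = (vf_d1 \<kappa> \<alpha> \<epsilon> v) y"
    unfolding dd_def vf_def vf_d1_def Let_def
      vector_add_component vector_scaleR_component real_scaleR_def
    apply (rule vector_derivative_at, rule has_vector_derivative_vector3)
    subgoal by (auto intro!: derivative_eq_intros)
    subgoal by ((rule derivative_eq_intros refl)+) (simp add: algebra_simps power2_eq_square)
    subgoal by ((rule derivative_eq_intros refl)+) (simp add: algebra_simps power2_eq_square)
    done
qed

lemma dd_vf_d1: "dd (vf_d1 \<kappa> \<alpha> \<epsilon> v) u = vf_d2 \<kappa> \<alpha> u v"
proof (rule ext)
  fix y
  show "(dd (vf_d1 \<kappa> \<alpha> \<epsilon> v) u) y = (vf_d2 \<kappa> \<alpha> u v) y"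
    unfolding dd_def vf_d1_def vf_d2_def
      vector_add_component vector_scaleR_component real_scaleR_def
    apply (rule vector_derivative_at, rule has_vector_derivative_vector3)
    subgoal by (auto intro!: derivative_eq_intros)
    subgoal by ((rule derivative_eq_intros refl)+) (simp add: algebra_simps power2_eq_square)
    subgoal by ((rule derivative_eq_intros refl)+) (simp add: algebra_simps power2_eq_square)
    done
qed

lemma dd_vf_d2: "dd (vf_d2 \<kappa> \<alpha> v w) u = vf_d3 \<kappa> \<alpha> u v w"
proof (rule ext)
  fix y
  show "(dd (vf_d2 \<kappa> \<alpha> v w) u) y = (vf_d3 \<kappa> \<alpha> u v w) y"
    unfolding dd_def vf_d2_def vf_d3_def
      vector_add_component vector_scaleR_component real_scaleR_def
    apply (rule vector_derivative_at, rule has_vector_derivative_vector3)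
    subgoal by (auto intro!: derivative_eq_intros)
    subgoal by ((rule derivative_eq_intros refl)+) (simp add: algebra_simps power2_eq_square)
    subgoal by ((rule derivative_eq_intros refl)+) (simp add: algebra_simps power2_eq_square)
    done
qed

lemma B_real_vf: "B_real (vf 0 \<kappa> \<alpha> \<beta> \<epsilon>) x u v = vf_d2 \<kappa> \<alpha> u v x"
  unfolding B_real_def dd_vf dd_vf_d1 ..

lemma C_real_vf: "C_real (vf 0 \<kappa> \<alpha> \<beta> \<epsilon>) x u v w = vf_d3 \<kappa> \<alpha> u v w x"
  unfolding C_real_def dd_vf dd_vf_d1 dd_vf_d2 ..

locale pendulum =
  fixes \<beta> \<alpha> \<kappa> :: real
  assumes par: "0 < \<beta>" "\<beta> < 1" "0 < \<alpha>" "0 \<le> \<kappa>" "\<kappa> < 1"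
begin

definition "sn = sqrt (1 - \<beta>^2)"
definition "zs = sqrt (1 / \<beta> - \<kappa>)"
definition "om = omega0 \<beta>"
definition "ec = eps_c \<beta> \<alpha> \<kappa>"
text \<open>The partial derivative in z of the second component at the equilibrium; it plays the
  role of \<open>b\<close> in the jet.\<close>

definition "bb = 2 * zs * \<beta> * sn"

lemma trig: "cos (arccos \<beta>) = \<beta>" "sin (arccos \<beta>) = sn"
  using par by (simp_all add: sn_def sin_arccos)

lemma sn: "0 < sn" "sn^2 = 1 - \<beta>^2"
  using par abs_square_less_1[of \<beta>] by (simp_all add: sn_def)

lemma zs: "0 < zs" "zs^2 + \<kappa> = 1 / \<beta>"
proof -
  have "1 < 1 / \<beta>" using par by simp
  then have "\<kappa> < 1 / \<beta>" using par(5) by linarith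
  then show "0 < zs" "zs^2 + \<kappa> = 1 / \<beta>" by (simp_all add: zs_def)
qed

lemma om: "0 < om" "om^2 = (1 - \<beta>^2) / \<beta>" "sn = sqrt \<beta> * om"
proof -
  have p: "0 < 1 - \<beta>^2" using sn by (metis zero_less_power)
  then show "0 < om" "om^2 = (1 - \<beta>^2) / \<beta>" using par by (simp_all add: om_def omega0_def)
  show "sn = sqrt \<beta> * om"
    unfolding om_def omega0_def sn_def real_sqrt_mult[symmetric] using par by simp
qed

lemma ec: "ec = 2 * \<alpha> * \<beta>^2 * zs" "0 < ec"
proof -
  have 1: "\<beta> powr (3/2) = \<beta> * sqrt \<beta>"
  proof -
    have "\<beta> powr (1 + 1/2) = \<beta> powr 1 * \<beta> powr (1/2)" by (rule powr_add)
    then show ?thesis using par by (simp add: powr_half_sqrt)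
  qed
  have 2: "sqrt (1 - \<kappa> * \<beta>) = sqrt \<beta> * zs"
    unfolding zs_def real_sqrt_mult[symmetric] using par by (simp add: right_diff_distrib mult.commute)
  have "\<beta> * sqrt \<beta> * (sqrt \<beta> * zs) = \<beta>^2 * zs"
    using par by (simp add: power2_eq_square)
  then show "ec = 2 * \<alpha> * \<beta>^2 * zs" unfolding ec_def eps_c_def 1 2 by (simp add: mult.assoc)
  then show "0 < ec" using par zs by simp
qed

lemma bb_pos: "0 < bb" using par sn zs by (simp add: bb_def)

text \<open>Identifies the entries prescribed by the jet with those of the system. The quotient
  \<open>om / om\<close> is kept because it mirrors the third entry of \<open>q\<close> in
  \<open>lyap1\<close>.\<close>

lemma a_sn: "om^2 * ec / bb = \<alpha> * sn" "om * ec / bb = \<alpha> * sqrt \<beta> * om / om"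
proof -
  have "om^2 * \<beta> = sn^2" using om(2) sn(2) par by simp
  then have "om^2 * ec = \<alpha> * sn * bb" unfolding ec(1) bb_def by (simp add: power2_eq_square algebra_simps)
  then show "om^2 * ec / bb = \<alpha> * sn" using bb_pos by simp
  have "sqrt \<beta> * sqrt \<beta> = \<beta>" using par by simp
  then have "om * ec = \<alpha> * sqrt \<beta> * bb"
    unfolding ec(1) bb_def om(3) by (simp add: power2_eq_square algebra_simps)
  then show "om * ec / bb = \<alpha> * sqrt \<beta> * om / om" using bb_pos om by simp
qed

lemma P0_nth: "P0 \<beta> \<kappa> $ 1 = arccos \<beta>" "P0 \<beta> \<kappa> $ 2 = 0" "P0 \<beta> \<kappa> $ 3 = zs"
  by (simp_all add: P0_def zs_def)

lemma vf_P0: "vf 0 \<kappa> \<alpha> \<beta> \<epsilon> (P0 \<beta> \<kappa>) = 0"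
  using par by (simp add: vf_def Let_def P0_nth zs trig vec_eq_iff forall_3)

lemma cos_double_P0: "\<beta> * \<beta> - sn * sn = 2 * \<beta>^2 - 1"
  using sn(2) by (simp add: power2_eq_square)

lemma jac_vf: "cmat (jac (vf 0 \<kappa> \<alpha> \<beta> \<epsilon>) (P0 \<beta> \<kappa>)) =
  vector [vector [0, 1, 0], vector [- of_real (om^2), - of_real \<epsilon>, of_real bb], vector [- of_real (om^2 * ec / bb), 0, 0]]"
proof -
  have "1 / \<beta> * (\<beta> * \<beta> - sn * sn) - \<beta> = - (om^2)"
    unfolding cos_double_P0 om(2) using par by (simp add: field_simps power2_eq_square)
  then have "jac (vf 0 \<kappa> \<alpha> \<beta> \<epsilon>) (P0 \<beta> \<kappa>) = vector [vector [0, 1, 0], vector [- (om^2), - \<epsilon>, bb], vector [- (om^2 * ec / bb), 0, 0]]"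
    unfolding jac_def dd_vf vf_d1_def P0_nth trig zs(2) a_sn
    by (simp add: vec_eq_iff forall_3 axis_def bb_def)
  then show ?thesis unfolding cmat_def by (simp add: vec_eq_iff forall_3)
qed

lemma eigenvalue_iff: "is_eigenvalue (jac (vf 0 \<kappa> \<alpha> \<beta> \<epsilon>) (P0 \<beta> \<kappa>)) x \<longleftrightarrow>
    x^3 + of_real \<epsilon> * x^2 + of_real (om^2) * x + of_real (om^2 * ec) = 0"
proof -
  have "of_real bb * of_real (om^2 * ec / bb) = complex_of_real (om^2 * ec)"
    unfolding of_real_mult[symmetric] using bb_pos by simp
  then show ?thesis
    unfolding is_eigenvalue_def det_companion[OF jac_vf] by (simp del: of_real_mult of_real_divide)
qed

lemma eigenvalue_critical_iff: "is_eigenvalue (jac (vf 0 \<kappa> \<alpha> \<beta> ec) (P0 \<beta> \<kappa>)) x \<longleftrightarrow>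
    x = - of_real ec \<or> x = \<i> * of_real om \<or> x = - \<i> * of_real om"
proof -
  have "x^3 + of_real ec * x^2 + of_real (om^2) * x + of_real (om^2 * ec) = (x + of_real ec) * ((x - \<i> * of_real om) * (x + \<i> * of_real om))"
    by (simp add: algebra_simps power2_eq_square power3_eq_cube)
  then show ?thesis unfolding eigenvalue_iff mult_eq_0_iff by (simp add: eq_neg_iff_add_eq_0)
qed

lemma hopf_point_P0: "hopf_point (vf 0 \<kappa> \<alpha> \<beta> ec) (P0 \<beta> \<kappa>)"
  unfolding hopf_point_def eigenvalue_critical_iff
  using vf_P0 om(1) ec(2) by (intro conjI exI[of _ om]) auto

text \<open>The real eigenvalue \<open>-r\<close> determines \<open>\<epsilon>\<close> through \<open>\<epsilon> = r + \<omega>\<^sup>2/r - \<omega>\<^sup>2\<epsilon>\<^sub>c/r\<^sup>2\<close>, which is increasing for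
  \<open>0 < r < 2\<epsilon>\<^sub>c\<close>; the complex pair is then the root pair of the remaining quadratic factor.\<close>

lemma real_eigenvalue_branch:
  obtains rt \<delta> where "0 < \<delta>" "rt ec = ec" "\<And>\<epsilon>. \<bar>\<epsilon> - ec\<bar> < \<delta> \<Longrightarrow> isCont rt \<epsilon>"
    "\<And>\<epsilon>. \<bar>\<epsilon> - ec\<bar> < \<delta> \<Longrightarrow> 0 < rt \<epsilon>"
    "\<And>\<epsilon>. \<bar>\<epsilon> - ec\<bar> < \<delta> \<Longrightarrow> rt \<epsilon> + om^2 / rt \<epsilon> - om^2 * ec / (rt \<epsilon>)^2 = \<epsilon>"
    "(rt has_real_derivative inverse (1 + om^2 / ec^2)) (at ec)"
proof -
  define f where "f r = r + om^2 / r - om^2 * ec / r^2" for r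
  \<comment> \<open>A neighbourhood of \<open>ec\<close> within (0, 2 ec), where the derivative of
    \<open>f\<close> exceeds 1.\<close>
  define I where "I = {ec / 2 .. 3 * ec / 2}"
  define rt where "rt = inv_into I f"
  have der: "(f has_real_derivative (1 + om^2 * (2 * ec - r) / r^3)) (at r)" if "0 < r" for r
  proof -
    have n: "r \<noteq> 0" "r^2 \<noteq> 0" using that by simp_all
    have p: "((\<lambda>r::real. r^2) has_real_derivative 2 * r) (at r)" using DERIV_power[OF DERIV_ident, of 2] by simp
    have d: "(f has_real_derivative 1 + (0 * r - om^2 * 1) / (r * r) - (0 * r^2 - om^2 * ec * (2 * r)) / (r^2 * r^2)) (at r)"
      unfolding f_def
      by (rule DERIV_diff[OF DERIV_add[OF DERIV_ident DERIV_divide[OF DERIV_const DERIV_ident n(1)]] DERIV_divide[OF DERIV_const p n(2)]])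
    have e: "1 + (0 * r - om^2 * 1) / (r * r) - (0 * r^2 - om^2 * ec * (2 * r)) / (r^2 * r^2) = 1 + om^2 * (2 * ec - r) / r^3"
      using n by (simp add: field_simps power2_eq_square power3_eq_cube)
    show ?thesis using d unfolding e .
  qed
  have cont: "isCont f r" if "0 < r" for r using DERIV_isCont[OF der[OF that]] .
  have mono: "f r < f s" if "r \<in> I" "s \<in> I" "r < s" for r s
  proof (rule DERIV_pos_imp_increasing[OF that(3)])
    fix x assume "r \<le> x" "x \<le> s"
    then have x: "0 < x" "x < 2 * ec" using that ec(2) by (auto simp: I_def)
    then have "0 < 1 + om^2 * (2 * ec - x) / x^3" by (intro add_pos_nonneg divide_nonneg_nonneg mult_nonneg_nonneg) auto
    then show "\<exists>y. DERIV f x :> y \<and> 0 < y" using der[OF x(1)] by blast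
  qed
  have inj: "inj_on f I"
    by (rule linorder_inj_onI) (use mono in force)+
  have left: "rt (f r) = r" if "r \<in> I" for r unfolding rt_def by (rule inv_into_f_f[OF inj that])
  have fe: "f ec = ec" using ec(2) by (simp add: f_def power2_eq_square)
  define lo hi where "lo = f (ec / 2)" and "hi = f (3 * ec / 2)"
  have ends: "ec / 2 \<in> I" "3 * ec / 2 \<in> I" "ec \<in> I" using ec(2) by (auto simp: I_def)
  have lh: "lo < ec" "ec < hi"
    using mono[OF ends(1,3)] mono[OF ends(3,2)] ec(2) unfolding lo_def hi_def fe by auto
  have pre: "\<exists>r. ec / 2 < r \<and> r < 3 * ec / 2 \<and> f r = y" if "lo < y" "y < hi" for y
  proof -
    have "\<exists>r\<ge>ec / 2. r \<le> 3 * ec / 2 \<and> f r = y"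
    proof (rule IVT)
      show "\<forall>x. ec / 2 \<le> x \<and> x \<le> 3 * ec / 2 \<longrightarrow> isCont f x" using cont ec(2) by auto
    qed (use that ec(2) in \<open>auto simp: lo_def hi_def\<close>)
    then obtain r where r: "ec / 2 \<le> r" "r \<le> 3 * ec / 2" "f r = y" by auto
    moreover have "r \<noteq> ec / 2" "r \<noteq> 3 * ec / 2" using r(3) that unfolding lo_def hi_def by (metis less_irrefl)+
    ultimately show ?thesis by force
  qed
  have right: "f (rt y) = y" "0 < rt y" if y: "lo < y" "y < hi" for y
  proof -
    obtain r where r: "ec / 2 < r" "r < 3 * ec / 2" "f r = y" using pre[OF y] by blast
    then have "rt y = r" using left[of r] by (auto simp: I_def)
    then show "f (rt y) = y" "0 < rt y" using r ec(2) by auto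
  qed
  have rcont: "isCont rt y" if y: "lo < y" "y < hi" for y
  proof -
    obtain r where r: "ec / 2 < r" "r < 3 * ec / 2" "f r = y" using pre[OF y] by blast
    define d where "d = min (r - ec / 2) (3 * ec / 2 - r)"
    have "isCont rt (f r)"
    proof (rule isCont_inverse_function[where f = f and g = rt and x = r and d = d])
      show "0 < d" using r by (simp add: d_def)
      fix z assume "\<bar>z - r\<bar> \<le> d"
      then have z: "z \<in> I" by (auto simp: d_def I_def abs_le_iff min_def split: if_splits)
      show "rt (f z) = z" by (rule left[OF z])
      show "isCont f z" using z ec(2) by (intro cont) (auto simp: I_def)
    qed
    then show ?thesis unfolding r(3) .
  qed
  show thesis
  proof (rule that[of "min (ec - lo) (hi - ec)" rt])
    show "0 < min (ec - lo) (hi - ec)" using lh by simp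
    show re: "rt ec = ec" using left[OF ends(3)] unfolding fe .
    have in': "lo < \<epsilon> \<and> \<epsilon> < hi" if "\<bar>\<epsilon> - ec\<bar> < min (ec - lo) (hi - ec)" for \<epsilon>
      using that by (auto simp: abs_less_iff)
    show "isCont rt \<epsilon>" "0 < rt \<epsilon>" "rt \<epsilon> + om^2 / rt \<epsilon> - om^2 * ec / (rt \<epsilon>)^2 = \<epsilon>"
      if "\<bar>\<epsilon> - ec\<bar> < min (ec - lo) (hi - ec)" for \<epsilon>
      using rcont[of \<epsilon>] right[of \<epsilon>] in'[OF that] unfolding f_def by auto
    have "1 + om^2 * (2 * ec - ec) / ec^3 = 1 + om^2 / ec^2" using ec(2) by (simp add: power2_eq_square power3_eq_cube)
    then have d: "DERIV f (rt ec) :> 1 + om^2 / ec^2" using der[OF ec(2)] unfolding re by simp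
    show "(rt has_real_derivative inverse (1 + om^2 / ec^2)) (at ec)"
    proof (rule DERIV_inverse_function[where g = rt and x = ec, OF d _ lh])
      show "1 + om^2 / ec^2 \<noteq> 0" using zero_le_divide_iff[of "om^2" "ec^2"] by (smt (verit) zero_le_power2)
    qed (use right rcont lh in auto)
  qed
qed

text \<open>Dividing the characteristic polynomial by x + r leaves x^2 + (eps - r) x + om^2 ec / r,
  and \<open>\<mu>\<close> is its root in the upper half plane. The real part is -(eps - r)/2, and
  at the critical value r grows more slowly than eps, so the derivative is nonzero.\<close>

lemma transversal: "transversal_hopf (vf 0 \<kappa> \<alpha> \<beta>) (P0 \<beta> \<kappa>) ec"
proof -
  obtain rt \<delta> where \<delta>: "0 < \<delta>" and re: "rt ec = ec" and rcont: "\<And>\<epsilon>. \<bar>\<epsilon> - ec\<bar> < \<delta> \<Longrightarrow> isCont rt \<epsilon>"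
    and rpos: "\<And>\<epsilon>. \<bar>\<epsilon> - ec\<bar> < \<delta> \<Longrightarrow> 0 < rt \<epsilon>"
    and req: "\<And>\<epsilon>. \<bar>\<epsilon> - ec\<bar> < \<delta> \<Longrightarrow> rt \<epsilon> + om^2 / rt \<epsilon> - om^2 * ec / (rt \<epsilon>)^2 = \<epsilon>"
    and rder: "(rt has_real_derivative inverse (1 + om^2 / ec^2)) (at ec)"
    by (rule real_eigenvalue_branch) blast
  \<comment> \<open>The square of the imaginary part of the root: the constant term of the quadratic
    factor minus the square of half the linear coefficient.\<close>
  define disc where "disc \<epsilon> = om^2 * ec / rt \<epsilon> - ((\<epsilon> - rt \<epsilon>) / 2)^2" for \<epsilon>
  define \<mu> where "\<mu> \<epsilon> = Complex (- (\<epsilon> - rt \<epsilon>) / 2) (sqrt (disc \<epsilon>))" for \<epsilon>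
  have dcont: "isCont disc \<epsilon>" if "\<bar>\<epsilon> - ec\<bar> < \<delta>" for \<epsilon>
    unfolding disc_def using rcont[OF that] rpos[OF that] by (intro continuous_intros) auto
  have de: "disc ec = om^2" using ec(2) by (simp add: disc_def re)
  \<comment> \<open>Positivity near \<open>ec\<close> ensures that
    \<open>sqrt (disc \<epsilon>)\<close> squares back to \<open>disc \<epsilon>\<close>, so that
    \<open>\<mu>\<close> really is a root.\<close>
  have "eventually (\<lambda>\<epsilon>. 0 < disc \<epsilon>) (at ec)"
    using dcont[of ec] \<delta> om(1) by (intro order_tendstoD(1)[of _ "disc ec"]) (auto simp: isCont_def de)
  then obtain \<delta>2 where \<delta>2: "0 < \<delta>2" "\<And>\<epsilon>. \<epsilon> \<noteq> ec \<Longrightarrow> \<bar>\<epsilon> - ec\<bar> < \<delta>2 \<Longrightarrow> 0 < disc \<epsilon>"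
    unfolding eventually_at by (auto simp: dist_real_def)
  define \<delta>3 where "\<delta>3 = min \<delta> \<delta>2"
  have b: "\<bar>\<epsilon> - ec\<bar> < \<delta>" "0 < disc \<epsilon>" if "\<epsilon> \<in> ball ec \<delta>3" for \<epsilon>
    using that \<delta>2(2)[of \<epsilon>] de om(1) by (cases "\<epsilon> = ec"; auto simp: \<delta>3_def dist_real_def abs_minus_commute)+
  have eig: "is_eigenvalue (jac (vf 0 \<kappa> \<alpha> \<beta> \<epsilon>) (P0 \<beta> \<kappa>)) (\<mu> \<epsilon>)" if "\<epsilon> \<in> ball ec \<delta>3" for \<epsilon>
  proof -
    define r K where "r = rt \<epsilon>" and "K = om^2 * ec / r"
    have r: "0 < r" using rpos b(1)[OF that] by (simp add: r_def)
    have K: "K * r = om^2 * ec" using r by (simp add: K_def)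
    have eq: "om^2 = K + r * (\<epsilon> - r)"
    proof -
      have "\<epsilon> - r = om^2 / r - K / r" using req[OF b(1)[OF that]] r unfolding K_def r_def[symmetric] by (simp add: power2_eq_square)
      then show ?thesis using r by (simp add: field_simps)
    qed
    have s: "(sqrt (disc \<epsilon>))^2 = K - ((\<epsilon> - r) / 2)^2" using b(2)[OF that] by (simp add: disc_def K_def r_def)
    have q: "(\<mu> \<epsilon>)^2 + of_real (\<epsilon> - r) * \<mu> \<epsilon> + of_real K = 0"
      using s unfolding \<mu>_def r_def[symmetric] by (simp add: complex_eq_iff power2_eq_square field_simps)
    have "x^3 + of_real \<epsilon> * x^2 + of_real (om^2) * x + of_real (om^2 * ec) = (x + of_real r) * (x^2 + of_real (\<epsilon> - r) * x + of_real K)" for x :: complex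
      unfolding eq K[unfolded eq, symmetric] by (simp add: algebra_simps power2_eq_square power3_eq_cube)
    from this[of "\<mu> \<epsilon>"] show ?thesis unfolding eigenvalue_iff q by simp
  qed
  have cont: "continuous_on (ball ec \<delta>3) \<mu>"
  proof (rule continuous_at_imp_continuous_on, rule ballI)
    fix \<epsilon> assume "\<epsilon> \<in> ball ec \<delta>3"
    from rcont[OF b(1)[OF this]] dcont[OF b(1)[OF this]] show "isCont \<mu> \<epsilon>"
      unfolding \<mu>_def[abs_def] Complex_eq by (intro continuous_intros) simp_all
  qed
  have der: "((\<lambda>\<epsilon>. Re (\<mu> \<epsilon>)) has_real_derivative - (1 - inverse (1 + om^2 / ec^2)) / 2) (at ec)"
    unfolding \<mu>_def using rder by (auto intro!: derivative_eq_intros)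
  have ne: "- (1 - inverse (1 + om^2 / ec^2)) / 2 \<noteq> 0"
  proof -
    have "0 < om^2 / ec^2" using om(1) ec(2) by simp
    then have "inverse (1 + x) < 1" if "0 < x" for x :: real using that by (simp add: inverse_less_1_iff)
    from this[of "om^2 / ec^2"] \<open>0 < om^2 / ec^2\<close> have "inverse (1 + om^2 / ec^2) < 1" .
    moreover have "- (1 - x) / 2 \<noteq> 0" if "x < 1" for x :: real using that by simp
    ultimately show ?thesis by blast
  qed
  have me: "\<mu> ec = \<i> * complex_of_real om" using om(1) by (simp add: \<mu>_def re de complex_eq_iff)
  have "0 < \<delta>3" using \<delta> \<delta>2 by (simp add: \<delta>3_def)
  moreover have "is_eigenvalue (jac (vf 0 \<kappa> \<alpha> \<beta> ec) (P0 \<beta> \<kappa>)) (- \<i> * complex_of_real om)"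
    unfolding eigenvalue_critical_iff by simp
  ultimately show ?thesis
    unfolding transversal_hopf_def using hopf_point_P0 vf_P0 me om(1) cont eig der ne by blast
qed

definition "C2 = 2 * \<beta>^2 - 1"
text \<open>Besides the Taylor remainders it contains the products of degree four and five that
  arise when the quadratic polynomial in \<open>u$3\<close> multiplies the Taylor polynomials in
  \<open>u$1\<close>.\<close>

definition rem2 :: "real^3 \<Rightarrow> real" where
  "rem2 u = (1 / \<beta> + 2 * zs * u$3 + u$3 * u$3) * (sn * \<beta> * cos_rem (2 * u$1) + C2 / 2 * sin_rem (2 * u$1))
     - (sn * cos_rem (u$1) + \<beta> * sin_rem (u$1))
     - (4/3 * zs * C2) * (u$1 * u$1 * u$1 * u$3) - (2 * sn * \<beta>) * (u$1 * u$1 * u$3 * u$3) - (2/3 * C2) * (u$1 * u$1 * u$1 * u$3 * u$3)"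
definition rem3 :: "real^3 \<Rightarrow> real" where
  "rem3 u = \<alpha> * (\<beta> * cos_rem (u$1) - sn * sin_rem (u$1))"

lemma lipo_rem: "lipo 4 rem2" "lipo 4 rem3"
proof -
  have n: "bounded_linear (\<lambda>u::real^3. u $ i)" "bounded_linear (\<lambda>u::real^3. 2 * u $ i)" for i
    by (simp_all add: bounded_linear_vec_nth bounded_linear_const_mult)
  have l: "lipo 1 (\<lambda>u::real^3. u $ i)" for i by (rule lipo_linear[OF n(1)])
  have p4: "lipo 4 (\<lambda>u::real^3. u$i * u$j * u$k * u$m)" for i j k m
    using lipo_mult[OF lipo_mult[OF lipo_mult[OF l l] l] l] by (simp add: numeral_eq_Suc)
  have p5: "lipo 4 (\<lambda>u::real^3. u$i * u$j * u$k * u$m * u$n)" for i j k m n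
    using lipo_mono[OF lipo_mult[OF p4 l], of 4] by simp
  have f: "lipo 0 (\<lambda>u::real^3. 1 / \<beta> + 2 * zs * u$3 + u$3 * u$3)"
    by (intro lipo_add lipo_const lipo_cmult lipo_mono[OF l] lipo_mono[OF lipo_mult[OF l l]]) auto
  have s: "lipo 4 (\<lambda>u::real^3. sn * \<beta> * cos_rem (2 * u$1) + C2 / 2 * sin_rem (2 * u$1))"
    by (intro lipo_add lipo_cmult lipo_trig_rem n)
  have "lipo (0 + 4) (\<lambda>u::real^3. (1 / \<beta> + 2 * zs * u$3 + u$3 * u$3) * (sn * \<beta> * cos_rem (2 * u$1) + C2 / 2 * sin_rem (2 * u$1)))"
    by (rule lipo_mult[OF f s])
  then show "lipo 4 rem2"
    unfolding rem2_def[abs_def] by (intro lipo_diff lipo_add lipo_cmult lipo_trig_rem n p4 p5) simp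
  show "lipo 4 rem3"
    unfolding rem3_def[abs_def] by (intro lipo_diff lipo_cmult lipo_trig_rem n)
qed

text \<open>The numerical arguments are the second and third partial derivatives of the field at the
  equilibrium, in the order fixed by \<open>hopf_jet\<close>; the damping parameter enters only
  through \<open>\<eta>\<close>.\<close>

sublocale hopf_jet "\<lambda>\<eta>. vf 0 \<kappa> \<alpha> \<beta> (ec + \<eta>)" "P0 \<beta> \<kappa>" ec om bb
  "- 3 * sn" "2 * zs * C2" "2 * sn * \<beta>" "- \<alpha> * \<beta>" "- 4 * C2 / \<beta> + \<beta>" "- 8 * zs * sn * \<beta>" "2 * C2" "\<alpha> * sn" rem2 rem3
proof
  fix \<eta> and u :: "real^3"
  define t w where "t = u $ 1" and "w = u $ 3"
  \<comment> \<open>Rewriting the product of sine and cosine with the doubled angle means that one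
    Taylor expansion of each function is enough, with no product of remainders.\<close>
  have sc: "sin (arccos \<beta> + t) * cos (arccos \<beta> + t) = sn * \<beta> * cos (2 * t) + C2 / 2 * sin (2 * t)"
  proof -
    have "sin (arccos \<beta> + t) * cos (arccos \<beta> + t) = (sn * cos t + \<beta> * sin t) * (\<beta> * cos t - sn * sin t)"
      unfolding sin_add cos_add trig by simp
    also have "\<dots> = sn * \<beta> * ((cos t)^2 - (sin t)^2) + (\<beta> * \<beta> - sn * sn) / 2 * (2 * sin t * cos t)"
      by (simp add: field_simps power2_eq_square)
    finally show ?thesis unfolding cos_double_P0 cos_double sin_double C2_def .
  qed
  have c2: "cos (2 * t) = 1 - 2 * t^2 + cos_rem (2 * t)" and s2: "sin (2 * t) = 2 * t - 4 / 3 * t^3 + sin_rem (2 * t)"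
    and c1: "cos t = 1 - t^2 / 2 + cos_rem t" and s1: "sin t = t - t^3 / 6 + sin_rem t"
    by (simp_all add: cos_rem_def sin_rem_def power_mult_distrib)
  have z: "(zs + w)^2 + \<kappa> = 1 / \<beta> + 2 * zs * w + w * w"
    using zs(2) by (simp add: power2_eq_square algebra_simps)
  have lin: "- (om^2) = C2 / \<beta> - \<beta>" unfolding om(2) C2_def using par by (simp add: field_simps power2_eq_square)
  show "vf 0 \<kappa> \<alpha> \<beta> (ec + \<eta>) (P0 \<beta> \<kappa> + u) $ 1 = u $ 2" by (simp add: vf_def P0_nth Let_def)
  have "vf 0 \<kappa> \<alpha> \<beta> (ec + \<eta>) (P0 \<beta> \<kappa> + u) $ 2
      = ((zs + w)^2 + \<kappa>) * (sin (arccos \<beta> + t) * cos (arccos \<beta> + t)) - sin (arccos \<beta> + t) - (ec + \<eta>) * u $ 2"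
    by (simp add: vf_def P0_nth t_def w_def mult.assoc Let_def)
  also have "\<dots> = (1 / \<beta> + 2 * zs * w + w * w) * (sn * \<beta> * (1 - 2 * t^2 + cos_rem (2 * t)) + C2 / 2 * (2 * t - 4 / 3 * t^3 + sin_rem (2 * t)))
      - (sn * (1 - t^2 / 2 + cos_rem t) + \<beta> * (t - t^3 / 6 + sin_rem t)) - (ec + \<eta>) * u $ 2"
    unfolding z sc unfolding sin_add trig c2 s2 c1 s1 by simp
  also have "\<dots> = (C2 / \<beta> - \<beta>) * t - (ec + \<eta>) * u $ 2 + bb * w
      + (- 3 * sn * t^2 + 2 * (2 * zs * C2) * t * w + 2 * sn * \<beta> * w^2) / 2
      + ((- 4 * C2 / \<beta> + \<beta>) * t^3 + 3 * (- 8 * zs * sn * \<beta>) * t^2 * w + 3 * (2 * C2) * t * w^2) / 6 + rem2 u"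
    unfolding rem2_def t_def[symmetric] w_def[symmetric] bb_def using par
    by (simp add: field_simps power2_eq_square power3_eq_cube)
  finally show "vf 0 \<kappa> \<alpha> \<beta> (ec + \<eta>) (P0 \<beta> \<kappa> + u) $ 2 = - (om^2) * u $ 1 - (ec + \<eta>) * u $ 2 + bb * u $ 3
      + (- 3 * sn * (u $ 1)^2 + 2 * (2 * zs * C2) * u $ 1 * u $ 3 + 2 * sn * \<beta> * (u $ 3)^2) / 2
      + ((- 4 * C2 / \<beta> + \<beta>) * (u $ 1)^3 + 3 * (- 8 * zs * sn * \<beta>) * (u $ 1)^2 * u $ 3 + 3 * (2 * C2) * u $ 1 * (u $ 3)^2) / 6 + rem2 u"
    unfolding lin t_def w_def .
  have "vf 0 \<kappa> \<alpha> \<beta> (ec + \<eta>) (P0 \<beta> \<kappa> + u) $ 3 = \<alpha> * (cos (arccos \<beta> + t) - \<beta>)"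
    by (simp add: vf_def P0_nth t_def Let_def)
  also have "\<dots> = \<alpha> * (\<beta> * (1 - t^2 / 2 + cos_rem t) - sn * (t - t^3 / 6 + sin_rem t) - \<beta>)"
    unfolding cos_add trig c1 s1 ..
  also have "\<dots> = - (\<alpha> * sn) * t + - \<alpha> * \<beta> * t^2 / 2 + \<alpha> * sn * t^3 / 6 + rem3 u"
    unfolding rem3_def t_def[symmetric] by (simp add: field_simps)
  finally show "vf 0 \<kappa> \<alpha> \<beta> (ec + \<eta>) (P0 \<beta> \<kappa> + u) $ 3
      = - (om^2 * ec / bb) * u $ 1 + - \<alpha> * \<beta> * (u $ 1)^2 / 2 + \<alpha> * sn * (u $ 1)^3 / 6 + rem3 u"
    unfolding a_sn t_def .
qed (use ec om bb_pos lipo_rem in auto)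

lemma B_form_vf: "B_form (vf 0 \<kappa> \<alpha> \<beta> \<epsilon>) (P0 \<beta> \<kappa>) = B0"
proof (intro ext)
  fix x y :: "complex^3"
  show "B_form (vf 0 \<kappa> \<alpha> \<beta> \<epsilon>) (P0 \<beta> \<kappa>) x y = B0 x y"
    unfolding B_form_def B_real_vf vf_d2_def P0_nth trig zs(2) cos_double_P0 C2_def[symmetric] B0_def
    using par by (simp add: vec_eq_iff forall_3 sum_3 axis_def algebra_simps)
qed

lemma C_form_vf: "C_form (vf 0 \<kappa> \<alpha> \<beta> \<epsilon>) (P0 \<beta> \<kappa>) = C0"
proof (intro ext)
  fix x y w :: "complex^3"
  show "C_form (vf 0 \<kappa> \<alpha> \<beta> \<epsilon>) (P0 \<beta> \<kappa>) x y w = C0 x y w"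
    unfolding C_form_def C_real_vf vf_d3_def P0_nth trig zs(2) cos_double_P0 C2_def[symmetric] C0_def
    using par by (simp add: vec_eq_iff forall_3 sum_3 axis_def algebra_simps)
qed

text \<open>The factor 2 in \<open>Re_G21\<close> cancels the 2 in the definition, so the sign of
  the Lyapunov coefficient is that of \<open>lc\<close>.\<close>

lemma lyap1_eq: "lyap1 \<beta> \<alpha> \<kappa> = lc / om"
proof -
  have A: "cmat (jac (vf 0 \<kappa> \<alpha> \<beta> ec) (P0 \<beta> \<kappa>)) = A0" unfolding jac_vf A0_def ..
  have q: "vector [- \<i>, complex_of_real om, complex_of_real (\<alpha> * sqrt \<beta> * om / om)] = q0"
    unfolding q0_def g_def a_sn(2) ..
  \<comment> \<open>The chosen vector satisfies its specification because a normalised left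
    eigenvector exists.\<close>
  have p: "(let p = SOME p. transpose A0 *v p = (- \<i> * complex_of_real om) *s p \<and> cinner p q0 = 1
     in transpose A0 *v p = (- \<i> * complex_of_real om) *s p \<and> cinner p q0 = 1)"
    unfolding Let_def by (rule someI_ex[OF left_eigenvector_exists])
  show ?thesis
    unfolding lyap1_def om_def[symmetric] ec_def[symmetric] Let_def A q B_form_vf C_form_vf
    using Re_G21 p[unfolded Let_def] by simp
qed

text \<open>The real part is -omega^2 / (2 D): stronger damping moves the critical pair to the left,
  so the equilibrium is stable for \<open>\<epsilon>\<close> slightly above the critical
  value.\<close>

lemma Re_k1_neg: "Re k1 < 0"
  using D_pos om(1) by (simp add: k1_def pc_def)

text \<open>Sign bookkeeping. As \<open>Re k1\<close> is negative, the condition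
  \<open>Re k1 * \<eta> * lc < 0\<close> for an orbit says that \<open>\<eta>\<close> has the sign
  of \<open>lc\<close>, while stability of the equilibrium is decided by the sign of
  \<open>\<eta>\<close> alone.\<close>

theorem hopf_conclusion:
  assumes "lyap1 \<beta> \<alpha> \<kappa> \<noteq> 0"
  shows "lyap1 \<beta> \<alpha> \<kappa> < 0 \<Longrightarrow> asym_stable (vf 0 \<kappa> \<alpha> \<beta> ec) (P0 \<beta> \<kappa>)"
    and "0 < lyap1 \<beta> \<alpha> \<kappa> \<Longrightarrow> \<not> lyap_stable (vf 0 \<kappa> \<alpha> \<beta> ec) (P0 \<beta> \<kappa>)"
    and "lyap1 \<beta> \<alpha> \<kappa> < 0 \<Longrightarrow> 0 < r \<Longrightarrow> \<exists>\<delta>>0. \<forall>\<epsilon>. ec - \<delta> < \<epsilon> \<and> \<epsilon> < ec \<longrightarrow>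
       \<not> lyap_stable (vf 0 \<kappa> \<alpha> \<beta> \<epsilon>) (P0 \<beta> \<kappa>) \<and>
       (\<exists>\<gamma>. periodic_solution (vf 0 \<kappa> \<alpha> \<beta> \<epsilon>) \<gamma> \<and> range \<gamma> \<subseteq> ball (P0 \<beta> \<kappa>) r \<and> orbit_asym_stable (vf 0 \<kappa> \<alpha> \<beta> \<epsilon>) (range \<gamma>))"
    and "0 < lyap1 \<beta> \<alpha> \<kappa> \<Longrightarrow> 0 < r \<Longrightarrow> \<exists>\<delta>>0. \<forall>\<epsilon>. ec < \<epsilon> \<and> \<epsilon> < ec + \<delta> \<longrightarrow>
       asym_stable (vf 0 \<kappa> \<alpha> \<beta> \<epsilon>) (P0 \<beta> \<kappa>) \<and>
       (\<exists>\<gamma>. periodic_solution (vf 0 \<kappa> \<alpha> \<beta> \<epsilon>) \<gamma> \<and> range \<gamma> \<subseteq> ball (P0 \<beta> \<kappa>) r \<and> \<not> orbit_stable (vf 0 \<kappa> \<alpha> \<beta> \<epsilon>) (range \<gamma>))"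
proof -
  have sgn: "lyap1 \<beta> \<alpha> \<kappa> < 0 \<longleftrightarrow> lc < 0" "0 < lyap1 \<beta> \<alpha> \<kappa> \<longleftrightarrow> 0 < lc" "lc \<noteq> 0"
    using assms om(1) unfolding lyap1_eq by (auto simp: divide_less_0_iff zero_less_divide_iff)
  have k: "Re k1 \<noteq> 0" using Re_k1_neg by simp
  show "lyap1 \<beta> \<alpha> \<kappa> < 0 \<Longrightarrow> asym_stable (vf 0 \<kappa> \<alpha> \<beta> ec) (P0 \<beta> \<kappa>)"
    "0 < lyap1 \<beta> \<alpha> \<kappa> \<Longrightarrow> \<not> lyap_stable (vf 0 \<kappa> \<alpha> \<beta> ec) (P0 \<beta> \<kappa>)"
    using equilibrium_critical[OF sgn(3)] sgn(1,2) by simp_all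
  obtain \<eta>0 where \<eta>0: "0 < \<eta>0"
    "\<And>\<eta>. \<bar>\<eta>\<bar> < \<eta>0 \<Longrightarrow> Re k1 * \<eta> < 0 \<Longrightarrow> asym_stable (vf 0 \<kappa> \<alpha> \<beta> (ec + \<eta>)) (P0 \<beta> \<kappa>)"
    "\<And>\<eta>. \<bar>\<eta>\<bar> < \<eta>0 \<Longrightarrow> 0 < Re k1 * \<eta> \<Longrightarrow> \<not> lyap_stable (vf 0 \<kappa> \<alpha> \<beta> (ec + \<eta>)) (P0 \<beta> \<kappa>)"
    by (rule equilibrium_hyperbolic[OF k], rule that)
  show "\<exists>\<delta>>0. \<forall>\<epsilon>. ec - \<delta> < \<epsilon> \<and> \<epsilon> < ec \<longrightarrow> \<not> lyap_stable (vf 0 \<kappa> \<alpha> \<beta> \<epsilon>) (P0 \<beta> \<kappa>) \<and>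
       (\<exists>\<gamma>. periodic_solution (vf 0 \<kappa> \<alpha> \<beta> \<epsilon>) \<gamma> \<and> range \<gamma> \<subseteq> ball (P0 \<beta> \<kappa>) r \<and> orbit_asym_stable (vf 0 \<kappa> \<alpha> \<beta> \<epsilon>) (range \<gamma>))"
      if l1: "lyap1 \<beta> \<alpha> \<kappa> < 0" and r: "0 < r"
  proof -
    obtain \<delta> where \<delta>: "0 < \<delta>" "\<And>\<eta>. \<bar>\<eta>\<bar> < \<delta> \<Longrightarrow> Re k1 * \<eta> * lc < 0 \<Longrightarrow>
        \<exists>\<gamma>. periodic_solution (vf 0 \<kappa> \<alpha> \<beta> (ec + \<eta>)) \<gamma> \<and> range \<gamma> \<subseteq> ball (P0 \<beta> \<kappa>) r \<and>
          (lc < 0 \<longrightarrow> orbit_asym_stable (vf 0 \<kappa> \<alpha> \<beta> (ec + \<eta>)) (range \<gamma>)) \<and>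
          (0 < lc \<longrightarrow> \<not> orbit_stable (vf 0 \<kappa> \<alpha> \<beta> (ec + \<eta>)) (range \<gamma>))"
      by (rule periodic_branch[OF sgn(3) k r], rule that)
    show ?thesis
    proof (intro exI[of _ "min \<eta>0 \<delta>"] conjI allI impI)
      fix \<epsilon> assume e: "ec - min \<eta>0 \<delta> < \<epsilon> \<and> \<epsilon> < ec"
      have l: "lc < 0" using sgn(1) l1 by simp
      have b: "\<bar>\<epsilon> - ec\<bar> < \<eta>0" "\<bar>\<epsilon> - ec\<bar> < \<delta>" using e by auto
      have s: "0 < Re k1 * (\<epsilon> - ec)" using e Re_k1_neg by (intro mult_neg_neg) auto
      show "\<not> lyap_stable (vf 0 \<kappa> \<alpha> \<beta> \<epsilon>) (P0 \<beta> \<kappa>)" using \<eta>0(3)[OF b(1) s] by simp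
      show "\<exists>\<gamma>. periodic_solution (vf 0 \<kappa> \<alpha> \<beta> \<epsilon>) \<gamma> \<and> range \<gamma> \<subseteq> ball (P0 \<beta> \<kappa>) r \<and> orbit_asym_stable (vf 0 \<kappa> \<alpha> \<beta> \<epsilon>) (range \<gamma>)"
        using \<delta>(2)[OF b(2) mult_pos_neg[OF s l]] l by auto
    qed (use \<eta>0(1) \<delta>(1) in simp)
  qed
  show "\<exists>\<delta>>0. \<forall>\<epsilon>. ec < \<epsilon> \<and> \<epsilon> < ec + \<delta> \<longrightarrow> asym_stable (vf 0 \<kappa> \<alpha> \<beta> \<epsilon>) (P0 \<beta> \<kappa>) \<and>
       (\<exists>\<gamma>. periodic_solution (vf 0 \<kappa> \<alpha> \<beta> \<epsilon>) \<gamma> \<and> range \<gamma> \<subseteq> ball (P0 \<beta> \<kappa>) r \<and> \<not> orbit_stable (vf 0 \<kappa> \<alpha> \<beta> \<epsilon>) (range \<gamma>))"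
      if l1: "0 < lyap1 \<beta> \<alpha> \<kappa>" and r: "0 < r"
  proof -
    obtain \<delta> where \<delta>: "0 < \<delta>" "\<And>\<eta>. \<bar>\<eta>\<bar> < \<delta> \<Longrightarrow> Re k1 * \<eta> * lc < 0 \<Longrightarrow>
        \<exists>\<gamma>. periodic_solution (vf 0 \<kappa> \<alpha> \<beta> (ec + \<eta>)) \<gamma> \<and> range \<gamma> \<subseteq> ball (P0 \<beta> \<kappa>) r \<and>
          (lc < 0 \<longrightarrow> orbit_asym_stable (vf 0 \<kappa> \<alpha> \<beta> (ec + \<eta>)) (range \<gamma>)) \<and>
          (0 < lc \<longrightarrow> \<not> orbit_stable (vf 0 \<kappa> \<alpha> \<beta> (ec + \<eta>)) (range \<gamma>))"
      by (rule periodic_branch[OF sgn(3) k r], rule that)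
    show ?thesis
    proof (intro exI[of _ "min \<eta>0 \<delta>"] conjI allI impI)
      fix \<epsilon> assume e: "ec < \<epsilon> \<and> \<epsilon> < ec + min \<eta>0 \<delta>"
      have l: "0 < lc" using sgn(2) l1 by simp
      have b: "\<bar>\<epsilon> - ec\<bar> < \<eta>0" "\<bar>\<epsilon> - ec\<bar> < \<delta>" using e by auto
      have s: "Re k1 * (\<epsilon> - ec) < 0" using e Re_k1_neg by (intro mult_neg_pos) auto
      show "asym_stable (vf 0 \<kappa> \<alpha> \<beta> \<epsilon>) (P0 \<beta> \<kappa>)" using \<eta>0(2)[OF b(1) s] by simp
      show "\<exists>\<gamma>. periodic_solution (vf 0 \<kappa> \<alpha> \<beta> \<epsilon>) \<gamma> \<and> range \<gamma> \<subseteq> ball (P0 \<beta> \<kappa>) r \<and> \<not> orbit_stable (vf 0 \<kappa> \<alpha> \<beta> \<epsilon>) (range \<gamma>)"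
        using \<delta>(2)[OF b(2) mult_neg_pos[OF s l]] l by auto
    qed (use \<eta>0(1) \<delta>(1) in simp)
  qed
qed

end

text \<open>Nearness of the orbit is expressed by a radius given before the parameter interval: the
  orbits shrink to the equilibrium at the critical value, so every radius is eventually met.\<close>

theorem theorem3p5:
  fixes \<beta> \<alpha> \<kappa> :: real
  assumes "0 < \<beta>" "\<beta> < 1" "0 < \<alpha>" "0 \<le> \<kappa>" "\<kappa> < 1"
    and "lyap1 \<beta> \<alpha> \<kappa> \<noteq> 0"
  shows "transversal_hopf (vf 0 \<kappa> \<alpha> \<beta>) (P0 \<beta> \<kappa>) (eps_c \<beta> \<alpha> \<kappa>)
    \<and> (lyap1 \<beta> \<alpha> \<kappa> < 0 \<longrightarrow>
         asym_stable (vf 0 \<kappa> \<alpha> \<beta> (eps_c \<beta> \<alpha> \<kappa>)) (P0 \<beta> \<kappa>) \<and>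
         (\<forall>r>0. \<exists>\<delta>>0. \<forall>\<epsilon>. eps_c \<beta> \<alpha> \<kappa> - \<delta> < \<epsilon> \<and> \<epsilon> < eps_c \<beta> \<alpha> \<kappa> \<longrightarrow>
            \<not> lyap_stable (vf 0 \<kappa> \<alpha> \<beta> \<epsilon>) (P0 \<beta> \<kappa>) \<and>
            (\<exists>\<gamma>. periodic_solution (vf 0 \<kappa> \<alpha> \<beta> \<epsilon>) \<gamma> \<and> range \<gamma> \<subseteq> ball (P0 \<beta> \<kappa>) r \<and>
                 orbit_asym_stable (vf 0 \<kappa> \<alpha> \<beta> \<epsilon>) (range \<gamma>))))
    \<and> (lyap1 \<beta> \<alpha> \<kappa> > 0 \<longrightarrow>
         \<not> lyap_stable (vf 0 \<kappa> \<alpha> \<beta> (eps_c \<beta> \<alpha> \<kappa>)) (P0 \<beta> \<kappa>) \<and>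
         (\<forall>r>0. \<exists>\<delta>>0. \<forall>\<epsilon>. eps_c \<beta> \<alpha> \<kappa> < \<epsilon> \<and> \<epsilon> < eps_c \<beta> \<alpha> \<kappa> + \<delta> \<longrightarrow>
            asym_stable (vf 0 \<kappa> \<alpha> \<beta> \<epsilon>) (P0 \<beta> \<kappa>) \<and>
            (\<exists>\<gamma>. periodic_solution (vf 0 \<kappa> \<alpha> \<beta> \<epsilon>) \<gamma> \<and> range \<gamma> \<subseteq> ball (P0 \<beta> \<kappa>) r \<and>
                 \<not> orbit_stable (vf 0 \<kappa> \<alpha> \<beta> \<epsilon>) (range \<gamma>))))"
proof -
  interpret pendulum \<beta> \<alpha> \<kappa> using assms by unfold_locales
  show ?thesis
    using transversal hopf_conclusion[OF assms(6)] unfolding ec_def by blast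
qed

end
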